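(* Let $f\in L_p^0(\mathbb{T}^2)$, $1<p<q<\infty$, $\theta:=\frac1p-\frac1q$, $\alpha_1>0$, $\alpha_2>0$. Then, for $\delta_1,\delta_2>0$, $$\omega_{\alpha_1,\alpha_2}(f,\delta_1,\delta_2)_{L_q(\mathbb{T}^2)}\lesssim\Big(\int_0^{\delta_1}\int_0^{\delta_2}\big[(t_1t_2)^{-\theta}\,\omega_{\alpha_1+\theta,\alpha_2+\theta}(f,t_1,t_2)_{L_p(\mathbb{T}^2)}\big]^q\frac{dt_2}{t_2}\frac{dt_1}{t_1}\Big)^{1/q}$$ (with $t_i\in(0,\delta_i)$).
   Context: $L_p(\mathbb{T}^2)$, $1<p<\infty$, is the space of measurable functions $f(x,y)$ that are $2\pi$-periodic in each variable with $\|f\|_{L_p(\mathbb{T}^2)}=\big(\int_0^{2\pi}\int_0^{2\pi}|f(x,y)|^p\,dx\,dy\big)^{1/p}<\infty$; $L_p^0(\mathbb{T}^2)$ is the set of $f\in L_p(\mathbb{T}^2)$ with $\int_0^{2\pi}f(x,y)\,dy=0$ for a.e. $x$ and $\int_0^{2\pi}f(x,y)\,dx=0$ for a.e. $y$. For $\alpha_1,\alpha_2>0$ the (fractional) differences are $\Delta_{h_1}^{\alpha_1}(f)=\sum_{\nu=0}^\infty(-1)^\nu\binom{\alpha_1}{\nu}f(x+(\alpha_1-\nu)h_1,y)$ and $\Delta_{h_2}^{\alpha_2}(f)=\sum_{\nu=0}^\infty(-1)^\nu\binom{\alpha_2}{\nu}f(x,y+(\alpha_2-\nu)h_2)$, where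 $\binom{\alpha}{0}=1$, $\binom{\alpha}{\nu}=\frac{\alpha(\alpha-1)\cdots(\alpha-\nu+1)}{\nu!}$ for $\nu\ge1$. The mixed modulus of smoothness in $L_s$, $1<s<\infty$, is $\omega_{\alpha_1,\alpha_2}(f,\delta_1,\delta_2)_{L_s(\mathbb{T}^2)}=\sup_{|h_i|\le\delta_i,\,i=1,2}\|\Delta_{h_1}^{\alpha_1}(\Delta_{h_2}^{\alpha_2}(f))\|_{L_s(\mathbb{T}^2)}$ (norms and integrals take values in $[0,\infty]$). $A\lesssim B$ means $A\le CB$ with a constant $C>0$ independent of $f,\delta_1,\delta_2$ ($C$ may depend on $p,q,\alpha_1,\alpha_2$). *)

theory Defs
  imports "HOL-Analysis.Analysis"
begin

text \<open>Powers \<open>x\<^sup>a\<close> on \<open>[0, \<infinity>]\<close>, used only for exponents \<open>a > 0\<close>, where \<open>0\<^sup>a = 0\<close> and \<open>\<infinity>\<^sup>a = \<infinity>\<close>.\<close>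

definition ennpowr :: "ennreal \<Rightarrow> real \<Rightarrow> ennreal" where
  "ennpowr x a = (if x = \<infinity> then \<infinity> else ennreal (enn2real x powr a))"

text \<open>Functions on the torus are complex-valued functions on the plane that are
  \<open>2\<pi>\<close>-periodic in each variable; real-valued functions are a special case.\<close>

definition periodic2 :: "(real \<times> real \<Rightarrow> complex) \<Rightarrow> bool" where
  "periodic2 f \<longleftrightarrow> (\<forall>x y. f (x + 2 * pi, y) = f (x, y) \<and> f (x, y + 2 * pi) = f (x, y))"

definition Lp_norm_T2 :: "real \<Rightarrow> (real \<times> real \<Rightarrow> complex) \<Rightarrow> ennreal" where
  "Lp_norm_T2 p f =
     ennpowr (\<integral>\<^sup>+z \<in> {0..2 * pi} \<times> {0..2 * pi}. ennreal (norm (f z) powr p) \<partial>lebesgue) (1 / p)"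

definition Lp_T2 :: "real \<Rightarrow> (real \<times> real \<Rightarrow> complex) set" where
  "Lp_T2 p = {f. f \<in> borel_measurable lebesgue \<and> periodic2 f \<and> Lp_norm_T2 p f < \<infinity>}"

text \<open>For \<open>p \<ge> 1\<close> and \<open>f\<close> in \<open>Lp_T2 p\<close>, Fubini's theorem makes almost every section of \<open>f\<close>
  integrable over a period, so the integrals below do not take the default value \<open>0\<close> of
  non-integrable functions except on a null set.\<close>

definition Lp0_T2 :: "real \<Rightarrow> (real \<times> real \<Rightarrow> complex) set" where
  "Lp0_T2 p = {f \<in> Lp_T2 p.
     (AE x in lebesgue. (LINT y:{0..2 * pi}|lebesgue. f (x, y)) = 0) \<and>
     (AE y in lebesgue. (LINT x:{0..2 * pi}|lebesgue. f (x, y)) = 0)}"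

text \<open>The fractional differences are pointwise sums. For \<open>\<alpha> > 0\<close> the coefficients are absolutely
  summable, so for \<open>f\<close> in \<open>Lp_T2 p\<close> with \<open>p \<ge> 1\<close> the series converge absolutely almost everywhere.
  Values on the remaining null set are irrelevant, also for the iterated difference, which
  only involves countably many translates.\<close>

definition frac_diff1 :: "real \<Rightarrow> real \<Rightarrow> (real \<times> real \<Rightarrow> complex) \<Rightarrow> real \<times> real \<Rightarrow> complex" where
  "frac_diff1 \<alpha> h f = (\<lambda>(x, y). \<Sum>\<nu>. of_real ((-1) ^ \<nu> * (\<alpha> gchoose \<nu>)) * f (x + (\<alpha> - real \<nu>) * h, y))"

definition frac_diff2 :: "real \<Rightarrow> real \<Rightarrow> (real \<times> real \<Rightarrow> complex) \<Rightarrow> real \<times> real \<Rightarrow> complex" where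
  "frac_diff2 \<alpha> h f = (\<lambda>(x, y). \<Sum>\<nu>. of_real ((-1) ^ \<nu> * (\<alpha> gchoose \<nu>)) * f (x, y + (\<alpha> - real \<nu>) * h))"

definition mixed_modulus ::
    "real \<Rightarrow> real \<Rightarrow> real \<Rightarrow> (real \<times> real \<Rightarrow> complex) \<Rightarrow> real \<Rightarrow> real \<Rightarrow> ennreal" where
  "mixed_modulus s \<alpha>1 \<alpha>2 f \<delta>1 \<delta>2 =
     (SUP (h1, h2) \<in> {(h1, h2). \<bar>h1\<bar> \<le> \<delta>1 \<and> \<bar>h2\<bar> \<le> \<delta>2}.
        Lp_norm_T2 s (frac_diff1 \<alpha>1 h1 (frac_diff2 \<alpha>2 h2 f)))"

end

theory Submission
  imports Defs
begin

text \<open>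
  Let \<open>S\<close> be the translation by a step \<open>h\<close>, so that the difference of order \<open>\<alpha>\<close> is \<open>(1 - S)\<^sup>\<alpha>\<close> up to a
  translation, and let \<open>A\<close> be the average over the translations by \<open>u\<close> in \<open>[0, h]\<close>. In one variable,
  \<open>(1 - S)\<^sup>\<alpha> f\<close> is split into a high-frequency and a low-frequency part. The high-frequency part
  telescopes over the dyadic scales \<open>h / 2\<^sup>k\<close> into smoothed differences of \<open>f\<close>. Each of these is controlled
  in \<open>L\<^sub>p\<close> and, with a loss \<open>(2\<^sup>k / h)\<^bsup>1/p\<^esup>\<close>, in \<open>L\<^sub>\<infinity>\<close>, and adding up such pieces in \<open>L\<^sub>q\<close> gives the
  \<open>l\<^sub>q\<close> sum over \<open>k\<close> that discretizes the integral over \<open>t\<close>. In the low-frequency part one writes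
  \<open>(1 - S)\<^sup>\<alpha> A = (1 - S)\<^sup>-\<^sup>\<theta> A (1 - S)\<^sup>\<alpha>\<^sup>+\<^sup>\<theta>\<close>. The coefficients of \<open>(1 - z)\<^sup>-\<^sup>\<theta>\<close> have size \<open>n powr (\<theta> - 1)\<close>, so
  up to the factor \<open>h powr (-\<theta>)\<close> the kernel of \<open>(1 - S)\<^sup>-\<^sup>\<theta> A\<close> is dominated by that of a fractional integral
  of order \<open>\<theta>\<close>, which maps \<open>L\<^sub>p\<close> to \<open>L\<^sub>q\<close> by the Hardy--Littlewood--Sobolev inequality. All of this works for
  functions with values in \<open>L\<^sub>p\<close>, and the theorem follows by treating one variable after the other.\<close>

subsection \<open>Powers of extended nonnegative reals\<close>

text \<open>Four obstacles shape the proof. Adding the dyadic pieces in L_q by the triangle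
  inequality would give an l_1 sum; the l_q sum is obtained by expanding the q-th power, because a
  product of pieces at two scales decays geometrically in the distance of the scales. For this every
  piece needs a sup bound besides its L_p bound, and so the smoothing operator V is applied twice:
  telescoping V V leaves in each term one difference and one factor that smooths it. Next, the
  kernel of (1 - S)^(-\<theta>) is not summable, so the low frequencies are reached through Abel
  means, and the mean value over the circle has to be subtracted before summing by parts. The low
  frequencies also produce a term at the full step h, which an integral over t < h cannot control;
  the identity (1 - S^2)^\<alpha> = (1 + S)^\<alpha> (1 - S)^\<alpha> halves the step beforehand.
  Finally, the inequality in x leaves an L_q norm in y of an L_p norm in x, so the second variable
  requires the version with values in L_p.\<close>

lemma ennpowr_ennreal [simp]: "0 \<le> x \<Longrightarrow> ennpowr (ennreal x) a = ennreal (x powr a)"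
  by (simp add: ennpowr_def)

lemma ennpowr_top [simp]: "ennpowr top a = top"
  by (simp add: ennpowr_def)

lemma ennpowr_0 [simp]: "ennpowr 0 a = 0"
  by (simp add: ennpowr_def)

lemma ennpowr_1 [simp]: "ennpowr x 1 = x"
  by (cases x) (auto simp: ennpowr_def)

lemma ennpowr_one_left [simp]: "ennpowr 1 a = 1"
  using ennpowr_ennreal[of 1 a] by simp

lemma ennpowr_mono: "x \<le> y \<Longrightarrow> 0 \<le> a \<Longrightarrow> ennpowr x a \<le> ennpowr y a"
  by (cases x; cases y) (auto simp: ennreal_leI powr_mono2 top_unique)

lemma ennpowr_mult: "0 < a \<Longrightarrow> ennpowr (x * y) a = ennpowr x a * ennpowr y a"
  by (cases x; cases y)
     (auto simp: ennreal_mult[symmetric] powr_mult ennreal_mult_top ennreal_top_mult)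

lemma ennpowr_ennpowr: "ennpowr (ennpowr x a) b = ennpowr x (a * b)"
  by (cases x) (auto simp: powr_powr)

lemma ennpowr_inverse [simp]: "a \<noteq> 0 \<Longrightarrow> ennpowr (ennpowr x a) (1 / a) = x"
  "a \<noteq> 0 \<Longrightarrow> ennpowr (ennpowr x (1 / a)) a = x"
  by (simp_all add: ennpowr_ennpowr)

lemma ennpowr_le_iff: "0 < a \<Longrightarrow> ennpowr x a \<le> y \<longleftrightarrow> x \<le> ennpowr y (1 / a)"
  by (metis ennpowr_inverse ennpowr_mono less_eq_real_def less_numeral_extra(3) zero_less_divide_1_iff)

lemma ennpowr_less_top_iff [simp]: "ennpowr x a < top \<longleftrightarrow> x < top"
  by (cases x) auto

lemma ennpowr_eq_top_iff [simp]: "ennpowr x a = top \<longleftrightarrow> x = top"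
  by (cases x) auto

lemma ennpowr_eq_0_iff [simp]: "ennpowr x a = 0 \<longleftrightarrow> x = 0"
  by (cases x) auto

lemma measurable_ennpowr [measurable]:
  assumes [measurable]: "f \<in> borel_measurable M"
  shows "(\<lambda>x. ennpowr (f x) a) \<in> borel_measurable M"
  unfolding ennpowr_def by measurable

lemma ennpowr_add_le:
  assumes "0 < a"
  shows "ennpowr (x + y) a \<le> ennreal (2 powr a) * (ennpowr x a + ennpowr y a)"
proof -
  have "ennpowr (x + y) a \<le> ennpowr (2 * max x y) a"
    using assms by (intro ennpowr_mono) (auto simp: max_def mult_2 intro: add_mono)
  also have "\<dots> = ennreal (2 powr a) * ennpowr (max x y) a"
    using assms ennpowr_ennreal[of 2 a] by (simp add: ennpowr_mult)
  also have "\<dots> \<le> ennreal (2 powr a) * (ennpowr x a + ennpowr y a)"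
    by (intro mult_left_mono) (auto simp: max_def)
  finally show ?thesis .
qed

text \<open>The graph of the convex function \<open>x powr s\<close> lies above its tangent at
  \<open>c\<close>. The terms are placed so that nothing is subtracted, hence the inequality passes
  to \<open>ennreal\<close>, where it does the work of Jensen's inequality even for infinite
  integrals.\<close>

lemma powr_tangent:
  fixes x c s :: real
  assumes "0 \<le> x" "0 \<le> c" "1 < s"
  shows "s * c powr (s - 1) * x \<le> x powr s + (s - 1) * c powr s"
proof -
  have "x * c powr (s - 1) \<le> x powr s / s + (c powr (s - 1)) powr (s / (s - 1)) / (s / (s - 1))"
    using assms by (intro Youngs_inequality) (auto simp: field_simps)
  also have "(c powr (s - 1)) powr (s / (s - 1)) = c powr s"
    using assms by (simp add: powr_powr)
  finally have "s * (x * c powr (s - 1)) \<le> s * (x powr s / s + c powr s / (s / (s - 1)))"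
    using assms by (intro mult_left_mono) auto
  also have "\<dots> = x powr s + (s - 1) * c powr s"
    using assms by (simp add: field_simps)
  finally show ?thesis by (simp add: mult_ac)
qed

lemma ennpowr_tangent:
  assumes "0 \<le> c" "1 < s"
  shows "ennreal (s * c powr (s - 1)) * x \<le> ennpowr x s + ennreal ((s - 1) * c powr s)"
proof (cases x)
  case (real r)
  then show ?thesis using powr_tangent[of r c s] assms
    by (simp add: ennreal_mult[symmetric] ennreal_plus[symmetric] ennreal_leI del: ennreal_plus)
qed auto

subsection \<open>The binomial coefficients of \<open>(1 - z)\<^sup>a\<close>\<close>

definition bincoeff :: "real \<Rightarrow> nat \<Rightarrow> real" where
  "bincoeff a n = (-1) ^ n * (a gchoose n)"

lemma bincoeff_0 [simp]: "bincoeff a 0 = 1"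
  by (simp add: bincoeff_def)

lemma bincoeff_Suc: "bincoeff a (Suc n) = bincoeff a n * (real n - a) / (real n + 1)"
proof -
  have "(a gchoose Suc n) * (real n + 1) = (a gchoose n) * (a - real n)"
    using gbinomial_mult_1[of a n] by (simp add: algebra_simps)
  then have *: "(a gchoose Suc n) = (a gchoose n) * (a - real n) / (real n + 1)"
    by (simp add: field_simps)
  show ?thesis by (simp add: bincoeff_def * diff_divide_distrib algebra_simps)
qed

lemma bincoeff_of_nat: "bincoeff (real m) n = (-1) ^ n * real (m choose n)"
  by (simp add: bincoeff_def binomial_gbinomial)

text \<open>Comparison of coefficients in (1 - z)^a (1 - z)^b = (1 - z)^(a + b). The identity is
  formal and so covers negative exponents such as \<open>-\<theta>\<close>, where the coefficients
  are not summable.\<close>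

lemma bincoeff_Vandermonde:
  "(\<Sum>i\<le>n. bincoeff a i * bincoeff b (n - i)) = bincoeff (a + b) n"
proof -
  have "(\<Sum>i\<le>n. bincoeff a i * bincoeff b (n - i))
      = (\<Sum>i\<le>n. (-1) ^ n * ((a gchoose i) * (b gchoose (n - i))))"
    by (intro sum.cong refl) (auto simp: bincoeff_def power_add[symmetric])
  also have "\<dots> = bincoeff (a + b) n"
    unfolding sum_distrib_left[symmetric] bincoeff_def
    using gbinomial_Vandermonde[of a b n] by (simp add: atMost_atLeast0)
  finally show ?thesis .
qed

text \<open>Forming partial sums multiplies the generating series by 1 / (1 - z), which lowers the
  exponent by one.\<close>

lemma sum_bincoeff: "(\<Sum>i\<le>n. bincoeff a i) = bincoeff (a - 1) n"
  using gbinomial_sum_lower_neg[of a n] by (simp add: bincoeff_def mult.commute)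

text \<open>Once \<open>n > a\<close> the coefficients have constant sign, so absolute summability follows from
  boundedness of the partial sums, which are again binomial coefficients.\<close>

lemma summable_bincoeff:
  assumes "a > 0"
  shows "summable (\<lambda>n. \<bar>bincoeff a n\<bar>)"
proof -
  define N where "N = nat \<lceil>a\<rceil> + 1"
  have N: "real n > a" if "n \<ge> N" for n
    using that unfolding N_def by linarith
  define s where "s = sgn (bincoeff a N)"
  have sgn: "bincoeff a (N + k) = s * \<bar>bincoeff a (N + k)\<bar>" for k
  proof (induction k)
    case (Suc k)
    have "bincoeff a (N + Suc k) = s * (\<bar>bincoeff a (N + k)\<bar> * (real (N + k) - a) / (real (N + k) + 1))"
      using bincoeff_Suc[of a "N + k"] Suc by (metis add_Suc_right mult.assoc times_divide_eq_right)
    moreover have "\<bar>bincoeff a (N + k)\<bar> * (real (N + k) - a) / (real (N + k) + 1)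
       = \<bar>bincoeff a (N + Suc k)\<bar>"
      using bincoeff_Suc[of a "N + k"] N[of "N + k"] by (simp add: abs_mult)
    ultimately show ?case by simp
  qed (simp add: s_def mult_sgn_abs)
  have dec: "\<bar>bincoeff (a - 1) (N + k)\<bar> \<le> \<bar>bincoeff (a - 1) N\<bar>" for k
  proof (induction k)
    case (Suc k)
    have r: "\<bar>(real (N + k) - (a - 1)) / (real (N + k) + 1)\<bar> \<le> 1"
      using N[of "N + k"] assms by (auto simp: abs_le_iff field_simps)
    have "\<bar>bincoeff (a - 1) (N + Suc k)\<bar>
        = \<bar>bincoeff (a - 1) (N + k)\<bar> * \<bar>(real (N + k) - (a - 1)) / (real (N + k) + 1)\<bar>"
      using bincoeff_Suc[of "a - 1" "N + k"] by (simp add: abs_mult)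
    also have "\<dots> \<le> \<bar>bincoeff (a - 1) (N + k)\<bar> * 1"
      by (intro mult_left_mono r) auto
    finally show ?case using Suc by simp
  qed auto
  have "summable (\<lambda>k. \<bar>bincoeff a (k + N)\<bar>)"
  proof (rule bounded_imp_summable)
    fix n
    have "s * (\<Sum>k\<le>n. \<bar>bincoeff a (k + N)\<bar>) = (\<Sum>k\<le>n. bincoeff a (N + k))"
      unfolding sum_distrib_left by (intro sum.cong refl) (metis sgn add.commute)
    also have "\<dots> = (\<Sum>i\<in>{N..N+n}. bincoeff a i)"
      using sum.shift_bounds_cl_nat_ivl[of "bincoeff a" 0 N n] by (simp add: atMost_atLeast0 add.commute)
    also have "\<dots> = (\<Sum>i\<le>N+n. bincoeff a i) - (\<Sum>i<N. bincoeff a i)"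
    proof -
      have "{..N+n} = {..<N} \<union> {N..N+n}" by auto
      then show ?thesis by (simp add: sum.union_disjoint ivl_disj_int)
    qed
    also have "\<dots> = bincoeff (a - 1) (N + n) - (\<Sum>i<N. bincoeff a i)"
      by (simp add: sum_bincoeff)
    finally have *: "\<bar>s * (\<Sum>k\<le>n. \<bar>bincoeff a (k + N)\<bar>)\<bar>
        \<le> \<bar>bincoeff (a - 1) N\<bar> + \<bar>\<Sum>i<N. bincoeff a i\<bar>"
      using dec[of n] by linarith
    show "(\<Sum>k\<le>n. \<bar>bincoeff a (k + N)\<bar>) \<le> \<bar>bincoeff (a - 1) N\<bar> + \<bar>\<Sum>i<N. bincoeff a i\<bar>"
    proof (cases "s = 0")
      case True
      then have "\<bar>bincoeff a (k + N)\<bar> = 0" for k using sgn[of k] by (simp add: add.commute)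
      then show ?thesis by simp
    next
      case False
      then have "\<bar>s\<bar> = 1" by (auto simp: s_def sgn_if)
      with * show ?thesis by (simp add: abs_mult sum_nonneg)
    qed
  qed auto
  then show ?thesis by (rule summable_iff_shift[THEN iffD1])
qed

lemma bincoeff_power_sums:
  assumes "0 \<le> r" "r < 1"
  shows "(\<lambda>n. bincoeff a n * r ^ n) sums ((1 - r) powr a)"
proof -
  have "(\<lambda>n. (a gchoose n) * (-r) ^ n) sums (1 + (-r)) powr a"
    using assms by (intro gen_binomial_real) auto
  moreover have "(a gchoose n) * (-r) ^ n = bincoeff a n * r ^ n" for n
    by (metis bincoeff_def mult.commute mult.left_commute power_minus)
  ultimately show ?thesis by simp
qed

text \<open>For negative \<open>a\<close> the coefficients themselves need not be summable; the
  convergent series at a radius \<open>r'\<close> strictly between \<open>r\<close> and 1 supplies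
  the absolute convergence at \<open>r\<close>.\<close>

lemma summable_bincoeff_power:
  assumes "0 \<le> r" "r < 1"
  shows "summable (\<lambda>n. \<bar>bincoeff a n * r ^ n\<bar>)"
proof -
  define r' where "r' = (r + 1) / 2"
  have r': "0 \<le> r'" "r' < 1" "r < r'" using assms by (auto simp: r'_def)
  have "summable (\<lambda>n. bincoeff a n * r' ^ n)"
    using bincoeff_power_sums[of r' a] r' by (auto simp: sums_iff)
  then show ?thesis
    using powser_insidea[of "bincoeff a" r' r] r' assms by (simp add: norm_mult power_abs)
qed

text \<open>This is the value of (1 - z)^a at z = 1, reached as the limit of
  \<open>(1 - r) powr a\<close> for r tending to 1 from below; summability of the coefficients
  allows the passage to the limit term by term. It makes differences with step 0 vanish.\<close>

lemma suminf_bincoeff: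
  assumes "a > 0"
  shows "(\<Sum>n. bincoeff a n) = 0"
proof -
  have sm: "summable (\<lambda>n. \<bar>bincoeff a n\<bar>)" by (rule summable_bincoeff[OF assms])
  define r where "r = (\<lambda>i::nat. 1 - 1 / (real i + 2))"
  have r: "0 \<le> r i" "r i < 1" for i by (auto simp: r_def)
  have lim0: "(\<lambda>i::nat. 1 / (real i + 2)) \<longlonglongrightarrow> 0"
    using LIMSEQ_ignore_initial_segment[of "\<lambda>n. 1 / real n" 0 2] lim_1_over_n[where 'a = real] by (simp add: add.commute)
  have rlim: "r \<longlonglongrightarrow> 1"
    using tendsto_diff[OF tendsto_const lim0, of 1] by (simp add: r_def)
  have "(\<lambda>i. \<Sum>n. bincoeff a n * r i ^ n) \<longlonglongrightarrow> (\<Sum>n. bincoeff a n)"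
  proof (rule tannerys_theorem[THEN conjunct2, THEN conjunct2])
    show "(\<lambda>i. bincoeff a k * r i ^ k) \<longlonglongrightarrow> bincoeff a k" for k
      using tendsto_mult[OF tendsto_const tendsto_power[OF rlim, of k], of "bincoeff a k"] by simp
    have "norm (bincoeff a k * r i ^ k) \<le> \<bar>bincoeff a k\<bar>" for k i
      using r[of i] by (simp add: abs_mult mult_left_le power_le_one)
    then show "\<forall>\<^sub>F (k, n) in sequentially \<times>\<^sub>F sequentially. norm (bincoeff a k * r n ^ k) \<le> \<bar>bincoeff a k\<bar>"
      by (simp add: case_prod_unfold)
  qed (use sm in auto)
  moreover have "(\<lambda>i. \<Sum>n. bincoeff a n * r i ^ n) = (\<lambda>i. (1 - r i) powr a)"
    using bincoeff_power_sums[OF r] by (auto simp: sums_iff)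
  moreover have "(\<lambda>i. (1 - r i) powr a) \<longlonglongrightarrow> 0"
    using tendsto_powr2[OF lim0 tendsto_const[of a]] assms by (simp add: r_def)
  ultimately show ?thesis using LIMSEQ_unique by metis
qed

text \<open>The coefficient is \<theta> (\<theta> + 1) ... (\<theta> + n - 1) / n!, with ratios (n +
  \<theta>) / (n + 1) below 1. Positivity and monotonicity are what summation by parts needs later,
  and the power bound relates the kernel to that of a fractional integral.\<close>

lemma bincoeff_neg:
  assumes "0 < \<theta>" "\<theta> < 1"
  shows "bincoeff (-\<theta>) n > 0" "bincoeff (-\<theta>) (Suc n) \<le> bincoeff (-\<theta>) n"
    "bincoeff (-\<theta>) n \<le> (real n + 1) powr (\<theta> - 1)"
proof -
  show pos: "bincoeff (-\<theta>) n > 0" for n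
    by (induction n) (use assms in \<open>auto simp: bincoeff_Suc\<close>)
  show "bincoeff (-\<theta>) (Suc n) \<le> bincoeff (-\<theta>) n"
    using pos[of n] assms by (simp add: bincoeff_Suc divide_le_eq)
  show "bincoeff (-\<theta>) n \<le> (real n + 1) powr (\<theta> - 1)"
  proof (induction n)
    case (Suc n)
    have n2: "(real n + 2) / (real n + 1) > 0" by simp
    \<comment> \<open>Bernoulli's inequality, as the weighted mean inequality for (n + 2) / (n + 1)
      and 1. With it the claim for the ratios reduces to (n + \<theta>) (n + 2 - \<theta>) = (n +
      1)^2 - (1 - \<theta>)^2.\<close>
    have "((real n + 2) / (real n + 1)) powr (1 - \<theta>) * 1
        \<le> (1 - \<theta>) * ((real n + 2) / (real n + 1)) + \<theta>"
      using Youngs_inequality_0[of "1 - \<theta>" \<theta> "(real n + 2) / (real n + 1)" 1] assms by simp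
    also have "\<dots> = (real n + 2 - \<theta>) / (real n + 1)" by (simp add: field_simps)
    finally have y: "((real n + 2) / (real n + 1)) powr (1 - \<theta>) \<le> (real n + 2 - \<theta>) / (real n + 1)" by simp
    have "(real n + \<theta>) / (real n + 1) * ((real n + 2) / (real n + 1)) powr (1 - \<theta>)
        \<le> (real n + \<theta>) / (real n + 1) * ((real n + 2 - \<theta>) / (real n + 1))"
      using assms by (intro mult_left_mono y) auto
    also have "\<dots> = ((real n + 1)\<^sup>2 - (1 - \<theta>)\<^sup>2) / (real n + 1)\<^sup>2"
      by (simp add: field_simps power2_eq_square)
    also have "\<dots> \<le> 1" by (simp add: field_simps)
    finally have "(real n + \<theta>) / (real n + 1) \<le> inverse (((real n + 2) / (real n + 1)) powr (1 - \<theta>))"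
      using n2 by (simp add: field_simps)
    also have "\<dots> = ((real n + 2) / (real n + 1)) powr (\<theta> - 1)"
      by (simp add: powr_minus[symmetric])
    finally have q: "(real n + \<theta>) / (real n + 1) \<le> ((real n + 2) / (real n + 1)) powr (\<theta> - 1)" .
    have "bincoeff (-\<theta>) (Suc n) = bincoeff (-\<theta>) n * ((real n + \<theta>) / (real n + 1))"
      by (simp add: bincoeff_Suc)
    also have "\<dots> \<le> (real n + 1) powr (\<theta> - 1) * ((real n + 2) / (real n + 1)) powr (\<theta> - 1)"
      using Suc q assms by (intro mult_mono) auto
    also have "\<dots> = (real n + 2) powr (\<theta> - 1)"
      by (simp add: powr_mult[symmetric])
    finally show ?case by (simp add: add.commute)
  qed simp
qed

text \<open>The coefficients of \<open>(1 + z)\<^sup>a (1 - z)\<^sup>a = (1 - z\<^sup>2)\<^sup>a\<close>, from the differential equation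
  \<open>(1 - z\<^sup>2) Y' = - 2 a z Y\<close>.\<close>

lemma bincoeff_duplication:
  "(\<Sum>i\<le>n. (a gchoose i) * bincoeff a (n - i)) = (if even n then bincoeff a (n div 2) else 0)"
proof -
  define A where "A = fps_binomial a"
  define B where "B = Abs_fps (bincoeff a)"
  define Y where "Y = A * B"
  have A: "(1 + fps_X) * fps_deriv A = fps_const a * A"
  proof (rule fps_ext)
    fix n
    show "fps_nth ((1 + fps_X) * fps_deriv A) n = fps_nth (fps_const a * A) n"
      using gbinomial_mult_1[of a n]
      by (cases n) (simp_all add: A_def distrib_right algebra_simps)
  qed
  have B: "(1 - fps_X) * fps_deriv B = - fps_const a * B"
  proof (rule fps_ext)
    fix n
    show "fps_nth ((1 - fps_X) * fps_deriv B) n = fps_nth (- fps_const a * B) n"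
      using bincoeff_Suc[of a n]
      by (cases n) (simp_all add: B_def left_diff_distrib field_simps del: fps_const_neg)
  qed
  have "fps_deriv Y - fps_X * (fps_X * fps_deriv Y)
      = (1 - fps_X) * B * ((1 + fps_X) * fps_deriv A) + (1 + fps_X) * A * ((1 - fps_X) * fps_deriv B)"
    by (simp add: Y_def algebra_simps)
  also have "\<dots> = - (fps_const (2 * a) * (fps_X * Y))"
    unfolding A B fps_const_neg[symmetric] by (simp add: Y_def algebra_simps fps_const_mult[symmetric] numeral_fps_const[symmetric] del: fps_const_mult fps_const_neg)
  finally have ode: "fps_deriv Y - fps_X * (fps_X * fps_deriv Y) = - (fps_const (2 * a) * (fps_X * Y))" .
  \<comment> \<open>The differential equation amounts to a two-step recurrence, so it determines the
    series from its first two coefficients.\<close>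
  have Y0: "fps_nth Y 0 = 1" by (simp add: Y_def A_def B_def)
  have Y1: "fps_nth Y 1 = 0" using arg_cong[OF ode, of "\<lambda>F. fps_nth F 0"] by simp
  have Yrec: "fps_nth Y (Suc (Suc n)) * (real n + 2) = fps_nth Y n * (real n - 2 * a)" for n
    using arg_cong[OF ode, of "\<lambda>F. fps_nth F (Suc n)"]
    by (cases n) (simp_all add: algebra_simps)
  have *: "fps_nth Y n = (if even n then bincoeff a (n div 2) else 0)" for n
  proof (induction n rule: induct_nat_012)
    case (ge2 n)
    show ?case
    proof (cases "even n")
      case True
      then obtain k where k: "n = 2 * k" by blast
      have "fps_nth Y (Suc (Suc n)) * (real n + 2) = bincoeff a k * (real n - 2 * a)"
        using Yrec[of n] ge2(1) k by simp
      then show ?thesis using k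
        by (simp add: bincoeff_Suc field_simps)
    next
      case False
      then show ?thesis using Yrec[of n] ge2(1) by simp
    qed
  qed (use Y0 Y1 in auto)
  show ?thesis
    using *[of n] by (simp add: Y_def A_def B_def fps_mult_nth atMost_atLeast0)
qed

subsection \<open>Integration over a period\<close>

text \<open>One period, as a density on the whole line rather than a restriction to an interval: the
  space stays \<open>UNIV\<close>, so a periodic function and all its translates are measurable for
  it as they stand.\<close>

definition circ :: "real measure" where
  "circ = density lborel (indicator {0..2 * pi})"

definition unit_itv :: "real measure" where
  "unit_itv = density lborel (indicator {0..1})"

definition periodic :: "(real \<Rightarrow> 'a) \<Rightarrow> bool" where
  "periodic n \<longleftrightarrow> (\<forall>x. n (x + 2 * pi) = n x)"

lemma sets_circ [simp, measurable_cong]: "sets circ = sets borel"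
  by (simp add: circ_def)

lemma space_circ [simp]: "space circ = UNIV"
  by (simp add: circ_def)

lemma sets_unit_itv [simp, measurable_cong]: "sets unit_itv = sets borel"
  by (simp add: unit_itv_def)

lemma space_unit_itv [simp]: "space unit_itv = UNIV"
  by (simp add: unit_itv_def)

lemma nn_integral_circ:
  assumes [measurable]: "f \<in> borel_measurable borel"
  shows "(\<integral>\<^sup>+x. f x \<partial>circ) = (\<integral>\<^sup>+x. indicator {0..2 * pi} x * f x \<partial>lborel)"
  unfolding circ_def by (subst nn_integral_density) auto

lemma nn_integral_unit_itv:
  assumes [measurable]: "f \<in> borel_measurable borel"
  shows "(\<integral>\<^sup>+x. f x \<partial>unit_itv) = (\<integral>\<^sup>+x. indicator {0..1} x * f x \<partial>lborel)"
  unfolding unit_itv_def by (subst nn_integral_density) auto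

lemma emeasure_circ: "emeasure circ UNIV = ennreal (2 * pi)"
  unfolding circ_def by (subst emeasure_density) auto

lemma emeasure_unit_itv: "emeasure unit_itv UNIV = 1"
  unfolding unit_itv_def by (subst emeasure_density) auto

lemma finite_measure_circ: "finite_measure circ"
  by (rule finite_measureI) (simp add: emeasure_circ)

lemma finite_measure_unit_itv: "finite_measure unit_itv"
  by (rule finite_measureI) (simp add: emeasure_unit_itv)

lemma sigma_finite_circ: "sigma_finite_measure circ"
  using finite_measure_circ by (rule finite_measure.axioms)

lemma sigma_finite_unit_itv: "sigma_finite_measure unit_itv"
  using finite_measure_unit_itv by (rule finite_measure.axioms)

lemma AE_circ_iff: "(AE x in circ. Q x) \<longleftrightarrow> (AE x in lborel. x \<in> {0..2 * pi} \<longrightarrow> Q x)"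
  unfolding circ_def by (subst AE_density) (auto intro!: AE_cong split: split_indicator)

lemma AE_circ_pos: "AE x in circ. 0 < x"
proof -
  have "AE x in lborel. x \<noteq> (0::real)" by (rule AE_lborel_singleton)
  then show ?thesis unfolding AE_circ_iff by eventually_elim auto
qed

lemma periodic_shift: "periodic n \<Longrightarrow> periodic (\<lambda>x. n (x - t))"
  unfolding periodic_def by (metis add.commute add_diff_eq)

lemma periodic_add_int:
  assumes "periodic n"
  shows "n (x + 2 * pi * of_int k) = n x"
proof (induction k arbitrary: x rule: int_induct[where k = 0])
  case (step1 i)
  have "n (x + 2 * pi * of_int (i + 1)) = n ((x + 2 * pi * of_int i) + 2 * pi)"
    by (simp add: algebra_simps)
  also have "\<dots> = n x" using assms step1 by (simp only: periodic_def)
  finally show ?case .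
next
  case (step2 i)
  have "n (x + 2 * pi * of_int (i - 1)) = n ((x + 2 * pi * of_int (i - 1)) + 2 * pi)"
    using assms by (simp only: periodic_def)
  also have "\<dots> = n (x + 2 * pi * of_int i)" by (simp add: algebra_simps)
  finally show ?case using step2 by simp
qed simp

lemma nn_integral_lborel_shift:
  fixes f :: "real \<Rightarrow> ennreal"
  assumes [measurable]: "f \<in> borel_measurable borel"
  shows "(\<integral>\<^sup>+x. f (x + t) \<partial>lborel) = (\<integral>\<^sup>+x. f x \<partial>lborel)"
  using nn_integral_real_affine[of f 1 t] by (simp add: add.commute)

text \<open>Modulo 2 pi the shift is some \<open>s\<close> with 0 \<le> s < 2 pi. The pieces
  [s, 2 pi] and [0, s] of the period move to [0, 2 pi - s] and [2 pi - s, 2 pi], the second after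
  one further period; the common end points form a null set.\<close>

lemma nn_integral_circ_shift:
  fixes n :: "real \<Rightarrow> ennreal"
  assumes [measurable]: "n \<in> borel_measurable borel" and per: "periodic n"
  shows "(\<integral>\<^sup>+x. n (x - t) \<partial>circ) = (\<integral>\<^sup>+x. n x \<partial>circ)"
proof -
  define k where "k = \<lfloor>t / (2 * pi)\<rfloor>"
  define s where "s = t - 2 * pi * of_int k"
  have "of_int k \<le> t / (2 * pi)" "t / (2 * pi) < of_int k + 1"
    unfolding k_def by linarith+
  then have s: "0 \<le> s" "s < 2 * pi"
    unfolding s_def by (simp_all add: field_simps)
  have ns: "n (x - t) = n (x - s)" for x
    using periodic_add_int[OF per, of "x - s" "-k"] by (simp add: s_def algebra_simps)
  have AE0: "AE x in lborel. x \<noteq> (0::real) \<and> x \<noteq> 2 * pi \<and> x \<noteq> s \<and> x \<noteq> 2 * pi - s"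
    by (intro AE_conjI AE_lborel_singleton)
  have "(\<integral>\<^sup>+x. n (x - t) \<partial>circ) = (\<integral>\<^sup>+x. indicator {0..2*pi} x * n (x - s) \<partial>lborel)"
    by (subst nn_integral_circ) (simp_all add: ns)
  also have "\<dots> = (\<integral>\<^sup>+x. (indicator {s..2*pi} x * n (x - s) + indicator {0..s} x * n (x - s)) \<partial>lborel)"
    using AE0 by (intro nn_integral_cong_AE, eventually_elim) (use s in \<open>auto split: split_indicator\<close>)
  also have "\<dots> = (\<integral>\<^sup>+x. indicator {s..2*pi} x * n (x - s) \<partial>lborel)
      + (\<integral>\<^sup>+x. indicator {0..s} x * n (x - s) \<partial>lborel)"
    by (subst nn_integral_add) auto
  also have "(\<integral>\<^sup>+x. indicator {s..2*pi} x * n (x - s) \<partial>lborel)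
      = (\<integral>\<^sup>+x. indicator {0..2*pi - s} x * n x \<partial>lborel)"
    by (subst nn_integral_lborel_shift[of _ s, symmetric])
       (auto intro!: nn_integral_cong split: split_indicator)
  also have "(\<integral>\<^sup>+x. indicator {0..s} x * n (x - s) \<partial>lborel)
      = (\<integral>\<^sup>+x. indicator {2*pi - s..2*pi} x * n x \<partial>lborel)"
  proof (subst nn_integral_lborel_shift[of _ "s - 2 * pi", symmetric])
    have "n (x + (s - 2 * pi) - s) = n x" for x
      using periodic_add_int[OF per, of "x" "-1"] by (simp add: algebra_simps)
    then show "(\<integral>\<^sup>+x. indicator {0..s} (x + (s - 2 * pi)) * n (x + (s - 2 * pi) - s) \<partial>lborel)
        = (\<integral>\<^sup>+x. indicator {2*pi - s..2*pi} x * n x \<partial>lborel)"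
      by (intro nn_integral_cong) (auto split: split_indicator)
  qed auto
  also have "(\<integral>\<^sup>+x. indicator {0..2*pi - s} x * n x \<partial>lborel)
      + (\<integral>\<^sup>+x. indicator {2*pi - s..2*pi} x * n x \<partial>lborel)
      = (\<integral>\<^sup>+x. (indicator {0..2*pi - s} x * n x + indicator {2*pi - s..2*pi} x * n x) \<partial>lborel)"
    by (subst nn_integral_add) auto
  also have "\<dots> = (\<integral>\<^sup>+x. indicator {0..2*pi} x * n x \<partial>lborel)"
    using AE0 by (intro nn_integral_cong_AE, eventually_elim) (use s in \<open>auto split: split_indicator\<close>)
  also have "\<dots> = (\<integral>\<^sup>+x. n x \<partial>circ)"
    by (simp add: nn_integral_circ)
  finally show ?thesis .
qed

lemma nn_integral_circ_reflect:
  fixes n :: "real \<Rightarrow> ennreal"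
  assumes [measurable]: "n \<in> borel_measurable borel" and per: "periodic n"
  shows "(\<integral>\<^sup>+x. n (- x) \<partial>circ) = (\<integral>\<^sup>+x. n x \<partial>circ)"
proof -
  have "(\<integral>\<^sup>+x. n (- x) \<partial>circ) = (\<integral>\<^sup>+x. indicator {0..2*pi} x * n (- x) \<partial>lborel)"
    by (subst nn_integral_circ) auto
  also have "\<dots> = (\<integral>\<^sup>+x. indicator {0..2*pi} (2 * pi - x) * n (x - 2 * pi) \<partial>lborel)"
    by (subst nn_integral_real_affine[of _ "-1" "2 * pi"]) auto
  also have "\<dots> = (\<integral>\<^sup>+x. indicator {0..2*pi} x * n x \<partial>lborel)"
    using periodic_add_int[OF per, of _ "-1"]
    by (intro nn_integral_cong) (auto split: split_indicator)
  finally show ?thesis by (simp add: nn_integral_circ)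
qed

text \<open>Averages over windows longer than a period are controlled by covering the window with
  \<open>j\<close> whole periods.\<close>

lemma periodic_nn_integral_lborel_le:
  fixes n :: "real \<Rightarrow> ennreal"
  assumes [measurable]: "n \<in> borel_measurable borel" and per: "periodic n"
  shows "(\<integral>\<^sup>+x. indicator {0..2 * pi * real j} x * n x \<partial>lborel) \<le> of_nat j * (\<integral>\<^sup>+x. n x \<partial>circ)"
proof (induction j)
  case 0
  have "(\<integral>\<^sup>+x. indicator {0} x * n x \<partial>lborel) = (\<integral>\<^sup>+x. 0 \<partial>(lborel :: real measure))"
  proof (rule nn_integral_cong_AE)
    show "AE x in lborel. indicator {0} x * n x = 0"
      using AE_lborel_singleton[of "0::real"] by eventually_elim auto
  qed
  then show ?case by simp
next
  case (Suc j)
  have "(\<integral>\<^sup>+x. indicator {0..2 * pi * real (Suc j)} x * n x \<partial>lborel)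
      \<le> (\<integral>\<^sup>+x. indicator {0..2 * pi * real j} x * n x
            + indicator {2 * pi * real j..2 * pi * real (Suc j)} x * n x \<partial>lborel)"
    by (intro nn_integral_mono) (auto split: split_indicator)
  also have "\<dots> = (\<integral>\<^sup>+x. indicator {0..2 * pi * real j} x * n x \<partial>lborel)
      + (\<integral>\<^sup>+x. indicator {2 * pi * real j..2 * pi * real (Suc j)} x * n x \<partial>lborel)"
    by (subst nn_integral_add) auto
  also have "(\<integral>\<^sup>+x. indicator {2 * pi * real j..2 * pi * real (Suc j)} x * n x \<partial>lborel)
      = (\<integral>\<^sup>+x. n x \<partial>circ)"
    using periodic_add_int[OF per, of _ "int j"]
    by (subst nn_integral_lborel_shift[of _ "2 * pi * real j", symmetric])
       (auto intro!: nn_integral_cong split: split_indicator simp: nn_integral_circ algebra_simps)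
  finally show ?case using Suc by (auto simp: distrib_right add.commute intro: order_trans add_left_mono)
qed

subsection \<open>Minkowski's integral inequality\<close>

definition Lnorm :: "real \<Rightarrow> 'a measure \<Rightarrow> ('a \<Rightarrow> ennreal) \<Rightarrow> ennreal" where
  "Lnorm s M g = ennpowr (\<integral>\<^sup>+y. ennpowr (g y) s \<partial>M) (1 / s)"

lemma Lnorm_mono_AE: "0 < s \<Longrightarrow> AE y in M. f y \<le> g y \<Longrightarrow> Lnorm s M f \<le> Lnorm s M g"
  unfolding Lnorm_def
  by (intro ennpowr_mono nn_integral_mono_AE) (auto elim!: eventually_mono intro: ennpowr_mono)

lemma Lnorm_mono: "0 < s \<Longrightarrow> (\<And>y. f y \<le> g y) \<Longrightarrow> Lnorm s M f \<le> Lnorm s M g"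
  by (intro Lnorm_mono_AE) auto

lemma Lnorm_powr: "0 < s \<Longrightarrow> ennpowr (Lnorm s M g) s = (\<integral>\<^sup>+y. ennpowr (g y) s \<partial>M)"
  unfolding Lnorm_def by simp

lemma Lnorm_cmult:
  assumes "0 < s" and [measurable]: "g \<in> borel_measurable M"
  shows "Lnorm s M (\<lambda>y. c * g y) = c * Lnorm s M g"
  using assms unfolding Lnorm_def by (simp add: ennpowr_mult nn_integral_cmult)

lemma measurable_Lnorm [measurable]:
  assumes "sigma_finite_measure M" and [measurable]: "case_prod g \<in> borel_measurable (N \<Otimes>\<^sub>M M)"
  shows "(\<lambda>x. Lnorm s M (g x)) \<in> borel_measurable N"
proof -
  interpret sigma_finite_measure M by fact
  show ?thesis unfolding Lnorm_def by measurable
qed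

lemma Lnorm_eq_0_iff:
  assumes "0 < s" and [measurable]: "g \<in> borel_measurable M"
  shows "Lnorm s M g = 0 \<longleftrightarrow> (AE y in M. g y = 0)"
  unfolding Lnorm_def by (simp add: nn_integral_0_iff_AE)

text \<open>The \<open>s\<close>-th power of the average of \<open>g(z, y) / A(z)\<close> against the probability density
  \<open>A(z) / A\<close>, where \<open>A(z)\<close> is the norm of \<open>g(z, \<cdot>)\<close> and \<open>A\<close> its integral, is estimated by
  Jensen's inequality in the form of the tangent line inequality.\<close>

lemma Minkowski_integral:
  assumes "sigma_finite_measure Q" "sigma_finite_measure M" "1 < s"
    and [measurable]: "case_prod g \<in> borel_measurable (Q \<Otimes>\<^sub>M M)"
  shows "Lnorm s M (\<lambda>y. \<integral>\<^sup>+z. g z y \<partial>Q) \<le> (\<integral>\<^sup>+z. Lnorm s M (g z) \<partial>Q)"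
proof -
  interpret Q: sigma_finite_measure Q by fact
  interpret M: sigma_finite_measure M by fact
  interpret QM: pair_sigma_finite Q M ..
  define a where "a = (\<lambda>z. Lnorm s M (g z))"
  have [measurable]: "a \<in> borel_measurable Q"
    unfolding a_def by (rule measurable_Lnorm[OF assms(2)]) simp
  define A where "A = (\<integral>\<^sup>+z. a z \<partial>Q)"
  have s: "s > 0" "s \<noteq> 0" using assms by auto
  have [measurable]: "(\<lambda>y. \<integral>\<^sup>+z. g z y \<partial>Q) \<in> borel_measurable M"
    by measurable
  \<comment> \<open>Division by \<open>a z\<close> is impossible where it vanishes, but there
    \<open>g z\<close> is zero almost everywhere.\<close>
  have zero: "AE y in M. AE z in Q. a z = 0 \<longrightarrow> g z y = 0"
  proof (subst QM.AE_commute[symmetric])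
    show "AE z in Q. AE y in M. a z = 0 \<longrightarrow> g z y = 0"
    proof (rule AE_I2)
      fix z assume [measurable]: "z \<in> space Q"
      show "AE y in M. a z = 0 \<longrightarrow> g z y = 0"
      proof (cases "a z = 0")
        case True
        then show ?thesis using s by (subst (asm) a_def, subst (asm) Lnorm_eq_0_iff) auto
      qed auto
    qed
  qed measurable
  consider "A = \<infinity>" | "A = 0" | B where "A = ennreal B" "B > 0"
    by (cases A) (force simp: less_le)+
  then show ?thesis
  proof cases
    case 1
    then show ?thesis by (simp add: A_def a_def)
  next
    case 2
    then have "AE z in Q. a z = 0" by (simp add: A_def nn_integral_0_iff_AE)
    then have az: "AE z in Q. a z = 0" .
    have "AE y in M. (\<integral>\<^sup>+z. g z y \<partial>Q) = 0"
      using zero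
    proof eventually_elim
      case (elim y)
      have "AE z in Q. g z y = 0" using elim az by eventually_elim simp
      then have "(\<integral>\<^sup>+z. g z y \<partial>Q) = (\<integral>\<^sup>+z. 0 \<partial>Q)" by (rule nn_integral_cong_AE)
      then show ?case by simp
    qed
    then have "Lnorm s M (\<lambda>y. \<integral>\<^sup>+z. g z y \<partial>Q) = 0"
      using s by (subst Lnorm_eq_0_iff) auto
    then show ?thesis by simp
  next
    case 3
    \<comment> \<open>With a = \<open>a z\<close> and A = \<open>B\<close> this is a^(1 - s) / A:
      the factor left when (g / a)^s is weighted by the density a / A.\<close>
    define w where "w = (\<lambda>z. ennreal (enn2real (a z) powr (1 - s) / B))"
    have [measurable]: "w \<in> borel_measurable Q" unfolding w_def by measurable
    have fin: "AE z in Q. a z \<noteq> \<infinity>"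
      using 3 by (intro nn_integral_PInf_AE) (auto simp: A_def[symmetric])
    have point: "ennreal (s * c powr (s - 1) / B) * g z y
        \<le> ennpowr (g z y) s * w z + ennreal ((s - 1) * c powr s / B) * a z"
      if c: "0 \<le> c" and z: "a z \<noteq> \<infinity>" "a z = 0 \<longrightarrow> g z y = 0" for c z y
    proof (cases "a z = 0")
      case False
      then obtain b where b: "a z = ennreal b" "b > 0"
        using z by (cases "a z") (force simp: less_le)+
      have "ennreal (s * c powr (s - 1)) * (ennreal (1 / b) * g z y)
          \<le> ennpowr (ennreal (1 / b) * g z y) s + ennreal ((s - 1) * c powr s)"
        using assms c by (intro ennpowr_tangent)
      then have "ennreal (b / B) * (ennreal (s * c powr (s - 1)) * (ennreal (1 / b) * g z y))
          \<le> ennreal (b / B) * (ennpowr (ennreal (1 / b) * g z y) s + ennreal ((s - 1) * c powr s))"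
        by (rule mult_left_mono) simp
      also have "\<dots> = ennreal (b / B) * ennreal ((1 / b) powr s) * ennpowr (g z y) s
          + ennreal (b / B) * ennreal ((s - 1) * c powr s)"
        using s b by (simp add: ennpowr_mult distrib_left mult.assoc)
      also have "ennreal (b / B) * ennreal ((1 / b) powr s) = w z"
        using b 3 by (simp add: w_def ennreal_mult[symmetric] powr_diff powr_divide)
      also have "ennreal (b / B) * ennreal ((s - 1) * c powr s) = ennreal ((s - 1) * c powr s / B) * a z"
        using b 3 assms by (simp add: ennreal_mult[symmetric])
      also have "ennreal (b / B) * (ennreal (s * c powr (s - 1)) * (ennreal (1 / b) * g z y))
          = ennreal (s * c powr (s - 1) / B) * g z y"
        using b 3 s by (simp add: ennreal_mult[symmetric] mult.assoc[symmetric])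
      finally show ?thesis by (simp add: mult.commute)
    qed (use z in simp)
    define J where "J = (\<lambda>y. \<integral>\<^sup>+z. ennpowr (g z y) s * w z \<partial>Q)"
    have [measurable]: "J \<in> borel_measurable M" unfolding J_def by measurable
    have J: "AE y in M. ennpowr (\<integral>\<^sup>+z. g z y \<partial>Q) s \<le> ennreal (B powr s) * J y"
      using zero AE_space
    proof eventually_elim
      case (elim y)
      note [measurable] = elim(2)
      define H where "H = (\<integral>\<^sup>+z. g z y \<partial>Q)"
      have main: "ennreal (s * c powr (s - 1) / B) * H \<le> J y + ennreal ((s - 1) * c powr s)"
        if "0 \<le> c" for c
      proof -
        have "ennreal (s * c powr (s - 1) / B) * H = (\<integral>\<^sup>+z. ennreal (s * c powr (s - 1) / B) * g z y \<partial>Q)"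
          unfolding H_def by (subst nn_integral_cmult) auto
        also have "\<dots> \<le> (\<integral>\<^sup>+z. ennpowr (g z y) s * w z + ennreal ((s - 1) * c powr s / B) * a z \<partial>Q)"
          using elim(1) fin by (intro nn_integral_mono_AE, eventually_elim) (use point that in auto)
        also have "\<dots> = J y + ennreal ((s - 1) * c powr s / B) * A"
          unfolding J_def A_def by (subst nn_integral_add) (auto simp: nn_integral_cmult)
        also have "ennreal ((s - 1) * c powr s / B) * A = ennreal ((s - 1) * c powr s)"
          using 3 assms by (simp add: ennreal_mult[symmetric])
        finally show ?thesis .
      qed
      show "ennpowr H s \<le> ennreal (B powr s) * J y"
      proof (cases H)
        case (real r)
        \<comment> \<open>The tangent is taken at r / B, the mean of g / a for the density a / A,
          where it yields the full power.\<close>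
        have *: "s * (r / B) powr (s - 1) * r / B = s * (r / B) powr s"
          using real 3 by (cases "r = 0") (simp_all add: powr_diff field_simps)
        have "ennreal (s * (r / B) powr s) \<le> J y + ennreal ((s - 1) * (r / B) powr s)"
          using main[of "r / B"] real 3 s by (simp add: ennreal_mult[symmetric] *[simplified])
        also have "ennreal (s * (r / B) powr s) = ennreal ((r / B) powr s) + ennreal ((s - 1) * (r / B) powr s)"
        proof -
          have "s * (r / B) powr s = (r / B) powr s + (s - 1) * (r / B) powr s"
            by (simp add: algebra_simps)
          then show ?thesis using assms by (simp del: distrib_right)
        qed
        finally have "ennreal ((r / B) powr s) \<le> J y"
          by (simp add: ennreal_add_left_cancel_le add.commute[of _ "ennreal ((s - 1) * (r / B) powr s)"])
        then have "ennreal (B powr s) * ennreal ((r / B) powr s) \<le> ennreal (B powr s) * J y"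
          by (rule mult_left_mono) simp
        then show ?thesis using real 3
          by (simp add: ennreal_mult[symmetric] powr_mult[symmetric])
      next
        case top
        then have "J y = \<infinity>"
          using main[of 1] 3 assms by (auto simp: ennreal_mult_top top_unique)
        then show ?thesis using 3 by (simp add: ennreal_mult_top)
      qed
    qed
    have "(\<integral>\<^sup>+y. J y \<partial>M) = (\<integral>\<^sup>+z. \<integral>\<^sup>+y. ennpowr (g z y) s * w z \<partial>M \<partial>Q)"
      unfolding J_def by (subst QM.Fubini') auto
    also have "\<dots> = (\<integral>\<^sup>+z. ennpowr (a z) s * w z \<partial>Q)"
      using s by (intro nn_integral_cong) (simp add: nn_integral_multc a_def Lnorm_powr)
    also have "\<dots> \<le> (\<integral>\<^sup>+z. ennreal (1 / B) * a z \<partial>Q)"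
      using fin
    proof (intro nn_integral_mono_AE, eventually_elim)
      case (elim z)
      then obtain b where b: "a z = ennreal b" "b \<ge> 0" by (cases "a z") auto
      have "b powr s * (b powr (1 - s) / B) = b / B"
        using b by (simp add: powr_add[symmetric])
      then show ?case using b 3 by (simp add: w_def ennreal_mult[symmetric])
    qed
    also have "\<dots> = ennreal (1 / B) * A"
      unfolding A_def by (rule nn_integral_cmult) simp
    also have "\<dots> = 1"
      using 3 by (simp add: ennreal_mult[symmetric])
    finally have J1: "(\<integral>\<^sup>+y. J y \<partial>M) \<le> 1" .
    have "(\<integral>\<^sup>+y. ennpowr (\<integral>\<^sup>+z. g z y \<partial>Q) s \<partial>M) \<le> (\<integral>\<^sup>+y. ennreal (B powr s) * J y \<partial>M)"
      by (intro nn_integral_mono_AE J)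
    also have "\<dots> \<le> ennreal (B powr s) * 1"
      by (subst nn_integral_cmult, simp, intro mult_left_mono J1, simp)
    also have "\<dots> = ennpowr A s" using 3 by simp
    finally have "Lnorm s M (\<lambda>y. \<integral>\<^sup>+z. g z y \<partial>Q) \<le> ennpowr (ennpowr A s) (1 / s)"
      unfolding Lnorm_def using s by (intro ennpowr_mono) auto
    then show ?thesis using s by (simp add: A_def a_def)
  qed
qed

subsection \<open>The Hardy--Littlewood--Sobolev inequality on the circle\<close>

lemma nn_integral_powr_from_0:
  fixes e a :: real
  assumes "-1 < e" "0 \<le> a"
  shows "(\<integral>\<^sup>+x. ennreal (x powr e) * indicator {0..a} x \<partial>lborel) = ennreal (a powr (e + 1) / (e + 1))"
proof -
  have "(\<integral>\<^sup>+x. ennreal (indicator {0..a} x * x powr e) \<partial>lborel) = ennreal (a powr (e + 1) / (e + 1))"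
    using has_integral_powr_from_0[of e a] assms by (intro nn_integral_has_integral_lebesgue) auto
  then show ?thesis
    by (simp add: ennreal_mult' ennreal_indicator mult.commute)
qed

lemma nn_integral_powr_to_inf:
  fixes e a :: real
  assumes "e < -1" "0 < a"
  shows "(\<integral>\<^sup>+x. ennreal (x powr e) * indicator {a..} x \<partial>lborel) = ennreal (- (a powr (e + 1)) / (e + 1))"
proof -
  have "(\<integral>\<^sup>+x. ennreal (indicator {a..} x * x powr e) \<partial>lborel) = ennreal (- (a powr (e + 1)) / (e + 1))"
    using has_integral_powr_to_inf[of e a] assms by (intro nn_integral_has_integral_lebesgue) auto
  then show ?thesis
    by (simp add: ennreal_mult' ennreal_indicator mult.commute)
qed

text \<open>The power is the integral of its derivative over the levels below \<open>x\<close>. An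
  infinite \<open>x\<close> exceeds every finite \<open>a\<close>, so the integral over the levels
  is then infinite as well.\<close>

lemma ennpowr_layer_cake:
  assumes "0 < q"
  shows "ennpowr x q \<le> (\<integral>\<^sup>+t. ennreal (q * t powr (q - 1)) * indicator {t. 0 < t \<and> ennreal t < x} t \<partial>lborel)"
proof -
  have fin: "ennreal (a powr q) \<le> (\<integral>\<^sup>+t. ennreal (q * t powr (q - 1)) * indicator {t. 0 < t \<and> ennreal t < x} t \<partial>lborel)"
    if "0 \<le> a" "ennreal a \<le> x" for a
  proof -
    have "ennreal (a powr q) = ennreal q * (\<integral>\<^sup>+t. ennreal (t powr (q - 1)) * indicator {0..a} t \<partial>lborel)"
      using assms that by (subst nn_integral_powr_from_0) (auto simp: ennreal_mult[symmetric])
    also have "\<dots> = (\<integral>\<^sup>+t. ennreal (q * t powr (q - 1)) * indicator {0..a} t \<partial>lborel)"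
      using assms by (subst nn_integral_cmult[symmetric]) (auto simp: ennreal_mult mult_ac)
    also have "\<dots> \<le> (\<integral>\<^sup>+t. ennreal (q * t powr (q - 1)) * indicator {t. 0 < t \<and> ennreal t < x} t \<partial>lborel)"
    proof (intro nn_integral_mono_AE)
      have *: "AE t in lborel. t \<noteq> 0 \<and> t \<noteq> a" by (intro AE_conjI AE_lborel_singleton)
      have T: "ennreal t < x" if "t \<in> {0..a}" "t \<noteq> a" for t
        using that \<open>ennreal a \<le> x\<close> \<open>0 \<le> a\<close> by (auto intro!: less_le_trans[OF ennreal_lessI])
      show "AE t in lborel. ennreal (q * t powr (q - 1)) * indicator {0..a} t
          \<le> ennreal (q * t powr (q - 1)) * indicator {t. 0 < t \<and> ennreal t < x} t"
        using * by eventually_elim (auto split: split_indicator simp: T)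
    qed
    finally show ?thesis .
  qed
  show ?thesis
  proof (cases x)
    case (real r)
    then show ?thesis using fin[of r] by simp
  next
    case top
    have "ennreal K \<le> (\<integral>\<^sup>+t. ennreal (q * t powr (q - 1)) * indicator {t. 0 < t \<and> ennreal t < x} t \<partial>lborel)"
      if "0 \<le> K" for K
      using fin[of "K powr (1 / q)"] that assms top by (simp add: powr_powr)
    from this[of "enn2real (\<integral>\<^sup>+t. ennreal (q * t powr (q - 1)) * indicator {t. 0 < t \<and> ennreal t < x} t \<partial>lborel) + 1"]
    show ?thesis
      by (cases "\<integral>\<^sup>+t. ennreal (q * t powr (q - 1)) * indicator {t. 0 < t \<and> ennreal t < x} t \<partial>lborel")
         (auto simp: top ennreal_le_iff)
  qed
qed

text \<open>One-sided fractional integral of order \<open>\<theta>\<close> over one period, without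
  the Gamma factor. The nonnegative kernel keeps it defined everywhere, with values in
  [0, infinity].\<close>

definition riesz :: "real \<Rightarrow> (real \<Rightarrow> ennreal) \<Rightarrow> real \<Rightarrow> ennreal" where
  "riesz \<theta> n x = (\<integral>\<^sup>+u. ennreal (u powr (\<theta> - 1)) * n (x - u) \<partial>circ)"

lemma measurable_riesz [measurable]:
  assumes [measurable]: "case_prod n \<in> borel_measurable (N \<Otimes>\<^sub>M borel)" "f \<in> borel_measurable N"
  shows "(\<lambda>y. riesz \<theta> (n y) (f y)) \<in> borel_measurable N"
proof -
  interpret sigma_finite_measure circ by (rule sigma_finite_circ)
  show ?thesis unfolding riesz_def by measurable
qed

context
  fixes p q \<theta> :: real
  assumes p: "1 < p" and pq: "p < q" and \<theta>: "\<theta> = 1 / p - 1 / q"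
begin

lemma theta_bounds: "0 < \<theta>" "\<theta> < 1" "\<theta> < 1 / p" "1 + q * \<theta> = q / p" "\<theta> * p = (q - p) / q"
proof -
  have "1 / q < 1 / p" "1 / p < 1" using p pq by (auto simp: field_simps)
  moreover have "0 < 1 / q" using p pq by simp
  ultimately show "0 < \<theta>" "\<theta> < 1" "\<theta> < 1 / p" unfolding \<theta> by linarith+
qed (use p pq in \<open>auto simp: \<theta> field_simps\<close>)

text \<open>At level \<open>t\<close> split the kernel at a radius proportional to \<open>t powr (-q)\<close> and the function at
  height proportional to \<open>t powr (q / p)\<close>: the far part of the kernel (by Young's inequality) and
  the low part of the function contribute at most three quarters of \<open>t\<close>.\<close>

lemma riesz_level:
  assumes n [measurable]: "n \<in> borel_measurable borel" "periodic n" and n1: "(\<integral>\<^sup>+x. ennpowr (n x) p \<partial>circ) \<le> 1"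
  defines "p' \<equiv> p / (p - 1)"
  defines "K \<equiv> 1 + 1 / ((1 - \<theta>) * p' - 1)"
  defines "c1 \<equiv> (2 * K) powr q"
  defines "c2 \<equiv> \<theta> / 4 * c1 powr (-\<theta>)"
  assumes t: "0 < t" "ennreal t < riesz \<theta> n x"
  shows "1 \<le> (\<integral>\<^sup>+u. ennreal (4 / t * u powr (\<theta> - 1)) * indicator {0..c1 * t powr (-q)} u
      * (n (x - u) * indicator {z. ennreal (c2 * t powr (q / p)) < n z} (x - u)) \<partial>circ)"
proof -
  note th = theta_bounds
  have p': "p' > 1" "1 / p' + 1 / p = 1" using p by (auto simp: p'_def field_simps)
  have e1: "(1 - \<theta>) * p' > 1"
  proof -
    have "(1 - \<theta>) > 1 - 1 / p" using th by auto
    then have "(1 - \<theta>) * p' > (1 - 1 / p) * p'" using p' by (intro mult_strict_right_mono) auto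
    also have "(1 - 1 / p) * p' = 1" using p by (auto simp: p'_def field_simps)
    finally show ?thesis by simp
  qed
  then have K: "K > 1" by (simp add: K_def)
  then have c1: "c1 > 0" by (simp add: c1_def)
  define R where "R = c1 * t powr (-q)"
  define s where "s = c2 * t powr (q / p)"
  have R: "R > 0" using c1 t by (simp add: R_def)
  have s0: "s > 0" using c1 t th by (simp add: s_def c2_def)
  \<comment> \<open>The constant \<open>c1\<close> is chosen for this:
    \<open>R powr (-1/q) * K\<close> bounds the far part. In \<open>K\<close> the summand 1 comes
    from the function and 1 / ((1 - \<theta>) p' - 1) from the tail of the kernel.\<close>
  have Rq: "R powr (-1/q) * K = t / 2"
  proof -
    have "R powr (-1/q) = (2 * K) powr (-1) * t powr 1"
      using p pq K t by (simp add: R_def c1_def powr_mult powr_powr)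
    then show ?thesis using K t by (simp add: powr_minus field_simps)
  qed
  \<comment> \<open>The constant \<open>c2\<close> makes the low part of the function, at most
    \<open>s\<close> times the mass \<open>R powr \<theta> / \<theta>\<close> of the near kernel,
    contribute a quarter of \<open>t\<close>.\<close>
  have sR: "s * (R powr \<theta> / \<theta>) = t / 4"
  proof -
    have "R powr \<theta> = c1 powr \<theta> * t powr (- q * \<theta>)"
      using c1 t by (simp add: R_def powr_mult powr_powr)
    moreover have "t powr (q / p) * t powr (- q * \<theta>) = t"
    proof -
      have "q / p + - q * \<theta> = 1" using th(4) by simp
      then show ?thesis using t by (simp only: powr_add[symmetric]) simp
    qed
    moreover have "c1 powr (-\<theta>) * c1 powr \<theta> = 1"
      using c1 by (simp add: powr_add[symmetric])
    ultimately show ?thesis using th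
      by (simp add: s_def c2_def) (metis mult.assoc mult.left_commute mult_1)
  qed
  define b where "b = (\<lambda>u. ennreal (u powr (\<theta> - 1)) * indicator {0..R} u
      * (n (x - u) * indicator {z. ennreal s < n z} (x - u)))"
  have [measurable]: "b \<in> borel_measurable borel" unfolding b_def by measurable
  have split: "ennreal (u powr (\<theta> - 1)) * n (x - u)
      \<le> b u + ennreal s * (ennreal (u powr (\<theta> - 1)) * indicator {0..R} u)
        + (ennreal (R powr (-1/q) * R powr (p'/q)) * (ennreal (u powr ((\<theta> - 1) * p')) * indicator {R..} u)
          + ennreal (R powr (-1/q)) * ennpowr (n (x - u)) p)" (is "?l \<le> ?b + ?s + (?f + ?g)")
    if u: "0 \<le> u" for u
  proof (cases "u \<le> R")
    case True
    have "?l \<le> ?b + ?s"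
    proof (cases "ennreal s < n (x - u)")
      case True
      then show ?thesis using u \<open>u \<le> R\<close> by (simp add: b_def)
    next
      case False
      then have "?l \<le> ennreal (u powr (\<theta> - 1)) * ennreal s" by (intro mult_left_mono) auto
      then show ?thesis using u \<open>u \<le> R\<close> by (simp add: b_def mult.commute add_increasing)
    qed
    then show ?thesis by (rule order_trans) simp
  next
    case False
    have "?l \<le> ?f + ?g"
    proof (cases "n (x - u)")
      case (real r)
      \<comment> \<open>Young's inequality after multiplying the kernel by
        \<open>R powr (1/q)\<close>; with this weight the integrals of both resulting terms scale
        alike, like \<open>R powr (-1/q)\<close>.\<close>
      have "R powr (1/q) * u powr (\<theta> - 1) * r
          \<le> (R powr (1/q) * u powr (\<theta> - 1)) powr p' / p' + r powr p / p"
        using real p' p by (intro Youngs_inequality) auto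
      also have "\<dots> \<le> (R powr (1/q) * u powr (\<theta> - 1)) powr p' + r powr p"
        using p' p by (intro add_mono) (simp_all add: divide_le_eq mult_le_cancel_left1)
      also have "(R powr (1/q) * u powr (\<theta> - 1)) powr p' = R powr (p'/q) * u powr ((\<theta> - 1) * p')"
        using R u by (simp add: powr_mult powr_powr)
      finally have "R powr (-1/q) * (R powr (1/q) * u powr (\<theta> - 1) * r)
          \<le> R powr (-1/q) * (R powr (p'/q) * u powr ((\<theta> - 1) * p') + r powr p)"
        by (rule mult_left_mono) simp
      also have "R powr (-1/q) * (R powr (1/q) * u powr (\<theta> - 1) * r)
         = (R powr (-1/q) * R powr (1/q)) * (u powr (\<theta> - 1) * r)" by simp
      also have "R powr (-1/q) * R powr (1/q) = 1" using R by (simp add: powr_add[symmetric])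
      finally show ?thesis using real False
        by (simp add: ennreal_mult[symmetric] ennreal_plus[symmetric] ennreal_leI distrib_left mult.assoc
            del: ennreal_plus)
    next
      case top
      then show ?thesis using R by (simp add: ennreal_mult_top)
    qed
    then show ?thesis by (rule order_trans) simp
  qed
  have e2: "R powr (-1/q) * R powr (p'/q) * (R powr ((\<theta> - 1) * p' + 1) / ((1 - \<theta>) * p' - 1))
      = R powr (-1/q) / ((1 - \<theta>) * p' - 1)"
  proof -
    have "p'/q + ((\<theta> - 1) * p' + 1) = p' * (1 / p - 1) + 1"
      by (simp add: \<theta> algebra_simps)
    also have "\<dots> = 0" using p by (simp add: p'_def field_simps)
    finally have "R powr (p'/q) * R powr ((\<theta> - 1) * p' + 1) = 1"
      using R by (simp add: powr_add[symmetric])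
    then show ?thesis by (simp add: mult.assoc)
  qed
  have "riesz \<theta> n x \<le> (\<integral>\<^sup>+u. b u + ennreal s * (ennreal (u powr (\<theta> - 1)) * indicator {0..R} u)
        + (ennreal (R powr (-1/q) * R powr (p'/q)) * (ennreal (u powr ((\<theta> - 1) * p')) * indicator {R..} u)
          + ennreal (R powr (-1/q)) * ennpowr (n (x - u)) p) \<partial>circ)"
    unfolding riesz_def by (intro nn_integral_mono_AE eventually_mono[OF AE_circ_pos] split less_imp_le)
  also have "\<dots> = (\<integral>\<^sup>+u. b u \<partial>circ) + ennreal s * (\<integral>\<^sup>+u. ennreal (u powr (\<theta> - 1)) * indicator {0..R} u \<partial>circ)
      + (ennreal (R powr (-1/q) * R powr (p'/q)) * (\<integral>\<^sup>+u. ennreal (u powr ((\<theta> - 1) * p')) * indicator {R..} u \<partial>circ)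
      + ennreal (R powr (-1/q)) * (\<integral>\<^sup>+u. ennpowr (n (x - u)) p \<partial>circ))"
    by (simp add: nn_integral_add nn_integral_cmult)
  also have "\<dots> \<le> (\<integral>\<^sup>+u. b u \<partial>circ) + ennreal s * ennreal (R powr \<theta> / \<theta>)
      + (ennreal (R powr (-1/q) * R powr (p'/q)) * ennreal (R powr ((\<theta> - 1) * p' + 1) / ((1 - \<theta>) * p' - 1))
      + ennreal (R powr (-1/q)) * 1)"
  proof (intro add_mono mult_left_mono order_refl zero_le)
    have le: "(\<integral>\<^sup>+u. f u \<partial>circ) \<le> (\<integral>\<^sup>+u. f u \<partial>lborel)" if [measurable]: "f \<in> borel_measurable borel" for f
      by (subst nn_integral_circ) (auto intro!: nn_integral_mono split: split_indicator)
    show "(\<integral>\<^sup>+u. ennreal (u powr (\<theta> - 1)) * indicator {0..R} u \<partial>circ) \<le> ennreal (R powr \<theta> / \<theta>)"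
      using nn_integral_powr_from_0[of "\<theta> - 1" R] th R by (intro order_trans[OF le]) auto
    have "- (R powr ((\<theta> - 1) * p' + 1)) / ((\<theta> - 1) * p' + 1) = R powr ((\<theta> - 1) * p' + 1) / ((1 - \<theta>) * p' - 1)"
      using e1 by (simp add: field_simps)
    then show "(\<integral>\<^sup>+u. ennreal (u powr ((\<theta> - 1) * p')) * indicator {R..} u \<partial>circ)
       \<le> ennreal (R powr ((\<theta> - 1) * p' + 1) / ((1 - \<theta>) * p' - 1))"
      using nn_integral_powr_to_inf[of "(\<theta> - 1) * p'" R] e1 R
      by (intro order_trans[OF le]) (auto simp: algebra_simps)
    have per: "periodic (\<lambda>z. ennpowr (n (x - (- z))) p)"
    proof -
      have "n (x - (- (z + 2 * pi))) = n (x - (- z))" for z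
        using \<open>periodic n\<close>[unfolded periodic_def, rule_format, of "x + z"] by (simp add: algebra_simps)
      then show ?thesis by (simp only: periodic_def) simp
    qed
    have "(\<integral>\<^sup>+u. ennpowr (n (x - u)) p \<partial>circ) = (\<integral>\<^sup>+u. ennpowr (n (u - (- x))) p \<partial>circ)"
      using nn_integral_circ_reflect[OF _ per] by (simp add: add.commute)
    also have "\<dots> = (\<integral>\<^sup>+u. ennpowr (n u) p \<partial>circ)"
      using \<open>periodic n\<close> by (intro nn_integral_circ_shift) (auto simp: periodic_def)
    finally show "(\<integral>\<^sup>+u. ennpowr (n (x - u)) p \<partial>circ) \<le> 1" using n1 by simp
  qed
  also have "\<dots> = (\<integral>\<^sup>+u. b u \<partial>circ) + ennreal (3 * t / 4)"
  proof -
    have "s * (R powr \<theta> / \<theta>) + (R powr (-1/q) / ((1 - \<theta>) * p' - 1) + R powr (-1/q))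
      = t / 4 + R powr (-1/q) * K" unfolding sR by (simp add: K_def algebra_simps)
    also have "\<dots> = 3 * t / 4" unfolding Rq by simp
    finally have eq: "s * (R powr \<theta> / \<theta>) + (R powr (-1/q) / ((1 - \<theta>) * p' - 1) + R powr (-1/q)) = 3 * t / 4" .
    have "ennreal (s * (R powr \<theta> / \<theta>)) + (ennreal (R powr (-1/q) / ((1 - \<theta>) * p' - 1)) + ennreal (R powr (-1/q)))
        = ennreal (3 * t / 4)"
      unfolding eq[symmetric] using s0 th e1 by simp
    moreover have "ennreal s * ennreal (R powr \<theta> / \<theta>) = ennreal (s * (R powr \<theta> / \<theta>))"
      using s0 th by (intro ennreal_mult[symmetric]) auto
    moreover have "ennreal (R powr (-1/q) * R powr (p'/q)) * ennreal (R powr ((\<theta> - 1) * p' + 1) / ((1 - \<theta>) * p' - 1))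
        = ennreal (R powr (-1/q) / ((1 - \<theta>) * p' - 1))"
      unfolding e2[symmetric] using e1 by (intro ennreal_mult[symmetric]) auto
    ultimately show ?thesis by (simp only: add.assoc mult_1_right)
  qed
  finally have "ennreal t \<le> (\<integral>\<^sup>+u. b u \<partial>circ) + ennreal (3 * t / 4)"
    using t(2) by simp
  also have "ennreal t = ennreal (t / 4) + ennreal (3 * t / 4)"
    using t by (simp add: ennreal_plus[symmetric] del: ennreal_plus)
  finally have "ennreal (t / 4) \<le> (\<integral>\<^sup>+u. b u \<partial>circ)"
    by (simp add: ennreal_add_left_cancel_le add.commute[of _ "ennreal (3 * t / 4)"])
  then have "ennreal (4 / t) * ennreal (t / 4) \<le> ennreal (4 / t) * (\<integral>\<^sup>+u. b u \<partial>circ)"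
    by (rule mult_left_mono) simp
  also have "ennreal (4 / t) * ennreal (t / 4) = 1"
    using t by (simp add: ennreal_mult[symmetric])
  also have "ennreal (4 / t) * (\<integral>\<^sup>+u. b u \<partial>circ) = (\<integral>\<^sup>+u. ennreal (4 / t) * b u \<partial>circ)"
    by (subst nn_integral_cmult) auto
  finally show ?thesis
    using t unfolding b_def R_def s_def by (subst ennreal_mult) (simp_all add: mult.assoc)
qed

text \<open>Marcinkiewicz interpolation carried out directly: at level t only the kernel up to a
  radius proportional to t^(-q) and the values of \<open>n\<close> above a height proportional to
  t^(q / p) are felt, so the level set is measured by an L_1 convolution. Integrating over the
  levels first, at fixed z, gives the p-th power of \<open>n z\<close>.\<close>

lemma riesz_Lq_normalized:
  "\<exists>C>0. \<forall>n. n \<in> borel_measurable borel \<longrightarrow> periodic n \<longrightarrow> (\<integral>\<^sup>+x. ennpowr (n x) p \<partial>circ) \<le> 1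
     \<longrightarrow> (\<integral>\<^sup>+x. ennpowr (riesz \<theta> n x) q \<partial>circ) \<le> ennreal C"
proof -
  note th = theta_bounds
  define K where "K = 1 + 1 / ((1 - \<theta>) * (p / (p - 1)) - 1)"
  define c1 where "c1 = (2 * K) powr q"
  define c2 where "c2 = \<theta> / 4 * c1 powr (-\<theta>)"
  have e1: "(1 - \<theta>) * (p / (p - 1)) > 1"
  proof -
    have "(1 - \<theta>) > 1 - 1 / p" using th by auto
    then have "(1 - \<theta>) * (p / (p - 1)) > (1 - 1 / p) * (p / (p - 1))"
      using p by (intro mult_strict_right_mono) auto
    also have "(1 - 1 / p) * (p / (p - 1)) = 1" using p by (auto simp: field_simps)
    finally show ?thesis by simp
  qed
  then have "K > 1" by (simp add: K_def)
  then have c1: "c1 > 0" by (simp add: c1_def)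
  then have c2: "c2 > 0" using th by (simp add: c2_def)
  \<comment> \<open>The exponent of \<open>t\<close> after collecting t^(q - 1) from the layers, 1 /
    t from the level estimate and t^(-q \<theta>) from the kernel mass.\<close>
  define e where "e = q - 2 - q * \<theta>"
  have ee: "e + 1 = (q / p) * (p - 1)"
    using th(4) p by (simp add: e_def field_simps)
  then have e: "e > -1" using p pq by (smt (verit) divide_pos_pos mult_pos_pos)
  define D where "D = 4 * q * c1 powr \<theta> / \<theta>"
  have D: "D > 0" using c1 th p pq by (simp add: D_def)
  define C where "C = D * (c2 powr (1 - p) / (e + 1))"
  have C: "C > 0" using D c2 e by (simp add: C_def)
  have "(\<integral>\<^sup>+x. ennpowr (riesz \<theta> n x) q \<partial>circ) \<le> ennreal C"
    if n [measurable]: "n \<in> borel_measurable borel" and per: "periodic n"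
      and n1: "(\<integral>\<^sup>+x. ennpowr (n x) p \<partial>circ) \<le> 1" for n
  proof -
    interpret c: sigma_finite_measure circ by (rule sigma_finite_circ)
    interpret cl: pair_sigma_finite circ lborel ..
    interpret cc: pair_sigma_finite circ circ ..
    define m where "m = (\<lambda>t z. n z * indicator {z. ennreal (c2 * t powr (q / p)) < n z} z)"
    have [measurable]: "case_prod m \<in> borel_measurable (borel \<Otimes>\<^sub>M borel)"
      unfolding m_def by measurable
    have [measurable]: "m t \<in> borel_measurable borel" for t
      unfolding m_def by measurable
    have mper: "periodic (m t)" for t
      using per by (simp add: periodic_def m_def indicator_def)
    have "(\<integral>\<^sup>+x. ennpowr (riesz \<theta> n x) q \<partial>circ)
        \<le> (\<integral>\<^sup>+x. \<integral>\<^sup>+t. ennreal (q * t powr (q - 1)) * indicator {t. 0 < t \<and> ennreal t < riesz \<theta> n x} t \<partial>lborel \<partial>circ)"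
      using p pq by (intro nn_integral_mono ennpowr_layer_cake) auto
    also have "\<dots> \<le> (\<integral>\<^sup>+x. \<integral>\<^sup>+t. ennreal (q * t powr (q - 1)) * indicator {0<..} t *
       (\<integral>\<^sup>+u. ennreal (4 / t * u powr (\<theta> - 1)) * indicator {0..c1 * t powr (-q)} u * m t (x - u) \<partial>circ) \<partial>lborel \<partial>circ)"
    proof (intro nn_integral_mono)
      fix x t :: real
      show "ennreal (q * t powr (q - 1)) * indicator {t. 0 < t \<and> ennreal t < riesz \<theta> n x} t
          \<le> ennreal (q * t powr (q - 1)) * indicator {0<..} t *
            (\<integral>\<^sup>+u. ennreal (4 / t * u powr (\<theta> - 1)) * indicator {0..c1 * t powr (-q)} u * m t (x - u) \<partial>circ)"
      proof (cases "0 < t \<and> ennreal t < riesz \<theta> n x")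
        case True
        have "1 \<le> (\<integral>\<^sup>+u. ennreal (4 / t * u powr (\<theta> - 1)) * indicator {0..c1 * t powr (-q)} u * m t (x - u) \<partial>circ)"
          using riesz_level[OF n per n1, of t x] True unfolding m_def c2_def c1_def K_def by blast
        then have "ennreal (q * t powr (q - 1)) * 1 \<le> ennreal (q * t powr (q - 1)) *
          (\<integral>\<^sup>+u. ennreal (4 / t * u powr (\<theta> - 1)) * indicator {0..c1 * t powr (-q)} u * m t (x - u) \<partial>circ)"
          by (rule mult_left_mono) simp
        then show ?thesis using True by simp
      qed simp
    qed
    also have "\<dots> = (\<integral>\<^sup>+t. \<integral>\<^sup>+x. ennreal (q * t powr (q - 1)) * indicator {0<..} t *
       (\<integral>\<^sup>+u. ennreal (4 / t * u powr (\<theta> - 1)) * indicator {0..c1 * t powr (-q)} u * m t (x - u) \<partial>circ) \<partial>circ \<partial>lborel)"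
    proof (rule cl.Fubini'[symmetric])
      show "(\<lambda>(x, t). ennreal (q * t powr (q - 1)) * indicator {0<..} t *
         (\<integral>\<^sup>+u. ennreal (4 / t * u powr (\<theta> - 1)) * indicator {0..c1 * t powr (-q)} u * m t (x - u) \<partial>circ))
         \<in> borel_measurable (circ \<Otimes>\<^sub>M lborel)"
        unfolding indicator_def of_bool_def atLeastAtMost_iff greaterThan_iff by measurable
    qed
    also have "\<dots> = (\<integral>\<^sup>+t. ennreal (q * t powr (q - 1)) * indicator {0<..} t *
       (\<integral>\<^sup>+u. \<integral>\<^sup>+x. ennreal (4 / t * u powr (\<theta> - 1)) * indicator {0..c1 * t powr (-q)} u * m t (x - u) \<partial>circ \<partial>circ) \<partial>lborel)"
    proof (intro nn_integral_cong)
      fix t :: real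
      have "(\<integral>\<^sup>+x. \<integral>\<^sup>+u. ennreal (4 / t * u powr (\<theta> - 1)) * indicator {0..c1 * t powr (-q)} u * m t (x - u) \<partial>circ \<partial>circ)
          = (\<integral>\<^sup>+u. \<integral>\<^sup>+x. ennreal (4 / t * u powr (\<theta> - 1)) * indicator {0..c1 * t powr (-q)} u * m t (x - u) \<partial>circ \<partial>circ)"
        by (rule cc.Fubini') simp
      then show "(\<integral>\<^sup>+x. ennreal (q * t powr (q - 1)) * indicator {0<..} t *
       (\<integral>\<^sup>+u. ennreal (4 / t * u powr (\<theta> - 1)) * indicator {0..c1 * t powr (-q)} u * m t (x - u) \<partial>circ) \<partial>circ)
        = ennreal (q * t powr (q - 1)) * indicator {0<..} t *
       (\<integral>\<^sup>+u. \<integral>\<^sup>+x. ennreal (4 / t * u powr (\<theta> - 1)) * indicator {0..c1 * t powr (-q)} u * m t (x - u) \<partial>circ \<partial>circ)"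
        by (subst nn_integral_cmult) simp_all
    qed
    also have "\<dots> \<le> (\<integral>\<^sup>+t. \<integral>\<^sup>+z. ennreal (D * t powr e) * indicator {0<..} t * m t z \<partial>circ \<partial>lborel)"
    proof (intro nn_integral_mono)
      fix t :: real
      show "ennreal (q * t powr (q - 1)) * indicator {0<..} t *
         (\<integral>\<^sup>+u. \<integral>\<^sup>+x. ennreal (4 / t * u powr (\<theta> - 1)) * indicator {0..c1 * t powr (-q)} u * m t (x - u) \<partial>circ \<partial>circ)
        \<le> (\<integral>\<^sup>+z. ennreal (D * t powr e) * indicator {0<..} t * m t z \<partial>circ)"
      proof (cases "0 < t")
        case True
        define R where "R = c1 * t powr (-q)"
        have R: "R > 0" using c1 True by (simp add: R_def)
        define I where "I = (\<integral>\<^sup>+z. m t z \<partial>circ)"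
        have "(\<integral>\<^sup>+u. \<integral>\<^sup>+x. ennreal (4 / t * u powr (\<theta> - 1)) * indicator {0..R} u * m t (x - u) \<partial>circ \<partial>circ)
            = (\<integral>\<^sup>+u. ennreal (4 / t) * I * (ennreal (u powr (\<theta> - 1)) * indicator {0..R} u) \<partial>circ)"
        proof (intro nn_integral_cong)
          fix u
          have "(\<integral>\<^sup>+x. ennreal (4 / t * u powr (\<theta> - 1)) * indicator {0..R} u * m t (x - u) \<partial>circ)
              = ennreal (4 / t * u powr (\<theta> - 1)) * indicator {0..R} u * I"
            by (subst nn_integral_cmult) (simp_all add: nn_integral_circ_shift[OF _ mper] I_def)
          also have "\<dots> = ennreal (4 / t) * I * (ennreal (u powr (\<theta> - 1)) * indicator {0..R} u)"
            using True by (subst ennreal_mult) (auto simp: mult_ac)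
          finally show "(\<integral>\<^sup>+x. ennreal (4 / t * u powr (\<theta> - 1)) * indicator {0..R} u * m t (x - u) \<partial>circ)
              = ennreal (4 / t) * I * (ennreal (u powr (\<theta> - 1)) * indicator {0..R} u)" .
        qed
        also have "\<dots> = ennreal (4 / t) * I * (\<integral>\<^sup>+u. ennreal (u powr (\<theta> - 1)) * indicator {0..R} u \<partial>circ)"
          by (subst nn_integral_cmult) auto
        also have "\<dots> \<le> ennreal (4 / t) * I * (\<integral>\<^sup>+u. ennreal (u powr (\<theta> - 1)) * indicator {0..R} u \<partial>lborel)"
          by (subst nn_integral_circ) (auto intro!: mult_left_mono nn_integral_mono split: split_indicator)
        also have "\<dots> = ennreal (4 / t) * I * ennreal (R powr \<theta> / \<theta>)"
          using nn_integral_powr_from_0[of "\<theta> - 1" R] th R by simp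
        finally have "ennreal (q * t powr (q - 1)) *
            (\<integral>\<^sup>+u. \<integral>\<^sup>+x. ennreal (4 / t * u powr (\<theta> - 1)) * indicator {0..R} u * m t (x - u) \<partial>circ \<partial>circ)
          \<le> ennreal (q * t powr (q - 1)) * (ennreal (4 / t) * I * ennreal (R powr \<theta> / \<theta>))"
          by (rule mult_left_mono) simp
        also have "\<dots> = ennreal (q * t powr (q - 1) * (4 / t) * (R powr \<theta> / \<theta>)) * I"
        proof -
          have "ennreal (q * t powr (q - 1) * (4 / t) * (R powr \<theta> / \<theta>))
              = ennreal (q * t powr (q - 1)) * ennreal (4 / t) * ennreal (R powr \<theta> / \<theta>)"
            using True p pq R th by (simp only: ennreal_mult mult_nonneg_nonneg divide_nonneg_pos powr_ge_zero less_imp_le)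
          then show ?thesis by (simp add: mult_ac)
        qed
        also have "q * t powr (q - 1) * (4 / t) * (R powr \<theta> / \<theta>) = D * t powr e"
        proof -
          have "R powr \<theta> = c1 powr \<theta> * t powr (- q * \<theta>)"
            using c1 True by (simp add: R_def powr_mult powr_powr)
          moreover have "t powr (q - 1) * (1 / t) * t powr (- q * \<theta>) = t powr e"
          proof -
            have "1 / t = t powr (-1)" using True by (simp add: powr_minus field_simps)
            then have "t powr (q - 1) * (1 / t) * t powr (- q * \<theta>) = t powr (q - 1 + (-1) + - q * \<theta>)"
              using True by (simp only: powr_add)
            also have "q - 1 + (-1) + - q * \<theta> = e" by (simp add: e_def)
            finally show ?thesis .
          qed
          moreover have "q * a * (4 / t) * ((c1 powr \<theta> * b) / \<theta>) = D * (a * (1 / t) * b)" for a b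
            by (simp add: D_def mult_ac)
          ultimately show ?thesis by metis
        qed
        finally show ?thesis using True
          by (simp add: R_def I_def nn_integral_cmult)
      qed simp
    qed
    also have "\<dots> = (\<integral>\<^sup>+z. \<integral>\<^sup>+t. ennreal (D * t powr e) * indicator {0<..} t * m t z \<partial>lborel \<partial>circ)"
      by (subst cl.Fubini') auto
    also have "\<dots> \<le> (\<integral>\<^sup>+z. ennreal C * ennpowr (n z) p \<partial>circ)"
    proof (intro nn_integral_mono)
      fix z
      show "(\<integral>\<^sup>+t. ennreal (D * t powr e) * indicator {0<..} t * m t z \<partial>lborel) \<le> ennreal C * ennpowr (n z) p"
      proof (cases "n z")
        case top
        then show ?thesis using C by (simp add: ennreal_mult_top)
      next
        case (real r)
        \<comment> \<open>The value \<open>n z\<close> counts at the levels t < L. Up to a constant,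
          L^(e + 1) is the power p - 1 of \<open>n z\<close>, and the remaining factor
          \<open>n z\<close> completes the power p.\<close>
        define L where "L = (r / c2) powr (p / q)"
        have "(\<integral>\<^sup>+t. ennreal (D * t powr e) * indicator {0<..} t * m t z \<partial>lborel)
            \<le> (\<integral>\<^sup>+t. ennreal (D * r) * (ennreal (t powr e) * indicator {0..L} t) \<partial>lborel)"
        proof (intro nn_integral_mono)
          fix t :: real
          have "t \<le> L" if "0 < t" "c2 * t powr (q / p) < r"
          proof -
            have "t powr (q / p) \<le> r / c2" using that c2 by (simp add: field_simps)
            then have "(t powr (q / p)) powr (p / q) \<le> L"
              unfolding L_def using p pq by (intro powr_mono2) auto
            then show ?thesis using that p pq by (simp add: powr_powr)
          qed
          then have tL: "t \<le> L" if "0 < t" "ennreal (c2 * t powr (q / p)) < n z"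
            using that real c2 by (simp add: ennreal_less_iff)
          have "ennreal (D * t powr e) * n z = ennreal (D * r) * ennreal (t powr e)"
            using real D by (simp add: ennreal_mult mult_ac)
          then show "ennreal (D * t powr e) * indicator {0<..} t * m t z
            \<le> ennreal (D * r) * (ennreal (t powr e) * indicator {0..L} t)"
            using tL by (auto simp: m_def simp del: ennreal_mult split: split_indicator)
        qed
        also have "\<dots> = ennreal (D * r) * ennreal (L powr (e + 1) / (e + 1))"
          using e by (subst nn_integral_cmult) (auto simp: nn_integral_powr_from_0 L_def)
        also have "\<dots> = ennreal (D * r * (L powr (e + 1) / (e + 1)))"
          using D e real by (intro ennreal_mult[symmetric]) auto
        also have "D * r * (L powr (e + 1) / (e + 1)) = C * r powr p"
        proof (cases "r = 0")
          case False
          have "L powr (e + 1) = (r / c2) powr (p - 1)"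
            using p pq by (simp add: L_def powr_powr ee)
          also have "\<dots> = r powr (p - 1) * c2 powr (1 - p)"
            using real c2 by (simp add: powr_divide powr_diff field_simps)
          finally have "r * L powr (e + 1) = r powr p * c2 powr (1 - p)"
            using real False by (simp add: powr_diff)
          then show ?thesis by (simp add: C_def)
        qed (use p in simp)
        also have "ennreal (C * r powr p) = ennreal C * ennpowr (n z) p"
          using real C by (simp add: ennreal_mult)
        finally show ?thesis .
      qed
    qed
    also have "\<dots> = ennreal C * (\<integral>\<^sup>+z. ennpowr (n z) p \<partial>circ)"
      by (rule nn_integral_cmult) simp
    also have "\<dots> \<le> ennreal C * 1" by (intro mult_left_mono n1) simp
    finally show ?thesis by simp
  qed
  with C show ?thesis by blast
qed

text \<open>Both sides are homogeneous of degree q in \<open>n\<close>, so the case of norm at most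
  1 suffices.\<close>

lemma Hardy_Littlewood_Sobolev:
  "\<exists>C>0. \<forall>n. n \<in> borel_measurable borel \<longrightarrow> periodic n \<longrightarrow>
     (\<integral>\<^sup>+x. ennpowr (riesz \<theta> n x) q \<partial>circ) \<le> ennreal C * ennpowr (Lnorm p circ n) q"
proof -
  obtain C where C: "C > 0" and *: "\<And>n. n \<in> borel_measurable borel \<Longrightarrow> periodic n \<Longrightarrow>
      (\<integral>\<^sup>+x. ennpowr (n x) p \<partial>circ) \<le> 1 \<Longrightarrow> (\<integral>\<^sup>+x. ennpowr (riesz \<theta> n x) q \<partial>circ) \<le> ennreal C"
    using riesz_Lq_normalized by blast
  have "(\<integral>\<^sup>+x. ennpowr (riesz \<theta> n x) q \<partial>circ) \<le> ennreal C * ennpowr (Lnorm p circ n) q"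
    if n [measurable]: "n \<in> borel_measurable borel" and per: "periodic n" for n
  proof -
    have scaled: "(\<integral>\<^sup>+x. ennpowr (riesz \<theta> n x) q \<partial>circ) \<le> ennreal (C * N powr q)"
      if N: "0 < N" "Lnorm p circ n \<le> ennreal N" for N
    proof -
      interpret c: sigma_finite_measure circ by (rule sigma_finite_circ)
      define k where "k = (\<lambda>x. ennreal (1 / N) * n x)"
      have [measurable]: "k \<in> borel_measurable borel" unfolding k_def by measurable
      have kper: "periodic k" using per by (simp add: periodic_def k_def)
      have "Lnorm p circ k = ennreal (1 / N) * Lnorm p circ n"
        unfolding k_def using p by (subst Lnorm_cmult) auto
      also have "\<dots> \<le> ennreal (1 / N) * ennreal N" by (intro mult_left_mono N) simp
      also have "\<dots> = 1" using N by (simp add: ennreal_mult[symmetric])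
      finally have "ennpowr (Lnorm p circ k) p \<le> ennpowr 1 p" using p by (intro ennpowr_mono) auto
      then have "(\<integral>\<^sup>+x. ennpowr (k x) p \<partial>circ) \<le> 1" using p by (simp add: Lnorm_powr)
      then have le: "(\<integral>\<^sup>+x. ennpowr (riesz \<theta> k x) q \<partial>circ) \<le> ennreal C" using kper by (intro *) auto
      have "riesz \<theta> n x = ennreal N * riesz \<theta> k x" for x
      proof -
        have "ennreal N * k y = n y" for y
          using N by (simp add: k_def mult.assoc[symmetric] ennreal_mult[symmetric])
        then show ?thesis
          unfolding riesz_def
          by (subst nn_integral_cmult[symmetric], simp, intro nn_integral_cong) (metis mult.left_commute)
      qed
      then have "(\<integral>\<^sup>+x. ennpowr (riesz \<theta> n x) q \<partial>circ) = (\<integral>\<^sup>+x. ennreal (N powr q) * ennpowr (riesz \<theta> k x) q \<partial>circ)"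
        using p pq N by (simp add: ennpowr_mult)
      also have "\<dots> = ennreal (N powr q) * (\<integral>\<^sup>+x. ennpowr (riesz \<theta> k x) q \<partial>circ)"
        by (rule nn_integral_cmult) measurable
      also have "\<dots> \<le> ennreal (N powr q) * ennreal C" by (intro mult_left_mono le) simp
      finally show ?thesis using C by (simp add: ennreal_mult mult.commute)
    qed
    show ?thesis
    proof (cases "Lnorm p circ n")
      case top
      then show ?thesis using C by (simp add: ennreal_mult_top)
    next
      case (real N)
      show ?thesis
      proof (cases "N = 0")
        case False
        then show ?thesis using scaled[of N] real C by (simp add: ennreal_mult)
      next
        \<comment> \<open>A vanishing norm cannot be scaled to 1; arbitrarily small upper bounds N
          are used instead, chosen so that C N^q = d.\<close>
        case True
        have "(\<integral>\<^sup>+x. ennpowr (riesz \<theta> n x) q \<partial>circ) \<le> 0 + ennreal d" if "d > 0" for d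
        proof -
          have "C * ((d / C) powr (1 / q)) powr q = d" using that C p pq by (simp add: powr_powr)
          then show ?thesis using scaled[of "(d / C) powr (1 / q)"] that C real True by simp
        qed
        then have "(\<integral>\<^sup>+x. ennpowr (riesz \<theta> n x) q \<partial>circ) \<le> 0" by (rule ennreal_le_epsilon)
        then show ?thesis by simp
      qed
    qed
  qed
  with C show ?thesis by blast
qed

end

subsection \<open>Sums of functions of dyadic frequencies\<close>

lemma ennpowr_SUP:
  assumes "0 < a"
  shows "ennpowr (SUP i\<in>I. f i) a = (SUP i\<in>I. ennpowr (f i) a)"
proof (rule antisym)
  show "ennpowr (SUP i\<in>I. f i) a \<le> (SUP i\<in>I. ennpowr (f i) a)"
    using assms by (auto simp: ennpowr_le_iff SUP_le_iff intro!: SUP_least)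
      (auto simp: ennpowr_le_iff[symmetric] intro!: SUP_upper)
  show "(SUP i\<in>I. ennpowr (f i) a) \<le> ennpowr (SUP i\<in>I. f i) a"
    using assms by (intro SUP_least ennpowr_mono) (auto intro: SUP_upper)
qed

text \<open>Discrete form of d(S^q) = q S^(q - 1) dS: each increment of the q-th power is bounded
  through the tangent at the later of two consecutive partial sums.\<close>

lemma sum_powr_le:
  fixes b :: "nat \<Rightarrow> real"
  assumes "1 < q" "\<And>k. 0 \<le> b k"
  shows "(\<Sum>k<n. b k) powr q \<le> q * (\<Sum>k<n. b k * (\<Sum>j\<le>k. b j) powr (q - 1))"
proof (induction n)
  case (Suc n)
  define x where "x = (\<Sum>k<n. b k)"
  define c where "c = (\<Sum>k\<le>n. b k)"
  have c: "c = x + b n" by (simp add: c_def x_def lessThan_Suc_atMost[symmetric])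
  have nn: "0 \<le> x" "0 \<le> c" using assms by (auto simp: c_def x_def intro: sum_nonneg)
  have "q * c powr (q - 1) * x \<le> x powr q + (q - 1) * c powr q"
    using nn assms by (intro powr_tangent)
  also have "c powr q = c powr (q - 1) * c" using nn by (cases "c = 0") (auto simp: powr_diff)
  finally have "c powr (q - 1) * c \<le> x powr q + q * (b n * c powr (q - 1))"
    by (simp add: c algebra_simps)
  moreover have "c powr q = c powr (q - 1) * c" using nn by (cases "c = 0") (auto simp: powr_diff)
  ultimately show ?case using Suc
    by (simp add: x_def[symmetric] c_def[symmetric] c distrib_left)
qed simp

text \<open>The largest of the weighted terms 2^(e (k - j) / r) b_j dominates the whole sum up to a
  geometric series. No convexity enters, so \<open>r\<close> may lie below 1, as r = q - 1 does when
  q < 2.\<close>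

lemma sum_powr_geometric:
  fixes b :: "nat \<Rightarrow> real"
  assumes "0 < r" "0 < e" and b: "\<And>j. 0 \<le> b j"
  shows "(\<Sum>j\<le>k. b j) powr r
    \<le> (1 / (1 - 2 powr (- e / r))) powr r * (\<Sum>j\<le>k. 2 powr (e * real (k - j)) * b j powr r)"
proof -
  define \<rho> where "\<rho> = 2 powr (- e / r)"
  have \<rho>: "0 < \<rho>" "\<rho> < 1" using assms by (auto simp: \<rho>_def powr_less_one)
  define f where "f = (\<lambda>j. 2 powr (e / r * real (k - j)) * b j)"
  obtain j0 where j0: "j0 \<le> k" "\<And>j. j \<le> k \<Longrightarrow> f j \<le> f j0"
  proof -
    have "Max (f ` {..k}) \<in> f ` {..k}" by (rule Max_in) auto
    then obtain j0 where "j0 \<le> k" "f j0 = Max (f ` {..k})" by (metis atMost_iff imageE)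
    then show ?thesis using Max_ge[of "f ` {..k}"] by (intro that[of j0]) auto
  qed
  have bj: "b j \<le> f j0 * \<rho> ^ (k - j)" if "j \<le> k" for j
  proof -
    have "b j = f j * \<rho> ^ (k - j)"
      by (simp add: f_def \<rho>_def powr_realpow[symmetric] powr_powr powr_add[symmetric] mult.commute[of _ "b j"])
    also have "\<dots> \<le> f j0 * \<rho> ^ (k - j)" using j0(2)[OF that] \<rho> by (intro mult_right_mono) auto
    finally show ?thesis .
  qed
  have "(\<Sum>j\<le>k. \<rho> ^ (k - j)) = (\<Sum>i\<le>k. \<rho> ^ i)"
    by (rule sum.reindex_bij_witness[of _ "\<lambda>i. k - i" "\<lambda>i. k - i"]) auto
  also have "\<dots> \<le> (\<Sum>i. \<rho> ^ i)" using \<rho> by (intro sum_le_suminf) auto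
  also have "\<dots> = 1 / (1 - \<rho>)" using \<rho> by (intro suminf_geometric) auto
  finally have g: "(\<Sum>j\<le>k. \<rho> ^ (k - j)) \<le> 1 / (1 - \<rho>)" .
  have f0: "0 \<le> f j0" using b by (simp add: f_def)
  have "(\<Sum>j\<le>k. b j) \<le> (\<Sum>j\<le>k. f j0 * \<rho> ^ (k - j))" by (intro sum_mono bj) auto
  also have "\<dots> \<le> f j0 * (1 / (1 - \<rho>))"
    unfolding sum_distrib_left[symmetric] by (intro mult_left_mono g f0)
  finally have "(\<Sum>j\<le>k. b j) powr r \<le> (f j0 * (1 / (1 - \<rho>))) powr r"
    using assms b by (intro powr_mono2) (auto intro: sum_nonneg)
  also have "\<dots> = (1 / (1 - \<rho>)) powr r * (2 powr (e * real (k - j0)) * b j0 powr r)"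
  proof -
    have "f j0 powr r = 2 powr (e * real (k - j0)) * b j0 powr r"
      using assms b by (simp add: f_def powr_mult powr_powr)
    then show ?thesis by (simp only: powr_mult mult.commute)
  qed
  also have "\<dots> \<le> (1 / (1 - \<rho>)) powr r * (\<Sum>j\<le>k. 2 powr (e * real (k - j)) * b j powr r)"
    using j0(1) by (intro mult_left_mono member_le_sum[of j0 "{..k}" "\<lambda>j. 2 powr (e * real (k - j)) * b j powr r"]) auto
  finally show ?thesis unfolding \<rho>_def .
qed

text \<open>Convolution with a geometric sequence is bounded on l_1. The combination A_k + 2 A_j is
  the one that arises below from the product of two scales.\<close>

lemma sum_geometric_convolution_le:
  fixes A :: "nat \<Rightarrow> real"
  assumes "0 < \<rho>" "\<rho> < 1" "\<And>k. 0 \<le> A k"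
  shows "(\<Sum>k<n. \<Sum>j\<le>k. \<rho> ^ (k - j) * (A k + 2 * A j)) \<le> 3 / (1 - \<rho>) * (\<Sum>k<n. A k)"
proof -
  have g: "(\<Sum>i\<le>k. \<rho> ^ i) \<le> 1 / (1 - \<rho>)" for k
  proof -
    have "(\<Sum>i\<le>k. \<rho> ^ i) \<le> (\<Sum>i. \<rho> ^ i)" using assms by (intro sum_le_suminf) auto
    also have "\<dots> = 1 / (1 - \<rho>)" using assms by (intro suminf_geometric) auto
    finally show ?thesis .
  qed
  have "(\<Sum>j\<le>k. \<rho> ^ (k - j)) = (\<Sum>i\<le>k. \<rho> ^ i)" for k
    by (rule sum.reindex_bij_witness[of _ "\<lambda>i. k - i" "\<lambda>i. k - i"]) auto
  then have 1: "(\<Sum>k<n. \<Sum>j\<le>k. \<rho> ^ (k - j) * A k) \<le> (\<Sum>k<n. 1 / (1 - \<rho>) * A k)"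
    using assms by (intro sum_mono) (simp only: sum_distrib_right[symmetric] mult_right_mono[OF g])
  have "(\<Sum>k<n. \<Sum>j\<le>k. \<rho> ^ (k - j) * A j) = (\<Sum>k<n. \<Sum>j | j < n \<and> j \<le> k. \<rho> ^ (k - j) * A j)"
    by (intro sum.cong refl) auto
  also have "\<dots> = (\<Sum>j<n. \<Sum>k | k < n \<and> j \<le> k. \<rho> ^ (k - j) * A j)"
    using sum.swap_restrict[of "{..<n}" "{..<n}" "\<lambda>k j. \<rho> ^ (k - j) * A j" "\<lambda>k j. j \<le> k"] by simp
  also have "\<dots> \<le> (\<Sum>j<n. 1 / (1 - \<rho>) * A j)"
  proof (intro sum_mono)
    fix j assume "j \<in> {..<n}"
    then have "(\<Sum>k | k < n \<and> j \<le> k. \<rho> ^ (k - j)) = (\<Sum>i\<le>n - 1 - j. \<rho> ^ i)"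
      by (intro sum.reindex_bij_witness[of _ "\<lambda>i. i + j" "\<lambda>k. k - j"]) auto
    then show "(\<Sum>k | k < n \<and> j \<le> k. \<rho> ^ (k - j) * A j) \<le> 1 / (1 - \<rho>) * A j"
      using g assms by (simp only: sum_distrib_right[symmetric] mult_right_mono[OF g])
  qed
  finally have 2: "(\<Sum>k<n. \<Sum>j\<le>k. \<rho> ^ (k - j) * A j) \<le> (\<Sum>j<n. 1 / (1 - \<rho>) * A j)" .
  have "(\<Sum>k<n. \<Sum>j\<le>k. \<rho> ^ (k - j) * (A k + 2 * A j))
      = (\<Sum>k<n. \<Sum>j\<le>k. \<rho> ^ (k - j) * A k) + 2 * (\<Sum>k<n. \<Sum>j\<le>k. \<rho> ^ (k - j) * A j)"
    by (simp add: distrib_left sum.distrib sum_distrib_left mult_ac)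
  also have "\<dots> \<le> (\<Sum>k<n. 1 / (1 - \<rho>) * A k) + 2 * (\<Sum>j<n. 1 / (1 - \<rho>) * A j)"
    using 1 2 by linarith
  finally show ?thesis by (simp add: sum_distrib_left[symmetric] sum_divide_distrib[symmetric])
qed

context
  fixes p q \<theta> :: real
  assumes p: "1 < p" and pq: "p < q" and \<theta>: "\<theta> = 1 / p - 1 / q"
begin

text \<open>The q-th power of the sum is expanded into products of b_k and b_j^(q - 1) with j \<le>
  k. The coarse factor b_j has the smaller sup bound in terms of its E_j, so the integral of such a
  product gains a factor 2^(-\<theta> (k - j)), and the double sum collapses to its diagonal. The
  triangle inequality in L_q would only give an l_1 sum.\<close>

lemma dyadic_sum_Lq:
  "\<exists>C>0. \<forall>(N :: 'a measure) b E s. (\<forall>k. b k \<in> borel_measurable N) \<longrightarrow> (\<forall>k. 0 \<le> E k) \<longrightarrow> 0 < s \<longrightarrow>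
     (\<forall>k x. ennpowr (b k x) p \<le> ennreal (E k powr p / (s / 2 ^ k))) \<longrightarrow>
     (\<forall>k. (\<integral>\<^sup>+x. ennpowr (b k x) p \<partial>N) \<le> ennreal (E k powr p)) \<longrightarrow>
     (\<integral>\<^sup>+x. ennpowr (\<Sum>k. b k x) q \<partial>N)
       \<le> ennreal C * (\<Sum>k. ennreal ((s / 2 ^ k) powr (- \<theta> * q) * E k powr q))"
proof -
  note th = theta_bounds[OF p pq \<theta>]
  \<comment> \<open>The decay 2^(-\<theta> (k - j)) of the products is divided into halves: one pays
    for moving the power q - 1 inside the inner sum, the other, \<open>\<rho>\<close>, remains for
    the summation.\<close>
  define C' where "C' = (1 / (1 - 2 powr (- (\<theta> / 2) / (q - 1)))) powr (q - 1)"
  have "2 powr (- (\<theta> / 2) / (q - 1)) < 1"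
    using p pq th by (intro powr_less_one) (auto simp: field_simps)
  then have C': "0 < C'" using th p pq by (simp add: C'_def)
  have C'2: "(\<Sum>j\<le>k. b j) powr (q - 1) \<le> C' * (\<Sum>j\<le>k. 2 powr (\<theta> / 2 * real (k - j)) * b j powr (q - 1))"
    if "\<And>j. 0 \<le> b j" for b :: "nat \<Rightarrow> real" and k
    unfolding C'_def using that p pq th by (intro sum_powr_geometric) auto
  define \<rho> where "\<rho> = 2 powr (- \<theta> / 2)"
  have \<rho>: "0 < \<rho>" "\<rho> < 1" using th by (auto simp: \<rho>_def powr_less_one)
  define C where "C = q * C' * (3 / (1 - \<rho>))"
  have C: "C > 0" using C' \<rho> p pq by (simp add: C_def)
  have main: "(\<integral>\<^sup>+x. ennreal ((\<Sum>k<n. b k x) powr q) \<partial>N)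
       \<le> ennreal (C * (\<Sum>k<n. (s / 2 ^ k) powr (- \<theta> * q) * E k powr q))"
    if [measurable]: "\<And>k. b k \<in> borel_measurable N" and E: "\<And>k. 0 \<le> E k" and s: "0 < s"
     and b0: "\<And>k x. 0 \<le> b k x" and bs: "\<And>k x. b k x powr p \<le> E k powr p / (s / 2 ^ k)"
     and bp: "\<And>k. (\<integral>\<^sup>+x. ennreal (b k x powr p) \<partial>N) \<le> ennreal (E k powr p)"
    for N :: "'a measure" and b E s n
  proof -
    define S where "S = (\<lambda>k::nat. s / 2 ^ k)"
    have S: "S k > 0" for k using s by (simp add: S_def)
    define A where "A = (\<lambda>k. S k powr (- \<theta> * q) * E k powr q)"
    have A: "0 \<le> A k" for k by (simp add: A_def)
    define m where "m = (\<lambda>j. E j powr (q - p) * S j powr (- \<theta> * q))"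
    have m: "0 \<le> m j" for j by (simp add: m_def)
    \<comment> \<open>This parameter balances Young's inequality below, so that both of its terms
      come out with the factor 2^(-\<theta> (k - j)).\<close>
    define \<tau> where "\<tau> = (\<lambda>k j :: nat. 2 powr (\<theta> * real (k - j)))"
    have \<tau>: "\<tau> k j > 0" for k j by (simp add: \<tau>_def)
    \<comment> \<open>The surplus power q - p of the coarse piece is spent on its sup bound; the
      remaining powers, p in total, are left to be integrated.\<close>
    have bm: "b j x powr (q - p) \<le> m j" for j x
    proof -
      have "b j x powr (q - p) = (b j x powr p) powr ((q - p) / p)"
        using p b0 by (simp add: powr_powr)
      also have "\<dots> \<le> (E j powr p / S j) powr ((q - p) / p)"
        using p pq bs by (intro powr_mono2) (auto simp: S_def)
      also have "\<dots> = E j powr (q - p) / S j powr ((q - p) / p)"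
        using p by (simp add: powr_divide powr_powr)
      also have "\<dots> = E j powr (q - p) * S j powr (- ((q - p) / p))"
        by (simp add: powr_minus_divide)
      also have "(q - p) / p = \<theta> * q" using th(4) p by (simp add: field_simps)
      finally show ?thesis by (simp add: m_def)
    qed
    have young: "x * y powr (p - 1) \<le> t powr (p - 1) * x powr p + 1 / t * y powr p"
      if "0 \<le> x" "0 \<le> y" "0 < t" for x y t
    proof (cases "y \<le> t * x")
      case True
      have "x * y powr (p - 1) \<le> x * (t * x) powr (p - 1)"
        using that True p by (intro mult_left_mono powr_mono2) auto
      also have "\<dots> = t powr (p - 1) * x powr p"
        using that by (cases "x = 0") (auto simp: powr_mult powr_diff)
      finally show ?thesis using that by (simp add: add_increasing2)
    next
      case False
      then have "x * y powr (p - 1) \<le> (y / t) * y powr (p - 1)"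
        using that by (intro mult_right_mono) (auto simp: field_simps)
      also have "\<dots> = 1 / t * y powr p"
        using that by (cases "y = 0") (auto simp: powr_diff)
      finally show ?thesis using that by (simp add: add_increasing)
    qed
    have bb: "b k x * b j x powr (q - 1)
        \<le> (\<tau> k j powr (p - 1) * b k x powr p + 1 / \<tau> k j * b j x powr p) * m j" for k j x
    proof -
      have "b k x * b j x powr (q - 1) = (b k x * b j x powr (p - 1)) * b j x powr (q - p)"
        using b0[of j x] by (cases "b j x = 0") (auto simp: powr_add[symmetric])
      also have "\<dots> \<le> (\<tau> k j powr (p - 1) * b k x powr p + 1 / \<tau> k j * b j x powr p) * m j"
        using b0 \<tau> by (intro mult_mono young bm) (auto simp: less_imp_le)
      finally show ?thesis .
    qed
    have Ibb: "(\<integral>\<^sup>+x. ennreal (b k x * b j x powr (q - 1)) \<partial>N) \<le> ennreal (2 powr (- \<theta> * real (k - j)) * (A k + 2 * A j))"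
      if "j \<le> k" for k j
    proof -
      have "(\<integral>\<^sup>+x. ennreal (b k x * b j x powr (q - 1)) \<partial>N)
          \<le> (\<integral>\<^sup>+x. ennreal (\<tau> k j powr (p - 1) * m j) * ennreal (b k x powr p)
               + ennreal (1 / \<tau> k j * m j) * ennreal (b j x powr p) \<partial>N)"
        using \<tau> m
        by (intro nn_integral_mono)
           (simp add: ennreal_mult[symmetric] ennreal_plus[symmetric] less_imp_le del: ennreal_plus,
            intro ennreal_leI order_trans[OF bb], simp add: algebra_simps)
      also have "\<dots> = ennreal (\<tau> k j powr (p - 1) * m j) * (\<integral>\<^sup>+x. ennreal (b k x powr p) \<partial>N)
               + ennreal (1 / \<tau> k j * m j) * (\<integral>\<^sup>+x. ennreal (b j x powr p) \<partial>N)"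
        by (simp add: nn_integral_add nn_integral_cmult)
      also have "\<dots> \<le> ennreal (\<tau> k j powr (p - 1) * m j) * ennreal (E k powr p)
               + ennreal (1 / \<tau> k j * m j) * ennreal (E j powr p)"
        by (intro add_mono mult_left_mono bp) auto
      also have "\<dots> = ennreal (\<tau> k j powr (p - 1) * m j * E k powr p + 1 / \<tau> k j * m j * E j powr p)"
        using \<tau> m by (simp add: ennreal_mult[symmetric] ennreal_plus[symmetric] less_imp_le del: ennreal_plus)
      also have "\<dots> \<le> ennreal (2 powr (- \<theta> * real (k - j)) * (A k + 2 * A j))"
      proof (intro ennreal_leI)
        define d where "d = real (k - j)"
        have Sj: "S j = 2 powr d * S k"
        proof -
          have "2 powr d = 2 ^ (k - j)" by (simp add: d_def powr_realpow)
          moreover have "(2::real) ^ k = 2 ^ (k - j) * 2 ^ j"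
            using that by (simp add: power_add[symmetric])
          ultimately show ?thesis by (simp add: S_def)
        qed
        define ak where "ak = S k powr (- \<theta>) * E k"
        define aj where "aj = S j powr (- \<theta>) * E j"
        have a0: "0 \<le> ak" "0 \<le> aj" using E by (auto simp: ak_def aj_def)
        have Aeq: "A k = ak powr q" "A j = aj powr q"
          using E by (auto simp: A_def ak_def aj_def powr_mult powr_powr)
        have Ek: "E k = S k powr \<theta> * ak" and Ej: "E j = S j powr \<theta> * aj"
          using S[of k] S[of j] by (auto simp: ak_def aj_def powr_add[symmetric] mult.assoc[symmetric])
        have t1: "\<tau> k j powr (p - 1) * m j * E k powr p = 2 powr (- \<theta> * d) * (ak powr p * aj powr (q - p))"
        proof -
          have "\<tau> k j powr (p - 1) * m j * E k powr p
              = 2 powr (\<theta> * d * (p - 1)) * (S j powr (\<theta> * (q - p)) * S j powr (- \<theta> * q)) * S k powr (\<theta> * p)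
                * (ak powr p * aj powr (q - p))"
            using a0 by (simp add: \<tau>_def d_def m_def Ej Ek powr_mult powr_powr)
          also have "S j powr (\<theta> * (q - p)) * S j powr (- \<theta> * q) = S j powr (- \<theta> * p)"
            by (simp add: powr_add[symmetric] algebra_simps)
          also have "S j powr (- \<theta> * p) = 2 powr (- \<theta> * p * d) * S k powr (- \<theta> * p)"
            using S[of k] by (simp add: Sj powr_mult powr_powr mult_ac)
          also have "2 powr (\<theta> * d * (p - 1)) * (2 powr (- \<theta> * p * d) * S k powr (- \<theta> * p)) * S k powr (\<theta> * p)
            = (2 powr (\<theta> * d * (p - 1)) * 2 powr (- \<theta> * p * d)) * (S k powr (- \<theta> * p) * S k powr (\<theta> * p))"
            by (simp only: mult_ac)
          also have "S k powr (- \<theta> * p) * S k powr (\<theta> * p) = 1"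
            using S[of k] by (simp add: powr_add[symmetric])
          also have "2 powr (\<theta> * d * (p - 1)) * 2 powr (- \<theta> * p * d) = 2 powr (- \<theta> * d)"
            by (simp add: powr_add[symmetric] algebra_simps)
          finally show ?thesis by simp
        qed
        have t2: "1 / \<tau> k j * m j * E j powr p = 2 powr (- \<theta> * d) * A j"
        proof -
          have "E j powr (q - p) * E j powr p = E j powr q"
            by (simp add: powr_add[symmetric])
          moreover have "1 / \<tau> k j = 2 powr (- \<theta> * d)"
            by (simp add: \<tau>_def d_def powr_minus divide_inverse)
          ultimately show ?thesis by (simp add: m_def A_def mult_ac)
        qed
        have "ak powr p * aj powr (q - p) \<le> max ak aj powr p * max ak aj powr (q - p)"
          using a0 p pq by (intro mult_mono powr_mono2) auto
        also have "\<dots> = max ak aj powr q" by (simp add: powr_add[symmetric])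
        also have "\<dots> \<le> ak powr q + aj powr q" by (auto simp: max_def)
        finally have "2 powr (- \<theta> * d) * (ak powr p * aj powr (q - p)) + 2 powr (- \<theta> * d) * A j
            \<le> 2 powr (- \<theta> * d) * (ak powr q + aj powr q) + 2 powr (- \<theta> * d) * A j"
          by (intro add_mono mult_left_mono) auto
        then show "\<tau> k j powr (p - 1) * m j * E k powr p + 1 / \<tau> k j * m j * E j powr p
            \<le> 2 powr (- \<theta> * real (k - j)) * (A k + 2 * A j)"
          unfolding t1 t2 d_def[symmetric] by (simp add: Aeq algebra_simps)
      qed
      finally show ?thesis .
    qed
    have point: "(\<Sum>k<n. b k x) powr q
        \<le> (\<Sum>k<n. \<Sum>j\<le>k. q * C' * 2 powr (\<theta> / 2 * real (k - j)) * (b k x * b j x powr (q - 1)))" for x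
    proof -
      have "(\<Sum>k<n. b k x) powr q \<le> q * (\<Sum>k<n. b k x * (\<Sum>j\<le>k. b j x) powr (q - 1))"
        using p pq b0 by (intro sum_powr_le) auto
      also have "\<dots> \<le> q * (\<Sum>k<n. b k x * (C' * (\<Sum>j\<le>k. 2 powr (\<theta> / 2 * real (k - j)) * b j x powr (q - 1))))"
        using p pq b0 by (intro mult_left_mono sum_mono C'2) auto
      also have "\<dots> = (\<Sum>k<n. \<Sum>j\<le>k. q * C' * 2 powr (\<theta> / 2 * real (k - j)) * (b k x * b j x powr (q - 1)))"
        by (simp add: sum_distrib_left mult_ac)
      finally show ?thesis .
    qed
    have "(\<integral>\<^sup>+x. ennreal ((\<Sum>k<n. b k x) powr q) \<partial>N)
        \<le> (\<integral>\<^sup>+x. (\<Sum>k<n. \<Sum>j\<le>k. ennreal (q * C' * 2 powr (\<theta> / 2 * real (k - j))) * ennreal (b k x * b j x powr (q - 1))) \<partial>N)"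
    proof (intro nn_integral_mono)
      fix x
      have "ennreal ((\<Sum>k<n. b k x) powr q)
        \<le> ennreal (\<Sum>k<n. \<Sum>j\<le>k. q * C' * 2 powr (\<theta> / 2 * real (k - j)) * (b k x * b j x powr (q - 1)))"
        by (intro ennreal_leI point)
      also have "\<dots> = (\<Sum>k<n. \<Sum>j\<le>k. ennreal (q * C' * 2 powr (\<theta> / 2 * real (k - j))) * ennreal (b k x * b j x powr (q - 1)))"
        using p pq C' b0 by (simp add: sum_nonneg ennreal_mult[symmetric])
      finally show "ennreal ((\<Sum>k<n. b k x) powr q)
        \<le> (\<Sum>k<n. \<Sum>j\<le>k. ennreal (q * C' * 2 powr (\<theta> / 2 * real (k - j))) * ennreal (b k x * b j x powr (q - 1)))" .
    qed
    also have "\<dots> = (\<Sum>k<n. \<Sum>j\<le>k. ennreal (q * C' * 2 powr (\<theta> / 2 * real (k - j)))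
         * (\<integral>\<^sup>+x. ennreal (b k x * b j x powr (q - 1)) \<partial>N))"
      by (simp add: nn_integral_sum nn_integral_cmult)
    also have "\<dots> \<le> (\<Sum>k<n. \<Sum>j\<le>k. ennreal (q * C' * 2 powr (\<theta> / 2 * real (k - j)))
         * ennreal (2 powr (- \<theta> * real (k - j)) * (A k + 2 * A j)))"
      by (intro sum_mono mult_left_mono Ibb) auto
    also have "\<dots> = (\<Sum>k<n. \<Sum>j\<le>k. ennreal (q * C' * (\<rho> ^ (k - j) * (A k + 2 * A j))))"
    proof (intro sum.cong refl)
      fix k j :: nat
      have "2 powr (\<theta> / 2 * real (k - j)) * 2 powr (- \<theta> * real (k - j)) = \<rho> ^ (k - j)"
        by (simp add: \<rho>_def powr_realpow[symmetric] powr_powr powr_add[symmetric])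
      then have eq: "q * C' * 2 powr (\<theta> / 2 * real (k - j)) * (2 powr (- \<theta> * real (k - j)) * (A k + 2 * A j))
          = q * C' * (\<rho> ^ (k - j) * (A k + 2 * A j))"
        by (metis mult.assoc)
      show "ennreal (q * C' * 2 powr (\<theta> / 2 * real (k - j))) * ennreal (2 powr (- \<theta> * real (k - j)) * (A k + 2 * A j))
          = ennreal (q * C' * (\<rho> ^ (k - j) * (A k + 2 * A j)))"
        unfolding eq[symmetric] using p pq C' A by (intro ennreal_mult[symmetric]) auto
    qed
    also have "\<dots> = ennreal (q * C' * (\<Sum>k<n. \<Sum>j\<le>k. \<rho> ^ (k - j) * (A k + 2 * A j)))"
    proof -
      have nn: "0 \<le> q * C' * (\<rho> ^ (k - j) * (A k + 2 * A j))" for k j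
        using p pq C' A \<rho> by (intro mult_nonneg_nonneg add_nonneg_nonneg) auto
      show ?thesis
        unfolding sum_distrib_left by (simp only: sum_ennreal nn sum_nonneg)
    qed
    also have "\<dots> \<le> ennreal (q * C' * (3 / (1 - \<rho>) * (\<Sum>k<n. A k)))"
      using p pq C' by (intro ennreal_leI mult_left_mono sum_geometric_convolution_le \<rho> A) auto
    finally show ?thesis by (simp add: C_def A_def S_def mult.assoc)
  qed
  have main': "(\<integral>\<^sup>+x. ennpowr (\<Sum>k. b k x) q \<partial>N)
       \<le> ennreal C * (\<Sum>k. ennreal ((s / 2 ^ k) powr (- \<theta> * q) * E k powr q))"
    if [measurable]: "\<And>k. b k \<in> borel_measurable N" and E: "\<And>k. 0 \<le> E k" and s: "0 < s"
     and bs: "\<And>k x. ennpowr (b k x) p \<le> ennreal (E k powr p / (s / 2 ^ k))"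
     and bp: "\<And>k. (\<integral>\<^sup>+x. ennpowr (b k x) p \<partial>N) \<le> ennreal (E k powr p)"
    for N :: "'a measure" and b E s
  proof -
    define B where "B = (\<lambda>k x. enn2real (b k x))"
    have [measurable]: "B k \<in> borel_measurable N" for k unfolding B_def by measurable
    have fin: "b k x < top" for k x
      using bs[of k x] by (auto simp: less_top[symmetric] top_unique)
    have b: "b k x = ennreal (B k x)" and B0: "0 \<le> B k x" for k x
      using fin by (auto simp: B_def)
    have "(\<integral>\<^sup>+x. ennpowr (\<Sum>k. b k x) q \<partial>N) = (\<integral>\<^sup>+x. (SUP n. ennreal ((\<Sum>k<n. B k x) powr q)) \<partial>N)"
      using p pq B0 by (intro nn_integral_cong)
        (simp add: suminf_eq_SUP ennpowr_SUP b sum_ennreal sum_nonneg)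
    also have "\<dots> = (SUP n. (\<integral>\<^sup>+x. ennreal ((\<Sum>k<n. B k x) powr q) \<partial>N))"
      using p pq B0
      by (intro nn_integral_monotone_convergence_SUP)
         (auto simp: incseq_def le_fun_def intro!: ennreal_leI powr_mono2 sum_mono2 sum_nonneg)
    also have "\<dots> \<le> ennreal C * (\<Sum>k. ennreal ((s / 2 ^ k) powr (- \<theta> * q) * E k powr q))"
    proof (rule SUP_least)
      fix n
      have "(\<integral>\<^sup>+x. ennreal ((\<Sum>k<n. B k x) powr q) \<partial>N)
          \<le> ennreal (C * (\<Sum>k<n. (s / 2 ^ k) powr (- \<theta> * q) * E k powr q))"
        using bs bp B0 by (intro main E s) (auto simp: b ennreal_le_iff s less_imp_le)
      also have "\<dots> = ennreal C * (\<Sum>k<n. ennreal ((s / 2 ^ k) powr (- \<theta> * q) * E k powr q))"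
        using C by (subst ennreal_mult) (auto simp: sum_nonneg sum_ennreal simp del: ennreal_mult')
      also have "\<dots> \<le> ennreal C * (\<Sum>k. ennreal ((s / 2 ^ k) powr (- \<theta> * q) * E k powr q))"
        by (intro mult_left_mono sum_le_suminf) auto
      finally show "(\<integral>\<^sup>+x. ennreal ((\<Sum>k<n. B k x) powr q) \<partial>N)
        \<le> ennreal C * (\<Sum>k. ennreal ((s / 2 ^ k) powr (- \<theta> * q) * E k powr q))" .
    qed
    finally show ?thesis .
  qed
  show ?thesis by (intro exI[of _ C] conjI allI impI C main') auto
qed

end

subsection \<open>Series of translates and averages\<close>

definition shift_series :: "(nat \<Rightarrow> real) \<Rightarrow> real \<Rightarrow> (real \<Rightarrow> complex) \<Rightarrow> real \<Rightarrow> complex" where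
  "shift_series c h \<phi> x = (\<Sum>\<nu>. complex_of_real (c \<nu>) * \<phi> (x - real \<nu> * h))"

text \<open>Nonnegative majorants accompany the operators on complex functions: complex series and
  integrals take default values where they fail to converge, whereas a majorant becomes infinite
  there if absolute convergence fails.\<close>

definition abs_shift_series :: "(nat \<Rightarrow> real) \<Rightarrow> real \<Rightarrow> (real \<Rightarrow> ennreal) \<Rightarrow> real \<Rightarrow> ennreal" where
  "abs_shift_series c h n x = (\<Sum>\<nu>. ennreal \<bar>c \<nu>\<bar> * n (x - real \<nu> * h))"

text \<open>Scaled to the unit interval, so that \<open>average 0\<close> is the identity and the
  length may vary measurably with a parameter.\<close>

definition average :: "real \<Rightarrow> (real \<Rightarrow> complex) \<Rightarrow> real \<Rightarrow> complex" where
  "average s \<phi> x = (\<integral>u. \<phi> (x - s * u) \<partial>unit_itv)"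

definition abs_average :: "real \<Rightarrow> (real \<Rightarrow> ennreal) \<Rightarrow> real \<Rightarrow> ennreal" where
  "abs_average s n x = (\<integral>\<^sup>+u. n (x - s * u) \<partial>unit_itv)"

definition periodic_L1 :: "(real \<Rightarrow> complex) \<Rightarrow> bool" where
  "periodic_L1 \<phi> \<longleftrightarrow> \<phi> \<in> borel_measurable borel \<and> periodic \<phi> \<and> (\<integral>\<^sup>+x. ennreal (norm (\<phi> x)) \<partial>circ) < top"

lemma measurable_shift_series [measurable (raw)]:
  assumes [measurable]: "case_prod \<phi> \<in> borel_measurable (N \<Otimes>\<^sub>M borel)" "f \<in> borel_measurable N" "h \<in> borel_measurable N"
  shows "(\<lambda>y. shift_series c (h y) (\<phi> y) (f y)) \<in> borel_measurable N"
  unfolding shift_series_def by measurable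

lemma measurable_abs_shift_series [measurable (raw)]:
  assumes [measurable]: "case_prod n \<in> borel_measurable (N \<Otimes>\<^sub>M borel)" "f \<in> borel_measurable N" "h \<in> borel_measurable N"
  shows "(\<lambda>y. abs_shift_series c (h y) (n y) (f y)) \<in> borel_measurable N"
  unfolding abs_shift_series_def by measurable

lemma measurable_average [measurable (raw)]:
  assumes [measurable]: "case_prod \<phi> \<in> borel_measurable (N \<Otimes>\<^sub>M borel)" "f \<in> borel_measurable N" "h \<in> borel_measurable N"
  shows "(\<lambda>y. average (h y) (\<phi> y) (f y)) \<in> borel_measurable N"
proof -
  interpret sigma_finite_measure unit_itv by (rule sigma_finite_unit_itv)
  show ?thesis unfolding average_def by measurable
qed

lemma measurable_abs_average [measurable (raw)]:
  assumes [measurable]: "case_prod n \<in> borel_measurable (N \<Otimes>\<^sub>M borel)" "f \<in> borel_measurable N" "h \<in> borel_measurable N"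
  shows "(\<lambda>y. abs_average (h y) (n y) (f y)) \<in> borel_measurable N"
proof -
  interpret sigma_finite_measure unit_itv by (rule sigma_finite_unit_itv)
  show ?thesis unfolding abs_average_def by measurable
qed

lemma suminf_ennreal_finite:
  assumes "summable (\<lambda>n. \<bar>c n\<bar>)"
  shows "(\<Sum>n. ennreal \<bar>c n\<bar>) = ennreal (\<Sum>n. \<bar>c n\<bar>)"
  using assms by (intro suminf_ennreal2) auto

lemma summable_norm_iff_ennreal:
  fixes f :: "nat \<Rightarrow> 'a :: real_normed_vector"
  shows "summable (\<lambda>n. norm (f n)) \<longleftrightarrow> (\<Sum>n. ennreal (norm (f n))) < top"
proof
  assume "summable (\<lambda>n. norm (f n))"
  then have "(\<Sum>n. ennreal (norm (f n))) \<noteq> top" by (intro ennreal_suminf_neq_top) auto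
  then show "(\<Sum>n. ennreal (norm (f n))) < top" by (simp only: less_top)
next
  assume "(\<Sum>n. ennreal (norm (f n))) < top"
  then have "(\<Sum>n. ennreal (norm (f n))) \<noteq> top" by (simp only: less_top)
  then show "summable (\<lambda>n. norm (f n))" by (intro summable_suminf_not_top) auto
qed

text \<open>If absolute convergence fails, the right side is infinite, so the value that
  \<open>suminf\<close> then takes does no harm.\<close>

lemma norm_suminf_le_ennreal:
  fixes f :: "nat \<Rightarrow> 'a :: banach"
  shows "ennreal (norm (suminf f)) \<le> (\<Sum>n. ennreal (norm (f n)))"
proof (cases "summable (\<lambda>n. norm (f n))")
  case True
  then have "ennreal (norm (suminf f)) \<le> ennreal (\<Sum>n. norm (f n))"
    by (intro ennreal_leI summable_norm)
  also have "\<dots> = (\<Sum>n. ennreal (norm (f n)))"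
    using True by (intro suminf_ennreal2[symmetric]) auto
  finally show ?thesis .
next
  case False
  then show ?thesis by (simp add: summable_norm_iff_ennreal not_less top_unique)
qed

lemma norm_shift_series_le:
  "ennreal (norm (shift_series c h \<phi> x)) \<le> abs_shift_series c h (\<lambda>x. ennreal (norm (\<phi> x))) x"
proof -
  have "ennreal (norm (shift_series c h \<phi> x))
      \<le> (\<Sum>\<nu>. ennreal (norm (complex_of_real (c \<nu>) * \<phi> (x - real \<nu> * h))))"
    unfolding shift_series_def by (rule norm_suminf_le_ennreal)
  then show ?thesis by (simp add: abs_shift_series_def norm_mult ennreal_mult)
qed

lemma summable_shift_series:
  assumes "abs_shift_series c h (\<lambda>x. ennreal (norm (\<phi> x))) x < top"
  shows "summable (\<lambda>\<nu>. norm (complex_of_real (c \<nu>) * \<phi> (x - real \<nu> * h)))"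
  unfolding summable_norm_iff_ennreal using assms
  by (simp add: abs_shift_series_def norm_mult ennreal_mult)

text \<open>Without integrability the Bochner integral is 0 by default, so no hypothesis on
  \<open>f\<close> is called for.\<close>

lemma integral_norm_le_nn_integral:
  fixes f :: "'a \<Rightarrow> 'b :: {banach, second_countable_topology}"
  shows "ennreal (norm (\<integral>x. f x \<partial>M)) \<le> (\<integral>\<^sup>+x. ennreal (norm (f x)) \<partial>M)"
  by (cases "integrable M f") (auto intro: integral_norm_bound_ennreal simp: not_integrable_integral_eq)

lemma norm_average_le: "ennreal (norm (average s \<phi> x)) \<le> abs_average s (\<lambda>x. ennreal (norm (\<phi> x))) x"
  unfolding average_def abs_average_def by (rule integral_norm_le_nn_integral)

lemma abs_average_mono: "(\<And>x. m x \<le> n x) \<Longrightarrow> abs_average s m x \<le> abs_average s n x"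
  unfolding abs_average_def by (intro nn_integral_mono)

lemma periodic_abs_shift_series: "periodic n \<Longrightarrow> periodic (abs_shift_series c h n)"
  unfolding periodic_def abs_shift_series_def by (auto simp: algebra_simps)
    (metis add.commute add_diff_eq)

lemma periodic_shift_series: "periodic \<phi> \<Longrightarrow> periodic (shift_series c h \<phi>)"
  unfolding periodic_def shift_series_def by (auto simp: algebra_simps)
    (metis add.commute add_diff_eq)

lemma periodic_average: "periodic \<phi> \<Longrightarrow> periodic (average s \<phi>)"
  unfolding periodic_def average_def by (auto simp: algebra_simps)
    (metis add.commute add_diff_eq)

lemma periodic_norm: "periodic \<phi> \<Longrightarrow> periodic (\<lambda>x. ennreal (norm (\<phi> x)))"
  by (simp add: periodic_def)

lemma nn_integral_abs_shift_series:
  assumes [measurable]: "n \<in> borel_measurable borel" and per: "periodic n"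
  shows "(\<integral>\<^sup>+x. abs_shift_series c h n x \<partial>circ) = (\<Sum>\<nu>. ennreal \<bar>c \<nu>\<bar>) * (\<integral>\<^sup>+x. n x \<partial>circ)"
  unfolding abs_shift_series_def
  by (simp add: nn_integral_suminf nn_integral_cmult nn_integral_circ_shift per ennreal_suminf_multc)

lemma nn_integral_abs_average:
  assumes [measurable]: "n \<in> borel_measurable borel" and per: "periodic n"
  shows "(\<integral>\<^sup>+x. abs_average s n x \<partial>circ) = (\<integral>\<^sup>+x. n x \<partial>circ)"
proof -
  interpret u: sigma_finite_measure unit_itv by (rule sigma_finite_unit_itv)
  interpret c: sigma_finite_measure circ by (rule sigma_finite_circ)
  interpret uc: pair_sigma_finite unit_itv circ ..
  have "(\<integral>\<^sup>+x. abs_average s n x \<partial>circ) = (\<integral>\<^sup>+u. \<integral>\<^sup>+x. n (x - s * u) \<partial>circ \<partial>unit_itv)"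
    unfolding abs_average_def by (rule uc.Fubini') simp
  also have "\<dots> = (\<integral>\<^sup>+u. (\<integral>\<^sup>+x. n x \<partial>circ) \<partial>unit_itv)"
    by (simp only: nn_integral_circ_shift[OF assms])
  also have "\<dots> = (\<integral>\<^sup>+x. n x \<partial>circ)" by (simp add: emeasure_unit_itv)
  finally show ?thesis .
qed

lemma AE_abs_shift_series_finite:
  assumes [measurable]: "n \<in> borel_measurable borel" and "periodic n" "(\<integral>\<^sup>+x. n x \<partial>circ) < top"
    and "summable (\<lambda>n. \<bar>c n\<bar>)"
  shows "AE x in circ. abs_shift_series c h n x < top"
proof -
  have "(\<integral>\<^sup>+x. abs_shift_series c h n x \<partial>circ) < top"
    using assms by (simp add: nn_integral_abs_shift_series suminf_ennreal_finite ennreal_mult_less_top)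
  then have "AE x in circ. abs_shift_series c h n x \<noteq> \<infinity>"
    by (intro nn_integral_PInf_AE) auto
  then show ?thesis by (auto simp: less_top)
qed

lemma abs_average_eq:
  assumes [measurable]: "n \<in> borel_measurable borel" and s: "0 < s"
  shows "abs_average s n x = ennreal (1 / s) * (\<integral>\<^sup>+v. indicator {0..s} v * n (x - v) \<partial>lborel)"
proof -
  have "(\<integral>\<^sup>+v. indicator {0..s} v * n (x - v) \<partial>lborel) = ennreal s * (\<integral>\<^sup>+u. indicator {0..s} (s * u) * n (x - s * u) \<partial>lborel)"
    using s by (subst nn_integral_real_affine[where c = s and t = 0]) auto
  also have "(\<integral>\<^sup>+u. indicator {0..s} (s * u) * n (x - s * u) \<partial>lborel) = abs_average s n x"
    unfolding abs_average_def using s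
    by (subst nn_integral_unit_itv) (auto intro!: nn_integral_cong simp: indicator_def zero_le_mult_iff mult_le_cancel_left2)
  finally show ?thesis using s by (simp add: mult.assoc[symmetric] ennreal_mult[symmetric])
qed

lemma nn_integral_circ_reflect_shift:
  fixes n :: "real \<Rightarrow> ennreal"
  assumes [measurable]: "n \<in> borel_measurable borel" and per: "periodic n"
  shows "(\<integral>\<^sup>+u. n (x - u) \<partial>circ) = (\<integral>\<^sup>+u. n u \<partial>circ)"
proof -
  have per': "periodic (\<lambda>z. n (x - (- z)))"
    using periodic_shift[OF per, of "-x"] by (simp add: add.commute)
  have "(\<integral>\<^sup>+u. n (x - u) \<partial>circ) = (\<integral>\<^sup>+u. n (u - (- x)) \<partial>circ)"
    using nn_integral_circ_reflect[OF _ per'] by (simp add: add.commute)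
  also have "\<dots> = (\<integral>\<^sup>+u. n u \<partial>circ)"
    by (rule nn_integral_circ_shift[OF assms])
  finally show ?thesis .
qed

lemma abs_average_le:
  assumes [measurable]: "n \<in> borel_measurable borel" and per: "periodic n" and s: "0 < s" "s \<le> 2 * pi * real j"
  shows "abs_average s n x \<le> ennreal (real j / s) * (\<integral>\<^sup>+x. n x \<partial>circ)"
proof -
  have per': "periodic (\<lambda>v. n (x - v))"
    unfolding periodic_def
  proof
    fix v show "n (x - (v + 2 * pi)) = n (x - v)"
      using per[unfolded periodic_def, rule_format, of "x - v - 2 * pi"] by (simp add: algebra_simps)
  qed
  have "(\<integral>\<^sup>+v. indicator {0..s} v * n (x - v) \<partial>lborel) \<le> (\<integral>\<^sup>+v. indicator {0..2 * pi * real j} v * n (x - v) \<partial>lborel)"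
    using s by (intro nn_integral_mono) (auto split: split_indicator)
  also have "\<dots> \<le> of_nat j * (\<integral>\<^sup>+x. n x \<partial>circ)"
    using periodic_nn_integral_lborel_le[OF _ per', of j] by (simp add: nn_integral_circ_reflect_shift per)
  finally have "abs_average s n x \<le> ennreal (1 / s) * (of_nat j * (\<integral>\<^sup>+x. n x \<partial>circ))"
    unfolding abs_average_eq[OF assms(1) s(1)] by (rule mult_left_mono) simp
  also have "\<dots> = ennreal (real j / s) * (\<integral>\<^sup>+x. n x \<partial>circ)"
    using s by (simp add: mult.assoc[symmetric] ennreal_of_nat_eq_real_of_nat ennreal_mult[symmetric])
  finally show ?thesis .
qed

text \<open>Averages of an integrable periodic function are bounded uniformly in \<open>x\<close>.
  Identities between series of averages can therefore be had at every point, not only almost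
  everywhere.\<close>

lemma abs_average_finite:
  assumes "n \<in> borel_measurable borel" "periodic n" "(\<integral>\<^sup>+x. n x \<partial>circ) < top" "0 < s"
  shows "abs_average s n x \<le> ennreal (real (nat \<lceil>s / (2 * pi)\<rceil>) / s) * (\<integral>\<^sup>+x. n x \<partial>circ)"
    "abs_average s n x < top"
proof -
  have "s / (2 * pi) \<le> real (nat \<lceil>s / (2 * pi)\<rceil>)" using assms by linarith
  then have "s \<le> 2 * pi * real (nat \<lceil>s / (2 * pi)\<rceil>)" by (simp add: field_simps)
  then show "abs_average s n x \<le> ennreal (real (nat \<lceil>s / (2 * pi)\<rceil>) / s) * (\<integral>\<^sup>+x. n x \<partial>circ)"
    using assms by (intro abs_average_le) auto
  also have "\<dots> < top" using assms by (simp add: ennreal_mult_less_top)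
  finally show "abs_average s n x < top" .
qed

lemma periodic_L1D:
  assumes "periodic_L1 \<phi>"
  shows "\<phi> \<in> borel_measurable borel" "periodic \<phi>" "(\<integral>\<^sup>+x. ennreal (norm (\<phi> x)) \<partial>circ) < top"
  using assms by (auto simp: periodic_L1_def)

lemma integrable_average:
  assumes "periodic_L1 \<phi>" "0 < s"
  shows "integrable unit_itv (\<lambda>u. \<phi> (x - s * u))"
proof (rule integrableI_bounded)
  note [measurable] = periodic_L1D(1)[OF assms(1)]
  show "(\<lambda>u. \<phi> (x - s * u)) \<in> borel_measurable unit_itv" by measurable
  have "abs_average s (\<lambda>x. ennreal (norm (\<phi> x))) x < top"
    using periodic_L1D[OF assms(1)] assms(2) by (intro abs_average_finite) (auto intro: periodic_norm)
  then show "(\<integral>\<^sup>+u. ennreal (norm (\<phi> (x - s * u))) \<partial>unit_itv) < \<infinity>"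
    by (simp add: abs_average_def)
qed

lemma periodic_L1_shift_series:
  assumes "periodic_L1 \<phi>" "summable (\<lambda>n. \<bar>c n\<bar>)"
  shows "periodic_L1 (shift_series c h \<phi>)"
proof -
  note [measurable] = periodic_L1D(1)[OF assms(1)]
  have "(\<integral>\<^sup>+x. ennreal (norm (shift_series c h \<phi> x)) \<partial>circ)
      \<le> (\<integral>\<^sup>+x. abs_shift_series c h (\<lambda>x. ennreal (norm (\<phi> x))) x \<partial>circ)"
    by (intro nn_integral_mono norm_shift_series_le)
  also have "\<dots> < top"
    using periodic_L1D[OF assms(1)] assms(2)
    by (simp add: nn_integral_abs_shift_series periodic_norm suminf_ennreal_finite ennreal_mult_less_top)
  finally show ?thesis
    using periodic_L1D(2)[OF assms(1)] by (simp add: periodic_L1_def periodic_shift_series)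
qed

lemma periodic_L1_average:
  assumes "periodic_L1 \<phi>"
  shows "periodic_L1 (average s \<phi>)"
proof -
  note [measurable] = periodic_L1D(1)[OF assms(1)]
  have "(\<integral>\<^sup>+x. ennreal (norm (average s \<phi> x)) \<partial>circ)
      \<le> (\<integral>\<^sup>+x. abs_average s (\<lambda>x. ennreal (norm (\<phi> x))) x \<partial>circ)"
    by (intro nn_integral_mono norm_average_le)
  also have "\<dots> < top"
    using periodic_L1D[OF assms(1)] by (simp add: nn_integral_abs_average periodic_norm)
  finally show ?thesis
    using periodic_L1D(2)[OF assms(1)] by (simp add: periodic_L1_def periodic_average)
qed

text \<open>Exchange of sum and integral; the uniform bound on averages makes the double expression
  absolutely convergent at each \<open>x\<close>.\<close>

lemma average_shift_series:
  assumes \<phi>: "periodic_L1 \<phi>" and s: "0 < s" and c: "summable (\<lambda>n. \<bar>c n\<bar>)"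
  shows "average s (shift_series c h \<phi>) x = shift_series c h (average s \<phi>) x"
proof -
  note [measurable] = periodic_L1D(1)[OF \<phi>]
  let ?f = "\<lambda>\<nu> u. complex_of_real (c \<nu>) * \<phi> (x - s * u - real \<nu> * h)"
  let ?n = "\<lambda>x. ennreal (norm (\<phi> x))"
  have int: "integrable unit_itv (?f \<nu>)" for \<nu>
    using integrable_average[OF \<phi> s, of "x - real \<nu> * h"]
    by (intro integrable_mult_right) (simp add: algebra_simps)
  have "(\<integral>\<^sup>+u. (\<Sum>\<nu>. ennreal (norm (?f \<nu> u))) \<partial>unit_itv)
      = (\<Sum>\<nu>. ennreal \<bar>c \<nu>\<bar> * abs_average s ?n (x - real \<nu> * h))"
    by (subst nn_integral_suminf)
       (auto simp: norm_mult ennreal_mult nn_integral_cmult abs_average_def algebra_simps)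
  also have "\<dots> \<le> (\<Sum>\<nu>. ennreal \<bar>c \<nu>\<bar> * (ennreal (real (nat \<lceil>s / (2 * pi)\<rceil>) / s) * (\<integral>\<^sup>+x. ?n x \<partial>circ)))"
    using periodic_L1D[OF \<phi>] s by (intro suminf_le mult_left_mono abs_average_finite) (auto intro: periodic_norm)
  also have "\<dots> < top"
    using periodic_L1D(3)[OF \<phi>] c
    by (simp add: ennreal_suminf_multc suminf_ennreal_finite ennreal_mult_less_top)
  finally have fin: "(\<integral>\<^sup>+u. (\<Sum>\<nu>. ennreal (norm (?f \<nu> u))) \<partial>unit_itv) < top" .
  have "average s (shift_series c h \<phi>) x = (\<integral>u. (\<Sum>\<nu>. ?f \<nu> u) \<partial>unit_itv)"
    by (simp add: average_def shift_series_def)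
  also have "\<dots> = (\<Sum>\<nu>. \<integral>u. ?f \<nu> u \<partial>unit_itv)"
  proof (rule integral_suminf[OF int])
    have "AE u in unit_itv. (\<Sum>\<nu>. ennreal (norm (?f \<nu> u))) \<noteq> \<infinity>"
      using fin by (intro nn_integral_PInf_AE) auto
    then show "AE u in unit_itv. summable (\<lambda>\<nu>. norm (?f \<nu> u))"
      by eventually_elim (simp add: summable_norm_iff_ennreal less_top del: norm_mult)
    have "(\<Sum>\<nu>. ennreal (\<integral>u. norm (?f \<nu> u) \<partial>unit_itv)) = (\<Sum>\<nu>. \<integral>\<^sup>+u. ennreal (norm (?f \<nu> u)) \<partial>unit_itv)"
      by (intro suminf_cong nn_integral_eq_integral[symmetric] integrable_norm int) auto
    also have "\<dots> = (\<integral>\<^sup>+u. (\<Sum>\<nu>. ennreal (norm (?f \<nu> u))) \<partial>unit_itv)"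
      by (subst nn_integral_suminf) auto
    finally show "summable (\<lambda>\<nu>. \<integral>u. norm (?f \<nu> u) \<partial>unit_itv)"
      using fin by (intro summable_suminf_not_top) auto
  qed
  also have "\<dots> = shift_series c h (average s \<phi>) x"
    by (simp add: shift_series_def average_def algebra_simps)
  finally show ?thesis .
qed

text \<open>The hypothesis gives absolute convergence of the double series.\<close>

lemma shift_series_compose:
  assumes "abs_shift_series (\<lambda>n. \<Sum>i\<le>n. \<bar>c i\<bar> * \<bar>d (n - i)\<bar>) h (\<lambda>x. ennreal (norm (\<phi> x))) x < top"
  shows "shift_series c h (shift_series d h \<phi>) x = shift_series (\<lambda>n. \<Sum>i\<le>n. c i * d (n - i)) h \<phi> x"
proof -
  define z where "z = (\<lambda>n. \<phi> (x - real n * h))"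
  define f where "f = (\<lambda>(i, j). complex_of_real (c i) * (complex_of_real (d j) * z (i + j)))"
  define g where "g = (\<lambda>(n, i). f (i, n - i))"
  have "summable (\<lambda>n. norm (complex_of_real (\<Sum>i\<le>n. \<bar>c i\<bar> * \<bar>d (n - i)\<bar>) * z n))"
    unfolding z_def by (rule summable_shift_series[OF assms])
  then have sm: "summable (\<lambda>n. (\<Sum>i\<le>n. \<bar>c i\<bar> * \<bar>d (n - i)\<bar>) * norm (z n))"
    by (simp add: norm_mult abs_of_nonneg sum_nonneg del: of_real_sum)
  have gs: "(\<lambda>w. norm (g w)) summable_on Sigma UNIV (\<lambda>n. {..n})"
    unfolding Infinite_Sum.abs_summable_on_Sigma_iff
  proof (intro conjI ballI)
    have "(\<Sum>\<^sub>\<infinity>i\<in>{..n}. norm (g (n, i))) = (\<Sum>i\<le>n. \<bar>c i\<bar> * \<bar>d (n - i)\<bar>) * norm (z n)" for n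
      by (simp add: g_def f_def norm_mult sum_distrib_left mult_ac)
    then show "(\<lambda>n. norm (\<Sum>\<^sub>\<infinity>i\<in>{..n}. norm (g (n, i)))) summable_on UNIV"
      using sm by (auto simp: summable_on_UNIV_nonneg_real_iff sum_nonneg)
  qed (auto)
  have bij: "bij_betw (\<lambda>(i, j). (i + j, i)) (UNIV \<times> UNIV) (Sigma UNIV (\<lambda>n::nat. {..n}))"
    by (rule bij_betwI[where g = "\<lambda>(n, i). (i, n - i)"]) auto
  have fg: "f = (\<lambda>x. g (case x of (i, j) \<Rightarrow> (i + j, i)))"
    by (auto simp: g_def fun_eq_iff)
  have f: "(\<lambda>w. norm (f w)) summable_on UNIV \<times> UNIV"
    using gs fg summable_on_reindex_bij_betw[OF bij, of "\<lambda>x. norm (g x)"] by simp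
  have inner: "(\<lambda>j. norm (f (i, j))) summable_on UNIV" for i
    using f unfolding Infinite_Sum.abs_summable_on_Sigma_iff by auto
  then have inner': "summable (\<lambda>j. norm (f (i, j)))" for i
    by (simp add: summable_on_UNIV_nonneg_real_iff)
  have zz: "\<phi> (x - real i * h - real j * h) = z (i + j)" for i j
    by (simp add: z_def algebra_simps)
  \<comment> \<open>For \<open>c i = 0\<close> nothing is known about the inner series; its value,
    possibly a default, is then multiplied by 0.\<close>
  have *: "summable (\<lambda>j. norm (complex_of_real (d j) * \<phi> (x - real i * h - real j * h)))" if "\<bar>c i\<bar> > 0" for i
    using inner'[of i] that unfolding zz f_def by (simp add: norm_mult[of "complex_of_real (c i)"] summable_cmult_iff)
  have suminf_infsum: "suminf k = (\<Sum>\<^sub>\<infinity>j. k j)" if "summable (\<lambda>j. norm (k j))" for k :: "nat \<Rightarrow> complex"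
    using norm_summable_imp_has_sum[OF that summable_sums[OF summable_norm_cancel[OF that]]]
    by (simp add: infsumI)
  have "(\<Sum>\<^sub>\<infinity>j. f (i, j)) = complex_of_real (c i) * (\<Sum>j. complex_of_real (d j) * z (i + j))" for i
  proof (cases "c i = 0")
    case False
    then have "summable (\<lambda>j. complex_of_real (d j) * z (i + j))"
      using *[of i] unfolding zz by (auto dest: summable_norm_cancel)
    then show ?thesis
      using inner'[of i] by (simp add: suminf_infsum[symmetric] f_def suminf_mult)
  qed (simp add: f_def)
  note row = this
  have "shift_series c h (shift_series d h \<phi>) x = (\<Sum>i. \<Sum>\<^sub>\<infinity>j. f (i, j))"
    unfolding row by (simp add: shift_series_def zz)
  also have "\<dots> = (\<Sum>\<^sub>\<infinity>i. \<Sum>\<^sub>\<infinity>j. f (i, j))"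
  proof (rule suminf_infsum)
    have "(\<lambda>i. norm (\<Sum>\<^sub>\<infinity>j. norm (f (i, j)))) summable_on UNIV"
      using f unfolding Infinite_Sum.abs_summable_on_Sigma_iff by auto
    then have s1: "summable (\<lambda>i. \<Sum>\<^sub>\<infinity>j. norm (f (i, j)))"
      by (auto simp: summable_on_UNIV_nonneg_real_iff infsum_nonneg)
    show "summable (\<lambda>i. norm (\<Sum>\<^sub>\<infinity>j. f (i, j)))"
      by (rule summable_comparison_test[OF _ s1]) (auto intro!: norm_infsum_bound inner exI[of _ 0] order_trans[OF _ abs_ge_self])
  qed
  also have "\<dots> = infsum f (UNIV \<times> UNIV)"
    using Infinite_Sum.abs_summable_summable[OF f] by (rule infsum_Sigma_banach)
  also have "\<dots> = infsum g (Sigma UNIV (\<lambda>n. {..n}))"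
    unfolding fg by (rule infsum_reindex_bij_betw[OF bij])
  also have "\<dots> = (\<Sum>\<^sub>\<infinity>n. \<Sum>\<^sub>\<infinity>i\<in>{..n}. g (n, i))"
    by (rule infsum_Sigma_banach[symmetric, OF Infinite_Sum.abs_summable_summable[OF gs]])
  also have "\<dots> = (\<Sum>\<^sub>\<infinity>n. complex_of_real (\<Sum>i\<le>n. c i * d (n - i)) * z n)"
  proof (intro infsum_cong)
    fix n
    have "(\<Sum>\<^sub>\<infinity>i\<in>{..n}. g (n, i)) = (\<Sum>i\<le>n. complex_of_real (c i * d (n - i)) * z n)"
      by (simp add: g_def f_def mult.assoc)
    then show "(\<Sum>\<^sub>\<infinity>i\<in>{..n}. g (n, i)) = complex_of_real (\<Sum>i\<le>n. c i * d (n - i)) * z n"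
      unfolding of_real_sum sum_distrib_right .
  qed
  also have "\<dots> = (\<Sum>n. complex_of_real (\<Sum>i\<le>n. c i * d (n - i)) * z n)"
  proof (rule suminf_infsum[symmetric])
    show "summable (\<lambda>n. norm (complex_of_real (\<Sum>i\<le>n. c i * d (n - i)) * z n))"
    proof (rule summable_comparison_test[OF _ sm], intro exI[of _ 0] allI impI)
      fix n
      have "\<bar>\<Sum>i\<le>n. c i * d (n - i)\<bar> \<le> (\<Sum>i\<le>n. \<bar>c i\<bar> * \<bar>d (n - i)\<bar>)"
        using sum_abs[of "\<lambda>i. c i * d (n - i)" "{..n}"] by (simp only: abs_mult)
      then show "norm (norm (complex_of_real (\<Sum>i\<le>n. c i * d (n - i)) * z n))
          \<le> (\<Sum>i\<le>n. \<bar>c i\<bar> * \<bar>d (n - i)\<bar>) * norm (z n)"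
        unfolding norm_mult norm_of_real real_norm_def abs_mult abs_abs abs_norm_cancel by (intro mult_right_mono) auto
    qed
  qed
  finally show "shift_series c h (shift_series d h \<phi>) x = shift_series (\<lambda>n. \<Sum>i\<le>n. c i * d (n - i)) h \<phi> x"
    by (simp add: shift_series_def z_def)
qed

subsection \<open>Smoothing operators\<close>

lemma shift_series_bincoeff_nat:
  "shift_series (bincoeff (real m)) t \<phi> x = (\<Sum>j\<le>m. complex_of_real (bincoeff (real m) j) * \<phi> (x - real j * t))"
  unfolding shift_series_def by (rule suminf_finite) (auto simp: bincoeff_of_nat binomial_eq_0)

text \<open>A Steklov type mean of order m: the identity minus the average over u in [0, 1] of the
  m-th differences with step \<open>s * u\<close>. The term j = 0 of the binomial sum is the
  identity and cancels, so the sum starts at 1 and carries a minus sign.\<close>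

definition smooth :: "nat \<Rightarrow> real \<Rightarrow> (real \<Rightarrow> complex) \<Rightarrow> real \<Rightarrow> complex" where
  "smooth m s \<phi> x = - (\<Sum>j\<in>{1..m}. complex_of_real (bincoeff (real m) j) * average (real j * s) \<phi> x)"

definition abs_smooth :: "nat \<Rightarrow> real \<Rightarrow> (real \<Rightarrow> ennreal) \<Rightarrow> real \<Rightarrow> ennreal" where
  "abs_smooth m s n x = (\<Sum>j\<in>{1..m}. ennreal \<bar>bincoeff (real m) j\<bar> * abs_average (real j * s) n x)"

definition osc :: "nat \<Rightarrow> real \<Rightarrow> (real \<Rightarrow> complex) \<Rightarrow> real \<Rightarrow> ennreal" where
  "osc m s \<phi> x = (\<integral>\<^sup>+u. ennreal (norm (shift_series (bincoeff (real m)) (s * u) \<phi> x)) \<partial>unit_itv)"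

lemma measurable_smooth [measurable (raw)]:
  assumes [measurable]: "case_prod \<phi> \<in> borel_measurable (N \<Otimes>\<^sub>M borel)" "f \<in> borel_measurable N" "h \<in> borel_measurable N"
  shows "(\<lambda>y. smooth m (h y) (\<phi> y) (f y)) \<in> borel_measurable N"
  unfolding smooth_def by measurable

lemma measurable_abs_smooth [measurable (raw)]:
  assumes [measurable]: "case_prod n \<in> borel_measurable (N \<Otimes>\<^sub>M borel)" "f \<in> borel_measurable N" "h \<in> borel_measurable N"
  shows "(\<lambda>y. abs_smooth m (h y) (n y) (f y)) \<in> borel_measurable N"
  unfolding abs_smooth_def by measurable

lemma measurable_osc [measurable (raw)]:
  assumes [measurable]: "case_prod \<phi> \<in> borel_measurable (N \<Otimes>\<^sub>M borel)" "f \<in> borel_measurable N" "h \<in> borel_measurable N"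
  shows "(\<lambda>y. osc m (h y) (\<phi> y) (f y)) \<in> borel_measurable N"
proof -
  interpret sigma_finite_measure unit_itv by (rule sigma_finite_unit_itv)
  show ?thesis unfolding osc_def by measurable
qed

lemma periodic_smooth: "periodic \<phi> \<Longrightarrow> periodic (smooth m s \<phi>)"
  using periodic_average[of \<phi>] by (auto simp: periodic_def smooth_def)

lemma periodic_osc: "periodic \<phi> \<Longrightarrow> periodic (osc m s \<phi>)"
  using periodic_shift_series[of \<phi>] by (auto simp: periodic_def osc_def)

lemma periodic_L1_add:
  assumes "periodic_L1 \<phi>" "periodic_L1 \<psi>"
  shows "periodic_L1 (\<lambda>x. \<phi> x + \<psi> x)"
proof -
  note [measurable] = periodic_L1D(1)[OF assms(1)] periodic_L1D(1)[OF assms(2)]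
  have "(\<integral>\<^sup>+x. ennreal (norm (\<phi> x + \<psi> x)) \<partial>circ) \<le> (\<integral>\<^sup>+x. ennreal (norm (\<phi> x)) + ennreal (norm (\<psi> x)) \<partial>circ)"
    by (intro nn_integral_mono) (simp add: ennreal_plus[symmetric] ennreal_leI norm_triangle_ineq del: ennreal_plus)
  also have "\<dots> < top"
    using periodic_L1D[OF assms(1)] periodic_L1D[OF assms(2)] by (subst nn_integral_add) auto
  finally show ?thesis
    using periodic_L1D(2)[OF assms(1)] periodic_L1D(2)[OF assms(2)]
    by (simp add: periodic_L1_def periodic_def)
qed

lemma periodic_L1_cmult:
  assumes "periodic_L1 \<phi>"
  shows "periodic_L1 (\<lambda>x. c * \<phi> x)"
proof -
  note [measurable] = periodic_L1D(1)[OF assms]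
  have "(\<integral>\<^sup>+x. ennreal (norm (c * \<phi> x)) \<partial>circ) = ennreal (norm c) * (\<integral>\<^sup>+x. ennreal (norm (\<phi> x)) \<partial>circ)"
    by (subst nn_integral_cmult[symmetric]) (auto simp: norm_mult ennreal_mult)
  then show ?thesis
    using periodic_L1D[OF assms] by (simp add: periodic_L1_def periodic_def ennreal_mult_less_top)
qed

lemma periodic_L1_diff:
  assumes "periodic_L1 \<phi>" "periodic_L1 \<psi>"
  shows "periodic_L1 (\<lambda>x. \<phi> x - \<psi> x)"
  using periodic_L1_add[OF assms(1) periodic_L1_cmult[OF assms(2), of "-1"]] by simp

lemma periodic_L1_zero: "periodic_L1 (\<lambda>x. 0)"
  by (simp add: periodic_L1_def periodic_def)

lemma periodic_L1_sum:
  assumes "\<And>j. j \<in> I \<Longrightarrow> periodic_L1 (f j)"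
  shows "periodic_L1 (\<lambda>x. \<Sum>j\<in>I. f j x)"
  using assms by (induction I rule: infinite_finite_induct) (auto intro: periodic_L1_add periodic_L1_zero)

lemma periodic_L1_smooth:
  assumes "periodic_L1 \<phi>"
  shows "periodic_L1 (smooth m s \<phi>)"
proof -
  have "periodic_L1 (\<lambda>x. (-1) * (\<Sum>j\<in>{1..m}. complex_of_real (bincoeff (real m) j) * average (real j * s) \<phi> x))"
    by (intro periodic_L1_cmult periodic_L1_sum periodic_L1_average assms)
  then show ?thesis by (simp add: smooth_def[abs_def])
qed

lemma norm_smooth_le: "ennreal (norm (smooth m s \<phi> x)) \<le> abs_smooth m s (\<lambda>x. ennreal (norm (\<phi> x))) x"
proof -
  have "norm (smooth m s \<phi> x)
      \<le> (\<Sum>j\<in>{1..m}. \<bar>bincoeff (real m) j\<bar> * norm (average (real j * s) \<phi> x))"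
    unfolding smooth_def norm_minus_cancel by (rule order_trans[OF norm_sum]) (simp add: norm_mult)
  then have "ennreal (norm (smooth m s \<phi> x))
      \<le> ennreal (\<Sum>j\<in>{1..m}. \<bar>bincoeff (real m) j\<bar> * norm (average (real j * s) \<phi> x))"
    by (rule ennreal_leI)
  also have "\<dots> = (\<Sum>j\<in>{1..m}. ennreal \<bar>bincoeff (real m) j\<bar> * ennreal (norm (average (real j * s) \<phi> x)))"
    by (simp add: ennreal_mult[symmetric])
  also have "\<dots> \<le> abs_smooth m s (\<lambda>x. ennreal (norm (\<phi> x))) x"
    unfolding abs_smooth_def by (intro sum_mono mult_left_mono norm_average_le) auto
  finally show ?thesis .
qed

lemma abs_smooth_mono: "(\<And>x. f x \<le> g x) \<Longrightarrow> abs_smooth m s f x \<le> abs_smooth m s g x"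
  unfolding abs_smooth_def by (intro sum_mono mult_left_mono abs_average_mono) auto

definition smooth_mass :: "nat \<Rightarrow> real" where
  "smooth_mass m = (\<Sum>j\<in>{1..m}. \<bar>bincoeff (real m) j\<bar>)"

lemma smooth_mass_nonneg: "0 \<le> smooth_mass m"
  by (simp add: smooth_mass_def sum_nonneg)

lemma nn_integral_abs_smooth:
  assumes [measurable]: "n \<in> borel_measurable borel" and "periodic n"
  shows "(\<integral>\<^sup>+x. abs_smooth m s n x \<partial>circ) = ennreal (smooth_mass m) * (\<integral>\<^sup>+x. n x \<partial>circ)"
proof -
  have "(\<integral>\<^sup>+x. abs_smooth m s n x \<partial>circ) = (\<Sum>j\<in>{1..m}. ennreal \<bar>bincoeff (real m) j\<bar> * (\<integral>\<^sup>+x. n x \<partial>circ))"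
    unfolding abs_smooth_def by (simp add: nn_integral_sum nn_integral_cmult nn_integral_abs_average assms)
  then show ?thesis by (simp add: smooth_mass_def sum_distrib_right[symmetric])
qed

lemma smooth_diff:
  assumes "periodic_L1 \<phi>" "periodic_L1 \<psi>" "0 < s"
  shows "smooth m s (\<lambda>x. \<phi> x - \<psi> x) x = smooth m s \<phi> x - smooth m s \<psi> x"
proof -
  have "average (real j * s) (\<lambda>x. \<phi> x - \<psi> x) x = average (real j * s) \<phi> x - average (real j * s) \<psi> x"
    if "j \<in> {1..m}" for j
    unfolding average_def using that assms by (intro Bochner_Integration.integral_diff integrable_average) auto
  then show ?thesis by (simp add: smooth_def right_diff_distrib sum_subtractf)
qed

text \<open>The average of the binomial sum is taken term by term; j = 0 reproduces \<phi> because
  \<open>unit_itv\<close> has total mass 1, and the other terms are averages of lengths j s.\<close>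

lemma diff_smooth_eq:
  assumes \<phi>: "periodic_L1 \<phi>" and s: "0 < s"
  shows "\<phi> x - smooth m s \<phi> x = (\<integral>u. shift_series (bincoeff (real m)) (s * u) \<phi> x \<partial>unit_itv)"
proof -
  interpret finite_measure unit_itv by (rule finite_measure_unit_itv)
  have i: "integrable unit_itv (\<lambda>u. complex_of_real (bincoeff (real m) j) * \<phi> (x - real j * (s * u)))" for j
  proof (cases "j = 0")
    case False
    then show ?thesis using integrable_average[OF \<phi>, of "real j * s" x] s
      by (intro integrable_mult_right) (simp add: mult.assoc)
  qed simp
  have av: "(\<integral>u. \<phi> (x - real j * (s * u)) \<partial>unit_itv) = average (real j * s) \<phi> x" for j
    by (simp add: average_def mult.assoc)
  have m: "measure unit_itv UNIV = 1" by (simp add: measure_def emeasure_unit_itv)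
  have "(\<integral>u. shift_series (bincoeff (real m)) (s * u) \<phi> x \<partial>unit_itv)
      = (\<Sum>j\<le>m. complex_of_real (bincoeff (real m) j) * average (real j * s) \<phi> x)"
    unfolding shift_series_bincoeff_nat using i by (simp add: Bochner_Integration.integral_sum av)
  also have "\<dots> = average 0 \<phi> x + (\<Sum>j\<in>{1..m}. complex_of_real (bincoeff (real m) j) * average (real j * s) \<phi> x)"
    by (simp add: atMost_atLeast0 sum.atLeast_Suc_atMost)
  also have "average 0 \<phi> x = \<phi> x" using m by (simp add: average_def)
  finally show ?thesis by (simp add: smooth_def)
qed

lemma norm_diff_smooth_le:
  assumes "periodic_L1 \<phi>" "0 < s"
  shows "ennreal (norm (\<phi> x - smooth m s \<phi> x)) \<le> osc m s \<phi> x"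
  unfolding diff_smooth_eq[OF assms] osc_def by (rule integral_norm_le_nn_integral)

lemma shift_series_smooth:
  assumes \<phi>: "periodic_L1 \<phi>" and s: "0 < s" and c: "summable (\<lambda>n. \<bar>c n\<bar>)"
  shows "shift_series c h (smooth m s \<phi>) x = smooth m s (shift_series c h \<phi>) x"
proof -
  have sm: "summable (\<lambda>\<nu>. complex_of_real (c \<nu>) * average (real j * s) \<phi> (x - real \<nu> * h))" if "j \<in> {1..m}" for j
  proof (intro summable_norm_cancel[OF summable_shift_series[unfolded shift_series_def]])
    note [measurable] = periodic_L1D(1)[OF \<phi>]
    let ?n = "\<lambda>x. ennreal (norm (\<phi> x))"
    have js: "0 < real j * s" using that s by simp
    have "abs_shift_series c h (\<lambda>x. ennreal (norm (average (real j * s) \<phi> x))) x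
        \<le> (\<Sum>\<nu>. ennreal \<bar>c \<nu>\<bar> * (ennreal (real (nat \<lceil>real j * s / (2 * pi)\<rceil>) / (real j * s)) * (\<integral>\<^sup>+x. ?n x \<partial>circ)))"
      unfolding abs_shift_series_def using periodic_L1D[OF \<phi>] js
      by (intro suminf_le mult_left_mono order_trans[OF norm_average_le] abs_average_finite) (auto intro: periodic_norm)
    also have "\<dots> < top"
      using periodic_L1D(3)[OF \<phi>] c
      by (simp add: ennreal_suminf_multc suminf_ennreal_finite ennreal_mult_less_top)
    finally show "abs_shift_series c h (\<lambda>x. ennreal (norm (average (real j * s) \<phi> x))) x < top" .
  qed
  have "shift_series c h (smooth m s \<phi>) x
      = (\<Sum>\<nu>. - (\<Sum>j\<in>{1..m}. complex_of_real (bincoeff (real m) j) * (complex_of_real (c \<nu>) * average (real j * s) \<phi> (x - real \<nu> * h))))"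
    by (simp add: shift_series_def smooth_def sum_distrib_left mult_ac)
  also have "\<dots> = - (\<Sum>j\<in>{1..m}. \<Sum>\<nu>. complex_of_real (bincoeff (real m) j) * (complex_of_real (c \<nu>) * average (real j * s) \<phi> (x - real \<nu> * h)))"
    using sm by (subst suminf_minus) (auto intro!: summable_sum summable_mult suminf_sum)
  also have "\<dots> = smooth m s (shift_series c h \<phi>) x"
    unfolding smooth_def using sm s
    by (intro arg_cong[where f = uminus] sum.cong refl)
       (subst average_shift_series[OF \<phi> _ c], auto simp: suminf_mult shift_series_def)
  finally show ?thesis .
qed

text \<open>Smoothing commutes with differences; then the two averages, over the step of the
  difference and over the smoothing, are exchanged.\<close>

lemma osc_smooth_le:
  assumes \<phi>: "periodic_L1 \<phi>" and t: "0 < t"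
  shows "osc m s (smooth m t \<phi>) x \<le> abs_smooth m t (osc m s \<phi>) x"
proof -
  note [measurable] = periodic_L1D(1)[OF \<phi>]
  interpret u: sigma_finite_measure unit_itv by (rule sigma_finite_unit_itv)
  interpret uu: pair_sigma_finite unit_itv unit_itv ..
  have sm: "summable (\<lambda>n. \<bar>bincoeff (real m) n\<bar>)"
    by (rule summable_finite[of "{..m}"]) (auto simp: bincoeff_of_nat binomial_eq_0)
  have "osc m s (smooth m t \<phi>) x
      \<le> (\<integral>\<^sup>+u. abs_smooth m t (\<lambda>x. ennreal (norm (shift_series (bincoeff (real m)) (s * u) \<phi> x))) x \<partial>unit_itv)"
    unfolding osc_def shift_series_smooth[OF \<phi> t sm] by (intro nn_integral_mono norm_smooth_le)
  also have "\<dots> = (\<Sum>j\<in>{1..m}. ennreal \<bar>bincoeff (real m) j\<bar> *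
      (\<integral>\<^sup>+u. \<integral>\<^sup>+v. ennreal (norm (shift_series (bincoeff (real m)) (s * u) \<phi> (x - real j * t * v))) \<partial>unit_itv \<partial>unit_itv))"
    unfolding abs_smooth_def abs_average_def
    by (subst nn_integral_sum) (auto simp: nn_integral_cmult)
  also have "\<dots> = abs_smooth m t (osc m s \<phi>) x"
    unfolding abs_smooth_def abs_average_def osc_def
    by (intro sum.cong refl arg_cong2[where f = "(*)"] uu.Fubini') measurable
  finally show ?thesis .
qed

text \<open>Majorant of V'V' - VV with V and V' the smoothing operators at the scales
  \<open>h / 2 ^ k\<close> and \<open>h / 2 ^ Suc k\<close>. The sum of two consecutive
  \<open>d\<close> bounds V' - V, and each summand smooths it with one of the two operators.\<close>

definition dyadic_piece :: "nat \<Rightarrow> real \<Rightarrow> (nat \<Rightarrow> real \<Rightarrow> ennreal) \<Rightarrow> nat \<Rightarrow> real \<Rightarrow> ennreal" where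
  "dyadic_piece m h d k x = abs_smooth m (h / 2 ^ Suc k) (\<lambda>x. d k x + d (Suc k) x) x
     + abs_smooth m (h / 2 ^ k) (\<lambda>x. d k x + d (Suc k) x) x"

lemma measurable_dyadic_piece [measurable (raw)]:
  assumes [measurable]: "\<And>k. case_prod (\<lambda>y. d y k) \<in> borel_measurable (N \<Otimes>\<^sub>M borel)" "f \<in> borel_measurable N"
  shows "(\<lambda>y. dyadic_piece m h (d y) k (f y)) \<in> borel_measurable N"
  unfolding dyadic_piece_def by measurable

text \<open>Telescoping of the squares of the smoothing operators \<open>V\<close> at dyadic scales, with
  \<open>V'V' - VV = V'(V' - V) + (V' - V)V\<close>. Every term contains one factor that is a difference
  and one factor that smooths it.\<close>

lemma norm_diff_smooth_smooth_le:
  assumes \<phi>: "periodic_L1 \<phi>" and h: "0 < h"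
    and fin: "(\<Sum>k. \<integral>\<^sup>+x. osc m (h / 2 ^ k) \<phi> x \<partial>circ) < top"
  shows "AE x in circ. ennreal (norm (\<phi> x - smooth m h (smooth m h \<phi>) x))
    \<le> (\<Sum>k. dyadic_piece m h (\<lambda>k. osc m (h / 2 ^ k) \<phi>) k x)"
proof -
  note [measurable] = periodic_L1D(1)[OF \<phi>]
  note per = periodic_L1D(2)[OF \<phi>]
  define s where "s = (\<lambda>k::nat. h / 2 ^ k)"
  have s: "0 < s k" for k using h by (simp add: s_def)
  define V where "V = (\<lambda>k. smooth m (s k))"
  define d where "d = (\<lambda>k. osc m (s k) \<phi>)"
  have [measurable]: "d k \<in> borel_measurable borel" for k unfolding d_def by measurable
  have dper: "periodic (d k)" for k unfolding d_def by (rule periodic_osc[OF per])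
  have L1: "periodic_L1 (V k \<phi>)" for k unfolding V_def by (rule periodic_L1_smooth[OF \<phi>])
  have step: "ennreal (norm (V (Suc k) (V (Suc k) \<phi>) x - V k (V k \<phi>) x)) \<le> dyadic_piece m h d k x" for k x
  proof -
    have tri: "ennreal (norm (V (Suc k) \<psi> x - V k \<psi> x)) \<le> osc m (s k) \<psi> x + osc m (s (Suc k)) \<psi> x"
      if "periodic_L1 \<psi>" for \<psi> x
    proof -
      have "norm (V (Suc k) \<psi> x - V k \<psi> x) \<le> norm (\<psi> x - V k \<psi> x) + norm (\<psi> x - V (Suc k) \<psi> x)"
        by (metis add_diff_cancel_left' diff_add_cancel diff_diff_eq2 norm_triangle_ineq4)
      then have "ennreal (norm (V (Suc k) \<psi> x - V k \<psi> x)) \<le> ennreal (norm (\<psi> x - V k \<psi> x)) + ennreal (norm (\<psi> x - V (Suc k) \<psi> x))"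
        by (simp add: ennreal_plus[symmetric] ennreal_leI del: ennreal_plus)
      also have "\<dots> \<le> osc m (s k) \<psi> x + osc m (s (Suc k)) \<psi> x"
        unfolding V_def using that s by (intro add_mono norm_diff_smooth_le)
      finally show ?thesis .
    qed
    have eq: "V (Suc k) (V (Suc k) \<phi>) x - V k (V k \<phi>) x
        = V (Suc k) (\<lambda>x. V (Suc k) \<phi> x - V k \<phi> x) x + (V (Suc k) (V k \<phi>) x - V k (V k \<phi>) x)"
      using smooth_diff[OF L1[of "Suc k"] L1[of k] s[of "Suc k"], of m x] by (simp add: V_def)
    have "ennreal (norm (V (Suc k) (V (Suc k) \<phi>) x - V k (V k \<phi>) x))
        \<le> ennreal (norm (V (Suc k) (\<lambda>x. V (Suc k) \<phi> x - V k \<phi> x) x)) + ennreal (norm (V (Suc k) (V k \<phi>) x - V k (V k \<phi>) x))"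
      unfolding eq by (simp add: ennreal_plus[symmetric] ennreal_leI norm_triangle_ineq del: ennreal_plus)
    also have "\<dots> \<le> abs_smooth m (s (Suc k)) (\<lambda>x. ennreal (norm (V (Suc k) \<phi> x - V k \<phi> x))) x
        + (osc m (s k) (V k \<phi>) x + osc m (s (Suc k)) (V k \<phi>) x)"
      by (intro add_mono tri[OF L1]) (simp add: V_def norm_smooth_le)
    also have "\<dots> \<le> abs_smooth m (s (Suc k)) (\<lambda>x. d k x + d (Suc k) x) x
        + (abs_smooth m (s k) (d k) x + abs_smooth m (s k) (d (Suc k)) x)"
      unfolding d_def V_def[symmetric] using s
      by (intro add_mono abs_smooth_mono tri[OF \<phi>]) (auto simp: V_def intro: osc_smooth_le[OF \<phi>])
    also have "abs_smooth m (s k) (d k) x + abs_smooth m (s k) (d (Suc k)) x = abs_smooth m (s k) (\<lambda>x. d k x + d (Suc k) x) x"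
      unfolding abs_smooth_def abs_average_def by (simp add: nn_integral_add distrib_left sum.distrib)
    finally show ?thesis by (simp add: dyadic_piece_def s_def)
  qed
  \<comment> \<open>This bounds the remainder \<phi> - V V \<phi> at scale k. Its integrals are
    summable, so it tends to 0 at almost every point, as the limit of the telescoping sum
    requires.\<close>
  define e where "e = (\<lambda>k x. d k x + abs_smooth m (s k) (d k) x)"
  have [measurable]: "e k \<in> borel_measurable borel" for k unfolding e_def by measurable
  have rem: "ennreal (norm (\<phi> x - V k (V k \<phi>) x)) \<le> e k x" for k x
  proof -
    have "V k (\<lambda>x. \<phi> x - V k \<phi> x) x = V k \<phi> x - V k (V k \<phi>) x"
      unfolding V_def by (rule smooth_diff[OF \<phi> L1[unfolded V_def] s])
    then have eq: "\<phi> x - V k (V k \<phi>) x = (\<phi> x - V k \<phi> x) + V k (\<lambda>x. \<phi> x - V k \<phi> x) x" by simp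
    have "ennreal (norm (\<phi> x - V k (V k \<phi>) x)) \<le> ennreal (norm (\<phi> x - V k \<phi> x)) + ennreal (norm (V k (\<lambda>x. \<phi> x - V k \<phi> x) x))"
      unfolding eq by (simp add: ennreal_plus[symmetric] ennreal_leI norm_triangle_ineq del: ennreal_plus)
    also have "\<dots> \<le> d k x + abs_smooth m (s k) (\<lambda>x. ennreal (norm (\<phi> x - V k \<phi> x))) x"
      unfolding d_def V_def by (intro add_mono norm_diff_smooth_le[OF \<phi> s] norm_smooth_le)
    also have "\<dots> \<le> e k x"
      unfolding e_def d_def V_def by (intro add_mono order_refl abs_smooth_mono norm_diff_smooth_le[OF \<phi> s])
    finally show ?thesis .
  qed
  have "(\<integral>\<^sup>+x. (\<Sum>k. e k x) \<partial>circ) = (\<Sum>k. \<integral>\<^sup>+x. e k x \<partial>circ)"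
    by (rule nn_integral_suminf) measurable
  also have "\<dots> = (\<Sum>k. (1 + ennreal (smooth_mass m)) * (\<integral>\<^sup>+x. d k x \<partial>circ))"
    unfolding e_def by (simp add: nn_integral_add nn_integral_abs_smooth dper distrib_right)
  also have "\<dots> < top"
    using fin by (simp add: ennreal_mult_less_top d_def s_def)
  finally have "AE x in circ. (\<Sum>k. e k x) \<noteq> \<infinity>"
    by (intro nn_integral_PInf_AE) auto
  then show ?thesis
  proof eventually_elim
    case (elim x)
    have "ennreal (norm (\<phi> x - V 0 (V 0 \<phi>) x)) \<le> (\<Sum>k. dyadic_piece m h d k x) + e K x" for K
    proof -
      have "ennreal (norm (V K (V K \<phi>) x - V 0 (V 0 \<phi>) x)) \<le> (\<Sum>k<K. dyadic_piece m h d k x)"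
      proof (induction K)
        case (Suc K)
        have "ennreal (norm (V (Suc K) (V (Suc K) \<phi>) x - V 0 (V 0 \<phi>) x))
            \<le> ennreal (norm (V K (V K \<phi>) x - V 0 (V 0 \<phi>) x)) + ennreal (norm (V (Suc K) (V (Suc K) \<phi>) x - V K (V K \<phi>) x))"
          using norm_triangle_ineq[of "V K (V K \<phi>) x - V 0 (V 0 \<phi>) x" "V (Suc K) (V (Suc K) \<phi>) x - V K (V K \<phi>) x"]
          by (simp add: ennreal_plus[symmetric] ennreal_leI del: ennreal_plus)
        also have "\<dots> \<le> (\<Sum>k<K. dyadic_piece m h d k x) + dyadic_piece m h d K x"
          by (intro add_mono Suc step)
        finally show ?case by simp
      qed simp
      also have "\<dots> \<le> (\<Sum>k. dyadic_piece m h d k x)" by (rule sum_le_suminf) auto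
      finally have 1: "ennreal (norm (V K (V K \<phi>) x - V 0 (V 0 \<phi>) x)) \<le> (\<Sum>k. dyadic_piece m h d k x)" .
      have "ennreal (norm (\<phi> x - V 0 (V 0 \<phi>) x))
          \<le> ennreal (norm (V K (V K \<phi>) x - V 0 (V 0 \<phi>) x)) + ennreal (norm (\<phi> x - V K (V K \<phi>) x))"
        using norm_triangle_ineq[of "V K (V K \<phi>) x - V 0 (V 0 \<phi>) x" "\<phi> x - V K (V K \<phi>) x"]
        by (simp add: ennreal_plus[symmetric] ennreal_leI del: ennreal_plus)
      also have "\<dots> \<le> (\<Sum>k. dyadic_piece m h d k x) + e K x" by (intro add_mono 1 rem)
      finally show ?thesis .
    qed
    moreover have "(\<lambda>K. (\<Sum>k. dyadic_piece m h d k x) + e K x) \<longlonglongrightarrow> (\<Sum>k. dyadic_piece m h d k x) + 0"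
    proof (intro tendsto_add tendsto_const)
      define r where "r = (\<lambda>k. enn2real (e k x))"
      have fin_e: "e k x \<noteq> top" for k
        using elim sum_le_suminf[of "\<lambda>k. e k x" "{k}"] by (auto simp: top_unique)
      then have er: "e k x = ennreal (r k)" for k by (simp add: r_def less_top)
      have "summable r"
        using elim unfolding er by (intro summable_suminf_not_top) (auto simp: r_def)
      then have "r \<longlonglongrightarrow> 0" by (rule summable_LIMSEQ_zero)
      then show "(\<lambda>K. e K x) \<longlonglongrightarrow> 0" unfolding er by (metis ennreal_0 tendsto_ennrealI)
    qed
    ultimately have "ennreal (norm (\<phi> x - V 0 (V 0 \<phi>) x)) \<le> (\<Sum>k. dyadic_piece m h d k x)"
      by (intro LIMSEQ_le_const[where X = "\<lambda>K. (\<Sum>k. dyadic_piece m h d k x) + e K x"]) auto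
    then show ?case by (simp add: V_def s_def d_def)
  qed
qed

subsection \<open>Fractional integration of differences\<close>

definition arc :: "(real \<Rightarrow> complex) \<Rightarrow> real \<Rightarrow> real \<Rightarrow> real \<Rightarrow> complex" where
  "arc \<phi> x a b = (\<integral>v. indicator {a..b} v *\<^sub>R \<phi> (x - v) \<partial>lborel)"

definition circ_mean :: "(real \<Rightarrow> complex) \<Rightarrow> complex" where
  "circ_mean \<phi> = (\<integral>v. \<phi> v \<partial>circ) / of_real (2 * pi)"

lemma unit_itv_eq: "unit_itv = density lborel (\<lambda>x. ennreal (indicator {0..1} x))"
  by (simp add: unit_itv_def ennreal_indicator)

lemma circ_eq: "circ = density lborel (\<lambda>x. ennreal (indicator {0..2*pi} x))"
  by (simp add: circ_def ennreal_indicator)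

lemma average_eq_integral:
  assumes [measurable]: "\<phi> \<in> borel_measurable borel"
  shows "average s \<phi> x = (\<integral>u. indicator {0..1} u *\<^sub>R \<phi> (x - s * u) \<partial>lborel)"
  unfolding average_def unit_itv_eq by (rule integral_density) auto

lemma arc_integrable:
  assumes \<phi>: "periodic_L1 \<phi>"
  shows "integrable lborel (\<lambda>v. indicator {a..b} v *\<^sub>R \<phi> (x - v))"
proof (cases "a < b")
  case True
  note [measurable] = periodic_L1D(1)[OF \<phi>]
  have "integrable unit_itv (\<lambda>u. \<phi> ((x - a) - (b - a) * u))"
    by (rule integrable_average[OF \<phi>]) (use True in simp)
  then have "integrable lborel (\<lambda>u. indicator {0..1} u *\<^sub>R \<phi> ((x - a) - (b - a) * u))"
    unfolding unit_itv_eq by (subst (asm) integrable_density) auto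
  also have "(\<lambda>u. indicator {0..1} u *\<^sub>R \<phi> ((x - a) - (b - a) * u))
      = (\<lambda>u. indicator {a..b} (a + (b - a) * u) *\<^sub>R \<phi> (x - (a + (b - a) * u)))"
  proof (rule ext)
    fix u
    have "a + (b - a) * u \<in> {a..b} \<longleftrightarrow> u \<in> {0..1}"
    proof -
      have "a + (b - a) * u \<in> {a..b} \<longleftrightarrow> 0 \<le> (b - a) * u \<and> (b - a) * u \<le> b - a"
        unfolding atLeastAtMost_iff by linarith
      also have "\<dots> \<longleftrightarrow> 0 \<le> u \<and> u \<le> 1"
        using True mult_le_cancel_left_pos[of "b - a" u 1] zero_le_mult_iff[of "b - a" u] by simp
      finally show ?thesis by simp
    qed
    moreover have "(x - a) - (b - a) * u = x - (a + (b - a) * u)" by simp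
    ultimately show "indicator {0..1} u *\<^sub>R \<phi> ((x - a) - (b - a) * u)
      = indicator {a..b} (a + (b - a) * u) *\<^sub>R \<phi> (x - (a + (b - a) * u))"
      by (simp only: indicator_def)
  qed
  finally show ?thesis
    using True by (subst (asm) lborel_integrable_real_affine_iff[where f = "\<lambda>v. indicator {a..b} v *\<^sub>R \<phi> (x - v)"]) auto
next
  case False
  note [measurable] = periodic_L1D(1)[OF \<phi>]
  have "AE v in lborel. v \<noteq> a" by (rule AE_lborel_singleton)
  then have "AE v in lborel. (0::complex) = indicator {a..b} v *\<^sub>R \<phi> (x - v)"
    by eventually_elim (use False in \<open>auto simp: indicator_def\<close>)
  then show ?thesis by (rule integrable_cong_AE_imp[rotated 2]) auto
qed

lemma average_eq_arc:
  assumes \<phi>: "periodic_L1 \<phi>" and s: "0 < s"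
  shows "of_real s * average s \<phi> (x - t) = arc \<phi> x t (t + s)"
proof -
  note [measurable] = periodic_L1D(1)[OF \<phi>]
  have "arc \<phi> x t (t + s) = s *\<^sub>R (\<integral>u. indicator {t..t + s} (t + s * u) *\<^sub>R \<phi> (x - (t + s * u)) \<partial>lborel)"
    unfolding arc_def using s by (subst lborel_integral_real_affine[where c = s and t = t]) auto
  also have "(\<lambda>u. indicator {t..t + s} (t + s * u) *\<^sub>R \<phi> (x - (t + s * u))) = (\<lambda>u. indicator {0..1} u *\<^sub>R \<phi> ((x - t) - s * u))"
    using s by (auto simp: fun_eq_iff indicator_def zero_le_mult_iff mult_le_cancel_left2 diff_diff_eq)
  finally show ?thesis by (simp add: average_eq_integral scaleR_conv_of_real)
qed

lemma arc_combine:
  assumes \<phi>: "periodic_L1 \<phi>" and "a \<le> b" "b \<le> c"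
  shows "arc \<phi> x a c = arc \<phi> x a b + arc \<phi> x b c"
proof -
  have "AE v in lborel. v \<noteq> b" by (rule AE_lborel_singleton)
  then have "AE v in lborel. indicator {a..c} v *\<^sub>R \<phi> (x - v)
      = indicator {a..b} v *\<^sub>R \<phi> (x - v) + indicator {b..c} v *\<^sub>R \<phi> (x - v)"
    by eventually_elim (use assms in \<open>auto simp: indicator_def\<close>)
  then have "arc \<phi> x a c = (\<integral>v. indicator {a..b} v *\<^sub>R \<phi> (x - v) + indicator {b..c} v *\<^sub>R \<phi> (x - v) \<partial>lborel)"
    unfolding arc_def using arc_integrable[OF \<phi>] by (intro integral_cong_AE) auto
  then show ?thesis
    unfolding arc_def using arc_integrable[OF \<phi>] by simp
qed

lemma arc_trivial: "arc \<phi> x a a = 0"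
proof -
  have "AE v in lborel. v \<noteq> a" by (rule AE_lborel_singleton)
  then have "AE v in lborel. indicator {a..a} v *\<^sub>R \<phi> (x - v) = 0"
    by eventually_elim auto
  then show ?thesis unfolding arc_def by (rule integral_eq_zero_AE)
qed

lemma sum_average:
  assumes \<phi>: "periodic_L1 \<phi>" and h: "0 < h"
  shows "of_real h * (\<Sum>\<nu><j. average h \<phi> (x - real \<nu> * h)) = arc \<phi> x 0 (real j * h)"
proof (induction j)
  case (Suc j)
  have "of_real h * average h \<phi> (x - real j * h) = arc \<phi> x (real j * h) (real j * h + h)"
    by (rule average_eq_arc[OF \<phi> h])
  moreover have "arc \<phi> x 0 (real j * h + h) = arc \<phi> x 0 (real j * h) + arc \<phi> x (real j * h) (real j * h + h)"
    using h by (intro arc_combine[OF \<phi>]) auto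
  ultimately show ?case using Suc by (simp add: distrib_left algebra_simps)
qed (simp add: arc_trivial)

lemma average_multiple:
  assumes \<phi>: "periodic_L1 \<phi>" and h: "0 < h" and j: "0 < j"
  shows "(\<Sum>\<nu><j. average h \<phi> (x - real \<nu> * h)) = of_nat j * average (real j * h) \<phi> x"
proof -
  have "of_real h * (\<Sum>\<nu><j. average h \<phi> (x - real \<nu> * h)) = of_real h * (of_nat j * average (real j * h) \<phi> x)"
    using average_eq_arc[OF \<phi>, of "real j * h" x 0] h j sum_average[OF \<phi> h, of x j] by (simp add: mult_ac)
  then show ?thesis using h by simp
qed

text \<open>An average of length j h is the mean of j translates of the average of length h. A
  smoothing thus reduces to the average for which the low frequency estimate is proved; the factor 1
  / j is dropped because j \<ge> 1.\<close>

lemma norm_smooth_le_average: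
  assumes \<phi>: "periodic_L1 \<phi>" and h: "0 < h"
  shows "ennreal (norm (smooth m h \<phi> x))
    \<le> (\<Sum>j\<in>{1..m}. \<Sum>i<j. ennreal \<bar>bincoeff (real m) j\<bar> * ennreal (norm (average h \<phi> (x - real i * h))))"
proof -
  have av: "norm (average (real j * h) \<phi> x) \<le> (\<Sum>i<j. norm (average h \<phi> (x - real i * h)))" if "j \<in> {1..m}" for j
  proof -
    have "norm (of_nat j * average (real j * h) \<phi> x) \<le> (\<Sum>i<j. norm (average h \<phi> (x - real i * h)))"
      using that by (subst average_multiple[OF \<phi> h, symmetric]) (auto intro: norm_sum)
    moreover have "1 * norm (average (real j * h) \<phi> x) \<le> real j * norm (average (real j * h) \<phi> x)"
      using that by (intro mult_right_mono) auto
    ultimately show ?thesis by (simp add: norm_mult)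
  qed
  have "norm (smooth m h \<phi> x)
      \<le> (\<Sum>j\<in>{1..m}. \<bar>bincoeff (real m) j\<bar> * norm (average (real j * h) \<phi> x))"
    unfolding smooth_def norm_minus_cancel by (rule order_trans[OF norm_sum]) (simp add: norm_mult)
  also have "\<dots> \<le> (\<Sum>j\<in>{1..m}. \<bar>bincoeff (real m) j\<bar> * (\<Sum>i<j. norm (average h \<phi> (x - real i * h))))"
    by (intro sum_mono mult_left_mono av) auto
  finally have "ennreal (norm (smooth m h \<phi> x))
      \<le> ennreal (\<Sum>j\<in>{1..m}. \<Sum>i<j. \<bar>bincoeff (real m) j\<bar> * norm (average h \<phi> (x - real i * h)))"
    by (intro ennreal_leI) (simp add: sum_distrib_left)
  also have "\<dots> = (\<Sum>j\<in>{1..m}. \<Sum>i<j. ennreal \<bar>bincoeff (real m) j\<bar> * ennreal (norm (average h \<phi> (x - real i * h))))"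
    by (simp add: sum_nonneg ennreal_mult[symmetric])
  finally show ?thesis .
qed

text \<open>The nonnegative version is transferred to complex values through image measures: after
  reduction modulo the period, u and x - u have the same distribution, and \<phi> factors through
  this reduction.\<close>

lemma integral_circ_reflect_shift:
  fixes \<phi> :: "real \<Rightarrow> complex"
  assumes [measurable]: "\<phi> \<in> borel_measurable borel" and per: "periodic \<phi>"
  shows "(\<integral>u. \<phi> (x - u) \<partial>circ) = (\<integral>u. \<phi> u \<partial>circ)"
proof -
  define rm where "rm = (\<lambda>y::real. y - 2 * pi * of_int \<lfloor>y / (2 * pi)\<rfloor>)"
  have [measurable]: "rm \<in> borel_measurable borel" unfolding rm_def by measurable
  have rm: "\<phi> (rm y) = \<phi> y" for y
    using periodic_add_int[OF per, of y "- \<lfloor>y / (2 * pi)\<rfloor>"] by (simp add: rm_def)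
  have rmper: "rm (y + 2 * pi) = rm y" for y
  proof -
    have "(y + 2 * pi) / (2 * pi) = y / (2 * pi) + 1" by (simp add: field_simps)
    then show ?thesis by (simp add: rm_def algebra_simps)
  qed
  have eq: "distr circ borel (\<lambda>u. rm (x - u)) = distr circ borel rm"
  proof (rule measure_eqI)
    fix A assume "A \<in> sets (distr circ borel (\<lambda>u. rm (x - u)))"
    then have A[measurable]: "A \<in> sets borel" by simp
    have "emeasure (distr circ borel (\<lambda>u. rm (x - u))) A = (\<integral>\<^sup>+u. indicator A (rm (x - u)) \<partial>circ)"
      by (subst nn_integral_indicator[symmetric], simp, subst nn_integral_distr) auto
    also have "\<dots> = (\<integral>\<^sup>+u. indicator A (rm u) \<partial>circ)"
      by (rule nn_integral_circ_reflect_shift) (auto simp: periodic_def rmper)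
    also have "\<dots> = emeasure (distr circ borel rm) A"
      by (subst nn_integral_indicator[symmetric], simp, subst nn_integral_distr) auto
    finally show "emeasure (distr circ borel (\<lambda>u. rm (x - u))) A = emeasure (distr circ borel rm) A" .
  qed simp
  have "(\<integral>u. \<phi> (x - u) \<partial>circ) = (\<integral>u. \<phi> u \<partial>distr circ borel (\<lambda>u. rm (x - u)))"
    by (subst integral_distr) (auto simp: rm)
  also have "\<dots> = (\<integral>u. \<phi> u \<partial>circ)"
    unfolding eq by (subst integral_distr) (auto simp: rm)
  finally show ?thesis .
qed

lemma average_period:
  assumes \<phi>: "periodic_L1 \<phi>"
  shows "average (2 * pi) \<phi> x = circ_mean \<phi>"
    and "arc \<phi> x 0 (2 * pi) = of_real (2 * pi) * circ_mean \<phi>"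
proof -
  note [measurable] = periodic_L1D(1)[OF \<phi>]
  have "arc \<phi> x 0 (2 * pi) = (\<integral>u. \<phi> (x - u) \<partial>circ)"
    unfolding arc_def circ_eq by (subst integral_density) auto
  then show *: "arc \<phi> x 0 (2 * pi) = of_real (2 * pi) * circ_mean \<phi>"
    using integral_circ_reflect_shift[OF periodic_L1D(1,2)[OF \<phi>], of x] by (simp add: circ_mean_def)
  have "of_real (2 * pi) * average (2 * pi) \<phi> x = of_real (2 * pi) * circ_mean \<phi>"
    using average_eq_arc[OF \<phi>, of "2 * pi" x 0] * by simp
  then show "average (2 * pi) \<phi> x = circ_mean \<phi>"
    by (metis mult_left_cancel of_real_eq_0_iff pi_neq_zero mult_eq_0_iff zero_neq_numeral)
qed

lemma norm_circ_mean_le: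
  assumes \<phi>: "periodic_L1 \<phi>"
  shows "ennreal (2 * pi) * ennreal (norm (circ_mean \<phi>)) \<le> (\<integral>\<^sup>+x. ennreal (norm (\<phi> x)) \<partial>circ)"
proof -
  have "2 * pi * norm (circ_mean \<phi>) = norm (\<integral>v. \<phi> v \<partial>circ)"
    by (simp add: circ_mean_def norm_divide norm_mult)
  then show ?thesis
    using integral_norm_le_nn_integral[of circ \<phi>] by (simp add: ennreal_mult[symmetric])
qed

text \<open>Once the mean is subtracted, the integral over an arc depends only on its length modulo
  2 pi, so it does not grow with L. The bound is written with the indicator of u \<le> L because
  summation by parts will superpose these indicators into a kernel.\<close>

lemma norm_arc_minus_mean_le:
  assumes \<phi>: "periodic_L1 \<phi>" and L: "0 \<le> L"
  defines "I \<equiv> (\<integral>\<^sup>+x. ennreal (norm (\<phi> x)) \<partial>circ)"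
  shows "ennreal (norm (arc \<phi> x 0 L - of_real L * circ_mean \<phi>))
    \<le> (\<integral>\<^sup>+u. indicator {..L} u * (ennreal (norm (\<phi> (x - u))) + ennreal (1 / (2 * pi)) * I) \<partial>circ)"
proof -
  note [measurable] = periodic_L1D(1)[OF \<phi>]
  have base: "ennreal (norm (arc \<phi> x 0 L - of_real L * circ_mean \<phi>))
    \<le> (\<integral>\<^sup>+u. indicator {..L} u * (ennreal (norm (\<phi> (x - u))) + ennreal (1 / (2 * pi)) * I) \<partial>circ)"
    if "L \<le> 2 * pi" "0 \<le> L" for L
  proof -
    have "ennreal (norm (arc \<phi> x 0 L)) \<le> (\<integral>\<^sup>+v. indicator {0..L} v * ennreal (norm (\<phi> (x - v))) \<partial>lborel)"
      unfolding arc_def by (rule order_trans[OF integral_norm_le_nn_integral])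
        (auto intro!: nn_integral_mono split: split_indicator)
    also have "\<dots> = (\<integral>\<^sup>+v. indicator {..L} v * ennreal (norm (\<phi> (x - v))) \<partial>circ)"
      using that by (subst nn_integral_circ) (auto intro!: nn_integral_cong split: split_indicator)
    finally have 1: "ennreal (norm (arc \<phi> x 0 L)) \<le> (\<integral>\<^sup>+v. indicator {..L} v * ennreal (norm (\<phi> (x - v))) \<partial>circ)" .
    have "ennreal L = (\<integral>\<^sup>+v. indicator {0..L} v \<partial>lborel)" using that by simp
    also have "\<dots> = (\<integral>\<^sup>+v. indicator {..L} v \<partial>circ)"
      by (subst nn_integral_circ, simp, rule nn_integral_cong) (use that in \<open>auto split: split_indicator\<close>)
    finally have 2: "ennreal L = (\<integral>\<^sup>+v. indicator {..L} v \<partial>circ)" .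
    have "ennreal (norm (circ_mean \<phi>)) = ennreal (1 / (2 * pi)) * (ennreal (2 * pi) * ennreal (norm (circ_mean \<phi>)))"
      by (simp add: mult.assoc[symmetric] ennreal_mult[symmetric])
    also have "\<dots> \<le> ennreal (1 / (2 * pi)) * I"
      unfolding I_def by (intro mult_left_mono norm_circ_mean_le \<phi>) auto
    finally have 3: "ennreal L * ennreal (norm (circ_mean \<phi>)) \<le> (\<integral>\<^sup>+v. indicator {..L} v \<partial>circ) * (ennreal (1 / (2 * pi)) * I)"
      unfolding 2 by (intro mult_left_mono) auto
    have "ennreal (norm (arc \<phi> x 0 L - of_real L * circ_mean \<phi>))
        \<le> ennreal (norm (arc \<phi> x 0 L)) + ennreal L * ennreal (norm (circ_mean \<phi>))"
      using norm_triangle_ineq4[of "arc \<phi> x 0 L" "of_real L * circ_mean \<phi>"] that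
      by (simp add: norm_mult ennreal_mult[symmetric] ennreal_plus[symmetric] ennreal_leI del: ennreal_plus)
    also have "\<dots> \<le> (\<integral>\<^sup>+v. indicator {..L} v * ennreal (norm (\<phi> (x - v))) \<partial>circ)
        + (\<integral>\<^sup>+v. indicator {..L} v \<partial>circ) * (ennreal (1 / (2 * pi)) * I)"
      by (intro add_mono 1 3)
    also have "\<dots> = (\<integral>\<^sup>+u. indicator {..L} u * (ennreal (norm (\<phi> (x - u))) + ennreal (1 / (2 * pi)) * I) \<partial>circ)"
      by (simp add: distrib_left nn_integral_add nn_integral_multc)
    finally show ?thesis .
  qed
  have step: "arc \<phi> x 0 (L + 2 * pi) - of_real (L + 2 * pi) * circ_mean \<phi> = arc \<phi> x 0 L - of_real L * circ_mean \<phi>"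
    if "0 \<le> L" for L
  proof -
    have "arc \<phi> x (2 * pi) (2 * pi + L) = arc \<phi> x 0 L"
    proof (cases "L = 0")
      case False
      then have "arc \<phi> x (2 * pi) (2 * pi + L) = of_real L * average L \<phi> (x - 2 * pi)"
        using that by (intro average_eq_arc[OF \<phi>, symmetric]) auto
      also have "average L \<phi> (x - 2 * pi) = average L \<phi> x"
        using periodic_add_int[OF periodic_average[OF periodic_L1D(2)[OF \<phi>]], of L x "-1"] by simp
      also have "of_real L * average L \<phi> x = arc \<phi> x 0 L"
        using average_eq_arc[OF \<phi>, of L x 0] that False by simp
      finally show ?thesis .
    qed (simp add: arc_trivial)
    moreover have "arc \<phi> x 0 (2 * pi + L) = arc \<phi> x 0 (2 * pi) + arc \<phi> x (2 * pi) (2 * pi + L)"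
      using that by (intro arc_combine[OF \<phi>]) auto
    ultimately show ?thesis
      using average_period(2)[OF \<phi>, of x] by (simp add: add.commute distrib_right)
  qed
  have steps: "arc \<phi> x 0 (L + 2 * pi * real i) - of_real (L + 2 * pi * real i) * circ_mean \<phi>
      = arc \<phi> x 0 L - of_real L * circ_mean \<phi>" if "0 \<le> L" for L i
  proof (induction i)
    case (Suc i)
    then show ?case using step[of "L + 2 * pi * real i"] that by (simp add: algebra_simps)
  qed simp
  \<comment> \<open>Whole periods are removed; the remaining length \<open>L0\<close> is at most
    \<open>L\<close>, so passing back to \<open>L\<close> only enlarges the indicator.\<close>
  define i where "i = nat \<lfloor>L / (2 * pi)\<rfloor>"
  define L0 where "L0 = L - 2 * pi * real i"
  have "real i = of_int \<lfloor>L / (2 * pi)\<rfloor>" using L by (simp add: i_def)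
  then have "real i \<le> L / (2 * pi)" "L / (2 * pi) \<le> real i + 1"
    by linarith+
  then have "real i * (2 * pi) \<le> L" "L \<le> (real i + 1) * (2 * pi)"
    by (simp_all add: pos_le_divide_eq pos_divide_le_eq)
  then have L0: "0 \<le> L0" "L0 \<le> 2 * pi"
    unfolding L0_def by (simp_all add: algebra_simps)
  have "ennreal (norm (arc \<phi> x 0 L - of_real L * circ_mean \<phi>)) = ennreal (norm (arc \<phi> x 0 L0 - of_real L0 * circ_mean \<phi>))"
    using steps[OF L0(1), of i] by (simp add: L0_def)
  also have "\<dots> \<le> (\<integral>\<^sup>+u. indicator {..L0} u * (ennreal (norm (\<phi> (x - u))) + ennreal (1 / (2 * pi)) * I) \<partial>circ)"
    by (rule base[OF L0(2,1)])
  also have "\<dots> \<le> (\<integral>\<^sup>+u. indicator {..L} u * (ennreal (norm (\<phi> (x - u))) + ennreal (1 / (2 * pi)) * I) \<partial>circ)"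
  proof (intro nn_integral_mono mult_right_mono zero_le)
    have "L0 \<le> L" by (simp add: L0_def)
    then show "indicator {..L0} u \<le> (indicator {..L} u :: ennreal)" for u
      by (auto split: split_indicator)
  qed
  finally show ?thesis .
qed

section \<open>Summation by parts against the kernel of the fractional integral\<close>

lemma Abel_summation:
  fixes z :: "nat \<Rightarrow> complex"
  shows "(\<Sum>\<nu><n. of_real (k \<nu>) * z \<nu>)
    = (\<Sum>j<n. of_real (k j - k (Suc j)) * (\<Sum>\<nu><Suc j. z \<nu>)) + of_real (k n) * (\<Sum>\<nu><n. z \<nu>)"
  by (induction n) (simp_all add: algebra_simps)

text \<open>For i h < u \<le> (i + 1) h with i < n the differences telescope to k_i, which is at
  most (i + 1)^(\<theta> - 1) and hence at most (u / h)^(\<theta> - 1). Beyond n h every indicator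
  vanishes; both claims go through the induction together.\<close>

lemma kernel_layers_le:
  fixes k :: "nat \<Rightarrow> real"
  assumes "\<And>\<nu>. k \<nu> \<le> (real \<nu> + 1) powr (\<theta> - 1)" "\<theta> < 1" "0 < u" "0 < h"
  shows "(\<Sum>j<n. (k j - k (Suc j)) * indicator {..real (Suc j) * h} u) + k n * indicator {..real n * h} u
    \<le> (u / h) powr (\<theta> - 1)"
    and "real n * h < u \<Longrightarrow> (\<Sum>j<n. (k j - k (Suc j)) * indicator {..real (Suc j) * h} u) + k n * indicator {..real n * h} u = 0"
proof (induction n)
  case 0
  { case 1 show ?case using assms by simp }
  { case 2 show ?case using assms by simp }
next
  case (Suc n)
  { case 1
    show ?case
    proof (cases "u \<le> real n * h")
      case True
      then have "u \<le> real (Suc n) * h" using assms by (simp add: distrib_right)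
      then show ?thesis using Suc(1) True by (simp add: algebra_simps)
    next
      case False
      then have z: "(\<Sum>j<n. (k j - k (Suc j)) * indicator {..real (Suc j) * h} u) = 0"
        using Suc(2) by simp
      show ?thesis
      proof (cases "u \<le> real (Suc n) * h")
        case True
        then have "u / h \<le> real n + 1" using assms by (simp add: field_simps)
        then have "(real n + 1) powr (\<theta> - 1) \<le> (u / h) powr (\<theta> - 1)"
          using assms by (intro powr_mono2') auto
        then show ?thesis using True z assms(1)[of n] by simp
      qed (use z in simp)
    qed }
  { case 2
    then have "real n * h < u" using assms by (simp add: distrib_right)
    then show ?case using Suc(2) 2 by simp }
qed

text \<open>Summation by parts replaces the values by partial sums, which are arc integrals minus
  their mean part, divided by h; the superposed layers are dominated by the kernel of
  \<open>riesz\<close>. The bound depends neither on n nor on the particular k, so n may tend to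
  infinity and, later, r to 1.\<close>

lemma norm_kernel_sum_le:
  fixes k :: "nat \<Rightarrow> real"
  assumes \<phi>: "periodic_L1 \<phi>" and h: "0 < h" and \<theta>: "0 < \<theta>" "\<theta> < 1"
    and k: "\<And>\<nu>. 0 \<le> k \<nu>" "\<And>\<nu>. k (Suc \<nu>) \<le> k \<nu>" "\<And>\<nu>. k \<nu> \<le> (real \<nu> + 1) powr (\<theta> - 1)"
  shows "ennreal (norm (\<Sum>\<nu><n. of_real (k \<nu>) * (average h \<phi> (x - real \<nu> * h) - circ_mean \<phi>)))
    \<le> ennreal (h powr (-\<theta>) * (1 + 1 / \<theta>)) * riesz \<theta> (\<lambda>x. ennreal (norm (\<phi> x))) x"
proof -
  note [measurable] = periodic_L1D(1)[OF \<phi>]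
  define I where "I = (\<integral>\<^sup>+x. ennreal (norm (\<phi> x)) \<partial>circ)"
  define z where "z = (\<lambda>\<nu>. average h \<phi> (x - real \<nu> * h) - circ_mean \<phi>)"
  define F where "F = (\<lambda>u. ennreal (norm (\<phi> (x - u))) + ennreal (1 / (2 * pi)) * I)"
  have [measurable]: "F \<in> borel_measurable borel" unfolding F_def by measurable
  define B where "B = (\<lambda>L. \<integral>\<^sup>+u. indicator {..L} u * F u \<partial>circ)"
  have Z: "ennreal (norm (\<Sum>\<nu><j. z \<nu>)) \<le> ennreal (1 / h) * B (real j * h)" for j
  proof -
    have "(\<Sum>\<nu><j. z \<nu>) = (arc \<phi> x 0 (real j * h) - of_real (real j * h) * circ_mean \<phi>) / of_real h"
      using h sum_average[OF \<phi> h, of x j, symmetric]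
      by (simp add: z_def sum_subtractf diff_divide_distrib)
    then have "norm (\<Sum>\<nu><j. z \<nu>) = 1 / h * norm (arc \<phi> x 0 (real j * h) - of_real (real j * h) * circ_mean \<phi>)"
      using h by (simp add: norm_divide del: of_real_mult)
    then have "ennreal (norm (\<Sum>\<nu><j. z \<nu>)) = ennreal (1 / h) * ennreal (norm (arc \<phi> x 0 (real j * h) - of_real (real j * h) * circ_mean \<phi>))"
      using h by (simp only: ennreal_mult[symmetric] norm_ge_zero divide_nonneg_pos zero_le_one)
    also have "\<dots> \<le> ennreal (1 / h) * B (real j * h)"
      unfolding B_def F_def I_def using h by (intro mult_left_mono norm_arc_minus_mean_le \<phi>) auto
    finally show ?thesis .
  qed
  have "norm (\<Sum>\<nu><n. of_real (k \<nu>) * z \<nu>)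
      \<le> (\<Sum>j<n. (k j - k (Suc j)) * norm (\<Sum>\<nu><Suc j. z \<nu>)) + k n * norm (\<Sum>\<nu><n. z \<nu>)"
    unfolding Abel_summation[of k z n]
    by (rule order_trans[OF norm_triangle_ineq], intro add_mono order_trans[OF norm_sum] sum_mono)
       (use k in \<open>auto simp: norm_mult abs_of_nonneg simp del: of_real_diff\<close>)
  then have "ennreal (norm (\<Sum>\<nu><n. of_real (k \<nu>) * z \<nu>))
      \<le> ennreal ((\<Sum>j<n. (k j - k (Suc j)) * norm (\<Sum>\<nu><Suc j. z \<nu>)) + k n * norm (\<Sum>\<nu><n. z \<nu>))"
    by (rule ennreal_leI)
  also have "\<dots> = (\<Sum>j<n. ennreal (k j - k (Suc j)) * ennreal (norm (\<Sum>\<nu><Suc j. z \<nu>))) + ennreal (k n) * ennreal (norm (\<Sum>\<nu><n. z \<nu>))"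
  proof -
    have "ennreal (\<Sum>j<n. (k j - k (Suc j)) * norm (\<Sum>\<nu><Suc j. z \<nu>))
        = (\<Sum>j<n. ennreal (k j - k (Suc j)) * ennreal (norm (\<Sum>\<nu><Suc j. z \<nu>)))"
    proof -
      have "(\<Sum>j<n. ennreal (k j - k (Suc j)) * ennreal (norm (\<Sum>\<nu><Suc j. z \<nu>)))
          = (\<Sum>j<n. ennreal ((k j - k (Suc j)) * norm (\<Sum>\<nu><Suc j. z \<nu>)))"
        using k by (intro sum.cong refl ennreal_mult[symmetric]) auto
      also have "\<dots> = ennreal (\<Sum>j<n. (k j - k (Suc j)) * norm (\<Sum>\<nu><Suc j. z \<nu>))"
        using k by (intro sum_ennreal mult_nonneg_nonneg) auto
      finally show ?thesis by simp
    qed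
    moreover have "0 \<le> (\<Sum>j<n. (k j - k (Suc j)) * norm (\<Sum>\<nu><Suc j. z \<nu>))"
      using k by (intro sum_nonneg mult_nonneg_nonneg) auto
    ultimately show ?thesis using k by (simp add: ennreal_mult)
  qed
  also have "\<dots> \<le> (\<Sum>j<n. ennreal (k j - k (Suc j)) * (ennreal (1 / h) * B (real (Suc j) * h))) + ennreal (k n) * (ennreal (1 / h) * B (real n * h))"
    by (intro add_mono sum_mono mult_left_mono Z) auto
  also have "\<dots> = ennreal (1 / h) * ((\<Sum>j<n. ennreal (k j - k (Suc j)) * B (real (Suc j) * h)) + ennreal (k n) * B (real n * h))"
    by (simp add: sum_distrib_left distrib_left mult_ac)
  also have "(\<Sum>j<n. ennreal (k j - k (Suc j)) * B (real (Suc j) * h)) + ennreal (k n) * B (real n * h)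
      = (\<integral>\<^sup>+u. ((\<Sum>j<n. ennreal (k j - k (Suc j)) * indicator {..real (Suc j) * h} u) + ennreal (k n) * indicator {..real n * h} u) * F u \<partial>circ)"
  proof -
    define G where "G = (\<lambda>r u. indicator {..r :: real} u :: ennreal)"
    have [measurable]: "G r \<in> borel_measurable borel" for r unfolding G_def by measurable
    have G: "indicator {..r} u = G r u" for r u by (simp add: G_def)
    show ?thesis
      unfolding B_def G
      by (simp add: distrib_right sum_distrib_right nn_integral_add nn_integral_sum nn_integral_cmult mult.assoc)
  qed
  also have "\<dots> \<le> (\<integral>\<^sup>+u. ennreal (h powr (1 - \<theta>)) * (ennreal (u powr (\<theta> - 1)) * F u) \<partial>circ)"
  proof (intro nn_integral_mono_AE eventually_mono[OF AE_circ_pos])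
    fix u :: real assume u: "0 < u"
    have "(\<Sum>j<n. ennreal (k j - k (Suc j)) * indicator {..real (Suc j) * h} u) + ennreal (k n) * indicator {..real n * h} u
        = ennreal ((\<Sum>j<n. (k j - k (Suc j)) * indicator {..real (Suc j) * h} u) + k n * indicator {..real n * h} u)"
    proof -
      have "ennreal (\<Sum>j<n. (k j - k (Suc j)) * indicator {..real (Suc j) * h} u)
          = (\<Sum>j<n. ennreal (k j - k (Suc j)) * indicator {..real (Suc j) * h} u)"
        using k by (subst sum_ennreal[symmetric]) (auto intro!: sum.cong mult_nonneg_nonneg split: split_indicator)
      moreover have "0 \<le> (\<Sum>j<n. (k j - k (Suc j)) * indicator {..real (Suc j) * h} u)"
        using k by (intro sum_nonneg mult_nonneg_nonneg) auto
      ultimately show ?thesis using k by (simp add: ennreal_mult ennreal_indicator)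
    qed
    also have "\<dots> \<le> ennreal ((u / h) powr (\<theta> - 1))"
      using \<theta> u h by (intro ennreal_leI kernel_layers_le k) auto
    also have "(u / h) powr (\<theta> - 1) = h powr (1 - \<theta>) * u powr (\<theta> - 1)"
      using u h by (simp add: powr_divide powr_diff)
    finally have "((\<Sum>j<n. ennreal (k j - k (Suc j)) * indicator {..real (Suc j) * h} u) + ennreal (k n) * indicator {..real n * h} u) * F u
        \<le> ennreal (h powr (1 - \<theta>) * u powr (\<theta> - 1)) * F u"
      by (rule mult_right_mono) simp
    then show "((\<Sum>j<n. ennreal (k j - k (Suc j)) * indicator {..real (Suc j) * h} u) + ennreal (k n) * indicator {..real n * h} u) * F u
        \<le> ennreal (h powr (1 - \<theta>)) * (ennreal (u powr (\<theta> - 1)) * F u)"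
      by (simp add: ennreal_mult mult.assoc)
  qed
  also have "\<dots> = ennreal (h powr (1 - \<theta>)) * (riesz \<theta> (\<lambda>x. ennreal (norm (\<phi> x))) x
      + (\<integral>\<^sup>+u. ennreal (u powr (\<theta> - 1)) \<partial>circ) * (ennreal (1 / (2 * pi)) * I))"
    by (simp add: F_def riesz_def distrib_left nn_integral_add nn_integral_cmult nn_integral_multc)
  also have "(\<integral>\<^sup>+u. ennreal (u powr (\<theta> - 1)) \<partial>circ) = ennreal ((2 * pi) powr \<theta> / \<theta>)"
    using nn_integral_powr_from_0[of "\<theta> - 1" "2 * pi"] \<theta> by (simp add: nn_integral_circ mult.commute)
  \<comment> \<open>Source of the constant 1 / \<theta>: on the period the kernel is at least (2
    pi)^(\<theta> - 1), so the fractional integral dominates the L_1 norm that came from the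
    mean.\<close>
  also have "ennreal ((2 * pi) powr \<theta> / \<theta>) * (ennreal (1 / (2 * pi)) * I) \<le> ennreal (1 / \<theta>) * riesz \<theta> (\<lambda>x. ennreal (norm (\<phi> x))) x"
  proof -
    have "I = (\<integral>\<^sup>+u. ennreal (norm (\<phi> (x - u))) \<partial>circ)"
      unfolding I_def using periodic_L1D(2)[OF \<phi>]
      by (intro nn_integral_circ_reflect_shift[symmetric] periodic_norm) auto
    then have "ennreal ((2 * pi) powr (\<theta> - 1)) * I = (\<integral>\<^sup>+u. ennreal ((2 * pi) powr (\<theta> - 1)) * ennreal (norm (\<phi> (x - u))) \<partial>circ)"
      by (simp add: nn_integral_cmult)
    also have "\<dots> \<le> riesz \<theta> (\<lambda>x. ennreal (norm (\<phi> x))) x"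
      unfolding riesz_def
    proof (rule nn_integral_mono_AE)
      have "AE u in circ. 0 < u \<and> u \<le> 2 * pi"
        using AE_circ_pos unfolding AE_circ_iff by eventually_elim auto
      then show "AE u in circ. ennreal ((2 * pi) powr (\<theta> - 1)) * ennreal (norm (\<phi> (x - u)))
          \<le> ennreal (u powr (\<theta> - 1)) * ennreal (norm (\<phi> (x - u)))"
        by eventually_elim (use \<theta> in \<open>auto intro!: mult_right_mono ennreal_leI powr_mono2'\<close>)
    qed
    finally have "ennreal (1 / \<theta>) * (ennreal ((2 * pi) powr (\<theta> - 1)) * I) \<le> ennreal (1 / \<theta>) * riesz \<theta> (\<lambda>x. ennreal (norm (\<phi> x))) x"
      by (rule mult_left_mono) simp
    moreover have "(2 * pi) powr \<theta> / \<theta> * (1 / (2 * pi)) = 1 / \<theta> * (2 * pi) powr (\<theta> - 1)"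
      by (simp add: powr_diff)
    ultimately show ?thesis using \<theta>
      by (simp only: mult.assoc[symmetric] ennreal_mult[symmetric] powr_ge_zero divide_nonneg_pos zero_le_one zero_less_mult_iff pi_gt_zero zero_less_numeral simp_thms)
  qed
  finally have "ennreal (norm (\<Sum>\<nu><n. of_real (k \<nu>) * z \<nu>))
      \<le> ennreal (1 / h) * (ennreal (h powr (1 - \<theta>)) * (riesz \<theta> (\<lambda>x. ennreal (norm (\<phi> x))) x + ennreal (1 / \<theta>) * riesz \<theta> (\<lambda>x. ennreal (norm (\<phi> x))) x))"
    by (simp add: mult_left_mono add_left_mono)
  also have "\<dots> = ennreal (1 / h * (h powr (1 - \<theta>) * (1 + 1 / \<theta>))) * riesz \<theta> (\<lambda>x. ennreal (norm (\<phi> x))) x"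
  proof -
    have "ennreal (a * (b * (1 + t))) = ennreal a * (ennreal b * (1 + ennreal t))" if "0 \<le> a" "0 \<le> b" "0 \<le> t" for a b t
      using that by (simp add: ennreal_mult)
    from this[of "1 / h" "h powr (1 - \<theta>)" "1 / \<theta>"] show ?thesis
      using h \<theta> by (simp only: less_imp_le divide_nonneg_pos zero_le_one powr_ge_zero simp_thms)
        (simp only: distrib_left distrib_right mult_1_left mult_1_right mult_ac)
  qed
  also have "1 / h * (h powr (1 - \<theta>) * (1 + 1 / \<theta>)) = h powr (-\<theta>) * (1 + 1 / \<theta>)"
    using h by (simp add: powr_diff powr_minus divide_inverse)
  finally show ?thesis by (simp add: z_def)
qed

section \<open>Products of differences and the splitting into frequencies\<close>

lemma summable_abs_Cauchy_product:
  fixes c d :: "nat \<Rightarrow> real"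
  assumes "summable (\<lambda>n. \<bar>c n\<bar>)" "summable (\<lambda>n. \<bar>d n\<bar>)"
  shows "summable (\<lambda>n. \<bar>\<Sum>i\<le>n. \<bar>c i\<bar> * \<bar>d (n - i)\<bar>\<bar>)"
proof -
  have "summable (\<lambda>n. \<Sum>i\<le>n. \<bar>c i\<bar> * \<bar>d (n - i)\<bar>)"
    using assms by (intro summable_Cauchy_product) auto
  then show ?thesis by (simp add: sum_nonneg abs_of_nonneg)
qed

lemma shift_series_compose_AE:
  assumes \<phi>: "periodic_L1 \<phi>" and c: "summable (\<lambda>n. \<bar>c n\<bar>)" and d: "summable (\<lambda>n. \<bar>d n\<bar>)"
  shows "AE x in circ. shift_series c h (shift_series d h \<phi>) x = shift_series (\<lambda>n. \<Sum>i\<le>n. c i * d (n - i)) h \<phi> x"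
proof -
  note [measurable] = periodic_L1D(1)[OF \<phi>]
  have "AE x in circ. abs_shift_series (\<lambda>n. \<Sum>i\<le>n. \<bar>c i\<bar> * \<bar>d (n - i)\<bar>) h (\<lambda>x. ennreal (norm (\<phi> x))) x < top"
    using periodic_L1D[OF \<phi>] summable_abs_Cauchy_product[OF c d]
    by (intro AE_abs_shift_series_finite) (auto intro: periodic_norm)
  then show ?thesis by eventually_elim (rule shift_series_compose)
qed

text \<open>From (1 - S)^(a + b) = (1 - S)^a (1 - S)^b, where the first factor has summable
  coefficients: a difference of higher order is controlled by one of lower order.\<close>

lemma norm_shift_series_bincoeff_split:
  assumes \<phi>: "periodic_L1 \<phi>" and "0 < a" "0 < b"
  shows "AE x in circ. ennreal (norm (shift_series (bincoeff (a + b)) h \<phi> x))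
    \<le> abs_shift_series (bincoeff a) h (\<lambda>x. ennreal (norm (shift_series (bincoeff b) h \<phi> x))) x"
  using shift_series_compose_AE[OF \<phi> summable_bincoeff[OF assms(2)] summable_bincoeff[OF assms(3)], of h]
  unfolding bincoeff_Vandermonde
  by eventually_elim (metis norm_shift_series_le)

lemma summable_gbinomial: "0 < a \<Longrightarrow> summable (\<lambda>n. \<bar>a gchoose n\<bar>)" for a :: real
  using summable_bincoeff[of a] by (simp add: bincoeff_def abs_mult)

text \<open>From (1 - S^2)^a = (1 + S)^a (1 - S)^a with S the translation by h / 2. Halving the step
  leaves room above it: the modulus at h / 2 is bounded by its values between h / 2 and h.\<close>

lemma norm_shift_series_bincoeff_half:
  assumes \<phi>: "periodic_L1 \<phi>" and a: "0 < a"
  shows "AE x in circ. ennreal (norm (shift_series (bincoeff a) h \<phi> x))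
    \<le> abs_shift_series (\<lambda>n. a gchoose n) (h / 2) (\<lambda>x. ennreal (norm (shift_series (bincoeff a) (h / 2) \<phi> x))) x"
proof -
  \<comment> \<open>Coefficients of (1 - z^2)^a: the series with step h is a series with step h / 2
    that uses even indices only.\<close>
  define e where "e = (\<lambda>n. if even n then bincoeff a (n div 2) else 0)"
  have eq: "shift_series (bincoeff a) h \<phi> x = shift_series e (h / 2) \<phi> x" for x
  proof -
    have "strict_mono (\<lambda>n::nat. 2 * n)" by (auto simp: strict_mono_def)
    then have "(\<Sum>n. complex_of_real (e (2 * n)) * \<phi> (x - real (2 * n) * (h / 2)))
        = (\<Sum>n. complex_of_real (e n) * \<phi> (x - real n * (h / 2)))"
      by (rule suminf_mono_reindex) (auto simp: e_def elim!: evenE)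
    then show ?thesis by (simp add: shift_series_def e_def)
  qed
  have "AE x in circ. shift_series (\<lambda>n. a gchoose n) (h / 2) (shift_series (bincoeff a) (h / 2) \<phi>) x
      = shift_series (\<lambda>n. \<Sum>i\<le>n. (a gchoose i) * bincoeff a (n - i)) (h / 2) \<phi> x"
    by (rule shift_series_compose_AE[OF \<phi> summable_gbinomial[OF a] summable_bincoeff[OF a]])
  then show ?thesis
    unfolding bincoeff_duplication e_def[symmetric] eq
    by eventually_elim (metis norm_shift_series_le)
qed

text \<open>With V = \<open>smooth m h\<close> one writes \<phi> = (\<phi> - V V \<phi>) + V V
  \<phi>. In the second part the series commutes with V V; the outer V is kept as a positive
  majorant, the inner one is estimated by translates of the average of length h.\<close>

lemma smooth_decomposition:
  assumes \<phi>: "periodic_L1 \<phi>" and h: "0 < h" and c: "summable (\<lambda>n. \<bar>c n\<bar>)"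
  shows "AE x in circ. ennreal (norm (shift_series c h \<phi> x))
    \<le> abs_shift_series c h (\<lambda>x. ennreal (norm (\<phi> x - smooth m h (smooth m h \<phi>) x))) x
      + abs_smooth m h (\<lambda>x. \<Sum>j\<in>{1..m}. \<Sum>i<j. ennreal \<bar>bincoeff (real m) j\<bar>
          * ennreal (norm (average h (shift_series c h \<phi>) (x - real i * h)))) x"
proof -
  define \<psi> where "\<psi> = smooth m h (smooth m h \<phi>)"
  have \<psi>: "periodic_L1 \<psi>" unfolding \<psi>_def by (intro periodic_L1_smooth \<phi>)
  note L1 = periodic_L1_smooth[OF \<phi>] periodic_L1_shift_series[OF \<phi> c]
  note [measurable] = periodic_L1D(1)[OF \<phi>] periodic_L1D(1)[OF \<psi>]
  have fin: "AE x in circ. abs_shift_series c h (\<lambda>x. ennreal (norm (\<eta> x))) x < top" if "periodic_L1 \<eta>" for \<eta>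
    using periodic_L1D[OF that] c by (intro AE_abs_shift_series_finite) (auto intro: periodic_norm)
  show ?thesis
    using fin[OF periodic_L1_diff[OF \<phi> \<psi>]] fin[OF \<psi>]
  proof eventually_elim
    case (elim x)
    have s: "summable (\<lambda>\<nu>. complex_of_real (c \<nu>) * (\<phi> (x - real \<nu> * h) - \<psi> (x - real \<nu> * h)))"
        "summable (\<lambda>\<nu>. complex_of_real (c \<nu>) * \<psi> (x - real \<nu> * h))"
      using summable_norm_cancel[OF summable_shift_series[OF elim(1)]]
        summable_norm_cancel[OF summable_shift_series[OF elim(2)]] by auto
    have "shift_series c h \<phi> x = shift_series c h (\<lambda>x. \<phi> x - \<psi> x) x + shift_series c h \<psi> x"
      unfolding shift_series_def suminf_add[OF s] by (simp add: algebra_simps)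
    also have "shift_series c h \<psi> x = smooth m h (smooth m h (shift_series c h \<phi>)) x"
    proof -
      have "shift_series c h (smooth m h \<phi>) = smooth m h (shift_series c h \<phi>)"
        by (rule ext, rule shift_series_smooth[OF \<phi> h c])
      then show ?thesis
        unfolding \<psi>_def shift_series_smooth[OF L1(1) h c] by simp
    qed
    finally have "ennreal (norm (shift_series c h \<phi> x))
        \<le> ennreal (norm (shift_series c h (\<lambda>x. \<phi> x - \<psi> x) x)) + ennreal (norm (smooth m h (smooth m h (shift_series c h \<phi>)) x))"
      by (simp add: ennreal_plus[symmetric] ennreal_leI norm_triangle_ineq del: ennreal_plus)
    also have "\<dots> \<le> abs_shift_series c h (\<lambda>x. ennreal (norm (\<phi> x - \<psi> x))) x
        + abs_smooth m h (\<lambda>x. ennreal (norm (smooth m h (shift_series c h \<phi>) x))) x"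
      by (intro add_mono norm_shift_series_le norm_smooth_le)
    also have "\<dots> \<le> abs_shift_series c h (\<lambda>x. ennreal (norm (\<phi> x - \<psi> x))) x
        + abs_smooth m h (\<lambda>x. \<Sum>j\<in>{1..m}. \<Sum>i<j. ennreal \<bar>bincoeff (real m) j\<bar>
          * ennreal (norm (average h (shift_series c h \<phi>) (x - real i * h)))) x"
      by (intro add_mono order_refl abs_smooth_mono norm_smooth_le_average L1 h)
    finally show ?case by (simp add: \<psi>_def)
  qed
qed

section \<open>The low frequency estimate\<close>

lemma nn_integral_riesz:
  assumes "0 < \<theta>" and [measurable]: "n \<in> borel_measurable borel" and per: "periodic n"
  shows "(\<integral>\<^sup>+x. riesz \<theta> n x \<partial>circ) = ennreal ((2 * pi) powr \<theta> / \<theta>) * (\<integral>\<^sup>+x. n x \<partial>circ)"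
proof -
  interpret c: sigma_finite_measure circ by (rule sigma_finite_circ)
  interpret cc: pair_sigma_finite circ circ ..
  have "(\<integral>\<^sup>+x. riesz \<theta> n x \<partial>circ) = (\<integral>\<^sup>+u. \<integral>\<^sup>+x. ennreal (u powr (\<theta> - 1)) * n (x - u) \<partial>circ \<partial>circ)"
    unfolding riesz_def by (rule cc.Fubini') simp
  also have "\<dots> = (\<integral>\<^sup>+u. ennreal (u powr (\<theta> - 1)) \<partial>circ) * (\<integral>\<^sup>+x. n x \<partial>circ)"
    by (simp add: nn_integral_cmult nn_integral_circ_shift per nn_integral_multc)
  also have "(\<integral>\<^sup>+u. ennreal (u powr (\<theta> - 1)) \<partial>circ) = ennreal ((2 * pi) powr \<theta> / \<theta>)"
    using nn_integral_powr_from_0[of "\<theta> - 1" "2 * pi"] assms by (simp add: nn_integral_circ mult.commute)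
  finally show ?thesis .
qed

text \<open>Abel means replace \<open>(1 - S)\<^sup>\<alpha> = (1 - S)\<^sup>-\<^sup>\<theta> (1 - S)\<^sup>\<alpha>\<^sup>+\<^sup>\<theta>\<close>, whose first factor has
  divergent coefficients, by \<open>(1 - r S)\<^sup>\<alpha> = (1 - r S)\<^sup>-\<^sup>\<theta> (1 - r S)\<^sup>\<alpha>\<^sup>+\<^sup>\<theta>\<close> with \<open>r < 1\<close>.\<close>

lemma Abel_low_frequency:
  assumes \<phi>: "periodic_L1 \<phi>" and h: "0 < h" and \<theta>: "0 < \<theta>" "\<theta> < 1" and \<alpha>: "0 < \<alpha>" and r: "0 < r" "r < 1"
  shows "ennreal (norm (shift_series (\<lambda>n. bincoeff \<alpha> n * r ^ n) h (average h \<phi>) x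
      - of_real ((1 - r) powr \<alpha>) * circ_mean \<phi>))
    \<le> ennreal (h powr (-\<theta>) * (1 + 1 / \<theta>))
      * riesz \<theta> (\<lambda>x. ennreal (norm (shift_series (\<lambda>n. bincoeff (\<alpha> + \<theta>) n * r ^ n) h \<phi> x))) x"
proof -
  define d where "d = (\<lambda>n. bincoeff (\<alpha> + \<theta>) n * r ^ n)"
  define k where "k = (\<lambda>n. bincoeff (-\<theta>) n * r ^ n)"
  have d: "summable (\<lambda>n. \<bar>d n\<bar>)" and k: "summable (\<lambda>n. \<bar>k n\<bar>)"
    unfolding d_def k_def using r by (auto intro: summable_bincoeff_power)
  define g where "g = shift_series d h \<phi>"
  have g: "periodic_L1 g" unfolding g_def by (rule periodic_L1_shift_series[OF \<phi> d])
  note [measurable] = periodic_L1D(1)[OF \<phi>]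
  have bounded: "ennreal (norm (average h \<eta> x)) \<le> ennreal (real (nat \<lceil>h / (2 * pi)\<rceil>) / h) * (\<integral>\<^sup>+x. ennreal (norm (\<eta> x)) \<partial>circ)"
    if "periodic_L1 \<eta>" for \<eta> x
    using periodic_L1D[OF that] h by (intro order_trans[OF norm_average_le] abs_average_finite) (auto intro: periodic_norm)
  have fin: "abs_shift_series c h (\<lambda>x. ennreal (norm (average h \<eta> x))) x < top"
    if "periodic_L1 \<eta>" "summable (\<lambda>n. \<bar>c n\<bar>)" for c \<eta> x
  proof -
    have "abs_shift_series c h (\<lambda>x. ennreal (norm (average h \<eta> x))) x
        \<le> (\<Sum>\<nu>. ennreal \<bar>c \<nu>\<bar> * (ennreal (real (nat \<lceil>h / (2 * pi)\<rceil>) / h) * (\<integral>\<^sup>+x. ennreal (norm (\<eta> x)) \<partial>circ)))"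
      unfolding abs_shift_series_def using that by (intro suminf_le mult_left_mono bounded) auto
    also have "\<dots> < top"
      using that periodic_L1D(3)[OF that(1)]
      by (simp add: ennreal_suminf_multc suminf_ennreal_finite ennreal_mult_less_top)
    finally show ?thesis .
  qed
  have conv: "(\<Sum>i\<le>n. k i * d (n - i)) = bincoeff \<alpha> n * r ^ n" for n
  proof -
    have "(\<Sum>i\<le>n. k i * d (n - i)) = (\<Sum>i\<le>n. (bincoeff (-\<theta>) i * bincoeff (\<alpha> + \<theta>) (n - i)) * r ^ n)"
    proof (intro sum.cong refl)
      fix i assume "i \<in> {..n}"
      then have "r ^ n = r ^ i * r ^ (n - i)" by (simp add: power_add[symmetric])
      then show "k i * d (n - i) = (bincoeff (-\<theta>) i * bincoeff (\<alpha> + \<theta>) (n - i)) * r ^ n"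
        by (simp add: k_def d_def)
    qed
    then show ?thesis using bincoeff_Vandermonde[of "-\<theta>" "\<alpha> + \<theta>" n] by (simp add: sum_distrib_right[symmetric])
  qed
  have comp: "shift_series k h (average h g) x = shift_series (\<lambda>n. bincoeff \<alpha> n * r ^ n) h (average h \<phi>) x"
  proof -
    have "average h g = shift_series d h (average h \<phi>)"
      unfolding g_def by (rule ext, rule average_shift_series[OF \<phi> h d])
    then show ?thesis
      using shift_series_compose[OF fin[OF \<phi> summable_abs_Cauchy_product[OF k d]], of x] by (simp add: conv)
  qed
  have dsum: "d sums ((1 - r) powr (\<alpha> + \<theta>))" and ksum: "k sums ((1 - r) powr (-\<theta>))"
    unfolding d_def k_def using r by (auto intro: bincoeff_power_sums)
  \<comment> \<open>The kernel \<open>k\<close> sums to (1 - r)^(-\<theta>), which blows up as r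
    tends to 1, but the mean of \<open>g\<close> carries (1 - r)^(\<alpha> + \<theta>); together
    they leave the harmless factor (1 - r)^\<alpha>.\<close>
  have mean: "circ_mean g = of_real ((1 - r) powr (\<alpha> + \<theta>)) * circ_mean \<phi>"
  proof -
    have "circ_mean g = average (2 * pi) g x" by (simp add: average_period(1)[OF g])
    also have "\<dots> = shift_series d h (average (2 * pi) \<phi>) x"
      unfolding g_def by (rule average_shift_series[OF \<phi> _ d]) simp
    also have "\<dots> = (\<Sum>n. complex_of_real (d n) * circ_mean \<phi>)"
      by (simp add: shift_series_def average_period(1)[OF \<phi>])
    also have "\<dots> = of_real ((1 - r) powr (\<alpha> + \<theta>)) * circ_mean \<phi>"
      using sums_mult2[OF sums_of_real[OF dsum], of "circ_mean \<phi>"] by (rule sums_unique[symmetric])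
    finally show ?thesis .
  qed
  have "(\<lambda>n. complex_of_real (k n) * (average h g (x - real n * h) - circ_mean g)) sums
      (shift_series k h (average h g) x - of_real ((1 - r) powr (-\<theta>)) * circ_mean g)"
    unfolding right_diff_distrib
    by (intro sums_diff sums_mult2 sums_of_real ksum)
       (auto simp: shift_series_def intro!: summable_sums summable_norm_cancel[OF summable_shift_series[OF fin[OF g k]]])
  also have "of_real ((1 - r) powr (-\<theta>)) * circ_mean g = of_real ((1 - r) powr \<alpha>) * circ_mean \<phi>"
    unfolding mean using r by (simp add: mult.assoc[symmetric] powr_add[symmetric] flip: of_real_mult)
  finally have lim: "(\<lambda>n. \<Sum>\<nu><n. complex_of_real (k \<nu>) * (average h g (x - real \<nu> * h) - circ_mean g))
      \<longlonglongrightarrow> shift_series (\<lambda>n. bincoeff \<alpha> n * r ^ n) h (average h \<phi>) x - of_real ((1 - r) powr \<alpha>) * circ_mean \<phi>"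
    unfolding comp by (simp add: sums_def)
  show ?thesis
  proof (rule LIMSEQ_le_const2[OF tendsto_ennrealI[OF tendsto_norm[OF lim]]], intro exI[of _ 0] allI impI)
    fix n
    have "ennreal (norm (\<Sum>\<nu><n. complex_of_real (k \<nu>) * (average h g (x - real \<nu> * h) - circ_mean g)))
      \<le> ennreal (h powr (-\<theta>) * (1 + 1 / \<theta>)) * riesz \<theta> (\<lambda>x. ennreal (norm (g x))) x"
    \<comment> \<open>The factor r^n preserves positivity, monotonicity and the power bound of the
      coefficients of (1 - z)^(-\<theta>).\<close>
    proof (rule norm_kernel_sum_le[OF g h \<theta>])
      fix \<nu>
      have b: "0 < bincoeff (-\<theta>) \<nu>" "bincoeff (-\<theta>) (Suc \<nu>) \<le> bincoeff (-\<theta>) \<nu>" "bincoeff (-\<theta>) \<nu> \<le> (real \<nu> + 1) powr (\<theta> - 1)"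
        using bincoeff_neg[OF \<theta>] by auto
      show "0 \<le> k \<nu>" using b r by (simp add: k_def)
      show "k (Suc \<nu>) \<le> k \<nu>"
        unfolding k_def using b r by (intro mult_mono power_decreasing) auto
      have "k \<nu> \<le> bincoeff (-\<theta>) \<nu>"
        unfolding k_def using b r by (simp add: mult_le_cancel_left2 power_le_one)
      then show "k \<nu> \<le> (real \<nu> + 1) powr (\<theta> - 1)" using b by simp
    qed
    then show "ennreal (norm (\<Sum>\<nu><n. complex_of_real (k \<nu>) * (average h g (x - real \<nu> * h) - circ_mean g)))
      \<le> ennreal (h powr (-\<theta>) * (1 + 1 / \<theta>)) * riesz \<theta> (\<lambda>x. ennreal (norm (shift_series (\<lambda>n. bincoeff (\<alpha> + \<theta>) n * r ^ n) h \<phi> x))) x"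
      by (simp add: g_def d_def)
  qed
qed

lemma shift_series_Abel_limit:
  assumes fin: "abs_shift_series c h (\<lambda>x. ennreal (norm (\<phi> x))) x < top"
    and r: "\<And>i::nat. 0 < r i" "\<And>i. r i < 1" "r \<longlonglongrightarrow> 1"
  shows "(\<lambda>i. shift_series (\<lambda>n. c n * r i ^ n) h \<phi> x) \<longlonglongrightarrow> shift_series c h \<phi> x"
  unfolding shift_series_def
proof (rule tannerys_theorem[THEN conjunct2, THEN conjunct2])
  show "(\<lambda>i. complex_of_real (c n * r i ^ n) * \<phi> (x - real n * h)) \<longlonglongrightarrow> complex_of_real (c n) * \<phi> (x - real n * h)" for n
    using tendsto_mult[OF tendsto_of_real[OF tendsto_mult[OF tendsto_const tendsto_power[OF r(3), of n]]] tendsto_const,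
      of "c n" "\<phi> (x - real n * h)"] by simp
  have "norm (complex_of_real (c n * r i ^ n) * \<phi> (x - real n * h)) \<le> norm (complex_of_real (c n) * \<phi> (x - real n * h))" for n i
    using r(1,2)[of i] by (simp add: norm_mult norm_power mult_right_mono mult_left_le power_le_one)
  then show "\<forall>\<^sub>F (n, i) in sequentially \<times>\<^sub>F sequentially.
      norm (complex_of_real (c n * r i ^ n) * \<phi> (x - real n * h)) \<le> norm (complex_of_real (c n) * \<phi> (x - real n * h))"
    by (simp add: case_prod_unfold)
  show "summable (\<lambda>n. norm (complex_of_real (c n) * \<phi> (x - real n * h)))"
    by (rule summable_shift_series[OF fin])
qed simp

text \<open>Here r tends to 1 in the Abel estimate. The mean term disappears like (1 - r)^\<alpha>.
  On the right, dominated convergence applies at every x where the fractional integral of the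
  majorant \<open>N\<close> is finite, hence almost everywhere.\<close>

lemma low_frequency:
  assumes \<phi>: "periodic_L1 \<phi>" and h: "0 < h" and \<theta>: "0 < \<theta>" "\<theta> < 1" and \<alpha>: "0 < \<alpha>"
  shows "AE x in circ. ennreal (norm (average h (shift_series (bincoeff \<alpha>) h \<phi>) x))
    \<le> ennreal (h powr (-\<theta>) * (1 + 1 / \<theta>))
      * riesz \<theta> (\<lambda>x. ennreal (norm (shift_series (bincoeff (\<alpha> + \<theta>)) h \<phi> x))) x"
proof -
  note [measurable] = periodic_L1D(1)[OF \<phi>]
  define r where "r = (\<lambda>i::nat. 1 - 1 / (real i + 2))"
  have lim0: "(\<lambda>i::nat. 1 / (real i + 2)) \<longlonglongrightarrow> 0"
    using LIMSEQ_ignore_initial_segment[of "\<lambda>n. 1 / real n" 0 2] lim_1_over_n[where 'a = real]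
    by (simp add: add.commute)
  have r: "0 < r i" "r i < 1" for i by (auto simp: r_def field_simps)
  have rlim: "r \<longlonglongrightarrow> 1"
    using tendsto_diff[OF tendsto_const lim0, of 1] by (simp add: r_def)
  have sm: "summable (\<lambda>n. \<bar>bincoeff \<alpha> n\<bar>)" "summable (\<lambda>n. \<bar>bincoeff (\<alpha> + \<theta>) n\<bar>)"
    using \<alpha> \<theta> by (auto intro: summable_bincoeff)
  define b where "b = bincoeff (\<alpha> + \<theta>)"
  define N where "N = abs_shift_series b h (\<lambda>x. ennreal (norm (\<phi> x)))"
  have [measurable]: "N \<in> borel_measurable borel" unfolding N_def by measurable
  have Nper: "periodic N" unfolding N_def by (intro periodic_abs_shift_series periodic_norm periodic_L1D(2)[OF \<phi>])
  have "(\<integral>\<^sup>+x. N x \<partial>circ) < top"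
    unfolding N_def b_def using periodic_L1D[OF \<phi>] sm
    by (simp add: nn_integral_abs_shift_series periodic_norm suminf_ennreal_finite ennreal_mult_less_top)
  then have "(\<integral>\<^sup>+x. riesz \<theta> N x \<partial>circ) < top"
    using \<theta> by (simp add: nn_integral_riesz Nper ennreal_mult_less_top)
  then have "AE x in circ. riesz \<theta> N x \<noteq> \<infinity>"
    by (intro nn_integral_PInf_AE) auto
  then show ?thesis
  proof eventually_elim
    case (elim x)
    let ?C = "ennreal (h powr (-\<theta>) * (1 + 1 / \<theta>))"
    let ?l = "\<lambda>i. ennreal (norm (shift_series (\<lambda>n. bincoeff \<alpha> n * r i ^ n) h (average h \<phi>) x - of_real ((1 - r i) powr \<alpha>) * circ_mean \<phi>))"
    let ?r = "\<lambda>i. riesz \<theta> (\<lambda>x. ennreal (norm (shift_series (\<lambda>n. b n * r i ^ n) h \<phi> x))) x"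
    have le: "?l i \<le> ?C * ?r i" for i
      unfolding b_def by (rule Abel_low_frequency[OF \<phi> h \<theta> \<alpha> r])
    have "abs_shift_series (bincoeff \<alpha>) h (\<lambda>x. ennreal (norm (average h \<phi> x))) x
        \<le> (\<Sum>\<nu>. ennreal \<bar>bincoeff \<alpha> \<nu>\<bar> * (ennreal (real (nat \<lceil>h / (2 * pi)\<rceil>) / h) * (\<integral>\<^sup>+x. ennreal (norm (\<phi> x)) \<partial>circ)))"
      unfolding abs_shift_series_def using periodic_L1D[OF \<phi>] h
      by (intro suminf_le mult_left_mono order_trans[OF norm_average_le] abs_average_finite) (auto intro: periodic_norm)
    also have "\<dots> < top"
      using periodic_L1D(3)[OF \<phi>] sm
      by (simp add: ennreal_suminf_multc suminf_ennreal_finite ennreal_mult_less_top)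
    finally have "(\<lambda>i. shift_series (\<lambda>n. bincoeff \<alpha> n * r i ^ n) h (average h \<phi>) x) \<longlonglongrightarrow> shift_series (bincoeff \<alpha>) h (average h \<phi>) x"
      by (rule shift_series_Abel_limit[OF _ r rlim])
    moreover have "(\<lambda>i. (1 - r i) powr \<alpha>) \<longlonglongrightarrow> 0"
      using tendsto_powr2[OF lim0 tendsto_const[of \<alpha>]] \<alpha> by (simp add: r_def)
    then have "(\<lambda>i. complex_of_real ((1 - r i) powr \<alpha>)) \<longlonglongrightarrow> 0"
      using tendsto_of_real[of _ 0] by fastforce
    ultimately have "(\<lambda>i. shift_series (\<lambda>n. bincoeff \<alpha> n * r i ^ n) h (average h \<phi>) x - of_real ((1 - r i) powr \<alpha>) * circ_mean \<phi>)
        \<longlonglongrightarrow> shift_series (bincoeff \<alpha>) h (average h \<phi>) x - 0 * circ_mean \<phi>"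
      by (intro tendsto_diff tendsto_mult tendsto_const)
    then have l: "?l \<longlonglongrightarrow> ennreal (norm (average h (shift_series (bincoeff \<alpha>) h \<phi>) x))"
      by (intro tendsto_ennrealI tendsto_norm) (simp add: average_shift_series[OF \<phi> h sm(1)])
    have "?r \<longlonglongrightarrow> riesz \<theta> (\<lambda>x. ennreal (norm (shift_series b h \<phi> x))) x"
      unfolding riesz_def
    proof (rule nn_integral_dominated_convergence[where w = "\<lambda>u. ennreal (u powr (\<theta> - 1)) * N (x - u)"])
      have "ennreal (norm (shift_series (\<lambda>n. b n * r i ^ n) h \<phi> y)) \<le> N y" for i y
      proof -
        have "ennreal (norm (shift_series (\<lambda>n. b n * r i ^ n) h \<phi> y)) \<le> abs_shift_series (\<lambda>n. b n * r i ^ n) h (\<lambda>x. ennreal (norm (\<phi> x))) y"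
          by (rule norm_shift_series_le)
        also have "\<dots> \<le> N y"
          unfolding N_def abs_shift_series_def using r[of i]
          by (intro suminf_le mult_right_mono ennreal_leI) (auto simp: abs_mult mult_left_le power_le_one)
        finally show ?thesis .
      qed
      then show "AE u in circ. ennreal (u powr (\<theta> - 1)) * ennreal (norm (shift_series (\<lambda>n. b n * r i ^ n) h \<phi> (x - u)))
          \<le> ennreal (u powr (\<theta> - 1)) * N (x - u)" for i
        by (intro AE_I2 mult_left_mono) auto
      show "(\<integral>\<^sup>+u. ennreal (u powr (\<theta> - 1)) * N (x - u) \<partial>circ) < \<infinity>"
        using elim by (simp add: riesz_def less_top)
      then have "AE u in circ. ennreal (u powr (\<theta> - 1)) * N (x - u) \<noteq> \<infinity>"
        by (intro nn_integral_PInf_AE) auto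
      then show "AE u in circ. (\<lambda>i. ennreal (u powr (\<theta> - 1)) * ennreal (norm (shift_series (\<lambda>n. b n * r i ^ n) h \<phi> (x - u))))
          \<longlonglongrightarrow> ennreal (u powr (\<theta> - 1)) * ennreal (norm (shift_series b h \<phi> (x - u)))"
        using AE_circ_pos
      proof eventually_elim
        case (elim u)
        then have "N (x - u) < top"
          by (auto simp: ennreal_mult_eq_top_iff less_top)
        then have "(\<lambda>i. shift_series (\<lambda>n. b n * r i ^ n) h \<phi> (x - u)) \<longlonglongrightarrow> shift_series b h \<phi> (x - u)"
          unfolding N_def by (intro shift_series_Abel_limit r rlim)
        then show ?case
          by (intro ennreal_tendsto_cmult tendsto_ennrealI tendsto_norm) auto
      qed
    qed measurable
    then have "(\<lambda>i. ?C * ?r i) \<longlonglongrightarrow> ?C * riesz \<theta> (\<lambda>x. ennreal (norm (shift_series b h \<phi> x))) x"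
      by (intro ennreal_tendsto_cmult) auto
    from LIMSEQ_le[OF l this] le show ?case unfolding b_def by blast
  qed
qed

subsection \<open>Mixed norms\<close>

text \<open>The L_s norm on the circle of a function with values in L_p(M). The parameter y of M
  comes first, so that each \<open>G y\<close> is a function on the circle.\<close>

definition mixed_norm :: "real \<Rightarrow> real \<Rightarrow> 'b measure \<Rightarrow> ('b \<Rightarrow> real \<Rightarrow> ennreal) \<Rightarrow> ennreal" where
  "mixed_norm p s M G = Lnorm s circ (\<lambda>x. Lnorm p M (\<lambda>y. G y x))"

text \<open>Minkowski's integral inequality over a two-point space; finite sums and series are
  treated the same way with counting measures.\<close>

lemma Lnorm_add_le:
  assumes "sigma_finite_measure M" "1 < s" and [measurable]: "f \<in> borel_measurable M" "g \<in> borel_measurable M"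
  shows "Lnorm s M (\<lambda>y. f y + g y) \<le> Lnorm s M f + Lnorm s M g"
proof -
  define G where "G = (\<lambda>(b :: bool) y. if b then f y else g y)"
  have [measurable]: "case_prod G \<in> borel_measurable (count_space UNIV \<Otimes>\<^sub>M M)"
    by (rule measurable_pair_measure_countable1) (auto simp: G_def)
  have sf: "sigma_finite_measure (count_space (UNIV :: bool set))"
    by (rule sigma_finite_measure_count_space_countable) auto
  have "Lnorm s M (\<lambda>y. \<integral>\<^sup>+b. G b y \<partial>count_space UNIV) \<le> (\<integral>\<^sup>+b. Lnorm s M (G b) \<partial>count_space UNIV)"
    by (rule Minkowski_integral[OF sf assms(1,2)]) simp
  then show ?thesis
    by (simp add: nn_integral_count_space_finite UNIV_bool G_def add.commute cong: if_cong)
qed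

text \<open>Jensen's inequality, from the tangent at the mean. If the integral is infinite, the
  tangent at 1 already forces the right side to be infinite.\<close>

lemma ennpowr_nn_integral_le:
  assumes "emeasure M (space M) = 1" "1 < s" and [measurable]: "f \<in> borel_measurable M"
  shows "ennpowr (\<integral>\<^sup>+x. f x \<partial>M) s \<le> (\<integral>\<^sup>+x. ennpowr (f x) s \<partial>M)"
proof -
  have main: "ennreal (s * c powr (s - 1)) * (\<integral>\<^sup>+x. f x \<partial>M) \<le> (\<integral>\<^sup>+x. ennpowr (f x) s \<partial>M) + ennreal ((s - 1) * c powr s)"
    if "0 \<le> c" for c
  proof -
    have "ennreal (s * c powr (s - 1)) * (\<integral>\<^sup>+x. f x \<partial>M) = (\<integral>\<^sup>+x. ennreal (s * c powr (s - 1)) * f x \<partial>M)"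
      by (rule nn_integral_cmult[symmetric]) simp
    also have "\<dots> \<le> (\<integral>\<^sup>+x. ennpowr (f x) s + ennreal ((s - 1) * c powr s) \<partial>M)"
      using that assms(2) by (intro nn_integral_mono ennpowr_tangent)
    also have "\<dots> = (\<integral>\<^sup>+x. ennpowr (f x) s \<partial>M) + ennreal ((s - 1) * c powr s)"
      using assms(1) by (simp add: nn_integral_add)
    finally show ?thesis .
  qed
  show ?thesis
  proof (cases "\<integral>\<^sup>+x. f x \<partial>M")
    case (real c)
    have "c powr (s - 1) * c = c powr s"
      using real by (cases "c = 0") (auto simp: powr_diff)
    then have "ennreal (s * c powr s) \<le> (\<integral>\<^sup>+x. ennpowr (f x) s \<partial>M) + ennreal ((s - 1) * c powr s)"
      using main[of c] real assms(2) by (simp add: ennreal_mult[symmetric] mult.assoc)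
    also have "ennreal (s * c powr s) = ennreal (c powr s) + ennreal ((s - 1) * c powr s)"
    proof -
      have "s * c powr s = c powr s + (s - 1) * c powr s" by (simp add: algebra_simps)
      then show ?thesis using assms by (simp del: distrib_right)
    qed
    finally show ?thesis using real
      by (simp add: ennreal_add_left_cancel_le add.commute[of _ "ennreal ((s - 1) * c powr s)"])
  next
    case top
    then have "(\<integral>\<^sup>+x. ennpowr (f x) s \<partial>M) = top"
      using main[of 1] assms(2) by (auto simp: ennreal_mult_top top_unique)
    then show ?thesis by simp
  qed
qed

context
  fixes p :: real and M :: "'b measure"
  assumes p: "1 < p" and M: "sigma_finite_measure M"
begin

interpretation M: sigma_finite_measure M by (rule M)
interpretation c: sigma_finite_measure circ by (rule sigma_finite_circ)
interpretation Mc: pair_sigma_finite M circ ..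

lemma measurable_inner_norm [measurable]:
  assumes [measurable]: "case_prod G \<in> borel_measurable (M \<Otimes>\<^sub>M borel)"
  shows "(\<lambda>x. Lnorm p M (\<lambda>y. G y x)) \<in> borel_measurable borel"
  by (rule measurable_Lnorm[OF M]) measurable

text \<open>Pointwise estimates are proved on almost every section \<open>G y\<close>, whereas the
  mixed norm fixes x first; joint measurability permits the exchange.\<close>

lemma AE_swap_le:
  assumes [measurable]: "case_prod G \<in> borel_measurable (M \<Otimes>\<^sub>M borel)" "case_prod H \<in> borel_measurable (M \<Otimes>\<^sub>M borel)"
    and "AE y in M. AE x in circ. (G y x :: ennreal) \<le> H y x"
  shows "AE x in circ. AE y in M. G y x \<le> H y x"
proof -
  have "Measurable.pred (M \<Otimes>\<^sub>M circ) (\<lambda>w. G (fst w) (snd w) \<le> H (fst w) (snd w))"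
    by measurable
  then show ?thesis
    using assms(3) by (subst (asm) Mc.AE_commute) (auto simp: pred_def)
qed

lemma mixed_norm_mono_AE:
  assumes "0 < s" and "AE x in circ. AE y in M. G y x \<le> H y x"
  shows "mixed_norm p s M G \<le> mixed_norm p s M H"
  unfolding mixed_norm_def using assms p
  by (intro Lnorm_mono_AE) (auto elim!: eventually_mono intro: Lnorm_mono_AE)

lemma mixed_norm_mono:
  assumes "0 < s" and "\<And>y x. G y x \<le> H y x"
  shows "mixed_norm p s M G \<le> mixed_norm p s M H"
  using assms by (intro mixed_norm_mono_AE) auto

text \<open>Minkowski's inequality is used twice, for the inner and then for the outer norm.\<close>

lemma mixed_norm_Minkowski:
  assumes Q: "sigma_finite_measure Q" and s: "1 < s"
    and [measurable]: "(\<lambda>(z, y, x). G z y x) \<in> borel_measurable (Q \<Otimes>\<^sub>M M \<Otimes>\<^sub>M borel)"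
  shows "mixed_norm p s M (\<lambda>y x. \<integral>\<^sup>+z. G z y x \<partial>Q) \<le> (\<integral>\<^sup>+z. mixed_norm p s M (G z) \<partial>Q)"
proof -
  interpret Q: sigma_finite_measure Q by (rule Q)
  have "mixed_norm p s M (\<lambda>y x. \<integral>\<^sup>+z. G z y x \<partial>Q) \<le> Lnorm s circ (\<lambda>x. \<integral>\<^sup>+z. Lnorm p M (\<lambda>y. G z y x) \<partial>Q)"
    unfolding mixed_norm_def
  proof (intro Lnorm_mono Minkowski_integral Q M p)
    fix x :: real
    have "(\<lambda>(z, y). (z, y, x)) \<in> measurable (Q \<Otimes>\<^sub>M M) (Q \<Otimes>\<^sub>M M \<Otimes>\<^sub>M borel)" by measurable
    from measurable_compose[OF this assms(3)]
    show "(\<lambda>(z, y). G z y x) \<in> borel_measurable (Q \<Otimes>\<^sub>M M)" by (simp add: split_beta')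
  qed (use s in simp)
  also have "\<dots> \<le> (\<integral>\<^sup>+z. mixed_norm p s M (G z) \<partial>Q)"
    unfolding mixed_norm_def
  proof (intro Minkowski_integral Q s sigma_finite_circ)
    show "(\<lambda>(z, x). Lnorm p M (\<lambda>y. G z y x)) \<in> borel_measurable (Q \<Otimes>\<^sub>M circ)"
      unfolding split_beta'
    proof (rule measurable_Lnorm[OF M])
      have "(\<lambda>w. (fst (fst w), snd w, snd (fst w))) \<in> measurable ((Q \<Otimes>\<^sub>M circ) \<Otimes>\<^sub>M M) (Q \<Otimes>\<^sub>M M \<Otimes>\<^sub>M borel)"
        by measurable
      from measurable_compose[OF this assms(3)]
      show "(\<lambda>(w, y). G (fst w) y (snd w)) \<in> borel_measurable ((Q \<Otimes>\<^sub>M circ) \<Otimes>\<^sub>M M)"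
        by (simp add: split_beta')
    qed
  qed
  finally show ?thesis .
qed

lemma mixed_norm_suminf:
  assumes s: "1 < s" and G [measurable]: "\<And>k::nat. case_prod (G k) \<in> borel_measurable (M \<Otimes>\<^sub>M borel)"
  shows "mixed_norm p s M (\<lambda>y x. \<Sum>k. G k y x) \<le> (\<Sum>k. mixed_norm p s M (G k))"
proof -
  have "(\<lambda>(k, y, x). G k y x) \<in> borel_measurable (count_space UNIV \<Otimes>\<^sub>M M \<Otimes>\<^sub>M borel)"
    by (rule measurable_pair_measure_countable1) (use G in \<open>auto simp: split_beta'\<close>)
  from mixed_norm_Minkowski[OF _ s this] show ?thesis
    by (simp add: nn_integral_count_space_nat sigma_finite_measure_count_space)
qed

lemma mixed_norm_sum:
  assumes s: "1 < s" and I: "finite I" and G [measurable]: "\<And>k. k \<in> I \<Longrightarrow> case_prod (G k) \<in> borel_measurable (M \<Otimes>\<^sub>M borel)"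
  shows "mixed_norm p s M (\<lambda>y x. \<Sum>k\<in>I. G k y x) \<le> (\<Sum>k\<in>I. mixed_norm p s M (G k))"
proof -
  have "(\<lambda>(k, y, x). G k y x) \<in> borel_measurable (count_space I \<Otimes>\<^sub>M M \<Otimes>\<^sub>M borel)"
    by (rule measurable_pair_measure_countable1) (use G I in \<open>auto simp: split_beta' countable_finite\<close>)
  from mixed_norm_Minkowski[OF _ s this] show ?thesis
    using I by (simp add: nn_integral_count_space_finite sigma_finite_measure_count_space_finite)
qed

lemma mixed_norm_add:
  assumes s: "1 < s" and [measurable]: "case_prod G \<in> borel_measurable (M \<Otimes>\<^sub>M borel)" "case_prod H \<in> borel_measurable (M \<Otimes>\<^sub>M borel)"
  shows "mixed_norm p s M (\<lambda>y x. G y x + H y x) \<le> mixed_norm p s M G + mixed_norm p s M H"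
proof -
  have "mixed_norm p s M (\<lambda>y x. \<Sum>b\<in>(UNIV :: bool set). if b then G y x else H y x)
      \<le> (\<Sum>b\<in>(UNIV :: bool set). mixed_norm p s M (\<lambda>y x. if b then G y x else H y x))"
    by (rule mixed_norm_sum[OF s]) auto
  then show ?thesis by (simp add: UNIV_bool add.commute)
qed

lemma mixed_norm_cmult:
  assumes s: "0 < s" and [measurable]: "case_prod G \<in> borel_measurable (M \<Otimes>\<^sub>M borel)"
  shows "mixed_norm p s M (\<lambda>y x. c * G y x) = c * mixed_norm p s M G"
proof -
  have "Lnorm p M (\<lambda>y. c * G y x) = c * Lnorm p M (\<lambda>y. G y x)" for x
    using p by (intro Lnorm_cmult) auto
  then show ?thesis
    unfolding mixed_norm_def using s by (simp add: Lnorm_cmult)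
qed

lemma periodic_inner_norm: "(\<And>y. periodic (G y)) \<Longrightarrow> periodic (\<lambda>x. Lnorm p M (\<lambda>y. G y x))"
  by (simp add: periodic_def)

lemma mixed_norm_shift:
  assumes s: "0 < s" and [measurable]: "case_prod G \<in> borel_measurable (M \<Otimes>\<^sub>M borel)" and per: "\<And>y. periodic (G y)"
  shows "mixed_norm p s M (\<lambda>y x. G y (x - t)) = mixed_norm p s M G"
proof -
  define n where "n = (\<lambda>x. ennpowr (Lnorm p M (\<lambda>y. G y x)) s)"
  have "periodic n" using per by (simp add: periodic_def n_def)
  then have "(\<integral>\<^sup>+x. n (x - t) \<partial>circ) = (\<integral>\<^sup>+x. n x \<partial>circ)"
    by (intro nn_integral_circ_shift) (auto simp: n_def)
  then show ?thesis
    by (simp add: mixed_norm_def Lnorm_def[of s] n_def)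
qed

lemma mixed_norm_abs_shift_series:
  assumes s: "1 < s" and [measurable]: "case_prod G \<in> borel_measurable (M \<Otimes>\<^sub>M borel)" and per: "\<And>y. periodic (G y)"
    and c: "summable (\<lambda>n. \<bar>c n\<bar>)"
  shows "mixed_norm p s M (\<lambda>y. abs_shift_series c h (G y)) \<le> ennreal (\<Sum>n. \<bar>c n\<bar>) * mixed_norm p s M G"
proof -
  have "mixed_norm p s M (\<lambda>y. abs_shift_series c h (G y)) \<le> (\<Sum>\<nu>. mixed_norm p s M (\<lambda>y x. ennreal \<bar>c \<nu>\<bar> * G y (x - real \<nu> * h)))"
    unfolding abs_shift_series_def by (rule mixed_norm_suminf[OF s]) measurable
  also have "\<dots> = (\<Sum>\<nu>. ennreal \<bar>c \<nu>\<bar> * mixed_norm p s M G)"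
    using s by (simp add: mixed_norm_cmult mixed_norm_shift per)
  also have "\<dots> = ennreal (\<Sum>n. \<bar>c n\<bar>) * mixed_norm p s M G"
    by (simp add: ennreal_suminf_multc suminf_ennreal_finite c)
  finally show ?thesis .
qed

lemma mixed_norm_abs_average:
  assumes s: "1 < s" and [measurable]: "case_prod G \<in> borel_measurable (M \<Otimes>\<^sub>M borel)" and per: "\<And>y. periodic (G y)"
  shows "mixed_norm p s M (\<lambda>y. abs_average t (G y)) \<le> mixed_norm p s M G"
proof -
  have "mixed_norm p s M (\<lambda>y. abs_average t (G y)) \<le> (\<integral>\<^sup>+u. mixed_norm p s M (\<lambda>y x. G y (x - t * u)) \<partial>unit_itv)"
    unfolding abs_average_def by (rule mixed_norm_Minkowski[OF sigma_finite_unit_itv s]) measurable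
  also have "\<dots> = mixed_norm p s M G"
    using s by (simp add: mixed_norm_shift per emeasure_unit_itv)
  finally show ?thesis .
qed

lemma mixed_norm_abs_smooth:
  assumes s: "1 < s" and [measurable]: "case_prod G \<in> borel_measurable (M \<Otimes>\<^sub>M borel)" and per: "\<And>y. periodic (G y)"
  shows "mixed_norm p s M (\<lambda>y. abs_smooth m t (G y)) \<le> ennreal (smooth_mass m) * mixed_norm p s M G"
proof -
  have "mixed_norm p s M (\<lambda>y. abs_smooth m t (G y))
      \<le> (\<Sum>j\<in>{1..m}. mixed_norm p s M (\<lambda>y x. ennreal \<bar>bincoeff (real m) j\<bar> * abs_average (real j * t) (G y) x))"
    unfolding abs_smooth_def by (rule mixed_norm_sum[OF s]) auto
  also have "\<dots> \<le> (\<Sum>j\<in>{1..m}. ennreal \<bar>bincoeff (real m) j\<bar> * mixed_norm p s M G)"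
    using s by (intro sum_mono) (auto simp: mixed_norm_cmult intro!: mult_left_mono mixed_norm_abs_average per)
  also have "\<dots> = ennreal (smooth_mass m) * mixed_norm p s M G"
    by (simp add: smooth_mass_def sum_distrib_right[symmetric])
  finally show ?thesis .
qed

lemma inner_norm_abs_average:
  assumes [measurable]: "case_prod G \<in> borel_measurable (M \<Otimes>\<^sub>M borel)"
  shows "Lnorm p M (\<lambda>y. abs_average t (G y) x) \<le> abs_average t (\<lambda>x. Lnorm p M (\<lambda>y. G y x)) x"
  unfolding abs_average_def by (rule Minkowski_integral[OF sigma_finite_unit_itv M p]) measurable

lemma inner_norm_sum:
  assumes "finite I" and [measurable]: "\<And>k. k \<in> I \<Longrightarrow> f k \<in> borel_measurable M"
  shows "Lnorm p M (\<lambda>y. \<Sum>k\<in>I. f k y) \<le> (\<Sum>k\<in>I. Lnorm p M (f k))"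
proof -
  have m: "case_prod f \<in> borel_measurable (count_space I \<Otimes>\<^sub>M M)"
    by (rule measurable_pair_measure_countable1) (use assms in \<open>auto simp: countable_finite\<close>)
  have "Lnorm p M (\<lambda>y. \<integral>\<^sup>+k. f k y \<partial>count_space I) \<le> (\<integral>\<^sup>+k. Lnorm p M (f k) \<partial>count_space I)"
    by (rule Minkowski_integral[OF sigma_finite_measure_count_space_finite[OF assms(1)] M p m])
  then show ?thesis using assms(1) by (simp add: nn_integral_count_space_finite)
qed

lemma inner_norm_suminf:
  assumes [measurable]: "\<And>k::nat. f k \<in> borel_measurable M"
  shows "Lnorm p M (\<lambda>y. \<Sum>k. f k y) \<le> (\<Sum>k. Lnorm p M (f k))"
proof -
  have m: "case_prod f \<in> borel_measurable (count_space UNIV \<Otimes>\<^sub>M M)"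
    by (rule measurable_pair_measure_countable1) (use assms in auto)
  have "Lnorm p M (\<lambda>y. \<integral>\<^sup>+k. f k y \<partial>count_space UNIV) \<le> (\<integral>\<^sup>+k. Lnorm p M (f k) \<partial>count_space UNIV)"
    by (rule Minkowski_integral[OF sigma_finite_measure_count_space M p m])
  then show ?thesis by (simp add: nn_integral_count_space_nat)
qed

lemma inner_norm_abs_smooth:
  assumes [measurable]: "case_prod G \<in> borel_measurable (M \<Otimes>\<^sub>M borel)"
  shows "Lnorm p M (\<lambda>y. abs_smooth m t (G y) x) \<le> abs_smooth m t (\<lambda>x. Lnorm p M (\<lambda>y. G y x)) x"
proof -
  have "Lnorm p M (\<lambda>y. abs_smooth m t (G y) x)
      \<le> (\<Sum>j\<in>{1..m}. Lnorm p M (\<lambda>y. ennreal \<bar>bincoeff (real m) j\<bar> * abs_average (real j * t) (G y) x))"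
    unfolding abs_smooth_def by (rule inner_norm_sum) auto
  also have "\<dots> = (\<Sum>j\<in>{1..m}. ennreal \<bar>bincoeff (real m) j\<bar> * Lnorm p M (\<lambda>y. abs_average (real j * t) (G y) x))"
    using p by (intro sum.cong refl Lnorm_cmult) auto
  also have "\<dots> \<le> abs_smooth m t (\<lambda>x. Lnorm p M (\<lambda>y. G y x)) x"
    unfolding abs_smooth_def by (intro sum_mono mult_left_mono inner_norm_abs_average) auto
  finally show ?thesis .
qed

lemma inner_norm_riesz:
  assumes [measurable]: "case_prod G \<in> borel_measurable (M \<Otimes>\<^sub>M borel)"
  shows "Lnorm p M (\<lambda>y. riesz \<theta> (G y) x) \<le> riesz \<theta> (\<lambda>x. Lnorm p M (\<lambda>y. G y x)) x"
proof -
  have "Lnorm p M (\<lambda>y. riesz \<theta> (G y) x) \<le> (\<integral>\<^sup>+u. Lnorm p M (\<lambda>y. ennreal (u powr (\<theta> - 1)) * G y (x - u)) \<partial>circ)"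
    unfolding riesz_def by (rule Minkowski_integral[OF sigma_finite_circ M p]) measurable
  also have "\<dots> = riesz \<theta> (\<lambda>x. Lnorm p M (\<lambda>y. G y x)) x"
    unfolding riesz_def using p by (intro nn_integral_cong Lnorm_cmult) auto
  finally show ?thesis .
qed

lemma mixed_norm_p_eq:
  assumes [measurable]: "case_prod G \<in> borel_measurable (M \<Otimes>\<^sub>M borel)"
  shows "ennpowr (mixed_norm p p M G) p = (\<integral>\<^sup>+y. \<integral>\<^sup>+x. ennpowr (G y x) p \<partial>circ \<partial>M)"
proof -
  have "ennpowr (mixed_norm p p M G) p = (\<integral>\<^sup>+x. \<integral>\<^sup>+y. ennpowr (G y x) p \<partial>M \<partial>circ)"
    unfolding mixed_norm_def using p by (simp add: Lnorm_powr)
  also have "\<dots> = (\<integral>\<^sup>+y. \<integral>\<^sup>+x. ennpowr (G y x) p \<partial>circ \<partial>M)"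
    by (rule Mc.Fubini') measurable
  finally show ?thesis .
qed

text \<open>With both exponents equal the order of integration is free, so almost every section is
  in L_p; as the circle has finite measure, z \<le> 1 + z^p then gives L_1.\<close>

lemma AE_section_finite:
  assumes [measurable]: "case_prod G \<in> borel_measurable (M \<Otimes>\<^sub>M borel)" and "mixed_norm p p M G < top"
  shows "AE y in M. (\<integral>\<^sup>+x. G y x \<partial>circ) < top"
proof -
  have "(\<integral>\<^sup>+y. \<integral>\<^sup>+x. ennpowr (G y x) p \<partial>circ \<partial>M) < top"
    using mixed_norm_p_eq[OF assms(1)] assms(2) by (metis ennpowr_less_top_iff)
  then have "AE y in M. (\<integral>\<^sup>+x. ennpowr (G y x) p \<partial>circ) \<noteq> \<infinity>"
    by (intro nn_integral_PInf_AE) auto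
  then show ?thesis
    using AE_space
  proof eventually_elim
    case (elim y)
    note [measurable] = elim(2)
    have "z \<le> 1 + ennpowr z p" for z :: ennreal
    proof (cases "z \<le> 1")
      case True
      then show ?thesis by (rule order_trans) simp
    next
      case False
      then have "ennpowr z 1 \<le> ennpowr z p"
      proof (cases z)
        case (real r)
        then have "r powr 1 \<le> r powr p" using False p by (intro powr_mono) auto
        then show ?thesis using real by (simp add: ennreal_leI)
      qed simp
      then show ?thesis by (simp add: add_increasing)
    qed
    then have "(\<integral>\<^sup>+x. G y x \<partial>circ) \<le> (\<integral>\<^sup>+x. 1 + ennpowr (G y x) p \<partial>circ)"
      by (intro nn_integral_mono)
    also have "\<dots> = emeasure circ UNIV + (\<integral>\<^sup>+x. ennpowr (G y x) p \<partial>circ)"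
      by (subst nn_integral_add) auto
    also have "\<dots> < top" using elim(1) by (simp add: emeasure_circ less_top)
    finally show ?case .
  qed
qed

end

subsection \<open>The inequality in one variable for functions with values in \<open>L\<^sub>p\<close>\<close>

definition abs_diff :: "real \<Rightarrow> real \<Rightarrow> ('b \<Rightarrow> real \<Rightarrow> complex) \<Rightarrow> 'b \<Rightarrow> real \<Rightarrow> ennreal" where
  "abs_diff a u F y x = ennreal (norm (shift_series (bincoeff a) u (F y) x))"

definition admissible :: "real \<Rightarrow> 'b measure \<Rightarrow> ('b \<Rightarrow> real \<Rightarrow> complex) \<Rightarrow> bool" where
  "admissible p M F \<longleftrightarrow> case_prod F \<in> borel_measurable (M \<Otimes>\<^sub>M borel) \<and> (\<forall>y. periodic (F y))
     \<and> mixed_norm p p M (\<lambda>y x. ennreal (norm (F y x))) < top"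

lemma admissibleD:
  assumes "admissible p M F"
  shows "case_prod F \<in> borel_measurable (M \<Otimes>\<^sub>M borel)" "\<And>y. periodic (F y)"
    "mixed_norm p p M (\<lambda>y x. ennreal (norm (F y x))) < top"
  using assms by (auto simp: admissible_def)

lemma periodic_abs_diff: "periodic (F y) \<Longrightarrow> periodic (abs_diff a u F y)"
  using periodic_shift_series[of "F y"] by (auto simp: periodic_def abs_diff_def)

lemma measurable_abs_diff:
  assumes [measurable]: "case_prod F \<in> borel_measurable (M \<Otimes>\<^sub>M borel)"
  shows "case_prod (abs_diff a u F) \<in> borel_measurable (M \<Otimes>\<^sub>M borel)"
  unfolding abs_diff_def[abs_def] by measurable

lemma measurable_abs_diff2:
  assumes [measurable]: "case_prod F \<in> borel_measurable (M \<Otimes>\<^sub>M borel)" "f \<in> borel_measurable Q"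
  shows "(\<lambda>(u, y, x). abs_diff a (f u) F y x) \<in> borel_measurable (Q \<Otimes>\<^sub>M M \<Otimes>\<^sub>M borel)"
  unfolding abs_diff_def[abs_def] by measurable

lemma measurable_mixed_norm:
  assumes M: "sigma_finite_measure M"
    and G: "(\<lambda>(z, y, x). G z y x) \<in> borel_measurable (Q \<Otimes>\<^sub>M M \<Otimes>\<^sub>M borel)"
  shows "(\<lambda>z. mixed_norm p s M (G z)) \<in> borel_measurable Q"
  unfolding mixed_norm_def
proof (rule measurable_Lnorm[OF sigma_finite_circ])
  show "(\<lambda>(z, x). Lnorm p M (\<lambda>y. G z y x)) \<in> borel_measurable (Q \<Otimes>\<^sub>M circ)"
    unfolding split_beta'
  proof (rule measurable_Lnorm[OF M])
    have "(\<lambda>w. (fst (fst w), snd w, snd (fst w))) \<in> measurable ((Q \<Otimes>\<^sub>M circ) \<Otimes>\<^sub>M M) (Q \<Otimes>\<^sub>M M \<Otimes>\<^sub>M borel)"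
      by measurable
    from measurable_compose[OF this G]
    show "(\<lambda>(w, y). G (fst w) y (snd w)) \<in> borel_measurable ((Q \<Otimes>\<^sub>M circ) \<Otimes>\<^sub>M M)"
      by (simp add: split_beta')
  qed
qed

text \<open>Smoothing turns an L_p bound into a sup bound at the cost t^(-1/p). A window of length j
  t \<le> 2 pi j is covered by j periods, so the factor j / (j t) is the same for all j.\<close>

lemma abs_smooth_pointwise_le:
  assumes p: "1 < p" and [measurable]: "n \<in> borel_measurable borel" and per: "periodic n" and t: "0 < t" "t \<le> 2 * pi"
  shows "abs_smooth m t n x \<le> ennreal (smooth_mass m * t powr (- 1 / p)) * Lnorm p circ n"
proof -
  have av: "abs_average (real j * t) n x \<le> ennreal (t powr (- 1 / p)) * Lnorm p circ n" if j: "j \<in> {1..m}" for j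
  proof -
    have "ennpowr (abs_average (real j * t) n x) p \<le> abs_average (real j * t) (\<lambda>x. ennpowr (n x) p) x"
      unfolding abs_average_def
      by (rule ennpowr_nn_integral_le) (use p in \<open>auto simp: emeasure_unit_itv\<close>)
    also have "\<dots> \<le> ennreal (real j / (real j * t)) * (\<integral>\<^sup>+x. ennpowr (n x) p \<partial>circ)"
      using per t j by (intro abs_average_le) (auto simp: periodic_def)
    also have "real j / (real j * t) = 1 / t" using j by simp
    also have "(\<integral>\<^sup>+x. ennpowr (n x) p \<partial>circ) = ennpowr (Lnorm p circ n) p"
      using p by (simp add: Lnorm_powr)
    also have "ennreal (1 / t) * ennpowr (Lnorm p circ n) p = ennpowr (ennreal (t powr (- 1 / p)) * Lnorm p circ n) p"
    proof -
      have "(t powr (- 1 / p)) powr p = t powr (-1)" using p by (simp add: powr_powr)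
      also have "\<dots> = 1 / t" using t by (simp add: powr_minus_divide)
      finally show ?thesis using p by (simp add: ennpowr_mult)
    qed
    finally show ?thesis using p by (simp add: ennpowr_le_iff)
  qed
  have "abs_smooth m t n x \<le> (\<Sum>j\<in>{1..m}. ennreal \<bar>bincoeff (real m) j\<bar> * (ennreal (t powr (- 1 / p)) * Lnorm p circ n))"
    unfolding abs_smooth_def by (intro sum_mono mult_left_mono av) auto
  also have "\<dots> = ennreal (smooth_mass m * t powr (- 1 / p)) * Lnorm p circ n"
    by (simp add: smooth_mass_def sum_distrib_right[symmetric] ennreal_mult sum_nonneg mult.assoc)
  finally show ?thesis .
qed

lemma Lnorm_abs_smooth_le:
  assumes p: "1 < p" and [measurable]: "n \<in> borel_measurable borel" and per: "periodic n"
  shows "Lnorm p circ (abs_smooth m t n) \<le> ennreal (smooth_mass m) * Lnorm p circ n"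
proof -
  have shift: "Lnorm p circ (\<lambda>x. n (x - s)) = Lnorm p circ n" for s
  proof -
    have "(\<integral>\<^sup>+x. ennpowr (n (x - s)) p \<partial>circ) = (\<integral>\<^sup>+x. ennpowr (n x) p \<partial>circ)"
      using per by (intro nn_integral_circ_shift[of "\<lambda>x. ennpowr (n x) p"]) (auto simp: periodic_def)
    then show ?thesis by (simp add: Lnorm_def)
  qed
  have av: "Lnorm p circ (abs_average s n) \<le> Lnorm p circ n" for s
  proof -
    have "Lnorm p circ (abs_average s n) \<le> (\<integral>\<^sup>+u. Lnorm p circ (\<lambda>x. n (x - s * u)) \<partial>unit_itv)"
      unfolding abs_average_def by (rule Minkowski_integral[OF sigma_finite_unit_itv sigma_finite_circ p]) measurable
    then show ?thesis by (simp add: shift emeasure_unit_itv)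
  qed
  have "Lnorm p circ (abs_smooth m t n)
      \<le> (\<Sum>j\<in>{1..m}. Lnorm p circ (\<lambda>x. ennreal \<bar>bincoeff (real m) j\<bar> * abs_average (real j * t) n x))"
    unfolding abs_smooth_def by (rule inner_norm_sum[OF p sigma_finite_circ]) auto
  also have "\<dots> = (\<Sum>j\<in>{1..m}. ennreal \<bar>bincoeff (real m) j\<bar> * Lnorm p circ (abs_average (real j * t) n))"
    using p by (intro sum.cong refl Lnorm_cmult) auto
  also have "\<dots> \<le> (\<Sum>j\<in>{1..m}. ennreal \<bar>bincoeff (real m) j\<bar> * Lnorm p circ n)"
    by (intro sum_mono mult_left_mono av) auto
  also have "\<dots> = ennreal (smooth_mass m) * Lnorm p circ n"
    by (simp add: smooth_mass_def sum_distrib_right[symmetric])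
  finally show ?thesis .
qed

lemma suminf_Suc_le: "(\<Sum>k. f (Suc k)) \<le> (\<Sum>k. f k)" for f :: "nat \<Rightarrow> ennreal"
proof (rule suminf_le_const)
  fix n
  have "(\<Sum>k<n. f (Suc k)) \<le> (\<Sum>k<Suc n. f k)"
    by (simp only: sum.lessThan_Suc_shift) simp
  also have "\<dots> \<le> (\<Sum>k. f k)" by (rule sum_le_suminf) auto
  finally show "(\<Sum>k<n. f (Suc k)) \<le> (\<Sum>k. f k)" .
qed auto

context
  fixes p q \<theta> \<alpha> :: real and m :: nat and M :: "'b measure"
  assumes p: "1 < p" and pq: "p < q" and \<theta>: "\<theta> = 1 / p - 1 / q" and \<alpha>: "0 < \<alpha>" and m: "\<alpha> + \<theta> < real m"
    and M: "sigma_finite_measure M"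
begin

lemma AE_periodic_L1:
  assumes "admissible p M F"
  shows "AE y in M. periodic_L1 (F y)"
proof -
  note [measurable] = admissibleD(1)[OF assms]
  have "AE y in M. (\<integral>\<^sup>+x. ennreal (norm (F y x)) \<partial>circ) < top"
    by (rule AE_section_finite[OF p M _ admissibleD(3)[OF assms]]) measurable
  then show ?thesis
    using AE_space
  proof eventually_elim
    case (elim y)
    have "F y \<in> borel_measurable borel"
      using measurable_Pair2[OF admissibleD(1)[OF assms] elim(2)] by simp
    then show ?case using elim admissibleD(2)[OF assms] by (auto simp: periodic_L1_def)
  qed
qed

definition diff_power :: "('b \<Rightarrow> real \<Rightarrow> complex) \<Rightarrow> real \<Rightarrow> ennreal" where
  "diff_power F u = ennpowr (mixed_norm p p M (abs_diff (\<alpha> + \<theta>) u F)) q"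

lemma measurable_diff_power [measurable]:
  assumes F: "admissible p M F" and [measurable]: "f \<in> borel_measurable Q"
  shows "(\<lambda>u. diff_power F (f u)) \<in> borel_measurable Q"
proof -
  note [measurable] = measurable_mixed_norm[OF M measurable_abs_diff2[OF admissibleD(1)[OF F] assms(2)]]
  show ?thesis unfolding diff_power_def by measurable
qed

text \<open>The kernel of the fractional integral is positive, so Minkowski's inequality moves the
  inner norm inside it. What remains is the scalar inequality for the inner norm as a function of
  x.\<close>

lemma low_frequency_norm:
  "\<exists>C>0. \<forall>F h. admissible p M F \<longrightarrow> 0 < h \<longrightarrow>
     ennpowr (mixed_norm p q M (\<lambda>y x. ennreal (norm (average h (shift_series (bincoeff \<alpha>) h (F y)) x)))) q
     \<le> ennreal C * (ennreal (h powr (- \<theta> * q)) * diff_power F h)"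
proof -
  note th = theta_bounds[OF p pq \<theta>]
  obtain C where C: "C > 0" and HLS: "\<And>n. n \<in> borel_measurable borel \<Longrightarrow> periodic n \<Longrightarrow>
     (\<integral>\<^sup>+x. ennpowr (riesz \<theta> n x) q \<partial>circ) \<le> ennreal C * ennpowr (Lnorm p circ n) q"
    using Hardy_Littlewood_Sobolev[OF p pq \<theta>] by blast
  define C' where "C' = (1 + 1 / \<theta>) powr q * C"
  have "1 + 1 / \<theta> > 0" using th by (simp add: add_pos_pos)
  then have C': "C' > 0" using C by (simp add: C'_def)
  have "ennpowr (mixed_norm p q M (\<lambda>y x. ennreal (norm (average h (shift_series (bincoeff \<alpha>) h (F y)) x)))) q
     \<le> ennreal C' * (ennreal (h powr (- \<theta> * q)) * diff_power F h)"
    if F: "admissible p M F" and h: "0 < h" for F h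
  proof -
    note [measurable] = admissibleD(1)[OF F] measurable_abs_diff[OF admissibleD(1)[OF F]]
    define c where "c = h powr (-\<theta>) * (1 + 1 / \<theta>)"
    have c: "c > 0" using h th by (simp add: c_def add_pos_pos)
    let ?D = "abs_diff (\<alpha> + \<theta>) h F"
    have "AE x in circ. AE y in M. ennreal (norm (average h (shift_series (bincoeff \<alpha>) h (F y)) x))
        \<le> ennreal c * riesz \<theta> (?D y) x"
    proof (rule AE_swap_le[OF p M])
      show "AE y in M. AE x in circ. ennreal (norm (average h (shift_series (bincoeff \<alpha>) h (F y)) x))
          \<le> ennreal c * riesz \<theta> (?D y) x"
        using AE_periodic_L1[OF F]
        by eventually_elim (use low_frequency[OF _ h th(1,2) \<alpha>] in \<open>simp add: c_def abs_diff_def[abs_def]\<close>)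
    qed measurable
    then have "mixed_norm p q M (\<lambda>y x. ennreal (norm (average h (shift_series (bincoeff \<alpha>) h (F y)) x)))
        \<le> mixed_norm p q M (\<lambda>y x. ennreal c * riesz \<theta> (?D y) x)"
      using p pq by (intro mixed_norm_mono_AE[OF p M]) auto
    also have "\<dots> = ennreal c * mixed_norm p q M (\<lambda>y x. riesz \<theta> (?D y) x)"
      using p pq by (intro mixed_norm_cmult[OF p M]) auto
    finally have "ennpowr (mixed_norm p q M (\<lambda>y x. ennreal (norm (average h (shift_series (bincoeff \<alpha>) h (F y)) x)))) q
        \<le> ennpowr (ennreal c * mixed_norm p q M (\<lambda>y x. riesz \<theta> (?D y) x)) q"
      using p pq by (intro ennpowr_mono) auto
    also have "\<dots> = ennreal (c powr q) * ennpowr (mixed_norm p q M (\<lambda>y x. riesz \<theta> (?D y) x)) q"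
      using p pq c by (simp add: ennpowr_mult)
    also have "ennpowr (mixed_norm p q M (\<lambda>y x. riesz \<theta> (?D y) x)) q
        = (\<integral>\<^sup>+x. ennpowr (Lnorm p M (\<lambda>y. riesz \<theta> (?D y) x)) q \<partial>circ)"
      unfolding mixed_norm_def using p pq by (intro Lnorm_powr) auto
    also have "\<dots> \<le> (\<integral>\<^sup>+x. ennpowr (riesz \<theta> (\<lambda>x. Lnorm p M (\<lambda>y. ?D y x)) x) q \<partial>circ)"
      using p pq by (intro nn_integral_mono ennpowr_mono inner_norm_riesz[OF p M]) auto
    also have "\<dots> \<le> ennreal C * ennpowr (Lnorm p circ (\<lambda>x. Lnorm p M (\<lambda>y. ?D y x))) q"
      by (intro HLS measurable_inner_norm[OF p M] periodic_inner_norm[OF p M] periodic_abs_diff admissibleD[OF F]) measurable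
    also have "\<dots> = ennreal C * diff_power F h"
      by (simp add: diff_power_def mixed_norm_def)
    also have "ennreal (c powr q) * (ennreal C * diff_power F h) = ennreal C' * (ennreal (h powr (- \<theta> * q)) * diff_power F h)"
    proof -
      have "c powr q * C = C' * h powr (- \<theta> * q)"
        using h th by (simp add: c_def C'_def powr_mult powr_powr)
      then show ?thesis
        using C C' by (simp add: mult.assoc[symmetric] ennreal_mult[symmetric])
    qed
    finally show ?thesis by (simp add: mult_left_mono)
  qed
  with C' show ?thesis by blast
qed

text \<open>Since m > \<alpha> + \<theta>, the integer difference factors as (1 - S)^(m - \<alpha> -
  \<theta>) (1 - S)^(\<alpha> + \<theta>), and the first factor is bounded. Jensen's inequality then
  moves the power q inside the average over the steps.\<close>

lemma osc_norm:
  "\<exists>K>0. \<forall>F s. admissible p M F \<longrightarrow>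
     ennpowr (mixed_norm p p M (\<lambda>y. osc m s (F y))) q \<le> ennreal K * (\<integral>\<^sup>+u. diff_power F (s * u) \<partial>unit_itv)"
proof -
  note th = theta_bounds[OF p pq \<theta>]
  define e where "e = bincoeff (real m - (\<alpha> + \<theta>))"
  have e: "summable (\<lambda>n. \<bar>e n\<bar>)" unfolding e_def using m by (intro summable_bincoeff) simp
  define E where "E = (\<Sum>n. \<bar>e n\<bar>)"
  have "\<bar>e 0\<bar> \<le> E" unfolding E_def using e sum_le_suminf[OF e, of "{0}"] by simp
  then have E: "E > 0" by (simp add: e_def)
  have "ennpowr (mixed_norm p p M (\<lambda>y. osc m s (F y))) q \<le> ennreal (E powr q) * (\<integral>\<^sup>+u. diff_power F (s * u) \<partial>unit_itv)"
    if F: "admissible p M F" for F s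
  proof -
    note [measurable] = admissibleD(1)[OF F] measurable_abs_diff[OF admissibleD(1)[OF F]]
    have split: "mixed_norm p p M (abs_diff (real m) t F) \<le> ennreal E * mixed_norm p p M (abs_diff (\<alpha> + \<theta>) t F)" for t
    proof -
      have "AE x in circ. AE y in M. abs_diff (real m) t F y x \<le> abs_shift_series e t (abs_diff (\<alpha> + \<theta>) t F y) x"
      proof (rule AE_swap_le[OF p M])
        show "AE y in M. AE x in circ. abs_diff (real m) t F y x \<le> abs_shift_series e t (abs_diff (\<alpha> + \<theta>) t F y) x"
          using AE_periodic_L1[OF F]
        proof eventually_elim
          case (elim y)
          have "0 < real m - (\<alpha> + \<theta>)" "0 < \<alpha> + \<theta>" using m \<alpha> th by auto
          from norm_shift_series_bincoeff_split[OF elim this, of t] show ?case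
            by (simp add: abs_diff_def[abs_def] e_def)
        qed
      qed measurable
      then have "mixed_norm p p M (abs_diff (real m) t F) \<le> mixed_norm p p M (\<lambda>y. abs_shift_series e t (abs_diff (\<alpha> + \<theta>) t F y))"
        using p by (intro mixed_norm_mono_AE[OF p M]) auto
      also have "\<dots> \<le> ennreal E * mixed_norm p p M (abs_diff (\<alpha> + \<theta>) t F)"
        unfolding E_def by (intro mixed_norm_abs_shift_series[OF p M p] periodic_abs_diff admissibleD[OF F] e) measurable
      finally show ?thesis .
    qed
    have "mixed_norm p p M (\<lambda>y. osc m s (F y)) \<le> (\<integral>\<^sup>+u. mixed_norm p p M (abs_diff (real m) (s * u) F) \<partial>unit_itv)"
    proof -
      have "(\<lambda>(u, y, x). abs_diff (real m) (s * u) F y x) \<in> borel_measurable (unit_itv \<Otimes>\<^sub>M M \<Otimes>\<^sub>M borel)"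
        by (rule measurable_abs_diff2) measurable
      from mixed_norm_Minkowski[OF p M sigma_finite_unit_itv p this]
      show ?thesis by (simp add: osc_def[abs_def] abs_diff_def[abs_def])
    qed
    also have "\<dots> \<le> (\<integral>\<^sup>+u. ennreal E * mixed_norm p p M (abs_diff (\<alpha> + \<theta>) (s * u) F) \<partial>unit_itv)"
      by (intro nn_integral_mono split)
    finally have "ennpowr (mixed_norm p p M (\<lambda>y. osc m s (F y))) q
        \<le> ennpowr (\<integral>\<^sup>+u. ennreal E * mixed_norm p p M (abs_diff (\<alpha> + \<theta>) (s * u) F) \<partial>unit_itv) q"
      using p pq by (intro ennpowr_mono) auto
    also have "\<dots> \<le> (\<integral>\<^sup>+u. ennpowr (ennreal E * mixed_norm p p M (abs_diff (\<alpha> + \<theta>) (s * u) F)) q \<partial>unit_itv)"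
    proof (rule ennpowr_nn_integral_le)
      have "(\<lambda>u. mixed_norm p p M (abs_diff (\<alpha> + \<theta>) (s * u) F)) \<in> borel_measurable unit_itv"
        by (rule measurable_mixed_norm[OF M], rule measurable_abs_diff2) measurable
      then show "(\<lambda>u. ennreal E * mixed_norm p p M (abs_diff (\<alpha> + \<theta>) (s * u) F)) \<in> borel_measurable unit_itv"
        by measurable
    qed (use p pq in \<open>auto simp: emeasure_unit_itv\<close>)
    also have "\<dots> = (\<integral>\<^sup>+u. ennreal (E powr q) * diff_power F (s * u) \<partial>unit_itv)"
      using p pq E by (simp add: ennpowr_mult diff_power_def)
    also have "\<dots> = ennreal (E powr q) * (\<integral>\<^sup>+u. diff_power F (s * u) \<partial>unit_itv)"
      by (intro nn_integral_cmult measurable_diff_power F) measurable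
    finally show ?thesis .
  qed
  then show ?thesis using E by (intro exI[of _ "E powr q"]) auto
qed

definition smoothness_sum :: "('b \<Rightarrow> real \<Rightarrow> complex) \<Rightarrow> real \<Rightarrow> ennreal" where
  "smoothness_sum F h = (\<Sum>k. ennreal ((h / 2 ^ k) powr (- \<theta> * q)) * (\<integral>\<^sup>+u. diff_power F (h / 2 ^ k * u) \<partial>unit_itv))"

text \<open>The inner norm of each dyadic piece is bounded first, which leaves scalar functions
  \<open>b k\<close> on the circle. Smoothing gives them both the sup bound and the L_p bound
  required for the summation in L_q, with E_k a multiple of the norm of the oscillations at the
  scales k and k + 1.\<close>

lemma high_frequency_norm:
  "\<exists>C>0. \<forall>F h. admissible p M F \<longrightarrow> 0 < h \<longrightarrow> h \<le> 2 * pi \<longrightarrow>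
     ennpowr (mixed_norm p q M (\<lambda>y x. ennreal (norm (F y x - smooth m h (smooth m h (F y)) x)))) q
     \<le> ennreal C * smoothness_sum F h"
proof -
  note th = theta_bounds[OF p pq \<theta>]
  have q: "1 < q" "0 < q" using p pq by auto
  obtain K where K: "K > 0" and osc: "\<And>F s. admissible p M F \<Longrightarrow>
     ennpowr (mixed_norm p p M (\<lambda>y. osc m s (F y))) q \<le> ennreal K * (\<integral>\<^sup>+u. diff_power F (s * u) \<partial>unit_itv)"
    using osc_norm by blast
  obtain C where C: "C > 0" and dyadic: "\<forall>(N :: real measure) b E s. (\<forall>k. b k \<in> borel_measurable N) \<longrightarrow> (\<forall>k. 0 \<le> E k) \<longrightarrow> 0 < s \<longrightarrow>
     (\<forall>k x. ennpowr (b k x) p \<le> ennreal (E k powr p / (s / 2 ^ k))) \<longrightarrow>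
     (\<forall>k. (\<integral>\<^sup>+x. ennpowr (b k x) p \<partial>N) \<le> ennreal (E k powr p)) \<longrightarrow>
     (\<integral>\<^sup>+x. ennpowr (\<Sum>k. b k x) q \<partial>N)
       \<le> ennreal C * (\<Sum>k. ennreal ((s / 2 ^ k) powr (- \<theta> * q) * E k powr q))"
    using dyadic_sum_Lq[OF p pq \<theta>] by (elim exE conjE)
  \<comment> \<open>The factor 3: at the finer scale \<open>s (Suc k)\<close> the sup bound is
    larger by 2^(1/p) \<le> 2, and the coarser scale adds 1.\<close>
  define B where "B = 3 * smooth_mass m"
  have B: "0 \<le> B" using smooth_mass_nonneg by (simp add: B_def)
  define C' where "C' = C * (B powr q * (2 powr q * K) * 2) + 1"
  have C': "C' > 0" using C K B by (simp add: C'_def add_nonneg_pos)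
  have "ennpowr (mixed_norm p q M (\<lambda>y x. ennreal (norm (F y x - smooth m h (smooth m h (F y)) x)))) q
     \<le> ennreal C' * smoothness_sum F h"
    if F: "admissible p M F" and h: "0 < h" "h \<le> 2 * pi" for F h
  proof (cases "smoothness_sum F h")
    case top
    then show ?thesis using C' by (simp add: ennreal_mult_top)
  next
    case (real \<rho>)
    note [measurable] = admissibleD(1)[OF F]
    note per = admissibleD(2)[OF F]
    define s where "s = (\<lambda>k::nat. h / 2 ^ k)"
    have s: "0 < s k" "s k \<le> 2 * pi" for k
    proof -
      show "0 < s k" using h by (simp add: s_def)
      have "h / 2 ^ k \<le> h / 1" using h by (intro divide_left_mono) auto
      then show "s k \<le> 2 * pi" using h by (simp add: s_def)
    qed
    have sSuc: "s (Suc k) = s k / 2" for k by (simp add: s_def)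
    define P where "P = (\<lambda>k. \<integral>\<^sup>+u. diff_power F (s k * u) \<partial>unit_itv)"
    define d where "d = (\<lambda>k y. osc m (s k) (F y))"
    have d [measurable]: "case_prod (d k) \<in> borel_measurable (M \<Otimes>\<^sub>M borel)" for k
      unfolding d_def by measurable
    have dper: "periodic (d k y)" for k y unfolding d_def by (intro periodic_osc per)
    define \<nu> where "\<nu> = (\<lambda>k. mixed_norm p p M (d k))"
    have \<nu>: "ennpowr (\<nu> k) q \<le> ennreal K * P k" for k
      unfolding \<nu>_def d_def P_def by (rule osc[OF F])
    have sumR: "(\<Sum>k. ennreal (s k powr (- \<theta> * q)) * P k) = ennreal \<rho>"
      using real by (simp add: smoothness_sum_def s_def P_def)
    \<comment> \<open>A finite right side bounds each of its terms, so the oscillations decay like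
      (h / 2^k)^\<theta>. Their sum is then finite, as the telescoping series requires on almost
      every section.\<close>
    have \<nu>_decay: "\<nu> k \<le> ennreal ((K * \<rho>) powr (1 / q) * h powr \<theta> * (2 powr (-\<theta>)) ^ k)" for k
    proof -
      have "ennreal (s k powr (- \<theta> * q)) * P k \<le> ennreal \<rho>"
        unfolding sumR[symmetric] using sum_le_suminf[of "\<lambda>k. ennreal (s k powr (- \<theta> * q)) * P k" "{k}"] by simp
      then have "ennreal (s k powr (\<theta> * q)) * (ennreal (s k powr (- \<theta> * q)) * P k) \<le> ennreal (s k powr (\<theta> * q)) * ennreal \<rho>"
        by (rule mult_left_mono) simp
      moreover have "ennreal (s k powr (\<theta> * q)) * (ennreal (s k powr (- \<theta> * q)) * P k) = P k"
        using s[of k] by (simp add: mult.assoc[symmetric] ennreal_mult[symmetric] powr_add[symmetric])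
      ultimately have "P k \<le> ennreal (s k powr (\<theta> * q)) * ennreal \<rho>" by simp
      then have "ennreal K * P k \<le> ennreal K * (ennreal (s k powr (\<theta> * q)) * ennreal \<rho>)"
        by (rule mult_left_mono) simp
      also have "\<dots> = ennreal (K * \<rho> * s k powr (\<theta> * q))"
        using K real by (simp add: ennreal_mult[symmetric] mult_ac)
      finally have "\<nu> k \<le> ennpowr (ennreal (K * \<rho> * s k powr (\<theta> * q))) (1 / q)"
        using \<nu>[of k] q by (subst ennpowr_le_iff[symmetric]) auto
      also have "\<dots> = ennreal ((K * \<rho>) powr (1 / q) * s k powr \<theta>)"
        using K real q by (simp add: powr_mult powr_powr)
      also have "s k powr \<theta> = h powr \<theta> * (2 powr (-\<theta>)) ^ k"
      proof -
        have "s k powr \<theta> = h powr \<theta> / (2 powr real k) powr \<theta>"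
          by (simp add: s_def powr_divide powr_realpow)
        also have "\<dots> = h powr \<theta> * 2 powr (- (real k * \<theta>))"
          by (simp add: powr_powr powr_minus_divide)
        also have "2 powr (- (real k * \<theta>)) = (2 powr (-\<theta>)) powr real k"
          by (simp add: powr_powr mult.commute)
        finally show ?thesis by (simp add: powr_realpow)
      qed
      finally show ?thesis by (simp add: mult.assoc)
    qed
    have \<nu>_fin: "\<nu> k < top" for k using \<nu>_decay[of k] by (rule le_less_trans) simp
    have "(\<Sum>k. \<nu> k) \<le> (\<Sum>k. ennreal ((K * \<rho>) powr (1 / q) * h powr \<theta> * (2 powr (-\<theta>)) ^ k))"
      by (intro suminf_le \<nu>_decay) auto
    also have "\<dots> < top"
    proof -
      have "summable (\<lambda>k. (K * \<rho>) powr (1 / q) * h powr \<theta> * (2 powr (-\<theta>)) ^ k)"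
        using th by (intro summable_mult summable_geometric) (auto simp: powr_less_one)
      then show ?thesis by (subst suminf_ennreal2) auto
    qed
    finally have \<nu>_sum: "(\<Sum>k. \<nu> k) < top" .
    have "mixed_norm p p M (\<lambda>y x. \<Sum>k. d k y x) \<le> (\<Sum>k. \<nu> k)"
      unfolding \<nu>_def by (rule mixed_norm_suminf[OF p M p d])
    then have "mixed_norm p p M (\<lambda>y x. \<Sum>k. d k y x) < top"
      using \<nu>_sum by (rule le_less_trans)
    then have "AE y in M. (\<integral>\<^sup>+x. (\<Sum>k. d k y x) \<partial>circ) < top"
      by (intro AE_section_finite[OF p M]) auto
    then have AEfin: "AE y in M. (\<Sum>k. \<integral>\<^sup>+x. d k y x \<partial>circ) < top"
      using AE_space
    proof eventually_elim
      case (elim y)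
      note [measurable] = elim(2)
      have "(\<Sum>k. \<integral>\<^sup>+x. d k y x \<partial>circ) = (\<integral>\<^sup>+x. (\<Sum>k. d k y x) \<partial>circ)"
        by (rule nn_integral_suminf[symmetric]) measurable
      then show ?case using elim by simp
    qed
    define pc where "pc = (\<lambda>k y x. dyadic_piece m h (\<lambda>k. d k y) k x)"
    have pc [measurable]: "case_prod (pc k) \<in> borel_measurable (M \<Otimes>\<^sub>M borel)" for k
      unfolding pc_def by measurable
    have "AE x in circ. AE y in M. ennreal (norm (F y x - smooth m h (smooth m h (F y)) x)) \<le> (\<Sum>k. pc k y x)"
    proof (rule AE_swap_le[OF p M])
      show "AE y in M. AE x in circ. ennreal (norm (F y x - smooth m h (smooth m h (F y)) x)) \<le> (\<Sum>k. pc k y x)"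
        using AE_periodic_L1[OF F] AEfin
      proof eventually_elim
        case (elim y)
        from norm_diff_smooth_smooth_le[OF elim(1) h(1), of m] elim(2)
        show ?case by (simp add: pc_def d_def s_def)
      qed
    qed measurable
    then have "mixed_norm p q M (\<lambda>y x. ennreal (norm (F y x - smooth m h (smooth m h (F y)) x)))
        \<le> mixed_norm p q M (\<lambda>y x. \<Sum>k. pc k y x)"
      using q by (intro mixed_norm_mono_AE[OF p M]) auto
    then have "ennpowr (mixed_norm p q M (\<lambda>y x. ennreal (norm (F y x - smooth m h (smooth m h (F y)) x)))) q
        \<le> ennpowr (mixed_norm p q M (\<lambda>y x. \<Sum>k. pc k y x)) q"
      using q by (intro ennpowr_mono) auto
    also have "\<dots> = (\<integral>\<^sup>+x. ennpowr (Lnorm p M (\<lambda>y. \<Sum>k. pc k y x)) q \<partial>circ)"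
      unfolding mixed_norm_def using q by (intro Lnorm_powr) auto
    finally have step1: "ennpowr (mixed_norm p q M (\<lambda>y x. ennreal (norm (F y x - smooth m h (smooth m h (F y)) x)))) q
        \<le> (\<integral>\<^sup>+x. ennpowr (Lnorm p M (\<lambda>y. \<Sum>k. pc k y x)) q \<partial>circ)" .
    define n where "n = (\<lambda>k x. Lnorm p M (\<lambda>y. d k y x + d (Suc k) y x))"
    have n [measurable]: "n k \<in> borel_measurable borel" for k
      unfolding n_def by (rule measurable_inner_norm[OF p M]) measurable
    have nper: "periodic (n k)" for k
      unfolding n_def using dper by (intro periodic_inner_norm[OF p M]) (auto simp: periodic_def)
    define b where "b = (\<lambda>k x. abs_smooth m (s (Suc k)) (n k) x + abs_smooth m (s k) (n k) x)"
    have b [measurable]: "b k \<in> borel_measurable borel" for k unfolding b_def by measurable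
    have pcb: "Lnorm p M (\<lambda>y. pc k y x) \<le> b k x" for k x
    proof -
      have "Lnorm p M (\<lambda>y. pc k y x)
          \<le> Lnorm p M (\<lambda>y. abs_smooth m (s (Suc k)) (\<lambda>x. d k y x + d (Suc k) y x) x)
            + Lnorm p M (\<lambda>y. abs_smooth m (s k) (\<lambda>x. d k y x + d (Suc k) y x) x)"
        unfolding pc_def dyadic_piece_def s_def by (rule Lnorm_add_le[OF M p]) measurable
      also have "\<dots> \<le> b k x"
        unfolding b_def n_def by (intro add_mono inner_norm_abs_smooth[OF p M]) measurable
      finally show ?thesis .
    qed
    have step2: "(\<integral>\<^sup>+x. ennpowr (Lnorm p M (\<lambda>y. \<Sum>k. pc k y x)) q \<partial>circ) \<le> (\<integral>\<^sup>+x. ennpowr (\<Sum>k. b k x) q \<partial>circ)"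
    proof (intro nn_integral_mono ennpowr_mono)
      fix x
      have "Lnorm p M (\<lambda>y. \<Sum>k. pc k y x) \<le> (\<Sum>k. Lnorm p M (\<lambda>y. pc k y x))"
        by (rule inner_norm_suminf[OF p M]) measurable
      also have "\<dots> \<le> (\<Sum>k. b k x)" by (intro suminf_le pcb) auto
      finally show "Lnorm p M (\<lambda>y. \<Sum>k. pc k y x) \<le> (\<Sum>k. b k x)" .
    qed (use q in simp)
    define \<mu> where "\<mu> = (\<lambda>k. Lnorm p circ (n k))"
    have \<mu>_le: "\<mu> k \<le> \<nu> k + \<nu> (Suc k)" for k
      unfolding \<mu>_def n_def \<nu>_def using mixed_norm_add[OF p M p d[of k] d[of "Suc k"]] by (simp add: mixed_norm_def)
    have \<mu>_fin: "\<mu> k < top" for k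
      using \<mu>_le[of k] \<nu>_fin[of k] \<nu>_fin[of "Suc k"] by (simp add: le_less_trans)
    define E where "E = (\<lambda>k. B * enn2real (\<mu> k))"
    have E: "0 \<le> E k" for k using B by (simp add: E_def)
    have E_eq: "ennreal (E k) = ennreal B * \<mu> k" for k
      using B \<mu>_fin[of k] by (simp add: E_def ennreal_mult)
    have bp: "ennpowr (b k x) p \<le> ennreal (E k powr p / s k)" for k x
    proof -
      have "b k x \<le> ennreal (smooth_mass m * s (Suc k) powr (- 1 / p)) * \<mu> k + ennreal (smooth_mass m * s k powr (- 1 / p)) * \<mu> k"
        unfolding b_def \<mu>_def by (intro add_mono abs_smooth_pointwise_le p n nper s)
      also have "\<dots> = ennreal (smooth_mass m * s (Suc k) powr (- 1 / p) + smooth_mass m * s k powr (- 1 / p)) * \<mu> k"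
        using smooth_mass_nonneg[of m] by (simp add: distrib_right)
      also have "\<dots> \<le> ennreal (B * s k powr (- 1 / p)) * \<mu> k"
      proof (intro mult_right_mono ennreal_leI)
        have "s (Suc k) powr (- 1 / p) = 2 powr (1 / p) * s k powr (- 1 / p)"
        proof -
          have "s (Suc k) powr (- 1 / p) = s k powr (- 1 / p) / 2 powr (- (1 / p))"
            by (simp add: sSuc powr_divide)
          then show ?thesis unfolding powr_minus_divide[of 2 "1 / p"] by simp
        qed
        also have "\<dots> \<le> 2 powr 1 * s k powr (- 1 / p)"
          using p by (intro mult_right_mono powr_mono) auto
        finally have "smooth_mass m * s (Suc k) powr (- 1 / p) \<le> smooth_mass m * (2 * s k powr (- 1 / p))"
          using smooth_mass_nonneg[of m] by (intro mult_left_mono) auto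
        then show "smooth_mass m * s (Suc k) powr (- 1 / p) + smooth_mass m * s k powr (- 1 / p) \<le> B * s k powr (- 1 / p)"
          by (simp add: B_def)
      qed simp
      also have "\<dots> = ennreal (s k powr (- 1 / p)) * ennreal (E k)"
        unfolding E_eq using B by (simp add: ennreal_mult mult_ac)
      finally have "ennpowr (b k x) p \<le> ennpowr (ennreal (s k powr (- 1 / p)) * ennreal (E k)) p"
        using p by (intro ennpowr_mono) auto
      also have "\<dots> = ennreal ((s k powr (- 1 / p)) powr p * E k powr p)"
        using p E by (simp add: ennpowr_mult ennreal_mult)
      also have "(s k powr (- 1 / p)) powr p * E k powr p = E k powr p / s k"
      proof -
        have "(s k powr (- 1 / p)) powr p = s k powr (-1)" using p by (simp add: powr_powr)
        also have "\<dots> = 1 / s k" using s[of k] by (simp add: powr_minus_divide)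
        finally show ?thesis by simp
      qed
      finally show ?thesis .
    qed
    have bI: "(\<integral>\<^sup>+x. ennpowr (b k x) p \<partial>circ) \<le> ennreal (E k powr p)" for k
    proof -
      have "Lnorm p circ (b k) \<le> Lnorm p circ (abs_smooth m (s (Suc k)) (n k)) + Lnorm p circ (abs_smooth m (s k) (n k))"
        unfolding b_def by (rule Lnorm_add_le[OF sigma_finite_circ p]) measurable
      also have "\<dots> \<le> ennreal (smooth_mass m) * \<mu> k + ennreal (smooth_mass m) * \<mu> k"
        unfolding \<mu>_def by (intro add_mono Lnorm_abs_smooth_le p n nper)
      also have "\<dots> = ennreal (2 * smooth_mass m) * \<mu> k"
        using smooth_mass_nonneg[of m] by (simp add: distrib_right[symmetric] ennreal_plus[symmetric] del: ennreal_plus)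
      also have "\<dots> \<le> ennreal (E k)"
        unfolding E_eq B_def using smooth_mass_nonneg[of m] by (intro mult_right_mono ennreal_leI) auto
      finally have "ennpowr (Lnorm p circ (b k)) p \<le> ennpowr (ennreal (E k)) p"
        using p by (intro ennpowr_mono) auto
      then show ?thesis using p E by (simp add: Lnorm_powr)
    qed
    have step3: "(\<integral>\<^sup>+x. ennpowr (\<Sum>k. b k x) q \<partial>circ) \<le> ennreal C * (\<Sum>k. ennreal ((h / 2 ^ k) powr (- \<theta> * q) * E k powr q))"
      by (rule dyadic[rule_format, of b circ E h]) (use b E h(1) bp bI in \<open>simp_all add: s_def del: powr_divide\<close>)
    have "(\<Sum>k. ennreal ((h / 2 ^ k) powr (- \<theta> * q) * E k powr q))
        \<le> (\<Sum>k. ennreal (B powr q * (2 powr q * K)) * (ennreal (s k powr (- \<theta> * q)) * P k + ennreal (s (Suc k) powr (- \<theta> * q)) * P (Suc k)))"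
    proof (intro suminf_le)
      fix k
      have "ennpowr (\<mu> k) q \<le> ennpowr (\<nu> k + \<nu> (Suc k)) q"
        using q by (intro ennpowr_mono \<mu>_le) auto
      also have "\<dots> \<le> ennreal (2 powr q) * (ennpowr (\<nu> k) q + ennpowr (\<nu> (Suc k)) q)"
        using q by (intro ennpowr_add_le) auto
      also have "\<dots> \<le> ennreal (2 powr q) * (ennreal K * P k + ennreal K * P (Suc k))"
        by (intro mult_left_mono add_mono \<nu>) auto
      finally have mu: "ennpowr (\<mu> k) q \<le> ennreal (2 powr q) * (ennreal K * P k + ennreal K * P (Suc k))" .
      have "ennreal ((h / 2 ^ k) powr (- \<theta> * q) * E k powr q) = ennreal (s k powr (- \<theta> * q)) * ennpowr (ennreal (E k)) q"
        using E by (simp add: s_def ennreal_mult)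
      also have "\<dots> = ennreal (s k powr (- \<theta> * q)) * (ennreal (B powr q) * ennpowr (\<mu> k) q)"
        unfolding E_eq using q B by (simp add: ennpowr_mult)
      also have "\<dots> \<le> ennreal (s k powr (- \<theta> * q)) * (ennreal (B powr q) * (ennreal (2 powr q) * (ennreal K * P k + ennreal K * P (Suc k))))"
        by (intro mult_left_mono mu) auto
      also have "\<dots> = ennreal (B powr q * (2 powr q * K)) * (ennreal (s k powr (- \<theta> * q)) * P k + ennreal (s k powr (- \<theta> * q)) * P (Suc k))"
        using K by (simp add: ennreal_mult distrib_left mult_ac)
      \<comment> \<open>The exponent -\<theta> q is negative and \<open>s (Suc k)\<close> is below
        \<open>s k\<close>, so the second term may be weighted at its own scale and belongs to the
        same sum, shifted by one.\<close>
      also have "\<dots> \<le> ennreal (B powr q * (2 powr q * K)) * (ennreal (s k powr (- \<theta> * q)) * P k + ennreal (s (Suc k) powr (- \<theta> * q)) * P (Suc k))"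
        using s[of k] s[of "Suc k"] q th
        by (intro mult_left_mono add_mono mult_right_mono ennreal_leI powr_mono2') (auto simp: sSuc)
      finally show "ennreal ((h / 2 ^ k) powr (- \<theta> * q) * E k powr q)
          \<le> ennreal (B powr q * (2 powr q * K)) * (ennreal (s k powr (- \<theta> * q)) * P k + ennreal (s (Suc k) powr (- \<theta> * q)) * P (Suc k))" .
    qed auto
    also have "\<dots> = ennreal (B powr q * (2 powr q * K)) * ((\<Sum>k. ennreal (s k powr (- \<theta> * q)) * P k) + (\<Sum>k. ennreal (s (Suc k) powr (- \<theta> * q)) * P (Suc k)))"
      by (simp add: ennreal_suminf_cmult suminf_add[symmetric])
    also have "\<dots> \<le> ennreal (B powr q * (2 powr q * K)) * (smoothness_sum F h + smoothness_sum F h)"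
      unfolding real sumR[symmetric]
      by (intro mult_left_mono add_mono order_refl suminf_Suc_le[of "\<lambda>k. ennreal (s k powr (- \<theta> * q)) * P k"]) auto
    also have "\<dots> = ennreal (B powr q * (2 powr q * K) * 2) * smoothness_sum F h"
      using K by (simp add: ennreal_mult mult_2[symmetric] mult_ac)
    finally have "ennreal C * (\<Sum>k. ennreal ((h / 2 ^ k) powr (- \<theta> * q) * E k powr q))
        \<le> ennreal C * (ennreal (B powr q * (2 powr q * K) * 2) * smoothness_sum F h)"
      by (rule mult_left_mono) simp
    also have "\<dots> = ennreal (C * (B powr q * (2 powr q * K) * 2)) * smoothness_sum F h"
      using C K by (simp add: ennreal_mult mult.assoc)
    also have "\<dots> \<le> ennreal C' * smoothness_sum F h"
      by (intro mult_right_mono ennreal_leI) (auto simp: C'_def)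
    finally show ?thesis using step1 step2 step3 by simp
  qed
  with C' show ?thesis by blast
qed

end

text \<open>The discrete counterpart of the integral of \<open>w(t) t powr (e - 1)\<close> over \<open>0 < t < h\<close>. It only
  involves steps of size at most \<open>h / 2\<close>.\<close>

definition dyadic_mean :: "real \<Rightarrow> real \<Rightarrow> (real \<Rightarrow> ennreal) \<Rightarrow> ennreal" where
  "dyadic_mean e h w = ennreal ((h / 2) powr e) * w (h / 2)
     + (\<Sum>k. ennreal ((h / 2 / 2 ^ k) powr e) * (\<integral>\<^sup>+u. w (h / 2 / 2 ^ k * u) \<partial>unit_itv))"

lemma dyadic_mean_mono: "(\<And>u. w u \<le> w' u) \<Longrightarrow> dyadic_mean e h w \<le> dyadic_mean e h w'"
  unfolding dyadic_mean_def by (intro add_mono mult_left_mono suminf_le nn_integral_mono) auto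

lemma dyadic_mean_cmult:
  assumes [measurable]: "w \<in> borel_measurable borel"
  shows "dyadic_mean e h (\<lambda>u. c * w u) = c * dyadic_mean e h w"
  unfolding dyadic_mean_def
  by (simp add: nn_integral_cmult distrib_left mult.left_commute[of _ c] ennreal_suminf_cmult)

lemma nn_integral_dyadic_mean:
  assumes "sigma_finite_measure N" and [measurable]: "case_prod w \<in> borel_measurable (N \<Otimes>\<^sub>M borel)"
  shows "(\<integral>\<^sup>+y. dyadic_mean e h (w y) \<partial>N) = dyadic_mean e h (\<lambda>u. \<integral>\<^sup>+y. w y u \<partial>N)"
proof -
  interpret N: sigma_finite_measure N by fact
  interpret u: sigma_finite_measure unit_itv by (rule sigma_finite_unit_itv)
  interpret Nu: pair_sigma_finite N unit_itv ..
  have swap: "(\<integral>\<^sup>+y. \<integral>\<^sup>+u. w y (a * u) \<partial>unit_itv \<partial>N) = (\<integral>\<^sup>+u. \<integral>\<^sup>+y. w y (a * u) \<partial>N \<partial>unit_itv)" for a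
    by (rule Nu.Fubini'[symmetric]) measurable
  define s where "s = (\<lambda>k::nat. h / 2 / 2 ^ k)"
  have s: "h / 2 / 2 ^ k = s k" for k by (simp add: s_def)
  show ?thesis
    unfolding dyadic_mean_def s swap[symmetric]
    by (simp add: nn_integral_add nn_integral_suminf nn_integral_cmult)
qed

text \<open>For use with an increasing modulus, \<open>W k\<close> being made from its value at
  \<open>h / 2 / 2 ^ k\<close>. The separate term at h / 2 is bounded by the summand k = 0, whence
  the factor 2.\<close>

lemma dyadic_mean_le:
  assumes "0 < h" and W: "\<And>k u. 0 \<le> u \<Longrightarrow> u \<le> h / 2 / 2 ^ k \<Longrightarrow> w u \<le> W k"
  shows "dyadic_mean e h w \<le> 2 * (\<Sum>k. ennreal ((h / 2 / 2 ^ k) powr e) * W k)"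
proof -
  have "(\<integral>\<^sup>+u. w (h / 2 / 2 ^ k * u) \<partial>unit_itv) \<le> (\<integral>\<^sup>+u. W k \<partial>unit_itv)" for k
  proof (rule nn_integral_mono_AE)
    have "AE u in unit_itv. u \<in> {0..1}"
      unfolding unit_itv_def by (subst AE_density) (auto simp: indicator_def)
    then show "AE u in unit_itv. w (h / 2 / 2 ^ k * u) \<le> W k"
    proof eventually_elim
      case (elim u)
      have "h / 2 / 2 ^ k * u \<le> h / 2 / 2 ^ k * 1"
        using elim assms(1) by (intro mult_left_mono) auto
      then show ?case using elim assms(1) by (intro W) auto
    qed
  qed
  then have "(\<integral>\<^sup>+u. w (h / 2 / 2 ^ k * u) \<partial>unit_itv) \<le> W k" for k
    by (simp add: emeasure_unit_itv)
  then have 1: "(\<Sum>k. ennreal ((h / 2 / 2 ^ k) powr e) * (\<integral>\<^sup>+u. w (h / 2 / 2 ^ k * u) \<partial>unit_itv))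
      \<le> (\<Sum>k. ennreal ((h / 2 / 2 ^ k) powr e) * W k)"
    by (intro suminf_le mult_left_mono) auto
  have "ennreal ((h / 2) powr e) * w (h / 2) \<le> ennreal ((h / 2 / 2 ^ 0) powr e) * W 0"
    using W[of "h / 2" 0] assms(1) by (auto intro: mult_left_mono)
  also have "\<dots> \<le> (\<Sum>k. ennreal ((h / 2 / 2 ^ k) powr e) * W k)"
    using sum_le_suminf[of "\<lambda>k. ennreal ((h / 2 / 2 ^ k) powr e) * W k" "{0}"] by simp
  finally show ?thesis
    unfolding dyadic_mean_def mult_2 using 1 by (intro add_mono)
qed

text \<open>The open intervals from s_k to 2 s_k with s_k = h / 2^(k + 1) are disjoint, have length
  s_k and lie between 0 and \<delta>.\<close>

lemma nn_integral_dyadic_lower: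
  assumes h: "0 < h" "h \<le> \<delta>" and c: "\<And>k t. h / 2 / 2 ^ k < t \<Longrightarrow> t < 2 * (h / 2 / 2 ^ k) \<Longrightarrow> c k \<le> g t"
  shows "(\<Sum>k. c k * ennreal (h / 2 / 2 ^ k)) \<le> (\<integral>\<^sup>+t\<in>{0<..<\<delta>}. g t \<partial>lborel)"
proof -
  define s where "s = (\<lambda>k::nat. h / 2 / 2 ^ k)"
  have s: "0 < s k" "2 * s k \<le> \<delta>" for k
  proof -
    show "0 < s k" using h by (simp add: s_def)
    have "h / 2 ^ k \<le> h / 1" using h by (intro divide_left_mono) auto
    then show "2 * s k \<le> \<delta>" using h by (simp add: s_def)
  qed
  have dec: "2 * s l \<le> s k" if "k < l" for k l
  proof -
    have "s l \<le> s (Suc k)" unfolding s_def using h that by (intro divide_left_mono power_increasing) auto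
    then show ?thesis by (simp add: s_def)
  qed
  have "(\<Sum>k. c k * ennreal (s k)) = (\<Sum>k. \<integral>\<^sup>+t. c k * indicator {s k<..<2 * s k} t \<partial>lborel)"
    using s by (simp add: nn_integral_cmult less_imp_le)
  also have "\<dots> = (\<integral>\<^sup>+t. (\<Sum>k. c k * indicator {s k<..<2 * s k} t) \<partial>lborel)"
    by (rule nn_integral_suminf[symmetric]) measurable
  also have "\<dots> \<le> (\<integral>\<^sup>+t\<in>{0<..<\<delta>}. g t \<partial>lborel)"
  proof (intro nn_integral_mono)
    fix t :: real
    show "(\<Sum>k. c k * indicator {s k<..<2 * s k} t) \<le> g t * indicator {0<..<\<delta>} t"
    proof (cases "\<exists>k. t \<in> {s k<..<2 * s k}")
      case True
      then obtain k where k: "t \<in> {s k<..<2 * s k}" by blast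
      have "t \<notin> {s l<..<2 * s l}" if "l \<noteq> k" for l
        using k that dec[of k l] dec[of l k] by (cases "l < k") auto
      then have "(\<Sum>l. c l * indicator {s l<..<2 * s l} t) = (\<Sum>l\<in>{k}. c l * indicator {s l<..<2 * s l} t)"
        by (intro suminf_finite) (auto simp: indicator_def)
      also have "\<dots> \<le> g t" using k c[of k t] by (simp add: s_def)
      also have "\<dots> = g t * indicator {0<..<\<delta>} t"
        using k s[of k] by (auto simp: indicator_def)
      finally show ?thesis .
    next
      case False
      then have "(\<Sum>k. c k * indicator {s k<..<2 * s k} t) = (\<Sum>k. 0)"
        by (intro suminf_cong) (auto simp: indicator_def)
      then show ?thesis by simp
    qed
  qed
  finally show ?thesis by (simp add: s_def)
qed

text \<open>The two frequency ranges are added: the sum over k comes from the high frequencies, the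
  single term at the full step h from the low ones.\<close>

lemma vector_Ulyanov_step:
  fixes M :: "'b measure"
  assumes p: "1 < p" and pq: "p < q" and \<theta>: "\<theta> = 1 / p - 1 / q" and \<alpha>: "0 < \<alpha>" and M: "sigma_finite_measure M"
  shows "\<exists>C>0. \<forall>F h. admissible p M F \<longrightarrow> 0 < h \<longrightarrow> h \<le> 2 * pi \<longrightarrow>
     ennpowr (mixed_norm p q M (abs_diff \<alpha> h F)) q \<le> ennreal C *
       (ennreal (h powr (- \<theta> * q)) * ennpowr (mixed_norm p p M (abs_diff (\<alpha> + \<theta>) h F)) q
        + (\<Sum>k. ennreal ((h / 2 ^ k) powr (- \<theta> * q))
            * (\<integral>\<^sup>+u. ennpowr (mixed_norm p p M (abs_diff (\<alpha> + \<theta>) (h / 2 ^ k * u) F)) q \<partial>unit_itv)))"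
proof -
  note th = theta_bounds[OF p pq \<theta>]
  have q: "1 < q" "0 < q" using p pq by auto
  \<comment> \<open>Any integer above \<alpha> + \<theta> serves as the order of smoothing; it
    enters the result only through the constant.\<close>
  obtain m :: nat where m: "\<alpha> + \<theta> < real m" using reals_Archimedean2 by blast
  note hyps = p pq \<theta> \<alpha> m M
  obtain C1 where C1: "C1 > 0" and low: "\<And>F h. admissible p M F \<Longrightarrow> 0 < h \<Longrightarrow>
     ennpowr (mixed_norm p q M (\<lambda>y x. ennreal (norm (average h (shift_series (bincoeff \<alpha>) h (F y)) x)))) q
     \<le> ennreal C1 * (ennreal (h powr (- \<theta> * q)) * ennpowr (mixed_norm p p M (abs_diff (\<alpha> + \<theta>) h F)) q)"
    using low_frequency_norm[OF hyps] unfolding diff_power_def[OF hyps] by blast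
  obtain C2 where C2: "C2 > 0" and high: "\<And>F h. admissible p M F \<Longrightarrow> 0 < h \<Longrightarrow> h \<le> 2 * pi \<Longrightarrow>
     ennpowr (mixed_norm p q M (\<lambda>y x. ennreal (norm (F y x - smooth m h (smooth m h (F y)) x)))) q
     \<le> ennreal C2 * (\<Sum>k. ennreal ((h / 2 ^ k) powr (- \<theta> * q))
            * (\<integral>\<^sup>+u. ennpowr (mixed_norm p p M (abs_diff (\<alpha> + \<theta>) (h / 2 ^ k * u) F)) q \<partial>unit_itv))"
    using high_frequency_norm[OF hyps] unfolding smoothness_sum_def[OF hyps] diff_power_def[OF hyps] by blast
  define c where "c = bincoeff \<alpha>"
  have c: "summable (\<lambda>n. \<bar>c n\<bar>)" unfolding c_def by (rule summable_bincoeff[OF \<alpha>])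
  define K1 where "K1 = (\<Sum>n. \<bar>c n\<bar>)"
  have K1: "0 \<le> K1" unfolding K1_def by (intro suminf_nonneg c) auto
  define K2 where "K2 = (\<Sum>j\<in>{1..m}. \<Sum>i<j. \<bar>bincoeff (real m) j\<bar>)"
  have K2: "0 \<le> K2" unfolding K2_def by (intro sum_nonneg) auto
  define K3 where "K3 = smooth_mass m * K2"
  have K3: "0 \<le> K3" using K2 smooth_mass_nonneg by (simp add: K3_def)
  define C where "C = 2 powr q * (K1 powr q * C2 + K3 powr q * C1) + 1"
  have C: "C > 0" using C1 C2 by (simp add: C_def add_nonneg_pos)
  have "ennpowr (mixed_norm p q M (abs_diff \<alpha> h F)) q \<le> ennreal C * (ennreal (h powr (- \<theta> * q)) * L + S)"
    if F: "admissible p M F" and h: "0 < h" "h \<le> 2 * pi"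
      and L: "L = ennpowr (mixed_norm p p M (abs_diff (\<alpha> + \<theta>) h F)) q"
      and S: "S = (\<Sum>k. ennreal ((h / 2 ^ k) powr (- \<theta> * q))
            * (\<integral>\<^sup>+u. ennpowr (mixed_norm p p M (abs_diff (\<alpha> + \<theta>) (h / 2 ^ k * u) F)) q \<partial>unit_itv))"
    for F h L S
  proof -
    note [measurable] = admissibleD(1)[OF F] measurable_abs_diff[OF admissibleD(1)[OF F]]
    note per = admissibleD(2)[OF F]
    define R where "R = (\<lambda>y x. ennreal (norm (F y x - smooth m h (smooth m h (F y)) x)))"
    define A where "A = (\<lambda>y x. ennreal (norm (average h (shift_series c h (F y)) x)))"
    have [measurable]: "case_prod R \<in> borel_measurable (M \<Otimes>\<^sub>M borel)" "case_prod A \<in> borel_measurable (M \<Otimes>\<^sub>M borel)"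
      unfolding R_def A_def by measurable
    have Rper: "periodic (R y)" for y
      using per periodic_smooth[OF periodic_smooth[OF per], of m h m h] by (simp add: R_def periodic_def)
    have Aper: "periodic (A y)" for y
      using periodic_average[OF periodic_shift_series[OF per], of h] by (simp add: A_def periodic_def)
    define A' where "A' = (\<lambda>y x. \<Sum>j\<in>{1..m}. \<Sum>i<j. ennreal \<bar>bincoeff (real m) j\<bar> * A y (x - real i * h))"
    have [measurable]: "case_prod A' \<in> borel_measurable (M \<Otimes>\<^sub>M borel)"
      unfolding A'_def by measurable
    have A'per: "periodic (A' y)" for y
      using periodic_shift[OF Aper] unfolding A'_def periodic_def by simp
    have "AE x in circ. AE y in M. abs_diff \<alpha> h F y x \<le> abs_shift_series c h (R y) x + abs_smooth m h (A' y) x"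
    proof (rule AE_swap_le[OF p M])
      show "AE y in M. AE x in circ. abs_diff \<alpha> h F y x \<le> abs_shift_series c h (R y) x + abs_smooth m h (A' y) x"
        using AE_periodic_L1[OF hyps F]
        by eventually_elim
          (use smooth_decomposition[OF _ h(1) c, of _ m] in \<open>simp add: abs_diff_def c_def R_def A'_def A_def\<close>)
    qed measurable
    then have "mixed_norm p q M (abs_diff \<alpha> h F) \<le> mixed_norm p q M (\<lambda>y x. abs_shift_series c h (R y) x + abs_smooth m h (A' y) x)"
      using q by (intro mixed_norm_mono_AE[OF p M]) auto
    also have "\<dots> \<le> mixed_norm p q M (\<lambda>y. abs_shift_series c h (R y)) + mixed_norm p q M (\<lambda>y. abs_smooth m h (A' y))"
      by (intro mixed_norm_add[OF p M q(1)]) measurable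
    also have "\<dots> \<le> ennreal K1 * mixed_norm p q M R + ennreal (smooth_mass m) * mixed_norm p q M A'"
      unfolding K1_def
      by (intro add_mono mixed_norm_abs_shift_series[OF p M q(1)] mixed_norm_abs_smooth[OF p M q(1)] Rper A'per c) measurable
    also have "mixed_norm p q M A' \<le> (\<Sum>j\<in>{1..m}. \<Sum>i<j. ennreal \<bar>bincoeff (real m) j\<bar> * mixed_norm p q M A)"
    proof -
      have "mixed_norm p q M A' \<le> (\<Sum>j\<in>{1..m}. mixed_norm p q M (\<lambda>y x. \<Sum>i<j. ennreal \<bar>bincoeff (real m) j\<bar> * A y (x - real i * h)))"
        unfolding A'_def by (rule mixed_norm_sum[OF p M q(1)]) auto
      also have "\<dots> \<le> (\<Sum>j\<in>{1..m}. \<Sum>i<j. mixed_norm p q M (\<lambda>y x. ennreal \<bar>bincoeff (real m) j\<bar> * A y (x - real i * h)))"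
        by (intro sum_mono mixed_norm_sum[OF p M q(1)]) auto
      also have "\<dots> = (\<Sum>j\<in>{1..m}. \<Sum>i<j. ennreal \<bar>bincoeff (real m) j\<bar> * mixed_norm p q M A)"
        using q by (simp add: mixed_norm_cmult[OF p M] mixed_norm_shift[OF p M] Aper)
      finally show ?thesis .
    qed
    also have "(\<Sum>j\<in>{1..m}. \<Sum>i<j. ennreal \<bar>bincoeff (real m) j\<bar> * mixed_norm p q M A) = ennreal K2 * mixed_norm p q M A"
    proof -
      have "ennreal K2 = (\<Sum>j\<in>{1..m}. \<Sum>i<j. ennreal \<bar>bincoeff (real m) j\<bar>)"
        unfolding K2_def by (subst sum_ennreal[symmetric], simp add: sum_nonneg, subst sum_ennreal[symmetric]) auto
      then show ?thesis by (simp only: sum_distrib_right)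
    qed
    finally have "mixed_norm p q M (abs_diff \<alpha> h F) \<le> ennreal K1 * mixed_norm p q M R + ennreal K3 * mixed_norm p q M A"
      using K2 smooth_mass_nonneg[of m] by (simp add: K3_def ennreal_mult mult.assoc mult_left_mono)
    then have "ennpowr (mixed_norm p q M (abs_diff \<alpha> h F)) q
        \<le> ennpowr (ennreal K1 * mixed_norm p q M R + ennreal K3 * mixed_norm p q M A) q"
      using q by (intro ennpowr_mono) auto
    also have "\<dots> \<le> ennreal (2 powr q) * (ennpowr (ennreal K1 * mixed_norm p q M R) q + ennpowr (ennreal K3 * mixed_norm p q M A) q)"
      using q by (intro ennpowr_add_le) auto
    also have "\<dots> = ennreal (2 powr q) * (ennreal (K1 powr q) * ennpowr (mixed_norm p q M R) q + ennreal (K3 powr q) * ennpowr (mixed_norm p q M A) q)"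
      using q K1 K3 by (simp add: ennpowr_mult)
    also have "\<dots> \<le> ennreal (2 powr q) * (ennreal (K1 powr q) * (ennreal C2 * S) + ennreal (K3 powr q) * (ennreal C1 * (ennreal (h powr (- \<theta> * q)) * L)))"
      unfolding S L R_def A_def c_def by (intro mult_left_mono add_mono high[OF F h] low[OF F h(1)]) auto
    also have "\<dots> = ennreal (2 powr q * (K1 powr q * C2)) * S + ennreal (2 powr q * (K3 powr q * C1)) * (ennreal (h powr (- \<theta> * q)) * L)"
      using C1 C2 by (simp add: ennreal_mult distrib_left mult.assoc)
    also have "\<dots> \<le> ennreal C * S + ennreal C * (ennreal (h powr (- \<theta> * q)) * L)"
      using C1 C2 by (intro add_mono mult_right_mono ennreal_leI) (auto simp: C_def distrib_left)
    finally show ?thesis by (simp add: distrib_left add.commute)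
  qed
  with C show ?thesis by blast
qed

text \<open>The single term at step h is not controlled by an integral over steps below h. Passing
  to the step h / 2 first moves all terms to steps of at most h / 2.\<close>

lemma vector_Ulyanov:
  fixes M :: "'b measure"
  assumes p: "1 < p" and pq: "p < q" and \<theta>: "\<theta> = 1 / p - 1 / q" and \<alpha>: "0 < \<alpha>" and M: "sigma_finite_measure M"
  shows "\<exists>C>0. \<forall>F h. admissible p M F \<longrightarrow> 0 < h \<longrightarrow> h \<le> 2 * pi \<longrightarrow>
     ennpowr (mixed_norm p q M (abs_diff \<alpha> h F)) q
     \<le> ennreal C * dyadic_mean (- \<theta> * q) h (\<lambda>u. ennpowr (mixed_norm p p M (abs_diff (\<alpha> + \<theta>) u F)) q)"
proof -
  have q: "1 < q" "0 < q" using p pq by auto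
  obtain C where C: "C > 0" and step: "\<And>F h. admissible p M F \<Longrightarrow> 0 < h \<Longrightarrow> h \<le> 2 * pi \<Longrightarrow>
     ennpowr (mixed_norm p q M (abs_diff \<alpha> h F)) q \<le> ennreal C *
       (ennreal (h powr (- \<theta> * q)) * ennpowr (mixed_norm p p M (abs_diff (\<alpha> + \<theta>) h F)) q
        + (\<Sum>k. ennreal ((h / 2 ^ k) powr (- \<theta> * q))
            * (\<integral>\<^sup>+u. ennpowr (mixed_norm p p M (abs_diff (\<alpha> + \<theta>) (h / 2 ^ k * u) F)) q \<partial>unit_itv)))"
    using vector_Ulyanov_step[OF assms] by blast
  define c where "c = (\<lambda>n. \<alpha> gchoose n)"
  have c: "summable (\<lambda>n. \<bar>c n\<bar>)" unfolding c_def by (rule summable_gbinomial[OF \<alpha>])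
  define K where "K = (\<Sum>n. \<bar>c n\<bar>)"
  have "\<bar>c 0\<bar> \<le> K" unfolding K_def using c sum_le_suminf[OF c, of "{0}"] by simp
  then have K: "K > 0" by (simp add: c_def)
  obtain m :: nat where m: "\<alpha> + \<theta> < real m" using reals_Archimedean2 by blast
  have "ennpowr (mixed_norm p q M (abs_diff \<alpha> h F)) q
     \<le> ennreal (K powr q * C) * dyadic_mean (- \<theta> * q) h (\<lambda>u. ennpowr (mixed_norm p p M (abs_diff (\<alpha> + \<theta>) u F)) q)"
    if F: "admissible p M F" and h: "0 < h" "h \<le> 2 * pi" for F h
  proof -
    note [measurable] = admissibleD(1)[OF F] measurable_abs_diff[OF admissibleD(1)[OF F]]
    have "AE x in circ. AE y in M. abs_diff \<alpha> h F y x \<le> abs_shift_series c (h / 2) (abs_diff \<alpha> (h / 2) F y) x"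
    proof (rule AE_swap_le[OF p M])
      show "AE y in M. AE x in circ. abs_diff \<alpha> h F y x \<le> abs_shift_series c (h / 2) (abs_diff \<alpha> (h / 2) F y) x"
        using AE_periodic_L1[OF p pq \<theta> \<alpha> m M F]
        by eventually_elim (use norm_shift_series_bincoeff_half[OF _ \<alpha>, of _ h] in \<open>simp add: abs_diff_def[abs_def] c_def\<close>)
    qed measurable
    then have "mixed_norm p q M (abs_diff \<alpha> h F) \<le> mixed_norm p q M (\<lambda>y. abs_shift_series c (h / 2) (abs_diff \<alpha> (h / 2) F y))"
      using q by (intro mixed_norm_mono_AE[OF p M]) auto
    also have "\<dots> \<le> ennreal K * mixed_norm p q M (abs_diff \<alpha> (h / 2) F)"
      unfolding K_def by (intro mixed_norm_abs_shift_series[OF p M q(1)] periodic_abs_diff admissibleD[OF F] c) measurable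
    finally have "ennpowr (mixed_norm p q M (abs_diff \<alpha> h F)) q \<le> ennpowr (ennreal K * mixed_norm p q M (abs_diff \<alpha> (h / 2) F)) q"
      using q by (intro ennpowr_mono) auto
    also have "\<dots> = ennreal (K powr q) * ennpowr (mixed_norm p q M (abs_diff \<alpha> (h / 2) F)) q"
      using q K by (simp add: ennpowr_mult)
    also have "\<dots> \<le> ennreal (K powr q) * (ennreal C * dyadic_mean (- \<theta> * q) h (\<lambda>u. ennpowr (mixed_norm p p M (abs_diff (\<alpha> + \<theta>) u F)) q))"
      unfolding dyadic_mean_def using h by (intro mult_left_mono step F) auto
    finally show ?thesis using C by (simp add: ennreal_mult mult.assoc)
  qed
  moreover have "K powr q * C > 0" using K C by simp
  ultimately show ?thesis by blast
qed

subsection \<open>Functions of two variables\<close>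

definition diffx :: "real \<Rightarrow> real \<Rightarrow> (real \<Rightarrow> real \<Rightarrow> complex) \<Rightarrow> real \<Rightarrow> real \<Rightarrow> complex" where
  "diffx a u f x y = shift_series (bincoeff a) u (\<lambda>x. f x y) x"

definition diffy :: "real \<Rightarrow> real \<Rightarrow> (real \<Rightarrow> real \<Rightarrow> complex) \<Rightarrow> real \<Rightarrow> real \<Rightarrow> complex" where
  "diffy b v f x y = shift_series (bincoeff b) v (f x) y"

definition biperiodic :: "(real \<Rightarrow> real \<Rightarrow> complex) \<Rightarrow> bool" where
  "biperiodic f \<longleftrightarrow> case_prod f \<in> borel_measurable (borel \<Otimes>\<^sub>M borel)
     \<and> (\<forall>x. periodic (f x)) \<and> (\<forall>y. periodic (\<lambda>x. f x y))"

text \<open>The s-th power of the L_s norm over two periods, not a square; without the root it is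
  additive in the outer variable.\<close>

definition pow2 :: "real \<Rightarrow> (real \<Rightarrow> real \<Rightarrow> complex) \<Rightarrow> ennreal" where
  "pow2 s g = (\<integral>\<^sup>+y. \<integral>\<^sup>+x. ennpowr (ennreal (norm (g x y))) s \<partial>circ \<partial>circ)"

lemma biperiodicD:
  assumes "biperiodic f"
  shows "case_prod f \<in> borel_measurable (borel \<Otimes>\<^sub>M borel)" "periodic (f x)" "periodic (\<lambda>x. f x y)"
  using assms by (auto simp: biperiodic_def)

lemma biperiodic_diffx:
  assumes "biperiodic f"
  shows "biperiodic (diffx a u f)"
proof -
  note [measurable] = biperiodicD(1)[OF assms]
  have "case_prod (diffx a u f) \<in> borel_measurable (borel \<Otimes>\<^sub>M borel)"
    unfolding diffx_def[abs_def] by measurable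
  moreover have "periodic (\<lambda>x. diffx a u f x y)" for y
    unfolding diffx_def by (rule periodic_shift_series[OF biperiodicD(3)[OF assms]])
  moreover have "periodic (diffx a u f x)" for x
    using biperiodicD(2)[OF assms] by (simp add: periodic_def diffx_def)
  ultimately show ?thesis by (simp add: biperiodic_def)
qed

lemma biperiodic_transpose: "biperiodic f \<Longrightarrow> biperiodic (\<lambda>x y. f y x)"
  unfolding biperiodic_def using measurable_pair_swap[of "case_prod f" borel borel borel]
  by (simp add: split_beta')

lemma diffy_transpose: "diffy b v f = (\<lambda>x y. diffx b v (\<lambda>x y. f y x) y x)"
  by (simp add: fun_eq_iff diffx_def diffy_def)

lemma biperiodic_diffy: "biperiodic f \<Longrightarrow> biperiodic (diffy b v f)"
  unfolding diffy_transpose by (rule biperiodic_transpose, rule biperiodic_diffx, rule biperiodic_transpose)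

lemma pow2_transpose:
  assumes "biperiodic g"
  shows "pow2 s (\<lambda>x y. g y x) = pow2 s g"
proof -
  note [measurable] = biperiodicD(1)[OF assms]
  interpret c: sigma_finite_measure circ by (rule sigma_finite_circ)
  interpret cc: pair_sigma_finite circ circ ..
  show ?thesis unfolding pow2_def by (rule cc.Fubini') measurable
qed

lemma pow2_cong_AE:
  assumes "AE y in circ. AE x in circ. g x y = g' x y"
  shows "pow2 s g = pow2 s g'"
  unfolding pow2_def
  using assms by (intro nn_integral_cong_AE) (auto elim!: eventually_mono intro!: nn_integral_cong_AE)

lemma pow2_eq_mixed_norm:
  assumes "1 < p" "biperiodic g"
  shows "pow2 p g = ennpowr (mixed_norm p p circ (\<lambda>y x. ennreal (norm (g x y)))) p"
proof -
  note [measurable] = biperiodicD(1)[OF assms(2)]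
  show ?thesis
    unfolding pow2_def by (rule mixed_norm_p_eq[OF assms(1) sigma_finite_circ, symmetric]) measurable
qed

lemma pow2_diffx_finite:
  assumes p: "1 < p" and f: "biperiodic f" and fin: "pow2 p f < top" and a: "0 < a"
  shows "pow2 p (diffx a u f) < top"
proof -
  note [measurable] = biperiodicD(1)[OF f]
  have "mixed_norm p p circ (\<lambda>y x. ennreal (norm (diffx a u f x y)))
      \<le> mixed_norm p p circ (\<lambda>y. abs_shift_series (bincoeff a) u (\<lambda>x. ennreal (norm (f x y))))"
    unfolding diffx_def using p by (intro mixed_norm_mono[OF p sigma_finite_circ] norm_shift_series_le) auto
  also have "\<dots> \<le> ennreal (\<Sum>n. \<bar>bincoeff a n\<bar>) * mixed_norm p p circ (\<lambda>y x. ennreal (norm (f x y)))"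
    by (intro mixed_norm_abs_shift_series[OF p sigma_finite_circ p] summable_bincoeff a periodic_norm biperiodicD[OF f]) measurable
  also have "\<dots> < top"
    using fin unfolding pow2_eq_mixed_norm[OF p f] by (simp add: ennreal_mult_less_top)
  finally show ?thesis
    unfolding pow2_eq_mixed_norm[OF p biperiodic_diffx[OF f]] by simp
qed

lemma pow2_diffy_finite:
  assumes p: "1 < p" and f: "biperiodic f" and fin: "pow2 p f < top" and a: "0 < a"
  shows "pow2 p (diffy a u f) < top"
  unfolding diffy_transpose
    pow2_transpose[OF biperiodic_diffx[OF biperiodic_transpose[OF f]]]
  using fin by (intro pow2_diffx_finite[OF p biperiodic_transpose[OF f] _ a]) (simp add: pow2_transpose[OF f])

lemma suminf_ennreal_swap: "(\<Sum>i. \<Sum>j. (f i j :: ennreal)) = (\<Sum>j. \<Sum>i. f i j)" for f :: "nat \<Rightarrow> nat \<Rightarrow> ennreal"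
proof -
  have "(\<Sum>i. \<Sum>j. f i j) = (\<integral>\<^sup>+i. (\<Sum>j. f i j) \<partial>count_space UNIV)"
    by (simp add: nn_integral_count_space_nat)
  also have "\<dots> = (\<Sum>j. \<integral>\<^sup>+i. f i j \<partial>count_space UNIV)"
    by (rule nn_integral_suminf) simp
  finally show ?thesis by (simp add: nn_integral_count_space_nat)
qed

lemma term_le_suminf_ennreal: "f i \<le> suminf f" for f :: "nat \<Rightarrow> ennreal"
  using sum_le_suminf[of f "{i}"] by simp

lemma suminf_swap_complex:
  fixes z :: "nat \<Rightarrow> nat \<Rightarrow> complex"
  assumes fin: "(\<Sum>i. \<Sum>j. ennreal (norm (z i j))) < top"
  shows "(\<Sum>i. \<Sum>j. z i j) = (\<Sum>j. \<Sum>i. z i j)"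
proof -
  have fin': "(\<Sum>j. \<Sum>i. ennreal (norm (z i j))) < top"
    by (subst suminf_ennreal_swap) (rule fin)
  have part: "(\<Sum>j. ennreal (norm (z i j))) < top" for i
    by (rule le_less_trans[OF term_le_suminf_ennreal[of "\<lambda>i. \<Sum>j. ennreal (norm (z i j))"] fin])
  have part': "(\<Sum>i. ennreal (norm (z i j))) < top" for j
    by (rule le_less_trans[OF term_le_suminf_ennreal[of "\<lambda>j. \<Sum>i. ennreal (norm (z i j))"] fin'])
  have int: "integrable (count_space UNIV) (\<lambda>i. z i j)" for j
    using part'[of j] by (intro integrableI_bounded) (auto simp: nn_integral_count_space_nat)
  have "(\<Sum>i. ennreal (norm (\<Sum>j. z i j))) \<le> (\<Sum>i. \<Sum>j. ennreal (norm (z i j)))"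
    by (intro suminf_le norm_suminf_le_ennreal) auto
  then have int': "integrable (count_space UNIV) (\<lambda>i. \<Sum>j. z i j)"
    using fin by (intro integrableI_bounded) (auto simp: nn_integral_count_space_nat)
  have "(\<Sum>i. \<Sum>j. z i j) = (\<integral>i. (\<Sum>j. z i j) \<partial>count_space UNIV)"
    by (rule integral_count_space_nat[OF int', symmetric])
  also have "\<dots> = (\<Sum>j. \<integral>i. z i j \<partial>count_space UNIV)"
  proof (rule integral_suminf[OF int])
    show "AE i in count_space UNIV. summable (\<lambda>j. norm (z i j))"
      using part by (auto simp: summable_norm_iff_ennreal)
    have "ennreal (\<integral>i. norm (z i j) \<partial>count_space UNIV) = (\<Sum>i. ennreal (norm (z i j)))" for j
      by (subst nn_integral_eq_integral[symmetric]) (auto intro!: integrable_norm int simp: nn_integral_count_space_nat)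
    then show "summable (\<lambda>j. \<integral>i. norm (z i j) \<partial>count_space UNIV)"
      using fin' by (intro summable_suminf_not_top) auto
  qed
  also have "\<dots> = (\<Sum>j. \<Sum>i. z i j)"
    by (intro suminf_cong integral_count_space_nat int)
  finally show ?thesis .
qed

text \<open>The double series converges absolutely almost everywhere: the majorant of the series in
  y lies in L_p, so almost all its sections in x are integrable, and then the majorant of the series
  in x is finite almost everywhere.\<close>

lemma diffx_diffy_commute:
  assumes f: "biperiodic f" and fin: "pow2 p f < top" and p: "1 < p" and a: "0 < a" "0 < b"
  shows "AE y in circ. AE x in circ. diffx a u (diffy b v f) x y = diffy b v (diffx a u f) x y"
proof -
  note [measurable] = biperiodicD(1)[OF f]
  interpret c: sigma_finite_measure circ by (rule sigma_finite_circ)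
  interpret cc: pair_sigma_finite circ circ ..
  define G where "G = (\<lambda>y x. abs_shift_series (bincoeff b) v (\<lambda>y. ennreal (norm (f x y))) y)"
  have [measurable]: "case_prod G \<in> borel_measurable (borel \<Otimes>\<^sub>M borel)"
    unfolding G_def by measurable
  have Gper: "periodic (G y)" for y
    using biperiodicD(3)[OF f] by (simp add: periodic_def G_def)
  have mb: "summable (\<lambda>n. \<bar>bincoeff a n\<bar>)" "summable (\<lambda>n. \<bar>bincoeff b n\<bar>)"
    using a by (auto intro: summable_bincoeff)
  have "mixed_norm p p circ (\<lambda>x. G' x) < top" if "G' = (\<lambda>x y. G y x)" for G'
  proof -
    have "mixed_norm p p circ (\<lambda>x. abs_shift_series (bincoeff b) v (\<lambda>y. ennreal (norm (f x y))))
        \<le> ennreal (\<Sum>n. \<bar>bincoeff b n\<bar>) * mixed_norm p p circ (\<lambda>x y. ennreal (norm (f x y)))"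
      by (intro mixed_norm_abs_shift_series[OF p sigma_finite_circ p] mb periodic_norm biperiodicD[OF f]) measurable
    also have "\<dots> < top"
    proof -
      have "ennpowr (mixed_norm p p circ (\<lambda>x y. ennreal (norm (f x y)))) p = pow2 p f"
        using pow2_eq_mixed_norm[OF p biperiodic_transpose[OF f]] pow2_transpose[OF f] by simp
      then show ?thesis using fin by (metis ennpowr_less_top_iff ennreal_mult_less_top ennreal_less_top)
    qed
    finally show ?thesis by (simp add: that G_def)
  qed
  then have m1: "mixed_norm p p circ (\<lambda>x y. G y x) < top" by simp
  have "ennpowr (mixed_norm p p circ (\<lambda>x y. G y x)) p = ennpowr (mixed_norm p p circ G) p"
  proof -
    have "ennpowr (mixed_norm p p circ (\<lambda>x y. G y x)) p = (\<integral>\<^sup>+x. \<integral>\<^sup>+y. ennpowr (G y x) p \<partial>circ \<partial>circ)"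
      by (rule mixed_norm_p_eq[OF p sigma_finite_circ]) measurable
    also have "\<dots> = (\<integral>\<^sup>+y. \<integral>\<^sup>+x. ennpowr (G y x) p \<partial>circ \<partial>circ)"
      by (rule cc.Fubini') measurable
    also have "\<dots> = ennpowr (mixed_norm p p circ G) p"
      by (rule mixed_norm_p_eq[OF p sigma_finite_circ, symmetric]) measurable
    finally show ?thesis .
  qed
  then have "mixed_norm p p circ G < top"
    using m1 by (metis ennpowr_less_top_iff)
  then have "AE y in circ. (\<integral>\<^sup>+x. G y x \<partial>circ) < top"
    by (intro AE_section_finite[OF p sigma_finite_circ]) auto
  then show ?thesis
  proof eventually_elim
    case (elim y)
    have "AE x in circ. abs_shift_series (bincoeff a) u (G y) x < top"
      using elim mb Gper by (intro AE_abs_shift_series_finite) auto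
    then show ?case
    proof eventually_elim
      case (elim x)
      define z where "z = (\<lambda>i j. complex_of_real (bincoeff a i) * (complex_of_real (bincoeff b j) * f (x - real i * u) (y - real j * v)))"
      have fin: "(\<Sum>i. \<Sum>j. ennreal (norm (z i j))) < top"
        using elim by (simp add: abs_shift_series_def G_def z_def norm_mult ennreal_mult ennreal_suminf_cmult)
      have fin': "(\<Sum>j. \<Sum>i. ennreal (norm (z i j))) < top"
        by (subst suminf_ennreal_swap) (rule fin)
      have part: "summable (\<lambda>j. z i j)" for i
      proof -
        have "(\<Sum>j. ennreal (norm (z i j))) < top"
          by (rule le_less_trans[OF term_le_suminf_ennreal[of "\<lambda>i. \<Sum>j. ennreal (norm (z i j))"] fin])
        then show ?thesis by (rule summable_norm_cancel[OF summable_norm_iff_ennreal[THEN iffD2]])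
      qed
      have part': "summable (\<lambda>i. z i j)" for j
      proof -
        have "(\<Sum>i. ennreal (norm (z i j))) < top"
          by (rule le_less_trans[OF term_le_suminf_ennreal[of "\<lambda>j. \<Sum>i. ennreal (norm (z i j))"] fin'])
        then show ?thesis by (rule summable_norm_cancel[OF summable_norm_iff_ennreal[THEN iffD2]])
      qed
      \<comment> \<open>A vanishing constant is allowed: both sides are then 0, even if the series
        of \<open>w\<close> diverges.\<close>
      have pull: "(\<Sum>j. c * w j) = c * (\<Sum>j. w j)" if "summable (\<lambda>j. c * w j)" for c :: complex and w
        using that by (cases "c = 0") (auto simp: summable_cmult_iff suminf_mult)
      have "diffx a u (diffy b v f) x y = (\<Sum>i. \<Sum>j. z i j)"
        using part by (simp add: diffx_def diffy_def shift_series_def z_def pull)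
      also have "\<dots> = (\<Sum>j. \<Sum>i. z i j)" by (rule suminf_swap_complex[OF fin])
      also have "\<dots> = diffy b v (diffx a u f) x y"
        using part' by (simp add: diffx_def diffy_def shift_series_def z_def mult.left_commute[of "complex_of_real (bincoeff a _)"] pull)
      finally show ?case .
    qed
  qed
qed

lemma measurable_dyadic_mean [measurable (raw)]:
  assumes [measurable]: "case_prod w \<in> borel_measurable (N \<Otimes>\<^sub>M borel)"
  shows "(\<lambda>y. dyadic_mean e h (w y)) \<in> borel_measurable N"
proof -
  interpret u: sigma_finite_measure unit_itv by (rule sigma_finite_unit_itv)
  show ?thesis unfolding dyadic_mean_def by measurable
qed

text \<open>The case of scalar functions is the vector-valued inequality over a one-point space.\<close>

lemma scalar_Ulyanov:
  assumes p: "1 < p" and pq: "p < q" and \<theta>: "\<theta> = 1 / p - 1 / q" and \<alpha>: "0 < \<alpha>"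
  shows "\<exists>C>0. \<forall>\<phi> h. \<phi> \<in> borel_measurable borel \<longrightarrow> periodic \<phi> \<longrightarrow> (\<integral>\<^sup>+x. ennpowr (ennreal (norm (\<phi> x))) p \<partial>circ) < top
     \<longrightarrow> 0 < h \<longrightarrow> h \<le> 2 * pi \<longrightarrow>
     (\<integral>\<^sup>+x. ennpowr (ennreal (norm (shift_series (bincoeff \<alpha>) h \<phi> x))) q \<partial>circ)
     \<le> ennreal C * dyadic_mean (- \<theta> * q) h
         (\<lambda>u. ennpowr (\<integral>\<^sup>+x. ennpowr (ennreal (norm (shift_series (bincoeff (\<alpha> + \<theta>)) u \<phi> x))) p \<partial>circ) (q / p))"
proof -
  define N where "N = (count_space UNIV :: unit measure)"
  have N: "sigma_finite_measure N" unfolding N_def by (rule sigma_finite_measure_count_space)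
  have Lnorm_N: "Lnorm p N (\<lambda>y. g) = g" for g
    using p by (simp add: Lnorm_def N_def nn_integral_count_space_finite)
  have q: "0 < q" using p pq by simp
  have mixed: "ennpowr (mixed_norm p s N (\<lambda>y. g)) r = ennpowr (\<integral>\<^sup>+x. ennpowr (g x) s \<partial>circ) (r / s)" for s r g
    unfolding mixed_norm_def Lnorm_N by (simp add: Lnorm_def ennpowr_ennpowr)
  obtain C where C: "C > 0" and *: "\<And>F h. admissible p N F \<Longrightarrow> 0 < h \<Longrightarrow> h \<le> 2 * pi \<Longrightarrow>
     ennpowr (mixed_norm p q N (abs_diff \<alpha> h F)) q
     \<le> ennreal C * dyadic_mean (- \<theta> * q) h (\<lambda>u. ennpowr (mixed_norm p p N (abs_diff (\<alpha> + \<theta>) u F)) q)"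
    using vector_Ulyanov[OF p pq \<theta> \<alpha> N] by blast
  have "(\<integral>\<^sup>+x. ennpowr (ennreal (norm (shift_series (bincoeff \<alpha>) h \<phi> x))) q \<partial>circ)
     \<le> ennreal C * dyadic_mean (- \<theta> * q) h
         (\<lambda>u. ennpowr (\<integral>\<^sup>+x. ennpowr (ennreal (norm (shift_series (bincoeff (\<alpha> + \<theta>)) u \<phi> x))) p \<partial>circ) (q / p))"
    if [measurable]: "\<phi> \<in> borel_measurable borel" and "periodic \<phi>"
      and fin: "(\<integral>\<^sup>+x. ennpowr (ennreal (norm (\<phi> x))) p \<partial>circ) < top" and h: "0 < h" "h \<le> 2 * pi" for \<phi> h
  proof -
    have "mixed_norm p p N (\<lambda>y x. ennreal (norm (\<phi> x))) < top"
      using fin mixed[of p "\<lambda>x. ennreal (norm (\<phi> x))" p] p by (metis divide_self ennpowr_1 ennpowr_less_top_iff less_numeral_extra(1) not_one_less_zero order_less_trans)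
    then have "admissible p N (\<lambda>y. \<phi>)"
      using \<open>periodic \<phi>\<close> by (simp add: admissible_def)
    from *[OF this h] show ?thesis
      using q by (simp add: abs_diff_def[abs_def] mixed)
  qed
  with C show ?thesis by blast
qed

text \<open>The scalar inequality in x, applied for almost every y, leaves the L_q norm in y of an
  L_p norm in x. The inequality for functions with values in L_p fits exactly this norm; it is
  applied in y, with x as the parameter, to \<open>diffx (\<alpha>1 + \<theta>) u f\<close> for each
  u.\<close>

lemma mixed_Ulyanov:
  assumes p: "1 < p" and pq: "p < q" and \<theta>: "\<theta> = 1 / p - 1 / q" and \<alpha>: "0 < \<alpha>1" "0 < \<alpha>2"
  shows "\<exists>C>0. \<forall>f h1 h2. biperiodic f \<longrightarrow> pow2 p f < top \<longrightarrow> 0 < h1 \<longrightarrow> h1 \<le> 2 * pi \<longrightarrow> 0 < h2 \<longrightarrow> h2 \<le> 2 * pi \<longrightarrow>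
     pow2 q (diffx \<alpha>1 h1 (diffy \<alpha>2 h2 f))
     \<le> ennreal C * dyadic_mean (- \<theta> * q) h1 (\<lambda>u. dyadic_mean (- \<theta> * q) h2
         (\<lambda>v. ennpowr (pow2 p (diffx (\<alpha>1 + \<theta>) u (diffy (\<alpha>2 + \<theta>) v f))) (q / p)))"
proof -
  note th = theta_bounds[OF p pq \<theta>]
  have q: "0 < q" using p pq by simp
  obtain C1 where C1: "C1 > 0" and scalar: "\<And>\<phi> h. \<phi> \<in> borel_measurable borel \<Longrightarrow> periodic \<phi> \<Longrightarrow>
      (\<integral>\<^sup>+x. ennpowr (ennreal (norm (\<phi> x))) p \<partial>circ) < top \<Longrightarrow> 0 < h \<Longrightarrow> h \<le> 2 * pi \<Longrightarrow>
     (\<integral>\<^sup>+x. ennpowr (ennreal (norm (shift_series (bincoeff \<alpha>1) h \<phi> x))) q \<partial>circ)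
     \<le> ennreal C1 * dyadic_mean (- \<theta> * q) h
         (\<lambda>u. ennpowr (\<integral>\<^sup>+x. ennpowr (ennreal (norm (shift_series (bincoeff (\<alpha>1 + \<theta>)) u \<phi> x))) p \<partial>circ) (q / p))"
    using scalar_Ulyanov[OF p pq \<theta> \<alpha>(1)] by blast
  obtain C2 where C2: "C2 > 0" and vector: "\<And>F h. admissible p circ F \<Longrightarrow> 0 < h \<Longrightarrow> h \<le> 2 * pi \<Longrightarrow>
     ennpowr (mixed_norm p q circ (abs_diff \<alpha>2 h F)) q
     \<le> ennreal C2 * dyadic_mean (- \<theta> * q) h (\<lambda>u. ennpowr (mixed_norm p p circ (abs_diff (\<alpha>2 + \<theta>) u F)) q)"
    using vector_Ulyanov[OF p pq \<theta> \<alpha>(2) sigma_finite_circ] by blast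
  have "pow2 q (diffx \<alpha>1 h1 (diffy \<alpha>2 h2 f))
     \<le> ennreal (C1 * C2) * dyadic_mean (- \<theta> * q) h1 (\<lambda>u. dyadic_mean (- \<theta> * q) h2
         (\<lambda>v. ennpowr (pow2 p (diffx (\<alpha>1 + \<theta>) u (diffy (\<alpha>2 + \<theta>) v f))) (q / p)))"
    if f: "biperiodic f" and fin: "pow2 p f < top" and h1: "0 < h1" "h1 \<le> 2 * pi" and h2: "0 < h2" "h2 \<le> 2 * pi"
    for f h1 h2
  proof -
    interpret c: sigma_finite_measure circ by (rule sigma_finite_circ)
    define g where "g = diffy \<alpha>2 h2 f"
    have g: "biperiodic g" unfolding g_def by (rule biperiodic_diffy[OF f])
    have gfin: "pow2 p g < top" unfolding g_def by (rule pow2_diffy_finite[OF p f fin \<alpha>(2)])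
    note [measurable] = biperiodicD(1)[OF f] biperiodicD(1)[OF g]
    define w where "w = (\<lambda>y u. ennpowr (\<integral>\<^sup>+x. ennpowr (ennreal (norm (diffx (\<alpha>1 + \<theta>) u g x y))) p \<partial>circ) (q / p))"
    have [measurable]: "case_prod w \<in> borel_measurable (borel \<Otimes>\<^sub>M borel)"
      unfolding w_def diffx_def by measurable
    have "AE y in circ. (\<integral>\<^sup>+x. ennpowr (ennreal (norm (g x y))) p \<partial>circ) \<noteq> \<infinity>"
      using gfin by (intro nn_integral_PInf_AE) (auto simp: pow2_def)
    then have "AE y in circ. (\<integral>\<^sup>+x. ennpowr (ennreal (norm (diffx \<alpha>1 h1 g x y))) q \<partial>circ) \<le> ennreal C1 * dyadic_mean (- \<theta> * q) h1 (w y)"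
    proof eventually_elim
      case (elim y)
      then show ?case
        unfolding w_def diffx_def by (intro scalar biperiodicD(3)[OF g] h1) (auto simp: less_top)
    qed
    then have "pow2 q (diffx \<alpha>1 h1 g) \<le> (\<integral>\<^sup>+y. ennreal C1 * dyadic_mean (- \<theta> * q) h1 (w y) \<partial>circ)"
      unfolding pow2_def by (rule nn_integral_mono_AE)
    \<comment> \<open>The inequality bounds q-th powers, so it can be integrated over y, and this
      integral passes inside the dyadic mean.\<close>
    also have "\<dots> = ennreal C1 * dyadic_mean (- \<theta> * q) h1 (\<lambda>u. \<integral>\<^sup>+y. w y u \<partial>circ)"
      by (subst nn_integral_cmult) (auto simp: nn_integral_dyadic_mean[OF sigma_finite_circ])
    also have "\<dots> \<le> ennreal C1 * dyadic_mean (- \<theta> * q) h1 (\<lambda>u. ennreal C2 * dyadic_mean (- \<theta> * q) h2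
         (\<lambda>v. ennpowr (pow2 p (diffx (\<alpha>1 + \<theta>) u (diffy (\<alpha>2 + \<theta>) v f))) (q / p)))"
    proof (intro mult_left_mono dyadic_mean_mono zero_le)
      fix u
      define k where "k = diffx (\<alpha>1 + \<theta>) u f"
      have k: "biperiodic k" unfolding k_def by (rule biperiodic_diffx[OF f])
      have kfin: "pow2 p k < top" unfolding k_def using \<alpha> th by (intro pow2_diffx_finite[OF p f fin]) auto
      note [measurable] = biperiodicD(1)[OF k]
      have "pow2 p k = ennpowr (mixed_norm p p circ (\<lambda>x y. ennreal (norm (k x y)))) p"
        using pow2_eq_mixed_norm[OF p biperiodic_transpose[OF k]] pow2_transpose[OF k] by simp
      then have adm: "admissible p circ k"
        using kfin biperiodicD[OF k] by (simp add: admissible_def)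
      have "AE y in circ. AE x in circ. diffx (\<alpha>1 + \<theta>) u g x y = diffy \<alpha>2 h2 k x y"
        unfolding g_def k_def using \<alpha> th by (intro diffx_diffy_commute[OF f fin p]) auto
      then have "(\<integral>\<^sup>+y. w y u \<partial>circ) = (\<integral>\<^sup>+y. ennpowr (\<integral>\<^sup>+x. ennpowr (ennreal (norm (diffy \<alpha>2 h2 k x y))) p \<partial>circ) (q / p) \<partial>circ)"
        unfolding w_def
        by (intro nn_integral_cong_AE) (auto elim!: eventually_mono intro!: arg_cong2[where f = ennpowr] nn_integral_cong_AE)
      also have "\<dots> = ennpowr (mixed_norm p q circ (abs_diff \<alpha>2 h2 k)) q"
        using q by (simp add: mixed_norm_def Lnorm_powr abs_diff_def diffy_def Lnorm_def[of p] ennpowr_ennpowr)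
      also have "\<dots> \<le> ennreal C2 * dyadic_mean (- \<theta> * q) h2 (\<lambda>v. ennpowr (mixed_norm p p circ (abs_diff (\<alpha>2 + \<theta>) v k)) q)"
        by (rule vector[OF adm h2])
      also have "(\<lambda>v. ennpowr (mixed_norm p p circ (abs_diff (\<alpha>2 + \<theta>) v k)) q)
          = (\<lambda>v. ennpowr (pow2 p (diffx (\<alpha>1 + \<theta>) u (diffy (\<alpha>2 + \<theta>) v f))) (q / p))"
      proof
        fix v
        have "AE y in circ. AE x in circ. diffx (\<alpha>1 + \<theta>) u (diffy (\<alpha>2 + \<theta>) v f) x y = diffy (\<alpha>2 + \<theta>) v k x y"
          unfolding k_def using \<alpha> th by (intro diffx_diffy_commute[OF f fin p]) auto
        then have "pow2 p (diffx (\<alpha>1 + \<theta>) u (diffy (\<alpha>2 + \<theta>) v f)) = pow2 p (diffy (\<alpha>2 + \<theta>) v k)"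
          by (rule pow2_cong_AE)
        also have "\<dots> = pow2 p (\<lambda>x y. diffy (\<alpha>2 + \<theta>) v k y x)"
          by (rule pow2_transpose[OF biperiodic_diffy[OF k], symmetric])
        also have "\<dots> = ennpowr (mixed_norm p p circ (\<lambda>y x. ennreal (norm (diffy (\<alpha>2 + \<theta>) v k y x)))) p"
          by (rule pow2_eq_mixed_norm[OF p biperiodic_transpose[OF biperiodic_diffy[OF k]]])
        also have "(\<lambda>y x. ennreal (norm (diffy (\<alpha>2 + \<theta>) v k y x))) = abs_diff (\<alpha>2 + \<theta>) v k"
          by (simp add: fun_eq_iff abs_diff_def diffy_def)
        finally show "ennpowr (mixed_norm p p circ (abs_diff (\<alpha>2 + \<theta>) v k)) q
            = ennpowr (pow2 p (diffx (\<alpha>1 + \<theta>) u (diffy (\<alpha>2 + \<theta>) v f))) (q / p)"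
          using p by (simp add: ennpowr_ennpowr)
      qed
      finally show "(\<integral>\<^sup>+y. w y u \<partial>circ) \<le> ennreal C2 * dyadic_mean (- \<theta> * q) h2
         (\<lambda>v. ennpowr (pow2 p (diffx (\<alpha>1 + \<theta>) u (diffy (\<alpha>2 + \<theta>) v f))) (q / p))" .
    qed
    also have "\<dots> = ennreal (C1 * C2) * dyadic_mean (- \<theta> * q) h1 (\<lambda>u. dyadic_mean (- \<theta> * q) h2
         (\<lambda>v. ennpowr (pow2 p (diffx (\<alpha>1 + \<theta>) u (diffy (\<alpha>2 + \<theta>) v f))) (q / p)))"
    proof (subst dyadic_mean_cmult)
      show "(\<lambda>u. dyadic_mean (- \<theta> * q) h2 (\<lambda>v. ennpowr (pow2 p (diffx (\<alpha>1 + \<theta>) u (diffy (\<alpha>2 + \<theta>) v f))) (q / p))) \<in> borel_measurable borel"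
        unfolding pow2_def diffx_def diffy_def by measurable
    qed (use C1 C2 in \<open>simp add: ennreal_mult mult.assoc\<close>)
    finally show ?thesis by (simp add: g_def)
  qed
  moreover have "C1 * C2 > 0" using C1 C2 by simp
  ultimately show ?thesis by blast
qed

subsection \<open>Reduction to Borel functions and positive steps\<close>

definition reduce_mod :: "real \<Rightarrow> real" where
  "reduce_mod x = x - 2 * pi * of_int \<lfloor>x / (2 * pi)\<rfloor>"

lemma measurable_reduce_mod [measurable]: "reduce_mod \<in> borel_measurable borel"
  unfolding reduce_mod_def[abs_def] by measurable

lemma periodic_reduce_mod: "periodic reduce_mod"
  unfolding periodic_def
proof
  fix x
  have "(x + 2 * pi) / (2 * pi) = x / (2 * pi) + 1" by (simp add: field_simps)
  then show "reduce_mod (x + 2 * pi) = reduce_mod x" by (simp add: reduce_mod_def algebra_simps)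
qed

lemma AE_lborel_translate:
  fixes c :: "real \<times> real"
  assumes "AE z in lborel. P z"
  shows "AE z in lborel. P (c + z)"
proof -
  have "AE z in distr lborel borel ((+) c). P z"
    using assms by (simp only: lborel_distr_plus)
  then show ?thesis by (rule AE_distrD[rotated]) simp
qed

lemma periodic2_add_int:
  assumes "periodic2 f"
  shows "f (x + 2 * pi * of_int k, y + 2 * pi * of_int l) = f (x, y)"
proof -
  have 1: "periodic (\<lambda>x. f (x, y))" for y using assms by (simp add: periodic2_def periodic_def)
  have 2: "periodic (\<lambda>y. f (x, y))" for x using assms by (simp add: periodic2_def periodic_def)
  show ?thesis using periodic_add_int[OF 1] periodic_add_int[OF 2] by simp
qed

lemma lebesgue_complex_AE_borel:
  fixes f :: "real \<times> real \<Rightarrow> complex"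
  assumes [measurable]: "f \<in> borel_measurable lebesgue"
  shows "\<exists>g \<in> borel_measurable borel. AE z in lborel. f z = g z"
proof -
  obtain g1 where g1: "g1 \<in> borel_measurable lborel" "AE z in lborel. Re (f z) = g1 z"
    using completion_ex_borel_measurable_real[of "\<lambda>z. Re (f z)" lborel] by auto
  obtain g2 where g2: "g2 \<in> borel_measurable lborel" "AE z in lborel. Im (f z) = g2 z"
    using completion_ex_borel_measurable_real[of "\<lambda>z. Im (f z)" lborel] by auto
  show ?thesis
  proof (rule bexI)
    show "AE z in lborel. f z = Complex (g1 z) (g2 z)"
      using g1(2) g2(2) by eventually_elim (simp add: complex_eq_iff)
    have "(\<lambda>z. complex_of_real (g1 z) + \<i> * complex_of_real (g2 z)) \<in> borel_measurable borel"
      using g1(1) g2(1) by simp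
    then show "(\<lambda>z. Complex (g1 z) (g2 z)) \<in> borel_measurable borel"
      by (simp add: complex_eq_iff Complex_eq)
  qed
qed

text \<open>A Borel representative need not be periodic, so its values on one cell are repeated.
  Equality almost everywhere holds at all lattice translates simultaneously, as there are only
  countably many.\<close>

lemma periodic2_AE_biperiodic:
  assumes "f \<in> borel_measurable lebesgue" "periodic2 f"
  shows "\<exists>g. biperiodic g \<and> (AE z in lborel. f z = g (fst z) (snd z))"
proof -
  obtain g0 where g0 [measurable]: "g0 \<in> borel_measurable borel" and eq: "AE z in lborel. f z = g0 z"
    using lebesgue_complex_AE_borel[OF assms(1)] by blast
  define g where "g = (\<lambda>x y. g0 (reduce_mod x, reduce_mod y))"
  have [measurable]: "g0 \<in> borel_measurable (borel \<Otimes>\<^sub>M borel)"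
    using g0 by (simp add: borel_prod)
  have "case_prod g \<in> borel_measurable (borel \<Otimes>\<^sub>M borel)"
    unfolding g_def by measurable
  then have "biperiodic g"
    using periodic_reduce_mod by (simp add: biperiodic_def g_def periodic_def)
  moreover have "AE z in lborel. \<forall>k l. f ((2 * pi * of_int k, 2 * pi * of_int l) + z) = g0 ((2 * pi * of_int k, 2 * pi * of_int l) + z)"
    unfolding AE_all_countable by (intro allI AE_lborel_translate eq)
  then have "AE z in lborel. f z = g (fst z) (snd z)"
  proof eventually_elim
    case (elim z)
    obtain x y where z: "z = (x, y)" by (cases z)
    show ?case
      using elim[rule_format, of "- \<lfloor>x / (2 * pi)\<rfloor>" "- \<lfloor>y / (2 * pi)\<rfloor>"]
        periodic2_add_int[OF assms(2), of x "- \<lfloor>x / (2 * pi)\<rfloor>" y "- \<lfloor>y / (2 * pi)\<rfloor>"]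
      by (simp add: z g_def reduce_mod_def)
  qed
  ultimately show ?thesis by blast
qed

text \<open>The offsets c and d absorb the centring of the differences, whose translates start at x
  + \<alpha> h; translation does not change the norm of a periodic function.\<close>

lemma Lp_norm_T2_eq:
  assumes G: "biperiodic G" and eq: "AE z in lborel. F z = G (fst z + c) (snd z + d)"
  shows "Lp_norm_T2 s F = ennpowr (pow2 s G) (1 / s)"
proof -
  note [measurable] = biperiodicD(1)[OF G]
  interpret c: sigma_finite_measure circ by (rule sigma_finite_circ)
  interpret cc: pair_sigma_finite circ circ ..
  define N where "N = (\<lambda>x y. ennpowr (ennreal (norm (G x y))) s)"
  have [measurable]: "case_prod N \<in> borel_measurable (borel \<Otimes>\<^sub>M borel)"
    unfolding N_def by measurable
  have Nper: "periodic (N x)" "periodic (\<lambda>x. N x y)" for x y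
    using biperiodicD(2,3)[OF G] by (simp_all add: N_def periodic_def)
  let ?I = "\<lambda>z. indicator ({0..2 * pi} \<times> {0..2 * pi}) z :: ennreal"
  have m: "(\<lambda>z. N (fst z + c) (snd z + d) * ?I z) \<in> borel_measurable borel"
    unfolding borel_prod[symmetric] by measurable
  have "(\<integral>\<^sup>+z. ennreal (norm (F z) powr s) * ?I z \<partial>lebesgue) = (\<integral>\<^sup>+z. N (fst z + c) (snd z + d) * ?I z \<partial>lebesgue)"
    using AE_completion[OF eq] by (intro nn_integral_cong_AE) (auto elim!: eventually_mono simp: N_def)
  also have "\<dots> = (\<integral>\<^sup>+z. N (fst z + c) (snd z + d) * ?I z \<partial>lborel)"
    by (rule nn_integral_completion)
  also have "\<dots> = (\<integral>\<^sup>+z. N (fst z + c) (snd z + d) * ?I z \<partial>(lborel \<Otimes>\<^sub>M lborel))"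
    by (simp add: lborel_prod)
  also have "\<dots> = (\<integral>\<^sup>+x. \<integral>\<^sup>+y. N (x + c) (y + d) * ?I (x, y) \<partial>lborel \<partial>lborel)"
  proof (subst lborel.nn_integral_fst[symmetric])
    show "(\<lambda>z. N (fst z + c) (snd z + d) * ?I z) \<in> borel_measurable (lborel \<Otimes>\<^sub>M lborel)"
      using m by (simp add: lborel_prod)
  qed simp
  also have "\<dots> = (\<integral>\<^sup>+x. \<integral>\<^sup>+y. N (x + c) (y + d) \<partial>circ \<partial>circ)"
    by (subst nn_integral_circ, measurable, subst nn_integral_circ, measurable)
       (auto intro!: nn_integral_cong simp: nn_integral_cmult[symmetric] indicator_times mult_ac)
  also have "\<dots> = (\<integral>\<^sup>+x. \<integral>\<^sup>+y. N (x + c) y \<partial>circ \<partial>circ)"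
    using nn_integral_circ_shift[OF _ Nper(1), of _ "- d"] by simp
  also have "\<dots> = (\<integral>\<^sup>+y. \<integral>\<^sup>+x. N (x + c) y \<partial>circ \<partial>circ)"
    by (rule cc.Fubini'[symmetric]) measurable
  also have "\<dots> = pow2 s G"
    using nn_integral_circ_shift[OF _ Nper(2), of _ "- c"] by (simp add: pow2_def N_def)
  finally show ?thesis by (simp add: Lp_norm_T2_def)
qed

text \<open>For almost every z the terms of both double series agree for all pairs of indices, so
  the sums agree without any question of convergence.\<close>

lemma frac_diff_AE:
  assumes eq: "AE z in lborel. f z = g (fst z) (snd z)"
  shows "AE z in lborel. frac_diff1 a h1 (frac_diff2 b h2 f) z = diffx a h1 (diffy b h2 g) (fst z + a * h1) (snd z + b * h2)"
proof -
  have "AE z in lborel. \<forall>i j. f (((a - real i) * h1, (b - real j) * h2) + z)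
      = g (fst (((a - real i) * h1, (b - real j) * h2) + z)) (snd (((a - real i) * h1, (b - real j) * h2) + z))"
    unfolding AE_all_countable by (intro allI AE_lborel_translate eq)
  then show ?thesis
  proof eventually_elim
    case (elim z)
    obtain x y where z: "z = (x, y)" by (cases z)
    have "f (x + (a - real i) * h1, y + (b - real j) * h2) = g (x + a * h1 - real i * h1) (y + b * h2 - real j * h2)" for i j
      using elim[rule_format, of i j] by (simp add: z algebra_simps)
    then show ?case
      by (simp add: z frac_diff1_def frac_diff2_def diffx_def diffy_def shift_series_def bincoeff_def)
  qed
qed

lemma Lp_norm_frac_diff:
  assumes "biperiodic g" "AE z in lborel. f z = g (fst z) (snd z)"
  shows "Lp_norm_T2 s (frac_diff1 a h1 (frac_diff2 b h2 f)) = ennpowr (pow2 s (diffx a h1 (diffy b h2 g))) (1 / s)"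
  by (rule Lp_norm_T2_eq[OF biperiodic_diffx[OF biperiodic_diffy[OF assms(1)]] frac_diff_AE[OF assms(2)]])

section \<open>Reduction to positive steps of at most one period\<close>

lemma pow2_reflect:
  assumes G: "biperiodic G" and s: "\<sigma> = 1 \<or> \<sigma> = -1" "\<tau> = 1 \<or> \<tau> = -1"
  shows "pow2 s (\<lambda>x y. G (\<sigma> * x) (\<tau> * y)) = pow2 s G"
proof -
  note [measurable] = biperiodicD(1)[OF G]
  interpret c: sigma_finite_measure circ by (rule sigma_finite_circ)
  have refl: "(\<integral>\<^sup>+x. n (\<sigma> * x) \<partial>circ) = (\<integral>\<^sup>+x. n x \<partial>circ)"
    if "n \<in> borel_measurable borel" "periodic n" "\<sigma> = 1 \<or> \<sigma> = -1" for n \<sigma>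
    using that nn_integral_circ_reflect[of n] by auto
  have "pow2 s (\<lambda>x y. G (\<sigma> * x) (\<tau> * y)) = (\<integral>\<^sup>+y. \<integral>\<^sup>+x. ennpowr (ennreal (norm (G x (\<tau> * y)))) s \<partial>circ \<partial>circ)"
    unfolding pow2_def
    by (intro nn_integral_cong refl[of "\<lambda>x. ennpowr (ennreal (norm (G x (\<tau> * _)))) s"] s)
       (use biperiodicD(3)[OF G] in \<open>auto simp: periodic_def\<close>)
  also have "\<dots> = pow2 s G"
    unfolding pow2_def
    by (intro refl[of "\<lambda>y. \<integral>\<^sup>+x. ennpowr (ennreal (norm (G x y))) s \<partial>circ"] s)
       (use biperiodicD(2)[OF G] in \<open>auto simp: periodic_def\<close>)
  finally show ?thesis .
qed

text \<open>Reflecting a variable changes the sign of the step in it; this is how negative steps are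
  made positive.\<close>

lemma diff_reflect:
  "diffx a u (diffy b v (\<lambda>x y. g (\<sigma> * x) (\<tau> * y))) = (\<lambda>x y. diffx a (\<sigma> * u) (diffy b (\<tau> * v) g) (\<sigma> * x) (\<tau> * y))"
  by (simp add: fun_eq_iff diffx_def diffy_def shift_series_def algebra_simps)

lemma biperiodic_reflect:
  assumes g: "biperiodic g" and s: "\<sigma> = 1 \<or> \<sigma> = -1" "\<tau> = 1 \<or> \<tau> = -1"
  shows "biperiodic (\<lambda>x y. g (\<sigma> * x) (\<tau> * y))"
proof -
  note [measurable] = biperiodicD(1)[OF g]
  have refl: "periodic (\<lambda>x. \<phi> (\<sigma> * x))" if "periodic \<phi>" "\<sigma> = 1 \<or> \<sigma> = -1" for \<phi> :: "real \<Rightarrow> complex" and \<sigma>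
    unfolding periodic_def
  proof
    fix x
    show "\<phi> (\<sigma> * (x + 2 * pi)) = \<phi> (\<sigma> * x)"
      using periodic_add_int[OF that(1), of "\<sigma> * x" "if \<sigma> = 1 then 1 else -1"] that(2)
      by (auto simp: algebra_simps)
  qed
  have "(\<lambda>(x, y). g (\<sigma> * x) (\<tau> * y)) \<in> borel_measurable (borel \<Otimes>\<^sub>M borel)" by measurable
  moreover have "periodic (\<lambda>y. g (\<sigma> * x) (\<tau> * y))" for x
    by (rule refl[OF biperiodicD(2)[OF g] s(2)])
  moreover have "periodic (\<lambda>x. g (\<sigma> * x) (\<tau> * y))" for y
    by (rule refl[OF biperiodicD(3)[OF g] s(1)])
  ultimately show ?thesis by (simp add: biperiodic_def)
qed

text \<open>The smoothing estimates are available for h \<le> 2 pi. Larger steps can be reduced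
  because only integer multiples of the step enter, and these matter modulo the period.\<close>

lemma shift_series_step_mod:
  assumes "periodic \<phi>"
  shows "shift_series c (h + 2 * pi * of_int k) \<phi> = shift_series c h \<phi>"
proof -
  have "\<phi> (x - real \<nu> * (h + 2 * pi * of_int k)) = \<phi> (x - real \<nu> * h)" for x \<nu>
    using periodic_add_int[OF assms, of "x - real \<nu> * h" "- int \<nu> * k"] by (simp add: algebra_simps)
  then show ?thesis by (simp add: fun_eq_iff shift_series_def)
qed

lemma step_mod_exists:
  assumes "0 < h"
  shows "\<exists>h' k. 0 < h' \<and> h' \<le> 2 * pi \<and> h' \<le> h \<and> h = h' + 2 * pi * of_int k"
proof -
  \<comment> \<open>The ceiling minus 1, and not the floor: a multiple of 2 pi is reduced to 2 pi
    instead of 0, so the step stays positive.\<close>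
  define k where "k = \<lceil>h / (2 * pi)\<rceil> - 1"
  define h' where "h' = h - 2 * pi * of_int k"
  have "h / (2 * pi) > 0" using assms by simp
  then have "0 \<le> k" unfolding k_def by linarith
  moreover have "of_int k < h / (2 * pi)" "h / (2 * pi) \<le> of_int k + 1"
    unfolding k_def by linarith+
  then have "of_int k * (2 * pi) < h" "h \<le> (of_int k + 1) * (2 * pi)"
    by (simp_all add: pos_less_divide_eq pos_divide_le_eq)
  ultimately show ?thesis
    by (intro exI[of _ h'] exI[of _ k]) (auto simp: h'_def algebra_simps)
qed

lemma shift_series_step_0: "0 < a \<Longrightarrow> shift_series (bincoeff a) 0 \<phi> x = 0"
  using suminf_bincoeff[of a] summable_rabs_cancel[OF summable_bincoeff[of a]]
  by (simp add: shift_series_def suminf_mult2[symmetric] suminf_of_real[symmetric])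

lemma mixed_modulus_mono:
  "t1 \<le> t1' \<Longrightarrow> t2 \<le> t2' \<Longrightarrow> mixed_modulus s a b f t1 t2 \<le> mixed_modulus s a b f t1' t2'"
  unfolding mixed_modulus_def by (intro SUP_subset_mono) auto

lemma Lp_norm_le_mixed_modulus:
  "\<bar>h1\<bar> \<le> t1 \<Longrightarrow> \<bar>h2\<bar> \<le> t2 \<Longrightarrow> Lp_norm_T2 s (frac_diff1 a h1 (frac_diff2 b h2 f)) \<le> mixed_modulus s a b f t1 t2"
  unfolding mixed_modulus_def by (intro SUP_upper2[of "(h1, h2)"]) auto

text \<open>On the rectangle s < t1 < 2 s, r < t2 < 2 r the modulus is at least its value at (s, r),
  while t1 t2 is at most 4 s r, which costs 4^(\<theta> q). The factor 4 is due to 1 / t1 \<ge> 1 /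
  (2 s) and 1 / t2 \<ge> 1 / (2 r).\<close>

lemma modulus_integral_lower:
  assumes e: "0 < \<theta>" "0 < q" and h: "0 < h1" "h1 \<le> \<delta>1" "0 < h2" "h2 \<le> \<delta>2"
    and mono: "\<And>t1 t2 t1' t2'. t1 \<le> t1' \<Longrightarrow> t2 \<le> t2' \<Longrightarrow> \<omega> t1 t2 \<le> (\<omega> t1' t2' :: ennreal)"
  shows "(\<Sum>k. ennreal ((h1 / 2 / 2 ^ k) powr (- \<theta> * q)) *
      (\<Sum>l. ennreal ((h2 / 2 / 2 ^ l) powr (- \<theta> * q)) * ennpowr (\<omega> (h1 / 2 / 2 ^ k) (h2 / 2 / 2 ^ l)) q))
    \<le> ennreal (4 * 4 powr (\<theta> * q)) *
      (\<integral>\<^sup>+t1\<in>{0<..<\<delta>1}. (\<integral>\<^sup>+t2\<in>{0<..<\<delta>2}. ennpowr (ennreal ((t1 * t2) powr (- \<theta>)) * \<omega> t1 t2) q * ennreal (1 / t2) \<partial>lborel)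
         * ennreal (1 / t1) \<partial>lborel)"
proof -
  define s where "s = (\<lambda>k::nat. h1 / 2 / 2 ^ k)"
  define r where "r = (\<lambda>k::nat. h2 / 2 / 2 ^ k)"
  have s: "0 < s k" and r: "0 < r k" for k using h by (auto simp: s_def r_def)
  define c where "c = (\<lambda>k l. ennreal ((4 * (s k * r l)) powr (- \<theta> * q) / (2 * r l)) * ennpowr (\<omega> (s k) (r l)) q)"
  have inner: "(\<Sum>l. c k l * ennreal (r l))
      \<le> (\<integral>\<^sup>+t2\<in>{0<..<\<delta>2}. ennpowr (ennreal ((t1 * t2) powr (- \<theta>)) * \<omega> t1 t2) q * ennreal (1 / t2) \<partial>lborel)"
    if t1: "s k < t1" "t1 < 2 * s k" for k t1
    unfolding r_def
  proof (rule nn_integral_dyadic_lower[OF h(3,4)])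
    fix l t2 assume "h2 / 2 / 2 ^ l < t2" "t2 < 2 * (h2 / 2 / 2 ^ l)"
    then have t2: "r l < t2" "t2 < 2 * r l" by (auto simp: r_def)
    have pos: "0 < t1" "0 < t2" using s[of k] r[of l] t1 t2 by linarith+
    have "t1 * t2 \<le> (2 * s k) * (2 * r l)" using pos t1 t2 by (intro mult_mono) auto
    then have "(4 * (s k * r l)) powr (- \<theta> * q) \<le> (t1 * t2) powr (- \<theta> * q)"
      using pos e by (intro powr_mono2') auto
    moreover have "1 / (2 * r l) \<le> 1 / t2" using pos t2 by (intro divide_left_mono) auto
    ultimately have "(4 * (s k * r l)) powr (- \<theta> * q) * (1 / (2 * r l)) \<le> (t1 * t2) powr (- \<theta> * q) * (1 / t2)"
      using r[of l] by (intro mult_mono) auto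
    then have "c k l \<le> ennreal ((t1 * t2) powr (- \<theta> * q) * (1 / t2)) * ennpowr (\<omega> t1 t2) q"
      unfolding c_def using t1 t2 e by (intro mult_mono ennreal_leI ennpowr_mono mono) auto
    also have "\<dots> = ennpowr (ennreal ((t1 * t2) powr (- \<theta>)) * \<omega> t1 t2) q * ennreal (1 / t2)"
      using pos e by (subst ennreal_mult) (auto simp: ennpowr_mult powr_powr mult_ac)
    finally show "c k l \<le> ennpowr (ennreal ((t1 * t2) powr (- \<theta>)) * \<omega> t1 t2) q * ennreal (1 / t2)" .
  qed
  define I where "I = (\<lambda>t1. \<integral>\<^sup>+t2\<in>{0<..<\<delta>2}. ennpowr (ennreal ((t1 * t2) powr (- \<theta>)) * \<omega> t1 t2) q * ennreal (1 / t2) \<partial>lborel)"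
  have outer: "(\<Sum>k. ((\<Sum>l. c k l * ennreal (r l)) * ennreal (1 / (2 * s k))) * ennreal (s k))
      \<le> (\<integral>\<^sup>+t1\<in>{0<..<\<delta>1}. I t1 * ennreal (1 / t1) \<partial>lborel)"
    unfolding s_def
  proof (rule nn_integral_dyadic_lower[OF h(1,2)])
    fix k t1 assume "h1 / 2 / 2 ^ k < t1" "t1 < 2 * (h1 / 2 / 2 ^ k)"
    then have t1: "s k < t1" "t1 < 2 * s k" by (auto simp: s_def)
    have "0 < t1" using s[of k] t1 by linarith
    then have "1 / (2 * s k) \<le> 1 / t1" using t1 by (intro divide_left_mono) auto
    then show "(\<Sum>l. c k l * ennreal (r l)) * ennreal (1 / (2 * (h1 / 2 / 2 ^ k))) \<le> I t1 * ennreal (1 / t1)"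
      unfolding I_def using inner[OF t1] by (intro mult_mono ennreal_leI) (auto simp: s_def)
  qed
  have term_eq: "ennreal (s k powr (- \<theta> * q)) * (ennreal (r l powr (- \<theta> * q)) * ennpowr (\<omega> (s k) (r l)) q)
      = ennreal (4 * 4 powr (\<theta> * q)) * (c k l * ennreal (r l) * ennreal (1 / (2 * s k)) * ennreal (s k))" for k l
  proof -
    have "4 powr (\<theta> * q) * 4 powr (- \<theta> * q) = 1" by (simp add: powr_add[symmetric])
    then have "s k powr (- \<theta> * q) * r l powr (- \<theta> * q)
        = (4 * 4 powr (\<theta> * q)) * ((4 * (s k * r l)) powr (- \<theta> * q) / (2 * r l) * r l * (1 / (2 * s k)) * s k)"
      using s[of k] r[of l] by (simp add: powr_mult)
    then have "ennreal (s k powr (- \<theta> * q)) * ennreal (r l powr (- \<theta> * q))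
        = ennreal (4 * 4 powr (\<theta> * q)) * (ennreal ((4 * (s k * r l)) powr (- \<theta> * q) / (2 * r l)) * ennreal (r l) * ennreal (1 / (2 * s k)) * ennreal (s k))"
      using s[of k] r[of l] by (simp only: ennreal_mult[symmetric] powr_ge_zero mult_nonneg_nonneg divide_nonneg_pos
          less_imp_le zero_less_mult_iff zero_less_numeral zero_le_one zero_le_numeral simp_thms zero_less_one)
    then show ?thesis by (simp add: c_def mult_ac)
  qed
  have "(\<Sum>k. ennreal (s k powr (- \<theta> * q)) * (\<Sum>l. ennreal (r l powr (- \<theta> * q)) * ennpowr (\<omega> (s k) (r l)) q))
      = (\<Sum>k. \<Sum>l. ennreal (4 * 4 powr (\<theta> * q)) * (c k l * ennreal (r l) * ennreal (1 / (2 * s k)) * ennreal (s k)))"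
    unfolding ennreal_suminf_cmult[symmetric] term_eq ..
  also have "\<dots> = ennreal (4 * 4 powr (\<theta> * q)) * (\<Sum>k. ((\<Sum>l. c k l * ennreal (r l)) * ennreal (1 / (2 * s k))) * ennreal (s k))"
    by (simp only: ennreal_suminf_cmult ennreal_suminf_multc)
  also have "\<dots> \<le> ennreal (4 * 4 powr (\<theta> * q)) * (\<integral>\<^sup>+t1\<in>{0<..<\<delta>1}. I t1 * ennreal (1 / t1) \<partial>lborel)"
    by (intro mult_left_mono outer) simp
  finally show ?thesis unfolding s_def r_def I_def .
qed

section \<open>The inequality for mixed moduli of smoothness\<close>

theorem theorem11p1:
  fixes p q \<theta> \<alpha>1 \<alpha>2 :: real
  assumes "1 < p" and "p < q" and "\<theta> = 1 / p - 1 / q" and "\<alpha>1 > 0" and "\<alpha>2 > 0"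
  shows "\<exists>C::real. C > 0 \<and>
    (\<forall>f \<in> Lp0_T2 p. \<forall>\<delta>1 > 0. \<forall>\<delta>2 > 0.
      mixed_modulus q \<alpha>1 \<alpha>2 f \<delta>1 \<delta>2
      \<le> ennreal C * ennpowr
          (\<integral>\<^sup>+t1 \<in> {0<..<\<delta>1}.
            (\<integral>\<^sup>+t2 \<in> {0<..<\<delta>2}.
              ennpowr (ennreal ((t1 * t2) powr (- \<theta>)) * mixed_modulus p (\<alpha>1 + \<theta>) (\<alpha>2 + \<theta>) f t1 t2) q
              * ennreal (1 / t2) \<partial>lborel)
            * ennreal (1 / t1) \<partial>lborel)
          (1 / q))"
proof -
  note p = assms(1) and pq = assms(2) and \<theta> = assms(3) and \<alpha> = assms(4,5)
  note th = theta_bounds[OF p pq \<theta>]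
  have q: "0 < q" using p pq by simp
  obtain C where C: "C > 0" and main: "\<And>g h1 h2. biperiodic g \<Longrightarrow> pow2 p g < top \<Longrightarrow> 0 < h1 \<Longrightarrow> h1 \<le> 2 * pi \<Longrightarrow> 0 < h2 \<Longrightarrow> h2 \<le> 2 * pi \<Longrightarrow>
     pow2 q (diffx \<alpha>1 h1 (diffy \<alpha>2 h2 g))
     \<le> ennreal C * dyadic_mean (- \<theta> * q) h1 (\<lambda>u. dyadic_mean (- \<theta> * q) h2
         (\<lambda>v. ennpowr (pow2 p (diffx (\<alpha>1 + \<theta>) u (diffy (\<alpha>2 + \<theta>) v g))) (q / p)))"
    using mixed_Ulyanov[OF p pq \<theta> \<alpha>] by blast
  \<comment> \<open>C is from the inequality in two variables, 4 = 2 * 2 from bounding the two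
    dyadic means, and the last factor from comparing the dyadic double sum with the
    integral.\<close>
  define K where "K = C * 4 * (4 * 4 powr (\<theta> * q))"
  have K: "K > 0" using C by (simp add: K_def)
  have "mixed_modulus q \<alpha>1 \<alpha>2 f \<delta>1 \<delta>2 \<le> ennreal (K powr (1 / q)) * ennpowr R (1 / q)"
    if f: "f \<in> Lp0_T2 p" and R: "R = (\<integral>\<^sup>+t1 \<in> {0<..<\<delta>1}.
            (\<integral>\<^sup>+t2 \<in> {0<..<\<delta>2}.
              ennpowr (ennreal ((t1 * t2) powr (- \<theta>)) * mixed_modulus p (\<alpha>1 + \<theta>) (\<alpha>2 + \<theta>) f t1 t2) q
              * ennreal (1 / t2) \<partial>lborel)
            * ennreal (1 / t1) \<partial>lborel)" for f \<delta>1 \<delta>2 R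
  proof -
    have f': "f \<in> borel_measurable lebesgue" "periodic2 f" "Lp_norm_T2 p f < \<infinity>"
      using f by (auto simp: Lp0_T2_def Lp_T2_def)
    obtain g where g: "biperiodic g" and fg: "AE z in lborel. f z = g (fst z) (snd z)"
      using periodic2_AE_biperiodic[OF f'(1,2)] by blast
    have "Lp_norm_T2 p f = ennpowr (pow2 p g) (1 / p)"
      using fg by (intro Lp_norm_T2_eq[OF g, of _ 0 0]) simp
    then have gfin: "pow2 p g < top" using f'(3) by simp
    define \<omega> where "\<omega> = mixed_modulus p (\<alpha>1 + \<theta>) (\<alpha>2 + \<theta>) f"
    have \<omega>_mono: "\<omega> t1 t2 \<le> \<omega> t1' t2'" if "t1 \<le> t1'" "t2 \<le> t2'" for t1 t2 t1' t2'
      unfolding \<omega>_def by (rule mixed_modulus_mono[OF that])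
    have le_\<omega>: "ennpowr (pow2 p (diffx (\<alpha>1 + \<theta>) u (diffy (\<alpha>2 + \<theta>) v g))) (q / p) \<le> ennpowr (\<omega> t1 t2) q"
      if "\<bar>u\<bar> \<le> t1" "\<bar>v\<bar> \<le> t2" for u v t1 t2
    proof -
      have "ennpowr (pow2 p (diffx (\<alpha>1 + \<theta>) u (diffy (\<alpha>2 + \<theta>) v g))) (1 / p) \<le> \<omega> t1 t2"
        unfolding \<omega>_def Lp_norm_frac_diff[OF g fg, symmetric] by (rule Lp_norm_le_mixed_modulus[OF that])
      then have "ennpowr (ennpowr (pow2 p (diffx (\<alpha>1 + \<theta>) u (diffy (\<alpha>2 + \<theta>) v g))) (1 / p)) q \<le> ennpowr (\<omega> t1 t2) q"
        using q by (intro ennpowr_mono) auto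
      then show ?thesis by (simp add: ennpowr_ennpowr)
    qed
    have bound: "pow2 q (diffx \<alpha>1 h1 (diffy \<alpha>2 h2 g)) \<le> ennreal K * R"
      if h: "\<bar>h1\<bar> \<le> \<delta>1" "\<bar>h2\<bar> \<le> \<delta>2" for h1 h2
    proof (cases "h1 = 0 \<or> h2 = 0")
      \<comment> \<open>A zero step gives the zero function; it is separated because the inequality
        in two variables requires positive steps.\<close>
      case True
      have "diffx \<alpha>1 h1 (diffy \<alpha>2 h2 g) = (\<lambda>x y. 0)"
        using True \<alpha> by (auto simp: fun_eq_iff diffx_def diffy_def shift_series_step_0) (simp add: shift_series_def)
      then show ?thesis by (simp add: pow2_def)
    next
      case False
      define \<sigma> where "\<sigma> = sgn h1"
      define \<tau> where "\<tau> = sgn h2"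
      have st: "\<sigma> = 1 \<or> \<sigma> = -1" "\<tau> = 1 \<or> \<tau> = -1" using False by (auto simp: \<sigma>_def \<tau>_def sgn_if)
      \<comment> \<open>Reflection by the signs of the steps: the differences of \<open>k\<close>
        with steps |h1| and |h2| have the same norms as those of \<open>g\<close> with steps h1 and
        h2.\<close>
      define k where "k = (\<lambda>x y. g (\<sigma> * x) (\<tau> * y))"
      have k: "biperiodic k" unfolding k_def by (rule biperiodic_reflect[OF g st])
      have pow2_k: "pow2 s (diffx a u (diffy b v k)) = pow2 s (diffx a (\<sigma> * u) (diffy b (\<tau> * v) g))" for s a b u v
        unfolding k_def diff_reflect by (rule pow2_reflect[OF biperiodic_diffx[OF biperiodic_diffy[OF g]] st])
      have kfin: "pow2 p k < top" unfolding k_def pow2_reflect[OF g st] by (rule gfin)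
      obtain h1' k1 where h1': "0 < h1'" "h1' \<le> 2 * pi" "h1' \<le> \<bar>h1\<bar>" "\<bar>h1\<bar> = h1' + 2 * pi * of_int k1"
        using step_mod_exists[of "\<bar>h1\<bar>"] False by auto
      obtain h2' k2 where h2': "0 < h2'" "h2' \<le> 2 * pi" "h2' \<le> \<bar>h2\<bar>" "\<bar>h2\<bar> = h2' + 2 * pi * of_int k2"
        using step_mod_exists[of "\<bar>h2\<bar>"] False by auto
      have "pow2 q (diffx \<alpha>1 h1 (diffy \<alpha>2 h2 g)) = pow2 q (diffx \<alpha>1 \<bar>h1\<bar> (diffy \<alpha>2 \<bar>h2\<bar> k))"
        unfolding pow2_k \<sigma>_def \<tau>_def by (simp add: sgn_mult_abs)
      also have "diffy \<alpha>2 \<bar>h2\<bar> k = diffy \<alpha>2 h2' k"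
        unfolding h2'(4) by (simp add: fun_eq_iff diffy_def shift_series_step_mod[OF biperiodicD(2)[OF k]])
      also have "diffx \<alpha>1 \<bar>h1\<bar> (diffy \<alpha>2 h2' k) = diffx \<alpha>1 h1' (diffy \<alpha>2 h2' k)"
        unfolding h1'(4) by (simp add: fun_eq_iff diffx_def shift_series_step_mod[OF biperiodicD(3)[OF biperiodic_diffy[OF k]]])
      also have "pow2 q (diffx \<alpha>1 h1' (diffy \<alpha>2 h2' k))
        \<le> ennreal C * dyadic_mean (- \<theta> * q) h1' (\<lambda>u. dyadic_mean (- \<theta> * q) h2'
         (\<lambda>v. ennpowr (pow2 p (diffx (\<alpha>1 + \<theta>) u (diffy (\<alpha>2 + \<theta>) v k))) (q / p)))"
        by (rule main[OF k kfin h1'(1,2) h2'(1,2)])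
      also have "dyadic_mean (- \<theta> * q) h1' (\<lambda>u. dyadic_mean (- \<theta> * q) h2'
         (\<lambda>v. ennpowr (pow2 p (diffx (\<alpha>1 + \<theta>) u (diffy (\<alpha>2 + \<theta>) v k))) (q / p)))
        \<le> 2 * (\<Sum>i. ennreal ((h1' / 2 / 2 ^ i) powr (- \<theta> * q)) *
           (2 * (\<Sum>j. ennreal ((h2' / 2 / 2 ^ j) powr (- \<theta> * q)) * ennpowr (\<omega> (h1' / 2 / 2 ^ i) (h2' / 2 / 2 ^ j)) q)))"
      \<comment> \<open>The steps u and v do not exceed the dyadic scales, and the modulus is a
        supremum over steps of either sign, so the reflection does not matter.\<close>
      proof (rule dyadic_mean_le[OF h1'(1)], rule dyadic_mean_le[OF h2'(1)])
        fix i j :: nat and u v :: real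
        assume "0 \<le> u" "u \<le> h1' / 2 / 2 ^ i" "0 \<le> v" "v \<le> h2' / 2 / 2 ^ j"
        then show "ennpowr (pow2 p (diffx (\<alpha>1 + \<theta>) u (diffy (\<alpha>2 + \<theta>) v k))) (q / p)
            \<le> ennpowr (\<omega> (h1' / 2 / 2 ^ i) (h2' / 2 / 2 ^ j)) q"
          unfolding pow2_k using st by (intro le_\<omega>) (auto simp: abs_mult)
      qed
      also have "\<dots> = 4 * (\<Sum>i. ennreal ((h1' / 2 / 2 ^ i) powr (- \<theta> * q)) *
           (\<Sum>j. ennreal ((h2' / 2 / 2 ^ j) powr (- \<theta> * q)) * ennpowr (\<omega> (h1' / 2 / 2 ^ i) (h2' / 2 / 2 ^ j)) q))"
      proof -
        have swap: "ennreal x * (2 * y) = 2 * (ennreal x * y)" for x y by (rule mult.left_commute)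
        have "2 * (2 * x) = 4 * x" for x :: ennreal by (simp add: mult.assoc[symmetric])
        then show ?thesis by (simp only: swap ennreal_suminf_cmult)
      qed
      also have "\<dots> \<le> 4 * (ennreal (4 * 4 powr (\<theta> * q)) * R)"
        unfolding R \<omega>_def[symmetric] using h h1' h2'
        by (intro mult_left_mono modulus_integral_lower th(1) q \<omega>_mono) auto
      finally have "pow2 q (diffx \<alpha>1 h1 (diffy \<alpha>2 h2 g)) \<le> ennreal C * (4 * (ennreal (4 * 4 powr (\<theta> * q)) * R))"
        by (simp add: mult_left_mono)
      also have "\<dots> = ennreal K * R"
        using C by (simp add: K_def ennreal_mult mult.assoc)
      finally show ?thesis .
    qed
    show ?thesis
      unfolding mixed_modulus_def
    proof (intro SUP_least, clarify)
      fix h1 h2 assume h: "\<bar>h1\<bar> \<le> \<delta>1" "\<bar>h2\<bar> \<le> \<delta>2"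
      have "Lp_norm_T2 q (frac_diff1 \<alpha>1 h1 (frac_diff2 \<alpha>2 h2 f)) = ennpowr (pow2 q (diffx \<alpha>1 h1 (diffy \<alpha>2 h2 g))) (1 / q)"
        by (rule Lp_norm_frac_diff[OF g fg])
      also have "\<dots> \<le> ennpowr (ennreal K * R) (1 / q)"
        using q by (intro ennpowr_mono bound h) auto
      also have "\<dots> = ennreal (K powr (1 / q)) * ennpowr R (1 / q)"
        using q K by (simp add: ennpowr_mult)
      finally show "Lp_norm_T2 q (frac_diff1 \<alpha>1 h1 (frac_diff2 \<alpha>2 h2 f)) \<le> ennreal (K powr (1 / q)) * ennpowr R (1 / q)" .
    qed
  qed
  then show ?thesis using K by (intro exI[of _ "K powr (1 / q)"]) auto
qed

end
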